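(* Consider a generic $1$-parameter family of binary implicit differential equations $F_\varepsilon=0$, with left and right curves of inflections $I_\ell$ and $I_r$. (i) If for $F_0$ the curves $I_\ell$ and $I_r$ are quadratically tangent at $q$, then at $\varepsilon=0$ there is a creation/annihilation transition of two hyperbolic nodes. (ii) If $q$ is a hyperbolic node for $F_0$ and $q$ is also a left bi-inflection, then as $\varepsilon$ passes through $0$ a left bi-inflection that moves along $I_\ell$ crosses $I_r$ at the hyperbolic node $q$. (Left and right may be interchanged.) (iii) If for $F_0$ two complex conjugate branches of the curve of inflections $I$ are tangent at $q$, then at $\varepsilon=0$ there is a creation/annihilation transition of two elliptic nodes.
   Context: All maps are smooth; "generic" has its usual meaning in singularity theory. $J^1(\mathbb{R},\mathbb{R})$ is $\mathbb{R}^3$ with coordinates $(x,y,p)$ and contact structure $\ker(p\,dx-dy)$; $\pi(x,y,p)=(x,y)$; $\pi^\vee(x,y,p)=(p,px-y)$. A binary implicit differential equation is $F(x,y,p)=a(x,y)+2b(x,y)p+c(x,y)p^2=0$, $p=dy/dx$; $\mathcal{V}^F=\{F=0\}$. Solution curves are the images by $\pi$ of the characteristics of $\mathcal{V}^F$ (integral curves of the field of lines cut on the tangent planes by the contact planes). The critical set of $\pi|_{\mathcal{V}^F}$ separates the (oriented) surface $\mathcal{V}^F$ into a left part, where $\pi|_{\mathcal{V}^F}$ reverses the orientation, and a right part, where it preserves it. A solution is left (right) if it comes from the left (right) part. The left (right) curve of inflections $I_\ell$ ($I_r$) consists of the inflections (at least 3-point contact with the tangent line) of the left (right) solutions. A left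 bi-inflection is a point where a left solution has (at least) 4-point contact with its tangent line. A hyperbolic node is a point of transverse intersection of $I_\ell$ and $I_r$. In the domain where the equation determines a pair of complex conjugate directions (complex conjugate roots $p$), the inflections of the complex solution curves are given by the equations $F=0$, $F_x+pF_y=0$ with $p$ complex, and form a pair of complex conjugate curves (branches of $I$); their real intersection points are called elliptic nodes. A creation/annihilation transition of two hyperbolic nodes is one equivalent to $(y-x^2+\varepsilon)(y+x^2-\varepsilon)=0$ at $\varepsilon=0$, where the two factors are the two branches (up to the sign of $\varepsilon$): two crossings collapse and disappear. For elliptic nodes it means that two elliptic nodes collapse at $\varepsilon=0$ and disappear (or the opposite). Two families with a local transition at $q$ for parameter value $0$ are equivalent if there is a local diffeomorphism (or homeomorphism) of $\mathbb{R}^2\times\mathbb{R}$ near $(q,0)$ sending isochronal sections diffeomorphically to isochronal sections. Quadratic tangency means exactly 2-point contact. *)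

theory Defs
  imports "HOL-Analysis.Analysis"
begin

section \<open>Smooth maps and genericity\<close>

fun iter_deriv :: "'a::real_normed_vector list \<Rightarrow> ('a \<Rightarrow> 'b::real_normed_vector) \<Rightarrow> 'a \<Rightarrow> 'b" where
  "iter_deriv [] f = f"
| "iter_deriv (v # vs) f = (\<lambda>x. frechet_derivative (iter_deriv vs f) (at x) v)"

text \<open>Used only for open sets \<open>S\<close>; all iterated directional derivatives exist and are
  (Frechet) differentiable, hence continuous.\<close>

definition smooth_on :: "'a::real_normed_vector set \<Rightarrow> ('a \<Rightarrow> 'b::real_normed_vector) \<Rightarrow> bool" where
  "smooth_on S f \<longleftrightarrow> (\<forall>vs. iter_deriv vs f differentiable_on S)"

definition diffeo_on ::
  "'a::real_normed_vector set \<Rightarrow> 'b::real_normed_vector set \<Rightarrow> ('a \<Rightarrow> 'b) \<Rightarrow> bool" where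
  "diffeo_on W W' \<Phi> \<longleftrightarrow> open W \<and> open W' \<and> smooth_on W \<Phi> \<and> \<Phi> ` W = W' \<and>
     (\<exists>\<Psi>. smooth_on W' \<Psi> \<and> (\<forall>w\<in>W. \<Psi> (\<Phi> w) = w))"

definition whitney_nbhd ::
  "('a::euclidean_space \<Rightarrow> 'b::real_normed_vector) \<Rightarrow> nat \<Rightarrow> ('a \<Rightarrow> real) \<Rightarrow> ('a \<Rightarrow> 'b) set" where
  "whitney_nbhd f k \<delta> = {g. smooth_on UNIV g \<and>
     (\<forall>x vs. set vs \<subseteq> Basis \<and> length vs \<le> k \<longrightarrow>
        norm (iter_deriv vs g x - iter_deriv vs f x) < \<delta> x)}"

text \<open>The Whitney (strong) $C^\infty$ topology on the space of smooth maps.\<close>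

definition whitney_topology :: "('a::euclidean_space \<Rightarrow> 'b::real_normed_vector) topology" where
  "whitney_topology = topology_generated_by
     {whitney_nbhd f k \<delta> | f k \<delta>.
        smooth_on UNIV f \<and> continuous_on UNIV \<delta> \<and> (\<forall>x. 0 < \<delta> x)}"

definition residual_in :: "'a topology \<Rightarrow> 'a set \<Rightarrow> bool" where
  "residual_in X G \<longleftrightarrow> (\<exists>\<U>. countable \<U> \<and>
     (\<forall>U\<in>\<U>. openin X U \<and> X closure_of U = topspace X) \<and> topspace X \<inter> \<Inter>\<U> \<subseteq> G)"

definition generic :: "(('a::euclidean_space \<Rightarrow> 'b::real_normed_vector) \<Rightarrow> bool) \<Rightarrow> bool" where
  "generic P \<longleftrightarrow> residual_in whitney_topology {f. P f}"


section \<open>Binary implicit differential equations\<close>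

type_synonym plane = "real \<times> real"

text \<open>Points and tangent vectors of $J^1(\mathbb{R},\mathbb{R})$, in the coordinates $(x,y,p)$.\<close>

type_synonym jet = "real \<times> real \<times> real"

text \<open>An equation is given by its coefficient map $(x,y) \mapsto (a,b,c)$, a one-parameter family
  by $((x,y),\varepsilon) \mapsto (a,b,c)$.\<close>

type_synonym bide = "plane \<Rightarrow> real \<times> real \<times> real"
type_synonym bide_family = "plane \<times> real \<Rightarrow> real \<times> real \<times> real"

definition member :: "bide_family \<Rightarrow> real \<Rightarrow> bide" where
  "member A \<epsilon> = (\<lambda>z. A (z, \<epsilon>))"

text \<open>The direction \<open>p\<close> may be real or complex.\<close>

definition F :: "bide \<Rightarrow> plane \<Rightarrow> 'k::real_normed_field \<Rightarrow> 'k" where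
  "F B z p = (case B z of (a, b, c) \<Rightarrow> of_real a + 2 * of_real b * p + of_real c * p\<^sup>2)"

definition F_x :: "bide \<Rightarrow> plane \<Rightarrow> 'k::real_normed_field \<Rightarrow> 'k" where
  "F_x B z p = frechet_derivative (\<lambda>w. F B w p) (at z) (1, 0)"

definition F_y :: "bide \<Rightarrow> plane \<Rightarrow> 'k::real_normed_field \<Rightarrow> 'k" where
  "F_y B z p = frechet_derivative (\<lambda>w. F B w p) (at z) (0, 1)"

fun proj :: "jet \<Rightarrow> plane" where
  "proj (x, y, p) = (x, y)"

fun F_jet :: "bide \<Rightarrow> jet \<Rightarrow> real" where
  "F_jet B (x, y, p) = F B (x, y) p"

definition surface :: "bide \<Rightarrow> jet set" where
  "surface B = {m. F_jet B m = 0}"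

abbreviation dF :: "bide \<Rightarrow> jet \<Rightarrow> jet \<Rightarrow> real" where
  "dF B m \<equiv> frechet_derivative (F_jet B) (at m)"

fun contact_plane :: "jet \<Rightarrow> jet set" where
  "contact_plane (x, y, p) = {(u, v, w). p * u - v = 0}"

fun det2 :: "plane \<Rightarrow> plane \<Rightarrow> real" where
  "det2 (a, b) (c, d) = a * d - b * c"

fun det3 :: "jet \<Rightarrow> jet \<Rightarrow> jet \<Rightarrow> real" where
  "det3 (a1, a2, a3) (b1, b2, b3) (c1, c2, c3) =
     a1 * (b2 * c3 - b3 * c2) - a2 * (b1 * c3 - b3 * c1) + a3 * (b1 * c2 - b2 * c1)"

text \<open>The surface is oriented as the boundary of \<open>{F < 0}\<close>: a basis \<open>(v, w)\<close> of its tangent plane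
  is positive iff \<open>(v, w, n)\<close> is a positive basis for vectors \<open>n\<close> with \<open>dF n > 0\<close>.\<close>

definition pos_basis :: "bide \<Rightarrow> jet \<Rightarrow> jet \<Rightarrow> jet \<Rightarrow> bool" where
  "pos_basis B m v w \<longleftrightarrow> dF B m v = 0 \<and> dF B m w = 0 \<and> (\<exists>n. dF B m n > 0 \<and> det3 v w n > 0)"

datatype side = Left_Side | Right_Side

fun other_side :: "side \<Rightarrow> side" where
  "other_side Left_Side = Right_Side"
| "other_side Right_Side = Left_Side"

text \<open>Left: the projection (which is linear) reverses the orientation; right: it preserves it.
  The first conjunct excludes singular points of the surface.\<close>

fun part :: "bide \<Rightarrow> side \<Rightarrow> jet set" where
  "part B Left_Side = {m \<in> surface B. (\<exists>n. dF B m n \<noteq> 0) \<and>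
     (\<forall>v w. pos_basis B m v w \<longrightarrow> det2 (proj v) (proj w) < 0)}"
| "part B Right_Side = {m \<in> surface B. (\<exists>n. dF B m n \<noteq> 0) \<and>
     (\<forall>v w. pos_basis B m v w \<longrightarrow> det2 (proj v) (proj w) > 0)}"

definition characteristic_on :: "bide \<Rightarrow> real set \<Rightarrow> (real \<Rightarrow> jet) \<Rightarrow> bool" where
  "characteristic_on B I \<gamma> \<longleftrightarrow> smooth_on I \<gamma> \<and>
     (\<forall>t\<in>I. \<gamma> t \<in> surface B \<and>
        (let v = vector_derivative \<gamma> (at t)
         in v \<noteq> 0 \<and> dF B (\<gamma> t) v = 0 \<and> v \<in> contact_plane (\<gamma> t)))"

text \<open>\<open>c\<close> is a left (right) solution curve with \<open>c 0 = q\<close>.\<close>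

definition solution_at :: "bide \<Rightarrow> side \<Rightarrow> plane \<Rightarrow> (real \<Rightarrow> plane) \<Rightarrow> bool" where
  "solution_at B s q c \<longleftrightarrow> (\<exists>r>0. \<exists>\<gamma>. characteristic_on B {-r<..<r} \<gamma> \<and>
     \<gamma> ` {-r<..<r} \<subseteq> part B s \<and> c = proj \<circ> \<gamma> \<and> c 0 = q)"


section \<open>Contact, inflections and nodes\<close>

text \<open>At least (exactly) \<open>k\<close>-point contact, at parameter \<open>0\<close>, of the curve \<open>c\<close> with the
  curve \<open>h = 0\<close>.\<close>

definition contact_at_least :: "nat \<Rightarrow> (real \<Rightarrow> plane) \<Rightarrow> (plane \<Rightarrow> real) \<Rightarrow> bool" where
  "contact_at_least k c h \<longleftrightarrow> (\<forall>j<k. (deriv ^^ j) (h \<circ> c) 0 = 0)"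

definition contact_exactly :: "nat \<Rightarrow> (real \<Rightarrow> plane) \<Rightarrow> (plane \<Rightarrow> real) \<Rightarrow> bool" where
  "contact_exactly k c h \<longleftrightarrow> contact_at_least k c h \<and> \<not> contact_at_least (Suc k) c h"

text \<open>An equation of the tangent line at \<open>c 0\<close>. It is nondegenerate for the projection of a
  characteristic in the left or right part: there the projection is immersive on the surface, so
  the velocity of \<open>c\<close> does not vanish.\<close>

definition tangent_line_eq :: "(real \<Rightarrow> plane) \<Rightarrow> plane \<Rightarrow> real" where
  "tangent_line_eq c z = det2 (vector_derivative c (at 0)) (z - c 0)"

definition inflection_curve :: "bide \<Rightarrow> side \<Rightarrow> plane set" where
  "inflection_curve B s = {q. \<exists>c. solution_at B s q c \<and> contact_at_least 3 c (tangent_line_eq c)}"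

definition bi_inflections :: "bide \<Rightarrow> side \<Rightarrow> plane set" where
  "bi_inflections B s = {q. \<exists>c. solution_at B s q c \<and> contact_at_least 4 c (tangent_line_eq c)}"

text \<open>In the open set \<open>U\<close>, \<open>g = 0\<close> is an equation of \<open>S\<close>, regular at \<open>q\<close>; so near \<open>q\<close> the set
  \<open>S\<close> is a smooth curve.\<close>

definition local_equation :: "plane set \<Rightarrow> plane \<Rightarrow> plane set \<Rightarrow> (plane \<Rightarrow> real) \<Rightarrow> bool" where
  "local_equation S q U g \<longleftrightarrow> open U \<and> q \<in> U \<and> q \<in> S \<and> smooth_on U g \<and>
     S \<inter> U = {z \<in> U. g z = 0} \<and> (\<exists>v. frechet_derivative g (at q) v \<noteq> 0)"

definition transverse_at :: "plane set \<Rightarrow> plane set \<Rightarrow> plane \<Rightarrow> bool" where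
  "transverse_at S T q \<longleftrightarrow> (\<exists>U g h. local_equation S q U g \<and> local_equation T q U h \<and>
     {v. frechet_derivative g (at q) v = 0} \<inter> {v. frechet_derivative h (at q) v = 0} = {0})"

definition quadratically_tangent_at :: "plane set \<Rightarrow> plane set \<Rightarrow> plane \<Rightarrow> bool" where
  "quadratically_tangent_at S T q \<longleftrightarrow> (\<exists>U g h. local_equation S q U g \<and> local_equation T q U h \<and>
     (\<exists>r>0. \<exists>c. smooth_on {-r<..<r} c \<and> c 0 = q \<and> vector_derivative c (at 0) \<noteq> 0 \<and>
        c ` {-r<..<r} \<subseteq> S \<inter> U \<and> contact_exactly 2 c h))"

definition hyperbolic_node :: "bide \<Rightarrow> plane \<Rightarrow> bool" where
  "hyperbolic_node B q \<longleftrightarrow>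
     transverse_at (inflection_curve B Left_Side) (inflection_curve B Right_Side) q"

definition elliptic_domain :: "bide \<Rightarrow> plane set" where
  "elliptic_domain B = {z. \<exists>p::complex. Im p \<noteq> 0 \<and> {r. F B z r = 0} = {p, cnj p}}"

definition complex_inflection :: "bide \<Rightarrow> plane \<Rightarrow> complex \<Rightarrow> bool" where
  "complex_inflection B z p \<longleftrightarrow> F B z p = 0 \<and> F_x B z p + p * F_y B z p = 0"

text \<open>Real points lying on both conjugate branches.\<close>

definition elliptic_nodes :: "bide \<Rightarrow> plane set" where
  "elliptic_nodes B = {z \<in> elliptic_domain B.
     \<exists>p. complex_inflection B z p \<and> complex_inflection B z (cnj p)}"

text \<open>\<open>p\<close> is a smooth choice of one of the two complex directions.\<close>

definition complex_root_field :: "bide \<Rightarrow> plane set \<Rightarrow> (plane \<Rightarrow> complex) \<Rightarrow> bool" where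
  "complex_root_field B U p \<longleftrightarrow> open U \<and> U \<subseteq> elliptic_domain B \<and> smooth_on U p \<and>
     (\<forall>z\<in>U. F B z (p z) = 0)"

text \<open>The branch of complex inflections of the direction field \<open>p\<close> has the equation
  \<open>branch_eq B p = 0\<close>. It is a complex curve; at a real point its tangent is a complex line in
  $\mathbb{C}^2$, determined by the partial derivatives of this equation in \<open>x\<close> and \<open>y\<close>.\<close>

definition branch_eq :: "bide \<Rightarrow> (plane \<Rightarrow> complex) \<Rightarrow> plane \<Rightarrow> complex" where
  "branch_eq B p z = F_x B z (p z) + p z * F_y B z (p z)"

definition branch_regular_at :: "bide \<Rightarrow> (plane \<Rightarrow> complex) \<Rightarrow> plane \<Rightarrow> bool" where
  "branch_regular_at B p q \<longleftrightarrow> branch_eq B p q = 0 \<and>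
     (\<exists>v. frechet_derivative (branch_eq B p) (at q) v \<noteq> 0)"

definition branch_tangent :: "bide \<Rightarrow> (plane \<Rightarrow> complex) \<Rightarrow> plane \<Rightarrow> (complex \<times> complex) set" where
  "branch_tangent B p q = {(u, v).
     frechet_derivative (branch_eq B p) (at q) (1, 0) * u +
     frechet_derivative (branch_eq B p) (at q) (0, 1) * v = 0}"

definition conjugate_branches_tangent_at :: "bide \<Rightarrow> plane \<Rightarrow> bool" where
  "conjugate_branches_tangent_at B q \<longleftrightarrow> (\<exists>U p. q \<in> U \<and> complex_root_field B U p \<and>
     branch_regular_at B p q \<and> branch_regular_at B (cnj \<circ> p) q \<and>
     branch_tangent B p q = branch_tangent B (cnj \<circ> p) q)"


section \<open>Transitions\<close>

text \<open>The families of curves \<open>S \<epsilon>\<close>, \<open>T \<epsilon>\<close> are, near \<open>(q, \<epsilon>0)\<close>, equivalent to the two factors of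
  \<open>(y - x\<^sup>2 + \<epsilon>) (y + x\<^sup>2 - \<epsilon>) = 0\<close> near the origin. The parameter change \<open>\<tau>\<close> may reverse the
  orientation, which accounts for the sign of \<open>\<epsilon>\<close>.\<close>

definition hyperbolic_creation_annihilation ::
  "(real \<Rightarrow> plane set) \<Rightarrow> (real \<Rightarrow> plane set) \<Rightarrow> plane \<Rightarrow> real \<Rightarrow> bool" where
  "hyperbolic_creation_annihilation S T q \<epsilon>0 \<longleftrightarrow>
     (\<exists>W W' (\<Phi> :: plane \<times> real \<Rightarrow> plane \<times> real) \<tau>.
        (q, \<epsilon>0) \<in> W \<and> diffeo_on W W' \<Phi> \<and> \<Phi> (q, \<epsilon>0) = ((0, 0), 0) \<and>
        (\<forall>(z, \<epsilon>)\<in>W. snd (\<Phi> (z, \<epsilon>)) = \<tau> \<epsilon>) \<and>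
        (\<forall>(z, \<epsilon>)\<in>W. z \<in> S \<epsilon> \<longleftrightarrow> (case \<Phi> (z, \<epsilon>) of ((x, y), e) \<Rightarrow> y - x\<^sup>2 + e = 0)) \<and>
        (\<forall>(z, \<epsilon>)\<in>W. z \<in> T \<epsilon> \<longleftrightarrow> (case \<Phi> (z, \<epsilon>) of ((x, y), e) \<Rightarrow> y + x\<^sup>2 - e = 0)))"

text \<open>Near \<open>q\<close>, for \<open>\<epsilon>\<close> near \<open>\<epsilon>0\<close>, \<open>P \<epsilon>\<close> consists of one point \<open>\<beta> \<epsilon>\<close>, which moves smoothly along
  \<open>S \<epsilon>\<close> and at \<open>\<epsilon> = \<epsilon>0\<close> passes, through \<open>q\<close>, from one side of the curve \<open>T \<epsilon>\<close> to the other; the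
  sides are given by the sign of an equation \<open>h\<close> of \<open>T \<epsilon>\<close> that depends smoothly on \<open>\<epsilon>\<close>.\<close>

definition moves_along_and_crosses ::
  "(real \<Rightarrow> plane set) \<Rightarrow> (real \<Rightarrow> plane set) \<Rightarrow> (real \<Rightarrow> plane set) \<Rightarrow> plane \<Rightarrow> real \<Rightarrow> bool" where
  "moves_along_and_crosses P S T q \<epsilon>0 \<longleftrightarrow>
     (\<exists>U r \<beta> h. open U \<and> q \<in> U \<and> r > 0 \<and>
        (let J = {\<epsilon>0 - r<..<\<epsilon>0 + r} in
           smooth_on J \<beta> \<and> \<beta> \<epsilon>0 = q \<and> (\<forall>\<epsilon>\<in>J. P \<epsilon> \<inter> U = {\<beta> \<epsilon>} \<and> \<beta> \<epsilon> \<in> S \<epsilon>) \<and>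
           smooth_on (U \<times> J) h \<and>
           (\<forall>\<epsilon>\<in>J. T \<epsilon> \<inter> U = {z \<in> U. h (z, \<epsilon>) = 0} \<and>
              (\<forall>z \<in> T \<epsilon> \<inter> U. local_equation (T \<epsilon>) z U (\<lambda>w. h (w, \<epsilon>)))) \<and>
           (\<forall>\<epsilon>\<in>J. sgn (h (\<beta> \<epsilon>, \<epsilon>)) = sgn (\<epsilon> - \<epsilon>0))))"

text \<open>Near \<open>q\<close>, the set \<open>E \<epsilon>\<close> consists of two points on one side of \<open>\<epsilon>0\<close>, which collapse to \<open>q\<close>
  at \<open>\<epsilon>0\<close>, and is empty on the other side. Whether the points are created or annihilated is
  given by the sign \<open>\<sigma>\<close>.\<close>

definition elliptic_creation_annihilation ::
  "(real \<Rightarrow> plane set) \<Rightarrow> plane \<Rightarrow> real \<Rightarrow> bool" where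
  "elliptic_creation_annihilation E q \<epsilon>0 \<longleftrightarrow>
     (\<exists>U r \<sigma> \<nu>1 \<nu>2. open U \<and> q \<in> U \<and> r > 0 \<and> \<sigma> \<in> {1, -1} \<and>
        continuous_on {0..<r} \<nu>1 \<and> continuous_on {0..<r} \<nu>2 \<and> \<nu>1 0 = q \<and> \<nu>2 0 = q \<and>
        (\<forall>t\<in>{0..<r}. E (\<epsilon>0 + \<sigma> * t) \<inter> U = {\<nu>1 t, \<nu>2 t}) \<and>
        (\<forall>t\<in>{0<..<r}. \<nu>1 t \<noteq> \<nu>2 t \<and> E (\<epsilon>0 - \<sigma> * t) \<inter> U = {}))"

end

theory Submission
  imports Defs
begin

text \<open>Where the equation has two finite directions, they are \<open>U \<plusminus> V\<close> (or \<open>U \<plusminus> \<i> V\<close>) with \<open>U\<close> and \<open>V\<close> smooth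
  in the point and in \<open>\<epsilon>\<close>. Inflections of the solutions of \<open>p = P\<close> are the zeros of \<open>G = P\<^sub>x + P P\<^sub>y\<close>, and
  bi-inflections are the common zeros of \<open>G\<close> and its derivative \<open>L = G\<^sub>x + P G\<^sub>y\<close> along the solutions; the
  elliptic nodes are the common zeros of the real and imaginary parts of \<open>G\<close> for \<open>P = U + \<i> V\<close>. All of
  these are differential polynomials in \<open>U\<close> and \<open>V\<close>. Adding polynomials with small coefficients, cut off
  by a bump function, to \<open>U\<close> and \<open>V\<close> moves finitely many of their derivatives independently, so by
  Sard's theorem the degenerate jets are avoided, and the others met transversely, on a countable
  intersection of open dense sets of families. For such families a tangency of the zero sets of
  two functions unfolds nondegenerately, and the Morse lemma with a parameter gives the normal form
  \<open>(y - x\<^sup>2 + e) (y + x\<^sup>2 - e) = 0\<close>; at a bi-inflection that is a node, \<open>(G, L, \<epsilon>)\<close> are local coordinates,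
  in which the bi-inflections form a curve transverse to the other curve of inflections.\<close>

section \<open>Smooth maps\<close>

text \<open>The formulas for U and V break down where the coefficient c or the discriminant
  vanishes. Nothing is lost there: each of the three hypotheses provides two distinct finite
  directions at q, real or conjugate, so q lies in the good domain
  (\<open>both_inflections_ddom\<close>, \<open>elliptic_domain_iff\<close>). The square root in V
  is not smooth on the whole space, so a perturbation of the pair is translated into one of the
  coefficients and confined to a compact part of the domain. Compact support also suits the strong
  topology, in which f + s g need not tend to f as s tends to 0. The unknowns are x, y and
  \<epsilon>: four independent jet conditions are avoided, three are met regularly. The delicate
  condition is the Jacobian of two curves: a perturbation of the jet reaches it only with a
  y-derivative of one of the functions as factor. Hence the common zeros are divided by which of
  these derivatives is nonzero, and their simultaneous vanishing is excluded by a separate set of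
  four conditions.\<close>

abbreviation dd :: "'a::real_normed_vector \<Rightarrow> ('a \<Rightarrow> 'b::real_normed_vector) \<Rightarrow> 'a \<Rightarrow> 'b" where
  "dd v f \<equiv> (\<lambda>x. frechet_derivative f (at x) v)"

text \<open>\<open>csm k\<close> grades smoothness by the number of derivatives: closure under products, composition, inverses
  and integrals is proved by induction on \<open>k\<close>.\<close>

primrec csm :: "nat \<Rightarrow> 'a::real_normed_vector set \<Rightarrow> ('a \<Rightarrow> 'b::real_normed_vector) \<Rightarrow> bool" where
  "csm 0 S f \<longleftrightarrow> f differentiable_on S"
| "csm (Suc k) S f \<longleftrightarrow> f differentiable_on S \<and> (\<forall>v. csm k S (dd v f))"

text \<open>In \<open>iter_deriv\<close> the head of the list is the outermost derivative, whereas
  the recursion of \<open>csm\<close> strips the innermost one; this identity passes between the two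
  ends.\<close>

lemma iter_deriv_snoc: "iter_deriv (vs @ [v]) f = iter_deriv vs (dd v f)"
  by (induction vs) auto

lemma csm_iff: "csm k S f \<longleftrightarrow> (\<forall>vs. length vs \<le> k \<longrightarrow> iter_deriv vs f differentiable_on S)"
proof (induction k arbitrary: f)
  case 0 show ?case by simp
next
  case (Suc k)
  show ?case
  proof
    assume L: "csm (Suc k) S f"
    show "\<forall>vs. length vs \<le> Suc k \<longrightarrow> iter_deriv vs f differentiable_on S"
    proof (intro allI impI)
      fix vs :: "'a list" assume "length vs \<le> Suc k"
      then show "iter_deriv vs f differentiable_on S"
        using L Suc.IH by (cases vs rule: rev_cases) (auto simp: iter_deriv_snoc)
    qed
  next
    assume R: "\<forall>vs. length vs \<le> Suc k \<longrightarrow> iter_deriv vs f differentiable_on S"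
    have "f differentiable_on S" using R[rule_format, of "[]"] by simp
    moreover have "csm k S (dd v f)" for v
      unfolding Suc.IH using R by (metis iter_deriv_snoc length_append_singleton Suc_le_mono)
    ultimately show "csm (Suc k) S f" by simp
  qed
qed

lemma smooth_on_iff: "smooth_on S f \<longleftrightarrow> (\<forall>k. csm k S f)"
  unfolding smooth_on_def csm_iff by auto

lemma csm_differentiable_on: "csm k S f \<Longrightarrow> f differentiable_on S"
  by (cases k) auto

lemma csm_differentiable_at:
  assumes "csm k S f" "open S" "x \<in> S" shows "f differentiable at x"
  using csm_differentiable_on[OF assms(1)] assms(2,3) by (simp add: differentiable_on_eq_differentiable_at)

lemma csm_has_derivative:
  assumes "csm k S f" "open S" "x \<in> S"
  shows "(f has_derivative frechet_derivative f (at x)) (at x)"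
  using csm_differentiable_at[OF assms] by (simp add: frechet_derivative_works)

lemma frechet_at_eqI: "(f has_derivative f') (at x) \<Longrightarrow> frechet_derivative f (at x) = f'"
  using frechet_derivative_at by metis

lemma dd_cong:
  assumes "open S" "\<And>x. x \<in> S \<Longrightarrow> f x = g x" "x \<in> S"
  shows "frechet_derivative f (at x) = frechet_derivative g (at x)"
proof -
  have "(f has_derivative D) (at x) \<longleftrightarrow> (g has_derivative D) (at x)" for D
    using has_derivative_transform_within_open[OF _ assms(1,3)] assms(2) by metis
  then show ?thesis unfolding frechet_derivative_def by simp
qed

lemma differentiable_on_cong:
  assumes "open S" "\<And>x. x \<in> S \<Longrightarrow> f x = g x" "f differentiable_on S"
  shows "g differentiable_on S"
  unfolding differentiable_on_eq_differentiable_at[OF assms(1)] differentiable_def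
proof
  fix x assume "x \<in> S"
  then obtain D where "(f has_derivative D) (at x)"
    using assms(1,3) by (auto simp: differentiable_on_eq_differentiable_at differentiable_def)
  then show "\<exists>D. (g has_derivative D) (at x)"
    using has_derivative_transform_within_open[OF _ assms(1) \<open>x \<in> S\<close>] assms(2) by metis
qed

lemma csm_cong:
  assumes "open S" "\<And>x. x \<in> S \<Longrightarrow> f x = g x" "csm k S f"
  shows "csm k S g"
  using assms(2,3)
proof (induction k arbitrary: f g)
  case 0 then show ?case using differentiable_on_cong[OF assms(1)] by auto
next
  case (Suc k)
  have "csm k S (dd v g)" for v
  proof (rule Suc.IH[of "dd v f"])
    show "dd v f x = dd v g x" if "x \<in> S" for x
      using dd_cong[OF assms(1), of f g x] Suc.prems(1) that by simp
  qed (use Suc.prems in auto)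
  then show ?case using Suc.prems differentiable_on_cong[OF assms(1)] by auto
qed

lemma smooth_on_cong:
  assumes "open S" "\<And>x. x \<in> S \<Longrightarrow> f x = g x" "smooth_on S f"
  shows "smooth_on S g"
  using assms csm_cong unfolding smooth_on_iff by blast

lemma smooth_on_subset: "smooth_on S f \<Longrightarrow> T \<subseteq> S \<Longrightarrow> smooth_on T f"
  unfolding smooth_on_def by (meson differentiable_on_subset)

text \<open>Differentiability of each iterated derivative is a pointwise matter, so different
  formulas may be used on different open sets; \<open>smooth_bump_sqrt\<close> depends on
  this.\<close>

lemma smooth_on_local:
  assumes "\<And>x. x \<in> S \<Longrightarrow> \<exists>T. open T \<and> x \<in> T \<and> smooth_on T f"
  shows "smooth_on S f"
  unfolding smooth_on_def differentiable_on_def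
proof (intro allI ballI)
  fix vs x assume "x \<in> S"
  then obtain T where "open T" "x \<in> T" "smooth_on T f" using assms by blast
  then have "iter_deriv vs f differentiable at x"
    unfolding smooth_on_def by (simp add: differentiable_on_eq_differentiable_at)
  then show "iter_deriv vs f differentiable at x within S"
    by (rule differentiable_at_withinI)
qed

lemma csm_Suc_imp: "csm (Suc k) S f \<Longrightarrow> csm k S f"
  unfolding csm_iff by auto

lemma csm_const [simp]: "csm k S (\<lambda>x. c)"
  by (induction k arbitrary: c) auto

lemma csm_bounded_linear:
  assumes "bounded_linear f" shows "csm k S f"
proof -
  have "f differentiable_on S"
    by (simp add: assms bounded_linear_imp_differentiable_on)
  moreover have "dd v f = (\<lambda>x. f v)" for v
    using frechet_at_eqI[OF bounded_linear_imp_has_derivative[OF assms]] by auto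
  ultimately show ?thesis by (cases k) auto
qed

lemma csm_linear_comp:
  assumes "open S" "bounded_linear L" "csm k S f"
  shows "csm k S (\<lambda>x. L (f x))"
  using assms(3)
proof (induction k arbitrary: f)
  case 0
  then show ?case
    unfolding csm.simps differentiable_on_def differentiable_def
    using bounded_linear.has_derivative[OF assms(2)] by blast
next
  case (Suc k)
  have der: "((\<lambda>x. L (f x)) has_derivative (\<lambda>v. L (dd v f x))) (at x)" if "x \<in> S" for x
    using bounded_linear.has_derivative[OF assms(2) csm_has_derivative[OF Suc.prems assms(1) that]] .
  have "csm k S (dd v (\<lambda>x. L (f x)))" for v
    by (rule csm_cong[OF assms(1) _ Suc.IH[of "dd v f"]]) (use Suc.prems frechet_at_eqI[OF der] in auto)
  moreover have "(\<lambda>x. L (f x)) differentiable_on S"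
    using der by (meson differentiable_at_imp_differentiable_on differentiableI)
  ultimately show ?case by simp
qed

lemma csm_add:
  assumes "open S" "csm k S f" "csm k S g"
  shows "csm k S (\<lambda>x. f x + g x)"
  using assms(2,3)
proof (induction k arbitrary: f g)
  case 0 then show ?case by auto
next
  case (Suc k)
  have der: "((\<lambda>x. f x + g x) has_derivative (\<lambda>v. dd v f x + dd v g x)) (at x)" if "x \<in> S" for x
    using has_derivative_add[OF csm_has_derivative[OF Suc.prems(1) assms(1) that]
      csm_has_derivative[OF Suc.prems(2) assms(1) that]] .
  have "csm k S (dd v (\<lambda>x. f x + g x))" for v
    by (rule csm_cong[OF assms(1) _ Suc.IH[of "dd v f" "dd v g"]]) (use Suc.prems frechet_at_eqI[OF der] in auto)
  moreover have "(\<lambda>x. f x + g x) differentiable_on S"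
    using der by (meson differentiable_at_imp_differentiable_on differentiableI)
  ultimately show ?case by simp
qed

lemma csm_bilinear:
  assumes "bounded_bilinear B" "open S" "csm k S f" "csm k S g"
  shows "csm k S (\<lambda>x. B (f x) (g x))"
  using assms(3,4)
proof (induction k arbitrary: f g)
  case 0
  then show ?case
    unfolding csm.simps differentiable_on_def differentiable_def
    using bounded_bilinear.FDERIV[OF assms(1)] by blast
next
  case (Suc k)
  have der: "((\<lambda>x. B (f x) (g x)) has_derivative (\<lambda>v. B (f x) (dd v g x) + B (dd v f x) (g x))) (at x)" if "x \<in> S" for x
    using bounded_bilinear.FDERIV[OF assms(1) csm_has_derivative[OF Suc.prems(1) assms(2) that]
      csm_has_derivative[OF Suc.prems(2) assms(2) that]] .
  have "csm k S (dd v (\<lambda>x. B (f x) (g x)))" for v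
    by (rule csm_cong[OF assms(2) _ csm_add[OF assms(2) Suc.IH[of f "dd v g"] Suc.IH[of "dd v f" g]]])
      (use Suc.prems csm_Suc_imp frechet_at_eqI[OF der] in auto)
  moreover have "(\<lambda>x. B (f x) (g x)) differentiable_on S"
    using der by (meson differentiable_at_imp_differentiable_on differentiableI)
  ultimately show ?case by simp
qed

lemma csm_sum:
  assumes "open S" "\<And>i. i \<in> I \<Longrightarrow> csm k S (f i)"
  shows "csm k S (\<lambda>x. \<Sum>i\<in>I. f i x)"
  using assms(2)
  by (induction I rule: infinite_finite_induct) (auto intro!: csm_add assms(1))

lemma linear_basis_expand:
  fixes f :: "'a::euclidean_space \<Rightarrow> 'b::real_vector"
  assumes "linear f" shows "f v = (\<Sum>i\<in>Basis. (v \<bullet> i) *\<^sub>R f i)"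
  using assms by (metis (no_types, lifting) euclidean_representation linear_scale linear_sum sum.cong)

text \<open>By the chain rule a derivative of the composite is a sum over \<open>Basis\<close> of
  components of the derivative of f times directional derivatives of g; a Euclidean middle space
  makes the sum finite. The induction varies g only, since each \<open>dd i g\<close> is again
  composed with the same f.\<close>

lemma csm_compose:
  fixes f :: "'a::real_normed_vector \<Rightarrow> 'b::euclidean_space"
  assumes "open S" "open T" "f ` S \<subseteq> T" "csm k T g" "csm k S f"
  shows "csm k S (\<lambda>x. g (f x))"
  using assms(4,5)
proof (induction k arbitrary: g)
  case 0
  have "(\<lambda>x. g (f x)) differentiable at x" if "x \<in> S" for x
    using 0 that assms by (intro differentiable_chain_at[of f x g, unfolded o_def])
      (auto simp: differentiable_on_eq_differentiable_at)
  then show ?case by (simp add: differentiable_at_imp_differentiable_on)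
next
  case (Suc k)
  have der: "((\<lambda>x. g (f x)) has_derivative (\<lambda>v. frechet_derivative g (at (f x)) (dd v f x))) (at x)" if "x \<in> S" for x
    using diff_chain_at[OF csm_has_derivative[OF Suc.prems(2) assms(1) that], of g]
      csm_has_derivative[OF Suc.prems(1) assms(2)] that assms(3) by (auto simp: o_def)
  have lin: "linear (frechet_derivative g (at (f x)))" if "x \<in> S" for x
    using csm_has_derivative[OF Suc.prems(1) assms(2)] that assms(3)
    by (metis has_derivative_linear image_subset_iff)
  have eq: "dd v (\<lambda>x. g (f x)) x = (\<Sum>i\<in>Basis. (dd v f x \<bullet> i) *\<^sub>R dd i g (f x))" if "x \<in> S" for v x
    using frechet_at_eqI[OF der[OF that]] linear_basis_expand[OF lin[OF that]] by metis
  have "csm k S (dd v (\<lambda>x. g (f x)))" for v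
  proof (rule csm_cong[OF assms(1) eq[symmetric]])
    show "csm k S (\<lambda>x. \<Sum>i\<in>Basis. (dd v f x \<bullet> i) *\<^sub>R dd i g (f x))"
    proof (rule csm_sum[OF assms(1)])
      fix i :: 'b assume "i \<in> Basis"
      show "csm k S (\<lambda>x. (dd v f x \<bullet> i) *\<^sub>R dd i g (f x))"
      proof (rule csm_bilinear[OF bounded_bilinear_scaleR assms(1)])
        show "csm k S (\<lambda>x. dd v f x \<bullet> i)"
          by (rule csm_linear_comp[OF assms(1) bounded_linear_inner_left]) (use Suc.prems in auto)
        show "csm k S (\<lambda>x. dd i g (f x))"
          using Suc.IH[of "dd i g"] Suc.prems csm_Suc_imp by auto
      qed
    qed
  qed
  moreover have "(\<lambda>x. g (f x)) differentiable_on S"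
    using der by (meson differentiable_at_imp_differentiable_on differentiableI)
  ultimately show ?case by simp
qed

lemma smooth_on_dd: "smooth_on S f \<Longrightarrow> smooth_on S (dd v f)"
  unfolding smooth_on_def by (metis iter_deriv_snoc)

lemma smooth_on_iter_deriv: "smooth_on S f \<Longrightarrow> smooth_on S (iter_deriv vs f)"
proof (induction vs arbitrary: f rule: rev_induct)
  case (snoc v vs) then show ?case using smooth_on_dd[of S f v] by (simp add: iter_deriv_snoc)
qed auto

lemma smooth_on_differentiable: "smooth_on S f \<Longrightarrow> open S \<Longrightarrow> x \<in> S \<Longrightarrow> f differentiable at x"
  using csm_differentiable_at[of 0] unfolding smooth_on_iff by blast

lemma smooth_on_has_derivative:
  "smooth_on S f \<Longrightarrow> open S \<Longrightarrow> x \<in> S \<Longrightarrow> (f has_derivative frechet_derivative f (at x)) (at x)"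
  using smooth_on_differentiable by (simp add: frechet_derivative_works)

lemma smooth_on_linear:
  "smooth_on S f \<Longrightarrow> open S \<Longrightarrow> x \<in> S \<Longrightarrow> linear (frechet_derivative f (at x))"
  using smooth_on_has_derivative has_derivative_linear by blast

lemma smooth_on_continuous_on: "smooth_on S f \<Longrightarrow> open S \<Longrightarrow> continuous_on S f"
  by (meson continuous_at_imp_continuous_on differentiable_imp_continuous_within smooth_on_differentiable)

section \<open>Closure rules for smooth maps on open sets\<close>

named_theorems smooth_intros

lemma smooth_on_const [smooth_intros]: "smooth_on S (\<lambda>x. c)"
  by (simp add: smooth_on_iff)

lemma smooth_on_bounded_linear: "bounded_linear f \<Longrightarrow> smooth_on S f"
  by (simp add: smooth_on_iff csm_bounded_linear)

lemma smooth_on_linear_comp: "open S \<Longrightarrow> bounded_linear L \<Longrightarrow> smooth_on S f \<Longrightarrow> smooth_on S (\<lambda>x. L (f x))"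
  by (simp add: smooth_on_iff csm_linear_comp)

lemma smooth_on_id [smooth_intros]: "smooth_on S (\<lambda>x. x)"
  by (rule smooth_on_bounded_linear) simp

lemma smooth_on_add [smooth_intros]:
  "open S \<Longrightarrow> smooth_on S f \<Longrightarrow> smooth_on S g \<Longrightarrow> smooth_on S (\<lambda>x. f x + g x)"
  by (simp add: smooth_on_iff csm_add)

lemma smooth_on_minus [smooth_intros]: "open S \<Longrightarrow> smooth_on S f \<Longrightarrow> smooth_on S (\<lambda>x. - f x)"
  by (rule smooth_on_linear_comp) (auto intro: bounded_linear_minus)

lemma smooth_on_diff [smooth_intros]:
  "open S \<Longrightarrow> smooth_on S f \<Longrightarrow> smooth_on S g \<Longrightarrow> smooth_on S (\<lambda>x. f x - g x)"
  using smooth_on_add[of S f "\<lambda>x. - g x"] smooth_on_minus[of S g] by simp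

lemma smooth_on_mult [smooth_intros]:
  fixes f g :: "_ \<Rightarrow> 'a::real_normed_algebra"
  shows "open S \<Longrightarrow> smooth_on S f \<Longrightarrow> smooth_on S g \<Longrightarrow> smooth_on S (\<lambda>x. f x * g x)"
  by (simp add: smooth_on_iff csm_bilinear[OF bounded_bilinear_mult])

lemma smooth_on_scaleR [smooth_intros]:
  "open S \<Longrightarrow> smooth_on S f \<Longrightarrow> smooth_on S g \<Longrightarrow> smooth_on S (\<lambda>x. f x *\<^sub>R g x)"
  by (simp add: smooth_on_iff csm_bilinear[OF bounded_bilinear_scaleR])

lemma smooth_on_inner [smooth_intros]:
  "open S \<Longrightarrow> smooth_on S f \<Longrightarrow> smooth_on S g \<Longrightarrow> smooth_on S (\<lambda>x. f x \<bullet> g x)"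
  by (simp add: smooth_on_iff csm_bilinear[OF bounded_bilinear_inner])

lemma smooth_on_power [smooth_intros]:
  fixes f :: "_ \<Rightarrow> real"
  assumes "open S" "smooth_on S f" shows "smooth_on S (\<lambda>x. f x ^ n)"
  by (induction n) (auto intro!: smooth_intros assms)

lemma smooth_on_sum [smooth_intros]:
  "open S \<Longrightarrow> (\<And>i. i \<in> I \<Longrightarrow> smooth_on S (f i)) \<Longrightarrow> smooth_on S (\<lambda>x. \<Sum>i\<in>I. f i x)"
  by (simp add: smooth_on_iff csm_sum)

lemma smooth_on_compose:
  fixes f :: "'a::real_normed_vector \<Rightarrow> 'b::euclidean_space"
  shows "smooth_on T g \<Longrightarrow> smooth_on S f \<Longrightarrow> open S \<Longrightarrow> open T \<Longrightarrow> f ` S \<subseteq> T \<Longrightarrow> smooth_on S (\<lambda>x. g (f x))"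
  using csm_compose unfolding smooth_on_iff by blast

lemma smooth_on_Pair [smooth_intros]:
  assumes "open S" "smooth_on S f" "smooth_on S g" shows "smooth_on S (\<lambda>x. (f x, g x))"
proof -
  have "bounded_linear (\<lambda>u. (u, 0::'c))" "bounded_linear (\<lambda>u. (0::'b, u))"
    by (auto intro!: bounded_linear_Pair bounded_linear_ident bounded_linear_zero)
  then have "smooth_on S (\<lambda>x. (f x, 0) + (0, g x))"
    by (intro smooth_on_add assms smooth_on_linear_comp[OF assms(1) _ assms(2)] smooth_on_linear_comp[OF assms(1) _ assms(3)])
  then show ?thesis by simp
qed

lemma smooth_on_fst [smooth_intros]: "open S \<Longrightarrow> smooth_on S f \<Longrightarrow> smooth_on S (\<lambda>x. fst (f x))"
  by (rule smooth_on_linear_comp) (auto intro: bounded_linear_fst)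

lemma smooth_on_snd [smooth_intros]: "open S \<Longrightarrow> smooth_on S f \<Longrightarrow> smooth_on S (\<lambda>x. snd (f x))"
  by (rule smooth_on_linear_comp) (auto intro: bounded_linear_snd)

text \<open>The derivative of 1/f involves only 1/f and the derivative of f, so one grade for 1/f
  gives the next; square roots and inverse functions are bootstrapped in the same way.\<close>

lemma csm_inverse:
  fixes f :: "'a::real_normed_vector \<Rightarrow> real"
  assumes "open S" "\<And>x. x \<in> S \<Longrightarrow> f x \<noteq> 0" "csm k S f"
  shows "csm k S (\<lambda>x. inverse (f x))"
  using assms(3)
proof (induction k)
  case 0
  then show ?case using assms(2) by (auto simp: differentiable_on_def intro!: differentiable_inverse)
next
  case (Suc k)
  have der: "((\<lambda>x. inverse (f x)) has_derivative (\<lambda>v. - (inverse (f x) * dd v f x * inverse (f x)))) (at x)" if "x \<in> S" for x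
    using Deriv.has_derivative_inverse[OF assms(2)[OF that] csm_has_derivative[OF Suc.prems assms(1) that]] .
  have I: "csm k S (\<lambda>x. inverse (f x))" by (rule Suc.IH[OF csm_Suc_imp[OF Suc.prems]])
  have "csm k S (dd v (\<lambda>x. inverse (f x)))" for v
  proof (rule csm_cong[OF assms(1)])
    show "csm k S (\<lambda>x. - (inverse (f x) * dd v f x * inverse (f x)))"
      using Suc.prems by (intro csm_linear_comp[OF assms(1) bounded_linear_minus[OF bounded_linear_ident]]
          csm_bilinear[OF bounded_bilinear_mult] assms(1) I) auto
  qed (use frechet_at_eqI[OF der] in auto)
  moreover have "(\<lambda>x. inverse (f x)) differentiable_on S"
    using der by (meson differentiable_at_imp_differentiable_on differentiableI)
  ultimately show ?case by simp
qed

lemma smooth_on_inverse [smooth_intros]: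
  fixes f :: "'a::real_normed_vector \<Rightarrow> real"
  shows "open S \<Longrightarrow> (\<And>x. x \<in> S \<Longrightarrow> f x \<noteq> 0) \<Longrightarrow> smooth_on S f \<Longrightarrow> smooth_on S (\<lambda>x. inverse (f x))"
  using csm_inverse unfolding smooth_on_iff by blast

lemma smooth_on_divide [smooth_intros]:
  fixes f g :: "'a::real_normed_vector \<Rightarrow> real"
  assumes "open S" "smooth_on S f" "smooth_on S g" "\<And>x. x \<in> S \<Longrightarrow> g x \<noteq> 0"
  shows "smooth_on S (\<lambda>x. f x / g x)"
  unfolding divide_inverse by (intro smooth_intros assms)

lemma csm_sqrt:
  fixes f :: "'a::real_normed_vector \<Rightarrow> real"
  assumes "open S" "\<And>x. x \<in> S \<Longrightarrow> f x > 0" "csm k S f"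
  shows "csm k S (\<lambda>x. sqrt (f x))"
  using assms(3)
proof (induction k)
  case 0
  have "((\<lambda>x. sqrt (f x)) has_derivative (\<lambda>v. dd v f x * (inverse (sqrt (f x)) / 2))) (at x)" if "x \<in> S" for x
    using has_derivative_real_sqrt[OF assms(2)[OF that] csm_has_derivative[OF 0 assms(1) that]] 
    by (simp add: field_simps)
  then show ?case by simp (meson differentiable_at_imp_differentiable_on differentiableI)
next
  case (Suc k)
  have der: "((\<lambda>x. sqrt (f x)) has_derivative (\<lambda>v. dd v f x * (inverse (sqrt (f x)) / 2))) (at x)" if "x \<in> S" for x
    using has_derivative_real_sqrt[OF assms(2)[OF that] csm_has_derivative[OF Suc.prems assms(1) that]] 
    by (simp add: field_simps)
  have I: "csm k S (\<lambda>x. inverse (sqrt (f x)))" 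
    by (rule csm_inverse[OF assms(1) _ Suc.IH[OF csm_Suc_imp[OF Suc.prems]]]) (use assms(2) in force)
  have "csm k S (dd v (\<lambda>x. sqrt (f x)))" for v
  proof (rule csm_cong[OF assms(1)])
    show "csm k S (\<lambda>x. dd v f x * (inverse (sqrt (f x)) / 2))"
      using Suc.prems by (intro csm_linear_comp[OF assms(1) bounded_linear_divide]
          csm_bilinear[OF bounded_bilinear_mult] assms(1) I) auto
  qed (use frechet_at_eqI[OF der] in auto)
  moreover have "(\<lambda>x. sqrt (f x)) differentiable_on S"
    using der by (meson differentiable_at_imp_differentiable_on differentiableI)
  ultimately show ?case by simp
qed

lemma smooth_on_sqrt [smooth_intros]:
  fixes f :: "'a::real_normed_vector \<Rightarrow> real"
  shows "open S \<Longrightarrow> smooth_on S f \<Longrightarrow> (\<And>x. x \<in> S \<Longrightarrow> f x > 0) \<Longrightarrow> smooth_on S (\<lambda>x. sqrt (f x))"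
  using csm_sqrt unfolding smooth_on_iff by blast

section \<open>Inverse functions\<close>

text \<open>Here f is only continuous at y0: the factor \<phi>, of first order at y0, absorbs the
  error of f. This is what is available before the inverse of a linear map is known to be
  differentiable in its parameter.\<close>

lemma has_derivative_times_null:
  fixes \<phi> :: "'c::real_normed_vector \<Rightarrow> 'a::real_normed_vector"
  assumes f: "(f \<longlongrightarrow> f y0) (at y0)" and \<phi>: "(\<phi> has_derivative \<phi>') (at y0)" and 0: "\<phi> y0 = 0"
  shows "((\<lambda>y. f y *\<^sub>R \<phi> y) has_derivative (\<lambda>h. f y0 *\<^sub>R \<phi>' h)) (at y0)"
  unfolding has_derivative_iff_norm
proof
  have bl: "bounded_linear \<phi>'" and lim: "((\<lambda>y. norm ((\<phi> y - \<phi> y0) - \<phi>' (y - y0)) / norm (y - y0)) \<longlongrightarrow> 0) (at y0)"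
    using \<phi> unfolding has_derivative_iff_norm by auto
  show "bounded_linear (\<lambda>h. f y0 *\<^sub>R \<phi>' h)"
    using bl by (rule bounded_linear_const_scaleR)
  obtain K where K: "\<And>h. norm (\<phi>' h) \<le> norm h * K" using bounded_linear.bounded[OF bl] by blast
  have l1: "((\<lambda>y. \<bar>f y\<bar> * (norm ((\<phi> y - \<phi> y0) - \<phi>' (y - y0)) / norm (y - y0))
     + \<bar>f y - f y0\<bar> * \<bar>K\<bar>) \<longlongrightarrow> \<bar>f y0\<bar> * 0 + \<bar>f y0 - f y0\<bar> * \<bar>K\<bar>) (at y0)"
    by (intro tendsto_intros f lim)
  show "((\<lambda>y. norm ((f y *\<^sub>R \<phi> y - f y0 *\<^sub>R \<phi> y0) - f y0 *\<^sub>R \<phi>' (y - y0)) / norm (y - y0)) \<longlongrightarrow> 0) (at y0)"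
  proof (rule Lim_null_comparison[OF _ l1[simplified]])
    show "\<forall>\<^sub>F y in at y0. norm (norm (f y *\<^sub>R \<phi> y - f y0 *\<^sub>R \<phi> y0 - f y0 *\<^sub>R \<phi>' (y - y0)) / norm (y - y0))
        \<le> \<bar>f y\<bar> * norm ((\<phi> y - \<phi> y0) - \<phi>' (y - y0)) / norm (y - y0) + \<bar>f y - f y0\<bar> * \<bar>K\<bar>"
    proof (rule eventually_at_filter[THEN iffD2], rule always_eventually, intro allI impI)
      fix y assume "y \<noteq> y0"
      then have n: "norm (y - y0) > 0" by simp
      have "f y *\<^sub>R \<phi> y - f y0 *\<^sub>R \<phi> y0 - f y0 *\<^sub>R \<phi>' (y - y0)
          = f y *\<^sub>R (\<phi> y - \<phi> y0 - \<phi>' (y - y0)) + (f y - f y0) *\<^sub>R \<phi>' (y - y0)"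
        by (simp add: 0 algebra_simps)
      then have "norm (f y *\<^sub>R \<phi> y - f y0 *\<^sub>R \<phi> y0 - f y0 *\<^sub>R \<phi>' (y - y0))
          \<le> \<bar>f y\<bar> * norm (\<phi> y - \<phi> y0 - \<phi>' (y - y0)) + \<bar>f y - f y0\<bar> * norm (\<phi>' (y - y0))"
        by (metis norm_scaleR norm_triangle_ineq)
      also have "\<dots> \<le> \<bar>f y\<bar> * norm (\<phi> y - \<phi> y0 - \<phi>' (y - y0)) + \<bar>f y - f y0\<bar> * (norm (y - y0) * \<bar>K\<bar>)"
        by (intro add_left_mono mult_left_mono order_trans[OF K]) auto
      finally show "norm (norm (f y *\<^sub>R \<phi> y - f y0 *\<^sub>R \<phi> y0 - f y0 *\<^sub>R \<phi>' (y - y0)) / norm (y - y0))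
        \<le> \<bar>f y\<bar> * norm ((\<phi> y - \<phi> y0) - \<phi>' (y - y0)) / norm (y - y0) + \<bar>f y - f y0\<bar> * \<bar>K\<bar>"
        using n by (simp add: field_simps)
    qed
  qed
qed

text \<open>The vector w y, the inverse of \<open>L y\<close> applied to v, satisfies a fixed-point
  equation whose coefficients \<open>\<phi> i y\<close> vanish at y0. It yields first a bound, then
  continuity, then by \<open>has_derivative_times_null\<close> the derivative.\<close>

lemma has_derivative_inv_linear:
  fixes L :: "'c::real_normed_vector \<Rightarrow> 'a::euclidean_space \<Rightarrow> 'a"
  assumes "open S" "y0 \<in> S" and lin: "\<And>y. y \<in> S \<Longrightarrow> linear (L y)" and inj: "\<And>y. y \<in> S \<Longrightarrow> inj (L y)"
    and der: "\<And>u. ((\<lambda>y. L y u) has_derivative L' u) (at y0)"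
  shows "((\<lambda>y. inv (L y) v) has_derivative
     (\<lambda>h. - (\<Sum>i\<in>Basis. (inv (L y0) v \<bullet> i) *\<^sub>R inv (L y0) (L' i h)))) (at y0)"
proof -
  define w where "w y = inv (L y) v" for y
  define M where "M = inv (L y0)"
  define \<phi> where "\<phi> i y = M (L y i - L y0 i)" for i y
  have surj: "surj (L y)" if "y \<in> S" for y
    using lin[OF that] inj[OF that] linear_injective_imp_surjective by blast
  have Lw: "L y (w y) = v" if "y \<in> S" for y
    using surj[OF that] by (simp add: w_def surj_f_inv_f)
  have linM: "linear M"
    using linear_surj_right_inverse lin[OF assms(2)] inj[OF assms(2)] surj[OF assms(2)]
    unfolding M_def by (meson inj_linear_imp_inv_linear)
  have Minv: "M (L y0 u) = u" for u using inj[OF assms(2)] by (simp add: M_def)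
  have blM: "bounded_linear M" using linM by (simp add: linear_conv_bounded_linear)
  \<comment> \<open>Obtained from L y0 (w y0 - w y) = (L y - L y0) (w y) by applying the inverse of
    \<open>L y0\<close>.\<close>
  have eq: "w y = w y0 - (\<Sum>i\<in>Basis. (w y \<bullet> i) *\<^sub>R \<phi> i y)" if "y \<in> S" for y
  proof -
    have "L y0 (w y0 - w y) = L y (w y) - L y0 (w y)"
      using Lw assms(2) that by (simp add: linear_diff[OF lin[OF assms(2)]])
    also have "\<dots> = (\<Sum>i\<in>Basis. (w y \<bullet> i) *\<^sub>R (L y i - L y0 i))"
      by (subst linear_basis_expand[OF lin[OF that]], subst linear_basis_expand[OF lin[OF assms(2)]])
        (simp add: sum_subtractf scaleR_diff_right)
    finally have "w y0 - w y = M (\<Sum>i\<in>Basis. (w y \<bullet> i) *\<^sub>R (L y i - L y0 i))" using Minv by metis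
    also have "\<dots> = (\<Sum>i\<in>Basis. (w y \<bullet> i) *\<^sub>R \<phi> i y)"
      by (simp add: \<phi>_def linear_sum[OF linM] linear_scale[OF linM])
    finally show ?thesis by (simp add: algebra_simps)
  qed
  have der\<phi>: "(\<phi> i has_derivative (\<lambda>h. M (L' i h))) (at y0)" for i
    unfolding \<phi>_def by (rule bounded_linear.has_derivative[OF blM]) (auto intro!: derivative_eq_intros der)
  have \<phi>0: "\<phi> i y0 = 0" for i by (simp add: \<phi>_def linear_0[OF linM])
  have lim\<phi>: "((\<lambda>y. norm (\<phi> i y)) \<longlongrightarrow> 0) (at y0)" for i
    using has_derivative_continuous[OF der\<phi>[of i]] \<phi>0[of i] by (simp add: isCont_def tendsto_norm_zero_iff)
  define \<psi> where "\<psi> y = (\<Sum>i\<in>Basis. norm (\<phi> i y))" for y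
  have lim\<psi>: "(\<psi> \<longlongrightarrow> 0) (at y0)"
    unfolding \<psi>_def by (rule tendsto_null_sum) (rule lim\<phi>)
  have bd: "norm (w y - w y0) \<le> norm (w y) * \<psi> y" if "y \<in> S" for y
  proof -
    have "norm (w y - w y0) = norm (\<Sum>i\<in>Basis. (w y \<bullet> i) *\<^sub>R \<phi> i y)"
      using eq[OF that] by (metis diff_add_cancel norm_minus_commute add_diff_cancel_left')
    also have "\<dots> \<le> (\<Sum>i\<in>Basis. norm (w y) * norm (\<phi> i y))"
      by (rule sum_norm_le) (auto intro!: mult_right_mono simp: Basis_le_norm)
    finally show ?thesis by (simp add: \<psi>_def sum_distrib_left)
  qed
  have evS: "\<forall>\<^sub>F y in at y0. y \<in> S" using assms(1,2) by (simp add: eventually_at_topological) blast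
  have limw: "(w \<longlongrightarrow> w y0) (at y0)"
  proof -
    \<comment> \<open>With \<psi> below 1/2, half of the norm of \<open>w y\<close> is absorbed on
      the left, so w is bounded near y0 by twice its norm there.\<close>
    have "\<forall>\<^sub>F y in at y0. \<psi> y < 1/2" using lim\<psi> by (rule order_tendstoD) simp
    then have ev: "\<forall>\<^sub>F y in at y0. norm (w y - w y0) \<le> 2 * norm (w y0) * \<psi> y"
      using evS
    proof eventually_elim
      case (elim y)
      have \<psi>0: "0 \<le> \<psi> y" by (simp add: \<psi>_def sum_nonneg)
      have "norm (w y) \<le> norm (w y0) + norm (w y - w y0)" by (metis norm_triangle_sub)
      also have "\<dots> \<le> norm (w y0) + norm (w y) * (1/2)"
        using bd[OF elim(2)] elim(1) mult_left_mono[of "\<psi> y" "1/2" "norm (w y)"] by simp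
      finally have "norm (w y) \<le> 2 * norm (w y0)" by simp
      then show ?case using bd[OF elim(2)] mult_right_mono[OF _ \<psi>0] order_trans by blast
    qed
    have "((\<lambda>y. 2 * norm (w y0) * \<psi> y) \<longlongrightarrow> 0) (at y0)"
      using tendsto_mult_right_zero[OF lim\<psi>] by blast
    then show ?thesis using Lim_null_comparison[OF ev] LIM_zero_iff by blast
  qed
  have "((\<lambda>y. w y0 - (\<Sum>i\<in>Basis. (w y \<bullet> i) *\<^sub>R \<phi> i y)) has_derivative
      (\<lambda>h. - (\<Sum>i\<in>Basis. (w y0 \<bullet> i) *\<^sub>R M (L' i h)))) (at y0)"
    by (rule derivative_eq_intros has_derivative_times_null der\<phi> \<phi>0 tendsto_intros limw refl)+ auto
  then have "(w has_derivative (\<lambda>h. - (\<Sum>i\<in>Basis. (w y0 \<bullet> i) *\<^sub>R M (L' i h)))) (at y0)"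
    by (rule has_derivative_transform_within_open[OF _ assms(1,2)]) (use eq in auto)
  then show ?thesis unfolding w_def[abs_def] M_def .
qed

lemma csm_inv_linear:
  fixes L :: "'c::real_normed_vector \<Rightarrow> 'a::euclidean_space \<Rightarrow> 'a"
  assumes S: "open S" and lin: "\<And>y. y \<in> S \<Longrightarrow> linear (L y)" and inj: "\<And>y. y \<in> S \<Longrightarrow> inj (L y)"
    and sm: "\<And>u. csm k S (\<lambda>y. L y u)"
  shows "csm k S (\<lambda>y. inv (L y) v)"
  using sm
proof (induction k arbitrary: v)
  case 0
  have "(\<lambda>y. inv (L y) v) differentiable at y" if "y \<in> S" for y
    using has_derivative_inv_linear[OF S that lin inj csm_has_derivative[OF 0 S that]]
    by (auto simp: differentiable_def)
  then show ?case by (simp add: differentiable_at_imp_differentiable_on)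
next
  case (Suc k)
  let ?D = "\<lambda>i y. frechet_derivative (\<lambda>y. L y i) (at y)"
  have der: "((\<lambda>y. inv (L y) v) has_derivative
     (\<lambda>h. - (\<Sum>i\<in>Basis. (inv (L y) v \<bullet> i) *\<^sub>R inv (L y) (?D i y h)))) (at y)" if "y \<in> S" for y
    using has_derivative_inv_linear[OF S that lin inj csm_has_derivative[OF Suc.prems S that]] .
  have I: "csm k S (\<lambda>y. inv (L y) v)" for v
    by (rule Suc.IH) (use Suc.prems csm_Suc_imp in blast)
  have lininv: "linear (inv (L y))" if "y \<in> S" for y
    using lin[OF that] inj[OF that] linear_injective_imp_surjective by (meson inj_linear_imp_inv_linear)
  have "csm k S (dd h (\<lambda>y. inv (L y) v))" for h
  proof (rule csm_cong[OF S])
    \<comment> \<open>The inverse acts on a vector that itself varies with y; expanding that vector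
      over the basis leaves only constant arguments, to which the induction hypothesis
      applies.\<close>
    show "- (\<Sum>i\<in>Basis. (inv (L y) v \<bullet> i) *\<^sub>R (\<Sum>j\<in>Basis. (?D i y h \<bullet> j) *\<^sub>R inv (L y) j)) =
      dd h (\<lambda>y. inv (L y) v) y" if "y \<in> S" for y
      unfolding frechet_at_eqI[OF der[OF that]]
      by (simp add: linear_basis_expand[OF lininv[OF that], symmetric])
    have D: "csm k S (\<lambda>y. ?D i y h)" for i using Suc.prems[of i] by auto
    show "csm k S (\<lambda>y. - (\<Sum>i\<in>Basis. (inv (L y) v \<bullet> i) *\<^sub>R (\<Sum>j\<in>Basis. (?D i y h \<bullet> j) *\<^sub>R inv (L y) j)))"
      by (intro csm_linear_comp[OF S bounded_linear_minus[OF bounded_linear_ident]] csm_sum S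
          csm_bilinear[OF bounded_bilinear_scaleR] csm_linear_comp[OF S bounded_linear_inner_left] I D)
  qed
  moreover have "(\<lambda>y. inv (L y) v) differentiable_on S"
    using der by (meson differentiable_at_imp_differentiable_on differentiableI)
  ultimately show ?case by simp
qed

theorem smooth_inverse_function:
  fixes f :: "'a::euclidean_space \<Rightarrow> 'a"
  assumes "open U" "smooth_on U f" "x0 \<in> U" and inj0: "\<And>v. frechet_derivative f (at x0) v = 0 \<Longrightarrow> v = 0"
  obtains W W' g where "open W" "open W'" "x0 \<in> W" "W \<subseteq> U" "f x0 \<in> W'" "f ` W = W'" "g ` W' = W" "smooth_on W' g"
    "\<And>x. x \<in> W \<Longrightarrow> g (f x) = x" "\<And>y. y \<in> W' \<Longrightarrow> f (g y) = y"
proof -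
  let ?f' = "\<lambda>x. Blinfun (frechet_derivative f (at x))"
  have bl: "bounded_linear (frechet_derivative f (at x))" if "x \<in> U" for x
    using smooth_on_has_derivative[OF assms(2,1) that] by (rule has_derivative_bounded_linear)
  have f'ap: "blinfun_apply (?f' x) = frechet_derivative f (at x)" if "x \<in> U" for x
    using bl[OF that] by (simp add: bounded_linear_Blinfun_apply)
  have der: "(f has_derivative blinfun_apply (?f' x)) (at x)" if "x \<in> U" for x
    using smooth_on_has_derivative[OF assms(2,1) that] f'ap[OF that] by simp
  have "continuous_on U (\<lambda>x. blinfun_apply (?f' x) i)" for i
    using smooth_on_continuous_on[OF smooth_on_dd[OF assms(2), of i] assms(1)]
    by (rule continuous_on_eq) (simp add: f'ap)
  then have cont: "continuous_on U ?f'"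
    by (intro continuous_on_blinfun_componentwise) auto
  have lin0: "linear (frechet_derivative f (at x0))" using bl[OF assms(3)] bounded_linear.linear by blast
  have "inj (frechet_derivative f (at x0))"
    using inj0 lin0 linear_injective_0 by blast
  then obtain h where h: "linear h" "h \<circ> frechet_derivative f (at x0) = id"
    using linear_injective_left_inverse[OF lin0] by blast
  have hb: "bounded_linear h" using h(1) by (simp add: linear_conv_bounded_linear)
  have "Blinfun h o\<^sub>L ?f' x0 = id_blinfun"
  proof (rule blinfun_eqI)
    fix i have "h (frechet_derivative f (at x0) i) = i" using h(2) by (metis comp_apply id_apply)
    then show "blinfun_apply (Blinfun h o\<^sub>L ?f' x0) i = blinfun_apply id_blinfun i"
      by (simp add: f'ap[OF assms(3)] bounded_linear_Blinfun_apply[OF hb])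
  qed
  from inverse_function_theorem[OF assms(1) der cont assms(3) this]
  obtain W W' g g' where *: "open W" "W \<subseteq> U" "x0 \<in> W" "open W'" "f x0 \<in> W'" "homeomorphism W W' f g"
    and dg: "\<And>y. y \<in> W' \<Longrightarrow> (g has_derivative (g' y)) (at y)"
    and g': "\<And>y. y \<in> W' \<Longrightarrow> g' y = inv (blinfun_apply (?f' (g y)))"
    and bij: "\<And>y. y \<in> W' \<Longrightarrow> bij (blinfun_apply (?f' (g y)))" by metis
  have hom: "f ` W = W'" "g ` W' = W" "\<And>x. x \<in> W \<Longrightarrow> g (f x) = x" "\<And>y. y \<in> W' \<Longrightarrow> f (g y) = y"
    using *(6) unfolding homeomorphism_def by auto
  have gU: "g y \<in> U" if "y \<in> W'" for y using hom(2) *(2) that by auto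
  define L where "L y = frechet_derivative f (at (g y))" for y
  \<comment> \<open>The derivative of g is the inverse of the derivative of f at g y, so by
    \<open>csm_inv_linear\<close> k derivatives of g give one more.\<close>
  have "csm k W' g" for k
  proof (induction k)
    case 0
    show ?case using dg by (simp, meson differentiable_at_imp_differentiable_on differentiableI)
  next
    case (Suc k)
    have "csm k W' (\<lambda>y. L y u)" for u
      unfolding L_def using smooth_on_dd[OF assms(2), of u] gU unfolding smooth_on_iff
      by (intro csm_compose[OF *(4) assms(1) _ _ Suc]) auto
    then have "csm k W' (\<lambda>y. inv (L y) v)" for v
      by (rule csm_inv_linear[OF *(4), rotated 2])
        (use bl[OF gU] bij f'ap[OF gU] in \<open>auto simp: L_def bij_def bounded_linear.linear\<close>)
    then have "csm k W' (dd v g)" for v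
      by (rule csm_cong[OF *(4), rotated]) (use frechet_at_eqI[OF dg] g' f'ap[OF gU] in \<open>simp add: L_def\<close>)
    moreover have "g differentiable_on W'"
      using dg by (meson differentiable_at_imp_differentiable_on differentiableI)
    ultimately show ?case by simp
  qed
  then have "smooth_on W' g" by (simp add: smooth_on_iff)
  then show thesis using that * hom by blast
qed

section \<open>Integrals with a parameter and bump functions\<close>

text \<open>Leibniz's rule needs a continuous derivative of the integrand, and differentiability of
  that derivative supplies it; hence the loss of one grade. The open set \<Omega> allows the
  derivative in t to be taken at the end points as well.\<close>

lemma csm_integral:
  fixes k :: "'a::euclidean_space \<times> real \<Rightarrow> real"
  assumes "open \<Omega>" "open S" "S \<times> {0..1} \<subseteq> \<Omega>" "csm (Suc n) \<Omega> k"
  shows "csm n S (\<lambda>x. integral {0..1} (\<lambda>t. k (x, t)))"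
  using assms(4)
proof (induction n arbitrary: k)
  have main: "((\<lambda>x. integral {0..1} (\<lambda>t. k (x, t))) has_derivative
      (\<lambda>v. integral {0..1} (\<lambda>t. dd (v, 0) k (x0, t)))) (at x0)"
    if k: "csm (Suc 0) \<Omega> k" and "x0 \<in> S" for k :: "'a \<times> real \<Rightarrow> real" and x0
  proof -
    obtain r where r: "r > 0" "ball x0 r \<subseteq> S" using assms(2) \<open>x0 \<in> S\<close> by (meson openE)
    have in\<Omega>: "(x, t) \<in> \<Omega>" if "x \<in> ball x0 r" "t \<in> cbox 0 (1::real)" for x t
      using that r assms(3) by (auto dest: subsetD simp: subset_iff)
    have hd: "(k has_derivative frechet_derivative k (at z)) (at z)" if "z \<in> \<Omega>" for z
      using csm_has_derivative[OF k assms(1) that] .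
    define fx where "fx x t = Blinfun (\<lambda>v. dd (v, 0) k (x, t))" for x t
    have dpair: "((\<lambda>x. k (x, t)) has_derivative (\<lambda>v. dd (v, 0) k (x, t))) (at x)"
      if "(x, t) \<in> \<Omega>" for x t
    proof -
      have "((\<lambda>x. (x, t)) has_derivative (\<lambda>v. (v, 0))) (at x)" by (auto intro!: derivative_eq_intros)
      from diff_chain_at[OF this hd[OF that]] show ?thesis by (simp add: o_def)
    qed
    have fxa: "blinfun_apply (fx x t) = (\<lambda>v. dd (v, 0) k (x, t))" if "(x, t) \<in> \<Omega>" for x t
      unfolding fx_def using has_derivative_bounded_linear[OF dpair[OF that]]
      by (rule bounded_linear_Blinfun_apply)
    have ck: "continuous_on \<Omega> k"
      by (meson assms(1) csm_differentiable_on differentiable_imp_continuous_on k)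
    have cdk: "continuous_on \<Omega> (dd v k)" for v
      by (rule differentiable_imp_continuous_on) (use k in \<open>unfold csm.simps, blast\<close>)
    have cfx: "continuous_on (ball x0 r \<times> cbox 0 1) (\<lambda>z. blinfun_apply (fx (fst z) (snd z)) i)" for i
    proof (rule continuous_on_eq)
      show "continuous_on (ball x0 r \<times> cbox 0 1) (dd (i, 0) k)"
        using cdk by (rule continuous_on_subset) (use in\<Omega> in auto)
    qed (use fxa in\<Omega> in auto)
    have cfx': "continuous_on (ball x0 r \<times> cbox 0 1) (\<lambda>z. fx (fst z) (snd z))"
      by (rule continuous_on_blinfun_componentwise) (use cfx in auto)
    have cfx2: "continuous_on (ball x0 r \<times> cbox 0 1) (\<lambda>(x, t). fx x t)"
      using cfx' by (simp add: case_prod_beta)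
    have int1: "(\<lambda>t. k (x, t)) integrable_on cbox 0 1" if "x \<in> ball x0 r" for x
    proof (rule integrable_continuous)
      show "continuous_on (cbox 0 1) (\<lambda>t. k (x, t))"
        by (rule continuous_on_compose2[OF ck]) (use in\<Omega> that in \<open>auto intro!: continuous_intros\<close>)
    qed
    have "((\<lambda>x. integral (cbox 0 1) (\<lambda>t. k (x, t))) has_derivative integral (cbox 0 1) (fx x0)) (at x0 within ball x0 r)"
      by (rule leibniz_rule[OF _ int1 cfx2])
        (use dpair fxa in\<Omega> r in \<open>auto intro: has_derivative_at_withinI\<close>)
    then have d: "((\<lambda>x. integral (cbox 0 1) (\<lambda>t. k (x, t))) has_derivative integral (cbox 0 1) (fx x0)) (at x0)"
      using r at_within_open[of x0 "ball x0 r"] by simp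
    have int2: "fx x0 integrable_on cbox 0 1"
    proof (rule integrable_continuous)
      show "continuous_on (cbox 0 1) (fx x0)"
        by (rule continuous_on_compose2[OF cfx', of _ "\<lambda>t. (x0, t)", simplified])
          (use r in \<open>auto intro!: continuous_intros\<close>)
    qed
    have "blinfun_apply (integral (cbox 0 1) (fx x0)) v = integral (cbox 0 1) (\<lambda>t. dd (v, 0) k (x0, t))" for v
    proof -
      have "blinfun_apply (integral (cbox 0 1) (fx x0)) v = integral (cbox 0 1) (\<lambda>t. blinfun_apply (fx x0 t) v)"
        using integral_linear[OF int2 blinfun.bounded_linear_left[of v]] by (simp add: o_def)
      also have "\<dots> = integral (cbox 0 1) (\<lambda>t. dd (v, 0) k (x0, t))"
        by (rule integral_cong) (use fxa in\<Omega> r in auto)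
      finally show ?thesis .
    qed
    then have "blinfun_apply (integral (cbox 0 1) (fx x0)) = (\<lambda>v. integral (cbox 0 1) (\<lambda>t. dd (v, 0) k (x0, t)))"
      by blast
    with d show ?thesis by (simp add: cbox_interval)
  qed
  {
    case 0
    then show ?case using main[of k] by (simp, meson differentiable_at_imp_differentiable_on differentiableI)
  next
    case (Suc n)
    have k1: "csm (Suc 0) \<Omega> k" using Suc.prems by (simp add: csm_iff)
    have "csm n S (dd v (\<lambda>x. integral {0..1} (\<lambda>t. k (x, t))))" for v
      by (rule csm_cong[OF assms(2) _ Suc.IH[of "dd (v, 0) k"]])
        (use Suc.prems frechet_at_eqI[OF main[OF k1]] in auto)
    moreover have "(\<lambda>x. integral {0..1} (\<lambda>t. k (x, t))) differentiable_on S"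
      using main[OF k1] by (meson differentiable_at_imp_differentiable_on differentiableI)
    ultimately show ?case by simp
  }
qed

lemma smooth_on_integral:
  fixes k :: "'a::euclidean_space \<times> real \<Rightarrow> real"
  assumes "open \<Omega>" "open S" "S \<times> {0..1} \<subseteq> \<Omega>" "smooth_on \<Omega> k"
  shows "smooth_on S (\<lambda>x. integral {0..1} (\<lambda>t. k (x, t)))"
  using csm_integral[OF assms(1-3)] assms(4) unfolding smooth_on_iff by blast

text \<open>The fundamental theorem of calculus along the segment from the projection of x onto the
  hyperplane orthogonal to i up to x; projecting does not increase the norm, so the segment stays in
  the ball. It serves to divide a function by a coordinate.\<close>

lemma hadamard:
  fixes f :: "'a::euclidean_space \<Rightarrow> real"
  assumes sm: "smooth_on (ball 0 r) f" and i: "i \<in> Basis"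
  obtains H where "smooth_on (ball 0 r) H"
    "\<And>x. x \<in> ball 0 r \<Longrightarrow> f x = f (x - (x \<bullet> i) *\<^sub>R i) + (x \<bullet> i) * H x"
    "\<And>x. x \<in> ball 0 r \<Longrightarrow> x \<bullet> i = 0 \<Longrightarrow> H x = dd i f x"
proof -
  define P where "P = (\<lambda>(x, t). x - ((1 - t) * (x \<bullet> i)) *\<^sub>R i)"
  define \<Omega> where "\<Omega> = P -` ball 0 r"
  have P: "smooth_on UNIV P" unfolding P_def case_prod_beta by (intro smooth_intros open_UNIV)
  have op: "open \<Omega>" unfolding \<Omega>_def
    using smooth_on_continuous_on[OF P open_UNIV] by (simp add: open_vimage)
  have in\<Omega>: "P (x, t) \<in> ball 0 r" if "x \<in> ball 0 r" "t \<in> {0..1}" for x t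
  proof -
    have nii: "i \<bullet> i = 1" using i by simp
    have "norm (x - (x \<bullet> i) *\<^sub>R i) \<le> norm x"
    proof (rule norm_le[THEN iffD2])
      show "(x - (x \<bullet> i) *\<^sub>R i) \<bullet> (x - (x \<bullet> i) *\<^sub>R i) \<le> x \<bullet> x"
        by (simp add: inner_diff_left inner_diff_right nii inner_commute)
    qed
    then have a: "x - (x \<bullet> i) *\<^sub>R i \<in> ball 0 r" using that by simp
    have "P (x, t) = (1 - t) *\<^sub>R (x - (x \<bullet> i) *\<^sub>R i) + t *\<^sub>R x"
      by (simp add: P_def algebra_simps)
    also have "\<dots> \<in> ball 0 r"
      by (rule convexD[OF convex_ball a that(1)]) (use that in auto)
    finally show ?thesis .
  qed
  define H where "H x = integral {0..1} (\<lambda>t. dd i f (P (x, t)))" for x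
  have smH: "smooth_on (ball 0 r) H"
    unfolding H_def
    by (rule smooth_on_integral[OF op open_ball _ smooth_on_compose[OF smooth_on_dd[OF sm] smooth_on_subset[OF P] op open_ball]])
      (use in\<Omega> in \<open>auto simp: \<Omega>_def\<close>)
  have eq: "f x = f (x - (x \<bullet> i) *\<^sub>R i) + (x \<bullet> i) * H x" if x: "x \<in> ball 0 r" for x
  proof -
    have d: "((\<lambda>t. f (P (x, t))) has_vector_derivative (x \<bullet> i) * dd i f (P (x, t))) (at t within {0..1})"
      if "t \<in> {0..1}" for t
    proof -
      have hf: "(f has_derivative frechet_derivative f (at (P (x, t)))) (at (P (x, t)))"
        by (rule smooth_on_has_derivative[OF sm open_ball in\<Omega>[OF x that]])
      have hP: "((\<lambda>t. P (x, t)) has_derivative (\<lambda>s. (s * (x \<bullet> i)) *\<^sub>R i)) (at t)"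
        unfolding P_def case_prod_conv by (auto intro!: derivative_eq_intros)
      have "((\<lambda>t. f (P (x, t))) has_derivative (\<lambda>s. frechet_derivative f (at (P (x, t))) ((s * (x \<bullet> i)) *\<^sub>R i))) (at t)"
        using diff_chain_at[OF hP hf] by (simp add: o_def)
      then show ?thesis
        unfolding has_vector_derivative_def
        using linear_scale[OF has_derivative_linear[OF hf]]
        by (auto simp: mult.assoc intro: has_derivative_at_withinI)
    qed
    have "((\<lambda>t. (x \<bullet> i) * dd i f (P (x, t))) has_integral f (P (x, 1)) - f (P (x, 0))) {0..1}"
      by (rule fundamental_theorem_of_calculus) (use d in auto)
    moreover have "(\<lambda>t. dd i f (P (x, t))) integrable_on {0..1}"
    proof (rule integrable_continuous_real)
      show "continuous_on {0..1} (\<lambda>t. dd i f (P (x, t)))"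
        by (rule continuous_on_compose2[OF smooth_on_continuous_on[OF smooth_on_dd[OF sm] open_ball]
            continuous_on_compose2[OF smooth_on_continuous_on[OF P open_UNIV]]])
          (use in\<Omega>[OF x] in \<open>auto intro!: continuous_intros\<close>)
    qed
    ultimately have "f (P (x, 1)) - f (P (x, 0)) = (x \<bullet> i) * H x"
      unfolding H_def by (metis has_integral_integral has_integral_mult_right has_integral_unique)
    then show ?thesis by (simp add: P_def)
  qed
  have "H x = dd i f x" if "x \<in> ball 0 r" "x \<bullet> i = 0" for x
    using that(2) by (simp add: H_def P_def)
  with smH eq show thesis using that by blast
qed

section \<open>Smooth bump functions\<close>

definition flat :: "nat \<Rightarrow> real \<Rightarrow> real" where
  "flat n t = (if t > 0 then exp (- (1 / t)) / t ^ n else 0)"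

lemma flat_tendsto_0: "(flat n \<longlongrightarrow> 0) (at 0)"
proof -
  have "((\<lambda>t. (1 / t) ^ n / exp (1 / t)) \<longlongrightarrow> 0) (at_right (0::real))"
    using filterlim_compose[OF tendsto_power_div_exp_0[of n] filterlim_inverse_at_top_right]
    by (simp add: inverse_eq_divide)
  then have r: "(flat n \<longlongrightarrow> 0) (at_right 0)"
    by (rule Lim_transform_eventually)
      (auto simp: eventually_at_right_less flat_def exp_minus field_simps eventually_at_filter)
  have l: "(flat n \<longlongrightarrow> 0) (at_left 0)"
    by (rule tendsto_eventually) (auto simp: eventually_at_filter flat_def)
  show ?thesis using filterlim_split_at[OF l r] .
qed

text \<open>The powers of 1/t make the family closed under differentiation up to constant factors,
  and every member tends to 0 at 0. Smoothness then follows by induction without formulas for higher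
  derivatives.\<close>

lemma flat_deriv: "(flat n has_field_derivative flat (n + 2) t - real n * flat (n + 1) t) (at t)"
proof -
  consider "t > 0" | "t < 0" | "t = 0" by linarith
  then show ?thesis
  proof cases
    case 1
    have "((\<lambda>t. exp (- (1 / t)) / t ^ n) has_field_derivative
        (exp (- (1 / t)) * (1 / t\<^sup>2) * t ^ n - exp (- (1 / t)) * (real n * t ^ (n - 1))) / (t ^ n * t ^ n)) (at t)"
      using 1 by (auto intro!: derivative_eq_intros simp: power2_eq_square divide_simps)
    moreover have "(exp (- (1 / t)) * (1 / t\<^sup>2) * t ^ n - exp (- (1 / t)) * (real n * t ^ (n - 1))) / (t ^ n * t ^ n)
      = flat (n + 2) t - real n * flat (n + 1) t"
      using 1 by (cases n) (auto simp: flat_def field_simps power2_eq_square)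
    ultimately have "((\<lambda>t. exp (- (1 / t)) / t ^ n) has_field_derivative flat (n + 2) t - real n * flat (n + 1) t) (at t)"
      by simp
    then show ?thesis
      unfolding has_field_derivative_def
      by (rule has_derivative_transform_within_open[where s="{0<..}"]) (use 1 in \<open>auto simp: flat_def\<close>)
  next
    case 2
    have "((\<lambda>t. 0::real) has_field_derivative 0) (at t)" by simp
    then have "(flat n has_field_derivative 0) (at t)"
      unfolding has_field_derivative_def
      by (rule has_derivative_transform_within_open[where s="{..<0}"]) (use 2 in \<open>auto simp: flat_def\<close>)
    then show ?thesis using 2 by (simp add: flat_def)
  next
    case 3
    have "(\<lambda>h. (flat n (0 + h) - flat n 0) / h) = flat (n + 1)"
      by (auto simp: flat_def fun_eq_iff)
    then have "(flat n has_field_derivative 0) (at 0)"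
      unfolding DERIV_def using flat_tendsto_0[of "n + 1"] by simp
    then show ?thesis using 3 by (simp add: flat_def)
  qed
qed

lemma smooth_on_flat: "smooth_on UNIV (flat n)"
proof -
  have "csm k UNIV (flat n)" for k
  proof (induction k arbitrary: n)
    case 0
    show ?case using flat_deriv by (simp add: differentiable_on_def) (meson field_differentiable_def field_differentiable_imp_differentiable)
  next
    case (Suc k)
    have "dd v (flat n) = (\<lambda>t. (flat (n + 2) t + (- real n) *\<^sub>R flat (n + 1) t) * v)" for v
      using frechet_at_eqI[OF flat_deriv[unfolded has_field_derivative_def]] by auto
    moreover have "csm k UNIV (\<lambda>t. (flat (n + 2) t + (- real n) *\<^sub>R flat (n + 1) t) * v)" for v
      by (intro csm_bilinear[OF bounded_bilinear_mult] csm_add csm_linear_comp[OF _ bounded_linear_scaleR_right] csm_const Suc open_UNIV)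
    ultimately show ?case using csm_differentiable_on[OF Suc[of n]] by simp
  qed
  then show ?thesis by (simp add: smooth_on_iff)
qed

lemma flat_0_sign: "t \<le> 0 \<Longrightarrow> flat 0 t = 0" "t > 0 \<Longrightarrow> flat 0 t > 0" "flat 0 t \<ge> 0"
  by (auto simp: flat_def)

text \<open>A finite sum of bumps over a cover by balls is positive on K; a smooth step between 0
  and half of its minimum turns it into a function equal to 1 near K.\<close>

lemma bump_exists:
  fixes K :: "'a::euclidean_space set"
  assumes "compact K" "open O'" "K \<subseteq> O'"
  obtains bump :: "'a \<Rightarrow> real" and N C where "smooth_on UNIV bump" "open N" "K \<subseteq> N" "\<And>x. x \<in> N \<Longrightarrow> bump x = 1"
    "compact C" "C \<subseteq> O'" "\<And>x. x \<notin> C \<Longrightarrow> bump x = 0" "N \<subseteq> C"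
proof -
  have "\<forall>x\<in>K. \<exists>r>0. cball x r \<subseteq> O'" using assms by (meson open_contains_cball subsetD)
  then obtain r where r: "\<And>x. x \<in> K \<Longrightarrow> r x > 0 \<and> cball x (r x) \<subseteq> O'" by metis
  obtain T where T: "T \<subseteq> K" "finite T" "K \<subseteq> (\<Union>x\<in>T. ball x (r x))"
    by (rule compactE_image[OF assms(1), of K "\<lambda>x. ball x (r x)"]) (use r in force)+
  define \<sigma> where "\<sigma> x = (\<Sum>c\<in>T. flat 0 ((r c)\<^sup>2 - (x - c) \<bullet> (x - c)))" for x
  have fl: "smooth_on UNIV (\<lambda>x. flat 0 ((r c)\<^sup>2 - (x - c) \<bullet> (x - c)))" for c
    by (rule smooth_on_compose[OF smooth_on_flat]) (auto intro!: smooth_intros)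
  have sm\<sigma>: "smooth_on UNIV \<sigma>" unfolding \<sigma>_def
    by (intro smooth_on_sum fl open_UNIV)
  have cont: "continuous_on UNIV \<sigma>" using smooth_on_continuous_on[OF sm\<sigma>] by simp
  have pos: "flat 0 ((r c)\<^sup>2 - (x - c) \<bullet> (x - c)) > 0 \<longleftrightarrow> x \<in> ball c (r c)" if "c \<in> T" for c x
  proof -
    have "r c > 0" using r T that by auto
    then have "(x - c) \<bullet> (x - c) < (r c)\<^sup>2 \<longleftrightarrow> norm (x - c) < r c"
      by (metis abs_norm_cancel abs_of_pos power2_norm_eq_inner real_sqrt_abs real_sqrt_less_iff)
    then show ?thesis using flat_0_sign[of "(r c)\<^sup>2 - (x - c) \<bullet> (x - c)"]
      by (auto simp: dist_norm norm_minus_commute not_less)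
  qed
  have \<sigma>pos: "\<sigma> x > 0" if xK: "x \<in> K" for x
  proof -
    obtain c where "c \<in> T" "x \<in> ball c (r c)" using T(3) xK by blast
    then show ?thesis unfolding \<sigma>_def using pos flat_0_sign(3) T(2)
      by (intro sum_pos2[of T c]) auto
  qed
  obtain m where m: "m > 0" "\<And>x. x \<in> K \<Longrightarrow> \<sigma> x \<ge> m"
  proof (cases "K = {}")
    case True then show ?thesis using that[of 1] by auto
  next
    case False
    then obtain x0 where "x0 \<in> K" "\<forall>y\<in>K. \<sigma> x0 \<le> \<sigma> y"
      using continuous_attains_inf[OF assms(1)] cont continuous_on_subset by blast
    then show ?thesis using that[of "\<sigma> x0"] \<sigma>pos by blast
  qed
  \<comment> \<open>The quotient is 1 once \<sigma> exceeds m/2 and 0 where \<sigma> is 0; since m/2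
    > 0, the two arguments of \<open>flat 0\<close> in the denominator are never both
    nonpositive.\<close>
  define bump where "bump x = flat 0 (\<sigma> x) / (flat 0 (\<sigma> x) + flat 0 (m / 2 - \<sigma> x))" for x
  have den: "flat 0 s + flat 0 (m / 2 - s) > 0" for s
    using flat_0_sign(2)[of s] flat_0_sign(2)[of "m/2 - s"] flat_0_sign(3)[of s] flat_0_sign(3)[of "m/2 - s"] m(1)
    by (cases "s > 0") (auto intro: add_pos_nonneg add_nonneg_pos)
  have s1: "smooth_on UNIV (\<lambda>x. flat 0 (\<sigma> x))" "smooth_on UNIV (\<lambda>x. flat 0 (m / 2 - \<sigma> x))"
    by (rule smooth_on_compose[OF smooth_on_flat]; auto intro!: smooth_intros sm\<sigma>)+
  have b1: "smooth_on UNIV bump" unfolding bump_def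
    by (intro smooth_intros s1 open_UNIV) (use den in \<open>metis less_irrefl\<close>)
  define N where "N = {x. \<sigma> x > m / 2}"
  define C where "C = (\<Union>c\<in>T. cball c (r c))"
  have b2: "open N" unfolding N_def
    by (rule open_Collect_less) (auto intro!: cont)
  have b3: "K \<subseteq> N"
  proof
    fix x assume "x \<in> K" then show "x \<in> N" using m(1) m(2)[of x] by (simp add: N_def)
  qed
  have b4: "bump x = 1" if "x \<in> N" for x
  proof -
    have "flat 0 (m / 2 - \<sigma> x) = 0" "flat 0 (\<sigma> x) > 0" using that m(1) by (auto simp: N_def intro!: flat_0_sign)
    then show ?thesis by (simp add: bump_def)
  qed
  have b5: "compact C" unfolding C_def using T(2) by (intro compact_UN) auto
  have b6: "C \<subseteq> O'" unfolding C_def using r T(1) by blast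
  have \<sigma>0: "\<sigma> x = 0" if "x \<notin> C" for x
    unfolding \<sigma>_def
  proof (rule sum.neutral, intro ballI)
    fix c assume "c \<in> T"
    then have "x \<notin> ball c (r c)" using that ball_subset_cball unfolding C_def by blast
    then show "flat 0 ((r c)\<^sup>2 - (x - c) \<bullet> (x - c)) = 0"
      using pos[OF \<open>c \<in> T\<close>, of x] flat_0_sign(3) by (metis less_eq_real_def)
  qed
  have b7: "bump x = 0" if "x \<notin> C" for x
    using \<sigma>0[OF that] by (simp add: bump_def flat_def)
  have b8: "N \<subseteq> C"
  proof (rule subsetI, rule ccontr)
    fix x assume "x \<in> N" "x \<notin> C" then show False using \<sigma>0[of x] m(1) by (simp add: N_def)
  qed
  show thesis by (rule that[OF b1 b2 b3 b4 b5 b6 b7 b8])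
qed

section \<open>Ordinary differential equations\<close>

text \<open>Rescaling to the fixed interval [0, 1] treats both signs of s at once and moves the
  dependence on s into the integrand.\<close>

lemma scaled_integral:
  fixes \<phi> :: "real \<Rightarrow> real"
  assumes \<Phi>: "\<And>t. t \<in> {-r..r} \<Longrightarrow> (\<Phi> has_vector_derivative \<phi> t) (at t within {-r..r})" and "s \<in> {-r..r}"
  shows "s * integral {0..1} (\<lambda>\<sigma>. \<phi> (s * \<sigma>)) = \<Phi> s - \<Phi> 0"
proof -
  have m: "s * \<sigma> \<in> {-r..r}" if "\<sigma> \<in> {0..1}" for \<sigma>
  proof -
    have "\<bar>s * \<sigma>\<bar> \<le> \<bar>s\<bar> * 1" using that unfolding abs_mult by (intro mult_left_mono) auto
    then show ?thesis using assms(2) by auto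
  qed
  have "((\<lambda>\<sigma>. \<Phi> (s * \<sigma>)) has_vector_derivative s * \<phi> (s * \<sigma>)) (at \<sigma> within {0..1})" if "\<sigma> \<in> {0..1}" for \<sigma>
  proof -
    have "((\<lambda>\<sigma>. s * \<sigma>) has_vector_derivative s) (at \<sigma> within {0..1})"
      by (auto intro!: derivative_eq_intros)
    moreover have "(\<Phi> has_vector_derivative \<phi> (s * \<sigma>)) (at (s * \<sigma>) within (\<lambda>\<sigma>. s * \<sigma>) ` {0..1})"
      by (rule has_vector_derivative_within_subset[OF \<Phi>[OF m[OF that]]]) (use m in blast)
    ultimately show ?thesis
      using vector_diff_chain_within[of "\<lambda>\<sigma>. s * \<sigma>" s \<sigma> "{0..1}" \<Phi> "\<phi> (s * \<sigma>)"] by (simp add: o_def)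
  qed
  then have "((\<lambda>\<sigma>. s * \<phi> (s * \<sigma>)) has_integral \<Phi> (s * 1) - \<Phi> (s * 0)) {0..1}"
    by (intro fundamental_theorem_of_calculus) auto
  from integral_unique[OF this] show ?thesis by simp
qed

text \<open>Picard's contraction on a closed set of bounded continuous functions, with the integral
  from 0 to t written over [0, 1].\<close>

lemma ode_solution_exists:
  fixes P :: "real \<times> real \<Rightarrow> real"
  assumes "open V" "smooth_on V P" "(x0, y0) \<in> V"
  obtains r Y where "r > 0" "Y 0 = y0" "\<And>t. t \<in> {-r<..<r} \<Longrightarrow> (x0 + t, Y t) \<in> V"
    "\<And>t. t \<in> {-r<..<r} \<Longrightarrow> (Y has_real_derivative P (x0 + t, Y t)) (at t)"
proof -
  obtain e where e: "e > 0" "cball (x0, y0) e \<subseteq> V" using assms(1,3) open_contains_cball by blast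
  define a where "a = e / 2"
  have a: "a > 0" using e by (simp add: a_def)
  define B where "B = {x0 - a..x0 + a} \<times> {y0 - a..y0 + a}"
  have BV: "B \<subseteq> V"
  proof
    fix z assume z: "z \<in> B"
    have "dist (x0, y0) z \<le> dist x0 (fst z) + dist y0 (snd z)"
      by (cases z) (simp add: dist_Pair_Pair sqrt_sum_squares_le_sum)
    also have "\<dots> \<le> a + a" using z by (intro add_mono) (auto simp: B_def dist_real_def)
    finally show "z \<in> V" using e by (auto simp: a_def)
  qed
  have cB: "compact B" unfolding B_def by (intro compact_Times) auto
  have contP: "continuous_on B P"
    using smooth_on_continuous_on[OF assms(2,1)] BV continuous_on_subset by blast
  have contD: "continuous_on B (dd (0,1) P)"
    using smooth_on_continuous_on[OF smooth_on_dd[OF assms(2)] assms(1)] BV continuous_on_subset by blast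
  obtain M where M: "M > 0" "\<And>z. z \<in> B \<Longrightarrow> \<bar>P z\<bar> \<le> M"
    using compact_imp_bounded[OF compact_continuous_image[OF contP cB]] unfolding bounded_pos by auto
  obtain L where L: "L > 0" "\<And>z. z \<in> B \<Longrightarrow> \<bar>dd (0,1) P z\<bar> \<le> L"
    using compact_imp_bounded[OF compact_continuous_image[OF contD cB]] unfolding bounded_pos by auto
  have lip: "\<bar>P (x, y) - P (x, y')\<bar> \<le> L * \<bar>y - y'\<bar>" if "(x, y) \<in> B" "(x, y') \<in> B" for x y y'
  proof -
    have "norm (P (x, y) - P (x, y')) \<le> L * norm (y - y')"
    proof (rule field_differentiable_bound[of "{y0 - a..y0 + a}" "\<lambda>y. P (x, y)" "\<lambda>y. dd (0,1) P (x, y)"])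
      fix z assume z: "z \<in> {y0 - a..y0 + a}"
      then have zB: "(x, z) \<in> B" using that by (auto simp: B_def)
      then have d: "(P has_derivative frechet_derivative P (at (x, z))) (at (x, z))"
        using smooth_on_has_derivative[OF assms(2,1)] BV by blast
      have "((\<lambda>y. (x, y)) has_derivative (\<lambda>v. (0, v))) (at z)" by (auto intro!: derivative_eq_intros)
      from diff_chain_at[OF this d]
      have "((\<lambda>y. P (x, y)) has_derivative (\<lambda>v. dd (0, v) P (x, z))) (at z)" by (simp add: o_def)
      moreover have "(\<lambda>v. dd (0, v) P (x, z)) = (*) (dd (0, 1) P (x, z))"
      proof
        fix v show "dd (0, v) P (x, z) = dd (0, 1) P (x, z) * v"
          using linear_scale[OF has_derivative_linear[OF d], of v "(0, 1)"] by simp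
      qed
      ultimately show "((\<lambda>y. P (x, y)) has_field_derivative dd (0,1) P (x, z)) (at z within {y0 - a..y0 + a})"
        unfolding has_field_derivative_def by (metis has_derivative_at_withinI)
      show "norm (dd (0, 1) P (x, z)) \<le> L" using L(2)[OF zB] by simp
    qed (use that in \<open>auto simp: B_def\<close>)
    then show ?thesis by simp
  qed
  \<comment> \<open>The three bounds keep x in the box, keep the iterates in the box, and make the
    Picard map a contraction with factor 1/2.\<close>
  define r where "r = min a (min (a / M) (1 / (2 * L)))"
  have r: "r > 0" "r \<le> a" "r * M \<le> a" "r * L \<le> 1/2"
  proof -
    show "r > 0" "r \<le> a" using a M(1) L(1) by (auto simp: r_def)
    have "r \<le> a / M" "r \<le> 1 / (2 * L)" by (auto simp: r_def)
    then show "r * M \<le> a" "r * L \<le> 1/2" using M(1) L(1) by (auto simp: field_simps)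
  qed
  \<comment> \<open>The function space consists of bounded functions on the whole line, so time is
    clamped to the interval of existence.\<close>
  define cl where "cl t = max (-r) (min r t)" for t
  have cl: "cl t \<in> {-r..r}" for t using r by (auto simp: cl_def)
  have contcl: "continuous_on UNIV cl" unfolding cl_def by (intro continuous_intros)
  define S where "S = {u :: real \<Rightarrow>\<^sub>C real. \<forall>t. \<bar>u t - y0\<bar> \<le> a}"
  have Seq: "S = PiC UNIV (\<lambda>_. {y0 - a..y0 + a})"
  proof -
    have "\<bar>v - y0\<bar> \<le> a \<longleftrightarrow> v \<in> {y0 - a..y0 + a}" for v
      unfolding atLeastAtMost_iff abs_le_iff by linarith
    then show ?thesis unfolding S_def mem_PiC_iff Pi_iff set_eq_iff mem_Collect_eq by blast
  qed
  have closedS: "closed S" unfolding Seq by (rule closed_PiC) auto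
  have inB: "(x0 + s * \<sigma>, u (s * \<sigma>)) \<in> B" if "u \<in> S" "s \<in> {-r..r}" "\<sigma> \<in> {0..1}" for u :: "real \<Rightarrow>\<^sub>C real" and s \<sigma>
  proof -
    have "\<bar>s * \<sigma>\<bar> \<le> \<bar>s\<bar> * 1" using that unfolding abs_mult by (intro mult_left_mono) auto
    then have "\<bar>s * \<sigma>\<bar> \<le> a" using that r by auto
    moreover have "\<bar>u (s * \<sigma>) - y0\<bar> \<le> a" using that by (simp add: S_def)
    ultimately show ?thesis by (auto simp: B_def abs_le_iff)
  qed
  define T where "T u t = y0 + cl t * integral {0..1} (\<lambda>\<sigma>. P (x0 + cl t * \<sigma>, apply_bcontfun u (cl t * \<sigma>)))" for u t
  have contI: "continuous_on (UNIV \<times> {0..1}) (\<lambda>(t, \<sigma>). P (x0 + cl t * \<sigma>, apply_bcontfun u (cl t * \<sigma>)))" if "u \<in> S" for u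
    unfolding case_prod_beta
    by (rule continuous_on_compose2[OF contP])
      (use inB[OF that cl] in \<open>auto intro!: continuous_intros continuous_on_compose2[OF contcl] continuous_on_compose2[OF continuous_on_apply_bcontfun[of UNIV u]]\<close>)
  have contI1: "continuous_on {0..1} (\<lambda>\<sigma>. P (x0 + cl t * \<sigma>, apply_bcontfun u (cl t * \<sigma>)))" if "u \<in> S" for u t
    by (rule continuous_on_compose2[OF contP])
      (use inB[OF that cl] in \<open>auto intro!: continuous_intros continuous_on_compose2[OF continuous_on_apply_bcontfun[of UNIV u]]\<close>)
  have Tbd: "\<bar>T u t - y0\<bar> \<le> a" if "u \<in> S" for u t
  proof -
    have "norm (integral {0..1} (\<lambda>\<sigma>. P (x0 + cl t * \<sigma>, apply_bcontfun u (cl t * \<sigma>)))) \<le> M * (1 - 0)"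
      by (rule integral_bound) (use contI1[OF that] M(2) inB[OF that cl] in auto)
    then have "\<bar>cl t\<bar> * \<bar>integral {0..1} (\<lambda>\<sigma>. P (x0 + cl t * \<sigma>, apply_bcontfun u (cl t * \<sigma>)))\<bar> \<le> r * M"
      using cl[of t] by (intro mult_mono) auto
    then show ?thesis using r by (simp add: T_def abs_mult)
  qed
  have Tcont: "continuous_on UNIV (T u)" if "u \<in> S" for u
  proof -
    have "continuous_on UNIV (\<lambda>t. integral (cbox 0 1) (\<lambda>\<sigma>. P (x0 + cl t * \<sigma>, apply_bcontfun u (cl t * \<sigma>))))"
      by (rule integral_continuous_on_param) (use contI[OF that] in simp)
    then show ?thesis unfolding T_def by (intro continuous_intros contcl) simp
  qed
  have Tb: "T u \<in> bcontfun" if "u \<in> S" for u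
  proof (rule bcontfun_normI[OF Tcont[OF that]])
    show "norm (T u t) \<le> \<bar>y0\<bar> + a" for t using Tbd[OF that, of t] by simp
  qed
  define T' where "T' u = Bcontfun (T u)" for u
  have T': "apply_bcontfun (T' u) t = T u t" if "u \<in> S" for u t
    using Tb[OF that] by (simp add: T'_def Bcontfun_inverse)
  have "\<exists>!u\<in>S. T' u = u"
  proof (rule Banach_fix[of S "1/2"])
    show "complete S" using closedS by (simp add: complete_eq_closed)
    have "const_bcontfun y0 \<in> S" using a by (simp add: S_def const_bcontfun.rep_eq)
    then show "S \<noteq> {}" by blast
    show "T' ` S \<subseteq> S" using Tbd T' by (auto simp: S_def)
    fix u v assume uv: "u \<in> S" "v \<in> S"
    show "dist (T' u) (T' v) \<le> 1/2 * dist u v"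
    proof (rule dist_bound)
      fix t
      let ?f = "\<lambda>u \<sigma>. P (x0 + cl t * \<sigma>, apply_bcontfun u (cl t * \<sigma>))"
      have "norm (integral {0..1} (\<lambda>\<sigma>. ?f u \<sigma> - ?f v \<sigma>)) \<le> (L * dist u v) * (1 - 0)"
      proof (rule integral_bound)
        show "continuous_on {0..1} (\<lambda>\<sigma>. ?f u \<sigma> - ?f v \<sigma>)" using contI1 uv by (intro continuous_intros)
        fix \<sigma> :: real assume \<sigma>: "\<sigma> \<in> {0..1}"
        have "\<bar>?f u \<sigma> - ?f v \<sigma>\<bar> \<le> L * \<bar>u (cl t * \<sigma>) - v (cl t * \<sigma>)\<bar>"
          by (rule lip) (use inB uv cl \<sigma> in auto)
        also have "\<dots> \<le> L * dist u v"
          using dist_bounded[of u "cl t * \<sigma>" v] L(1) by (simp add: dist_real_def)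
        finally show "norm (?f u \<sigma> - ?f v \<sigma>) \<le> L * dist u v" by simp
      qed simp
      then have "\<bar>integral {0..1} (?f u) - integral {0..1} (?f v)\<bar> \<le> L * dist u v"
        using contI1 uv by (simp add: integral_diff integrable_continuous_real)
      then have "\<bar>cl t\<bar> * \<bar>integral {0..1} (?f u) - integral {0..1} (?f v)\<bar> \<le> r * (L * dist u v)"
        using cl[of t] r by (intro mult_mono) auto
      also have "\<dots> \<le> 1/2 * dist u v"
        using mult_right_mono[OF r(4) zero_le_dist[of u v]] by (simp add: mult.assoc)
      finally show "dist (apply_bcontfun (T' u) t) (apply_bcontfun (T' v) t) \<le> 1/2 * dist u v"
        using uv by (simp add: T' T_def dist_real_def abs_mult[symmetric] right_diff_distrib)
    qed
  qed auto
  then obtain u where u: "u \<in> S" "T' u = u" by blast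
  define Y where "Y = apply_bcontfun u"
  define \<phi> where "\<phi> t = P (x0 + t, Y t)" for t
  have inB': "(x0 + t, Y t) \<in> B" if "t \<in> {-r..r}" for t
    using inB[OF u(1) that, of 1] by (simp add: Y_def)
  have "continuous_on {-r..r} \<phi>" unfolding \<phi>_def
    by (rule continuous_on_compose2[OF contP]) (use inB' in \<open>auto intro!: continuous_intros simp: Y_def\<close>)
  then obtain \<Phi> where \<Phi>: "\<And>t. t \<in> {-r..r} \<Longrightarrow> (\<Phi> has_vector_derivative \<phi> t) (at t within {-r..r})"
    using antiderivative_continuous by blast
  have Yeq: "Y t = y0 + (\<Phi> t - \<Phi> 0)" if t: "t \<in> {-r..r}" for t
  proof -
    have "cl t = t" using t by (auto simp: cl_def)
    then have "Y t = y0 + t * integral {0..1} (\<lambda>\<sigma>. \<phi> (t * \<sigma>))"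
      using T'[OF u(1), of t] u(2) by (simp add: Y_def T_def \<phi>_def)
    then show ?thesis using scaled_integral[OF \<Phi> t] by simp
  qed
  have der: "(Y has_real_derivative \<phi> t) (at t)" if t: "t \<in> {-r<..<r}" for t
  proof -
    have "(\<Phi> has_vector_derivative \<phi> t) (at t within {-r<..<r})"
      by (rule has_vector_derivative_within_subset[OF \<Phi>]) (use t in auto)
    then have "(\<Phi> has_vector_derivative \<phi> t) (at t)" using at_within_open[OF t] by simp
    then have "((\<lambda>t. y0 + (\<Phi> t - \<Phi> 0)) has_real_derivative \<phi> t) (at t)"
      by (auto simp: has_real_derivative_iff_has_vector_derivative intro!: derivative_eq_intros)
    then show ?thesis
      unfolding has_field_derivative_def
      by (rule has_derivative_transform_within_open[where s="{-r<..<r}"]) (use t Yeq in auto)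
  qed
  show thesis
  proof (rule that[of r Y])
    have "0 \<in> {-r..r}" using r(1) unfolding atLeastAtMost_iff by linarith
    from Yeq[OF this] show "Y 0 = y0" unfolding diff_self add_0_right .
    show "r > 0" by (rule r(1))
    fix t assume t: "t \<in> {-r<..<r}"
    then have "t \<in> {-r..r}" by auto
    from inB'[OF this] show "(x0 + t, Y t) \<in> V" using BV by (rule subsetD[rotated])
    show "(Y has_real_derivative P (x0 + t, Y t)) (at t)" using der[OF t] unfolding \<phi>_def .
  qed
qed

text \<open>The equation expresses the derivative through \<open>Y\<close> itself, so k derivatives
  of \<open>Y\<close> give one more.\<close>

lemma smooth_on_ode_solution:
  fixes P :: "real \<times> real \<Rightarrow> real"
  assumes "open V" "smooth_on V P" "\<And>t. t \<in> {-r<..<r} \<Longrightarrow> (x0 + t, Y t) \<in> V"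
    "\<And>t. t \<in> {-r<..<r} \<Longrightarrow> (Y has_real_derivative P (x0 + t, Y t)) (at t)"
  shows "smooth_on {-r<..<r} Y"
proof -
  have o: "open {-r<..<r}" by simp
  have d: "Y differentiable_on {-r<..<r}"
    using assms(4) unfolding has_field_derivative_def
    by (meson differentiable_at_imp_differentiable_on differentiableI)
  have "csm k {-r<..<r} Y" for k
  proof (induction k)
    case (Suc k)
    have "csm k {-r<..<r} (dd v Y)" for v
    proof (rule csm_cong[OF o])
      show "P (x0 + t, Y t) * v = dd v Y t" if "t \<in> {-r<..<r}" for t
        using frechet_at_eqI[OF assms(4)[OF that, unfolded has_field_derivative_def]] by simp
      have lin: "csm k {-r<..<r} (\<lambda>t. (x0 + t, Y t))"
      proof -
        have "bounded_linear (\<lambda>u. (0::real, u::real))" "bounded_linear (\<lambda>u. (u::real, 0::real))"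
          by (auto intro!: bounded_linear_Pair bounded_linear_ident bounded_linear_zero)
        then have "csm k {-r<..<r} (\<lambda>t. ((x0, 0) + (t, 0)) + (0, Y t))"
          by (intro csm_add o csm_const csm_linear_comp[OF o _ Suc] csm_bounded_linear)
        then show ?thesis by simp
      qed
      show "csm k {-r<..<r} (\<lambda>t. P (x0 + t, Y t) * v)"
        using assms(2,3) unfolding smooth_on_iff
        by (intro csm_bilinear[OF bounded_bilinear_mult] csm_const o csm_compose[OF o assms(1) _ _ lin]) auto
    qed
    then show ?case using d by simp
  qed (use d in simp)
  then show ?thesis by (simp add: smooth_on_iff)
qed

section \<open>Inflections of solution curves\<close>

text \<open>The sign of F_p on the part (\<open>part_iff\<close>), and therefore the index \<tau> of
  its direction field U + \<tau> V (\<open>part_root\<close>).\<close>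

fun side_sgn :: "side \<Rightarrow> real" where
  "side_sgn Left_Side = -1"
| "side_sgn Right_Side = 1"

definition along :: "'a::real_normed_vector \<Rightarrow> 'a \<Rightarrow> ('a \<Rightarrow> real) \<Rightarrow> ('a \<Rightarrow> real) \<Rightarrow> 'a \<Rightarrow> real" where
  "along u v P g = (\<lambda>z. dd u g z + P z * dd v g z)"

lemma smooth_on_along [smooth_intros]:
  "open S \<Longrightarrow> smooth_on S P \<Longrightarrow> smooth_on S g \<Longrightarrow> smooth_on S (along u v P g)"
  unfolding along_def by (intro smooth_intros smooth_on_dd)

lemma F_jet_eq: "F_jet B (x, y, p) = fst (B (x, y)) + 2 * fst (snd (B (x, y))) * p + snd (snd (B (x, y))) * p\<^sup>2"
  by (simp add: F_def case_prod_beta)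

lemma smooth_F_jet:
  assumes "smooth_on UNIV B" shows "smooth_on UNIV (F_jet B)"
proof -
  have eq: "F_jet B = (\<lambda>m. fst (B (fst m, fst (snd m))) + 2 * fst (snd (B (fst m, fst (snd m)))) * snd (snd m)
      + snd (snd (B (fst m, fst (snd m)))) * (snd (snd m))\<^sup>2)"
    by (auto simp: fun_eq_iff F_jet_eq simp del: F_jet.simps)
  have "smooth_on UNIV (\<lambda>m::jet. B (fst m, fst (snd m)))"
    by (rule smooth_on_compose[OF assms]) (auto intro!: smooth_intros)
  then show ?thesis unfolding eq by (intro smooth_intros open_UNIV)
qed

lemma dF_vertical:
  assumes "smooth_on UNIV B"
  shows "dF B (x, y, p) (0, 0, v) = 2 * (fst (snd (B (x, y))) + snd (snd (B (x, y))) * p) * v"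
proof -
  have 1: "(F_jet B has_derivative dF B (x, y, p)) (at (x, y, p))"
    using smooth_on_has_derivative[OF smooth_F_jet[OF assms]] by simp
  have "((\<lambda>t. (x, y, t)) has_derivative (\<lambda>v. (0, 0, v))) (at p)" by (auto intro!: derivative_eq_intros)
  from diff_chain_at[OF this 1]
  have 2: "((\<lambda>t. F_jet B (x, y, t)) has_derivative (\<lambda>v. dF B (x, y, p) (0, 0, v))) (at p)" by (simp add: o_def)
  have 3: "((\<lambda>t. F_jet B (x, y, t)) has_derivative (\<lambda>v. 2 * (fst (snd (B (x, y))) + snd (snd (B (x, y))) * p) * v)) (at p)"
    unfolding F_jet_eq by (auto intro!: derivative_eq_intros simp: algebra_simps)
  show ?thesis using has_derivative_unique[OF 2 3] by metis
qed

text \<open>How the projection acts on orientations is decided by the sign of F_p, the derivative of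
  F in p: dF and the determinants in the plane and in space are linked by one identity. Points with
  F_p = 0, the folds, lie in neither part.\<close>

lemma part_iff:
  assumes "smooth_on UNIV B"
  shows "(x, y, p) \<in> part B s \<longleftrightarrow> F B (x, y) p = 0 \<and>
    side_sgn s * (fst (snd (B (x, y))) + snd (snd (B (x, y))) * p) > 0"
proof -
  define \<phi> where "\<phi> = dF B (x, y, p)"
  define Fp where "Fp = 2 * (fst (snd (B (x, y))) + snd (snd (B (x, y))) * p)"
  define \<alpha> where "\<alpha> = \<phi> (1, 0, 0)"
  define \<beta> where "\<beta> = \<phi> (0, 1, 0)"
  have lin: "linear \<phi>" unfolding \<phi>_def
    using smooth_on_linear[OF smooth_F_jet[OF assms]] by simp
  have \<phi>: "\<phi> (u, v, w) = \<alpha> * u + \<beta> * v + Fp * w" for u v w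
  proof -
    have "(u, v, w) = u *\<^sub>R (1, 0, 0) + v *\<^sub>R (0, 1, 0) + (0, 0, w)" by simp
    then have "\<phi> (u, v, w) = u *\<^sub>R \<phi> (1, 0, 0) + v *\<^sub>R \<phi> (0, 1, 0) + \<phi> (0, 0, w)"
      by (simp only: linear_add[OF lin] linear_scale[OF lin])
    then show ?thesis using dF_vertical[OF assms, of x y p w]
      by (simp add: \<alpha>_def \<beta>_def Fp_def \<phi>_def)
  qed
  have pb: "pos_basis B (x, y, p) v w \<longleftrightarrow> \<phi> v = 0 \<and> \<phi> w = 0 \<and> (\<exists>n. \<phi> n > 0 \<and> det3 v w n > 0)" for v w
    by (simp add: pos_basis_def \<phi>_def)
  \<comment> \<open>Cramer's rule: tangency expresses F_p times the p-component of v and of w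
    through their projections.\<close>
  have key: "Fp * det3 v w n = \<phi> n * det2 (proj v) (proj w)" if "\<phi> v = 0" "\<phi> w = 0" for v w n
  proof -
    obtain v1 v2 v3 w1 w2 w3 n1 n2 n3 where e: "v = (v1, v2, v3)" "w = (w1, w2, w3)" "n = (n1, n2, n3)"
      by (metis prod_cases3)
    have v3: "Fp * v3 = - (\<alpha> * v1 + \<beta> * v2)" and w3: "Fp * w3 = - (\<alpha> * w1 + \<beta> * w2)"
      using that unfolding e \<phi> by auto
    have "Fp * det3 v w n = v1 * w2 * Fp * n3 - v1 * n2 * (Fp * w3) - v2 * w1 * Fp * n3 + v2 * n1 * (Fp * w3)
        + (Fp * v3) * (w1 * n2 - w2 * n1)"
      unfolding e det3.simps by (simp add: algebra_simps)
    also have "\<dots> = \<phi> n * det2 (proj v) (proj w)"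
      unfolding v3 w3 unfolding e \<phi> proj.simps det2.simps by (simp add: algebra_simps)
    finally show ?thesis .
  qed
  have pos: "det2 (proj v) (proj w) > 0" if "Fp > 0" "pos_basis B (x, y, p) v w" for v w
  proof -
    from that(2) obtain n where n: "\<phi> v = 0" "\<phi> w = 0" "\<phi> n > 0" "det3 v w n > 0" unfolding pb by blast
    have "\<phi> n * det2 (proj v) (proj w) > 0" using key[OF n(1,2), of n] that(1) n(4) by (metis mult_pos_pos)
    then show ?thesis using n(3) by (simp add: zero_less_mult_iff)
  qed
  have neg: "det2 (proj v) (proj w) < 0" if "Fp < 0" "pos_basis B (x, y, p) v w" for v w
  proof -
    from that(2) obtain n where n: "\<phi> v = 0" "\<phi> w = 0" "\<phi> n > 0" "det3 v w n > 0" unfolding pb by blast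
    have "\<phi> n * det2 (proj v) (proj w) < 0" using key[OF n(1,2), of n] that(1) n(4) by (metis mult_neg_pos)
    then show ?thesis using n(3) by (simp add: mult_less_0_iff)
  qed
  have zero: "det2 (proj v) (proj w) = 0" if "Fp = 0" "pos_basis B (x, y, p) v w" for v w
  proof -
    from that(2) obtain n where n: "\<phi> v = 0" "\<phi> w = 0" "\<phi> n > 0" "det3 v w n > 0" unfolding pb by blast
    show ?thesis using key[OF n(1,2), of n] that(1) n(3) by simp
  qed
  \<comment> \<open>Positive bases must exist, because a universal condition on them would otherwise
    hold vacuously. Off the fold the lifts of the coordinate vectors serve, in the order given by
    the sign of F_p; on it, the vertical vector and a tangent vector without p-component.\<close>
  have ex: "\<exists>v w. pos_basis B (x, y, p) v w" if "\<phi> n \<noteq> 0" for n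
  proof (cases "Fp = 0")
    case True
    obtain n1 n2 n3 where "n = (n1, n2, n3)" by (metis prod_cases3)
    then have ne: "\<alpha> \<noteq> 0 \<or> \<beta> \<noteq> 0" using that True by (auto simp: \<phi>)
    have "\<alpha> * \<alpha> + \<beta> * \<beta> > 0" using ne by (metis sum_squares_gt_zero_iff)
    then have "\<phi> (-\<beta>, \<alpha>, 0) = 0 \<and> \<phi> (0, 0, 1) = 0 \<and> \<phi> (\<alpha>, \<beta>, 0) > 0 \<and> det3 (-\<beta>, \<alpha>, 0) (0, 0, 1) (\<alpha>, \<beta>, 0) > 0"
      using True by (simp add: \<phi>)
    then show ?thesis unfolding pb by blast
  next
    case False
    show ?thesis
    proof (cases "Fp > 0")
      case True
      then have "\<phi> (1, 0, -\<alpha>/Fp) = 0 \<and> \<phi> (0, 1, -\<beta>/Fp) = 0 \<and> \<phi> (0, 0, 1) > 0 \<and> det3 (1, 0, -\<alpha>/Fp) (0, 1, -\<beta>/Fp) (0, 0, 1) > 0"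
        by (simp add: \<phi>)
      then show ?thesis unfolding pb by blast
    next
      case neg: False
      then have "\<phi> (0, 1, -\<beta>/Fp) = 0 \<and> \<phi> (1, 0, -\<alpha>/Fp) = 0 \<and> \<phi> (0, 0, -1) > 0 \<and> det3 (0, 1, -\<beta>/Fp) (1, 0, -\<alpha>/Fp) (0, 0, -1) > 0"
        using False by (simp add: \<phi>)
      then show ?thesis unfolding pb by blast
    qed
  qed
  have ne: "\<phi> (0, 0, 1) \<noteq> 0" if "Fp \<noteq> 0" using that by (simp add: \<phi>)
  have sgn: "(side_sgn s * (fst (snd (B (x, y))) + snd (snd (B (x, y))) * p) > 0) \<longleftrightarrow> side_sgn s * Fp > 0"
    unfolding Fp_def mult.left_commute[of _ 2] by simp
  have surf: "(x, y, p) \<in> surface B \<longleftrightarrow> F B (x, y) p = 0" by (simp add: surface_def)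
  show ?thesis
  proof (cases s)
    case Right_Side
    have "(\<exists>n. \<phi> n \<noteq> 0) \<and> (\<forall>v w. pos_basis B (x, y, p) v w \<longrightarrow> det2 (proj v) (proj w) > 0) \<longleftrightarrow> Fp > 0"
    proof
      assume L: "(\<exists>n. \<phi> n \<noteq> 0) \<and> (\<forall>v w. pos_basis B (x, y, p) v w \<longrightarrow> det2 (proj v) (proj w) > 0)"
      then obtain v w where "pos_basis B (x, y, p) v w" "det2 (proj v) (proj w) > 0" using ex by blast
      then show "Fp > 0" using neg[of v w] zero[of v w] by (cases Fp "0::real" rule: linorder_cases) auto
    qed (use pos ne in \<open>auto intro!: exI[of _ "(0, 0, 1)"]\<close>)
    then show ?thesis using sgn surf Right_Side by (auto simp: \<phi>_def)
  next
    case Left_Side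
    have "(\<exists>n. \<phi> n \<noteq> 0) \<and> (\<forall>v w. pos_basis B (x, y, p) v w \<longrightarrow> det2 (proj v) (proj w) < 0) \<longleftrightarrow> Fp < 0"
    proof
      assume L: "(\<exists>n. \<phi> n \<noteq> 0) \<and> (\<forall>v w. pos_basis B (x, y, p) v w \<longrightarrow> det2 (proj v) (proj w) < 0)"
      then obtain v w where "pos_basis B (x, y, p) v w" "det2 (proj v) (proj w) < 0" using ex by blast
      then show "Fp < 0" using pos[of v w] zero[of v w] by (cases Fp "0::real" rule: linorder_cases) auto
    qed (use neg ne in \<open>auto intro!: exI[of _ "(0, 0, 1)"]\<close>)
    then show ?thesis using sgn surf Left_Side by (auto simp: \<phi>_def)
  qed
qed

lemma smooth_real_derivative:
  fixes u :: "real \<Rightarrow> real"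
  assumes "smooth_on S u" "open S" "t \<in> S"
  shows "(u has_real_derivative dd 1 u t) (at t)"
proof -
  have d: "(u has_derivative frechet_derivative u (at t)) (at t)" by (rule smooth_on_has_derivative[OF assms])
  have "frechet_derivative u (at t) = (*) (dd 1 u t)"
  proof
    fix v show "frechet_derivative u (at t) v = dd 1 u t * v"
      using linear_scale[OF has_derivative_linear[OF d], of v 1] by simp
  qed
  then show ?thesis using d unfolding has_field_derivative_def by simp
qed

lemma deriv_eq_on:
  fixes h k :: "real \<Rightarrow> real"
  assumes "open J" "\<And>t. t \<in> J \<Longrightarrow> h t = k t" "\<And>t. t \<in> J \<Longrightarrow> (k has_real_derivative k' t) (at t)" "t \<in> J"
  shows "deriv h t = k' t"
proof (rule DERIV_imp_deriv)
  show "(h has_real_derivative k' t) (at t)"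
    using has_derivative_transform_within_open[OF assms(3)[OF assms(4), unfolded has_field_derivative_def] assms(1,4)]
      assms(2) unfolding has_field_derivative_def by metis
qed

section \<open>Solution curves over a region where one part of the surface is a graph p = P(x,
  y)\<close>

context
  fixes B :: bide and s :: side and V :: "plane set" and P :: "plane \<Rightarrow> real"
  assumes smB: "smooth_on UNIV B" and V: "open V" and smP: "smooth_on V P"
    and root: "\<And>x y p. (x, y) \<in> V \<Longrightarrow> (x, y, p) \<in> part B s \<longleftrightarrow> p = P (x, y)"
begin

text \<open>On the part F_p is nonzero, so a tangent vector in the contact plane without x-component
  is zero. A solution therefore projects to a regular curve of slope P with nonvanishing horizontal
  speed u.\<close>

lemma solution_local:
  assumes "solution_at B s q c" "q \<in> V"
  obtains r u where "r > 0" "smooth_on {-r<..<r} u" "\<And>t. t \<in> {-r<..<r} \<Longrightarrow> u t \<noteq> 0" "\<And>t. t \<in> {-r<..<r} \<Longrightarrow> c t \<in> V"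
    "\<And>t. t \<in> {-r<..<r} \<Longrightarrow> (c has_vector_derivative (u t, P (c t) * u t)) (at t)"
proof -
  from assms(1) obtain r0 \<gamma> where r0: "r0 > 0" and ch: "characteristic_on B {-r0<..<r0} \<gamma>"
    and pt: "\<gamma> ` {-r0<..<r0} \<subseteq> part B s" and c: "c = proj \<circ> \<gamma>" "c 0 = q"
    unfolding solution_at_def by blast
  let ?J = "{-r0<..<r0}"
  have sm: "smooth_on ?J \<gamma>" using ch by (simp add: characteristic_on_def)
  have ceq: "c = (\<lambda>t. (fst (\<gamma> t), fst (snd (\<gamma> t))))"
    using c(1) by (auto simp: fun_eq_iff) (metis proj.simps prod.collapse)+
  have smc: "smooth_on ?J c" unfolding ceq by (intro smooth_intros sm) auto
  have d\<gamma>: "(\<gamma> has_vector_derivative dd 1 \<gamma> t) (at t)" if "t \<in> ?J" for t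
  proof -
    have d: "(\<gamma> has_derivative frechet_derivative \<gamma> (at t)) (at t)"
      by (rule smooth_on_has_derivative[OF sm _ that]) simp
    have "frechet_derivative \<gamma> (at t) = (\<lambda>v. v *\<^sub>R dd 1 \<gamma> t)"
    proof
      fix v show "frechet_derivative \<gamma> (at t) v = v *\<^sub>R dd 1 \<gamma> t"
        using linear_scale[OF has_derivative_linear[OF d], of v 1] by simp
    qed
    then show ?thesis using d unfolding has_vector_derivative_def by simp
  qed
  have vd: "vector_derivative \<gamma> (at t) = dd 1 \<gamma> t" if "t \<in> ?J" for t
    using d\<gamma>[OF that] by (rule vector_derivative_at)
  define u where "u t = fst (dd 1 \<gamma> t)" for t
  have smu: "smooth_on ?J u" unfolding u_def by (intro smooth_intros smooth_on_dd sm) auto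
  have "open (c -` V \<inter> ?J)"
    using continuous_open_preimage[OF smooth_on_continuous_on[OF smc] _ V] by (simp add: Int_commute)
  moreover have "0 \<in> c -` V \<inter> ?J" using c assms(2) r0 by auto
  ultimately obtain r where r: "r > 0" "ball 0 r \<subseteq> c -` V \<inter> ?J" by (meson openE)
  have sub: "{-r<..<r} \<subseteq> c -` V \<inter> ?J" using r(2) by (auto simp: ball_def dist_real_def subset_iff)
  have main: "u t \<noteq> 0 \<and> (c has_vector_derivative (u t, P (c t) * u t)) (at t)" if t: "t \<in> {-r<..<r}" for t
  proof -
    have tJ: "t \<in> ?J" and ctV: "c t \<in> V" using sub t by auto
    obtain x y p where g: "\<gamma> t = (x, y, p)" by (metis prod_cases3)
    obtain v1 v2 v3 where v: "dd 1 \<gamma> t = (v1, v2, v3)" by (metis prod_cases3)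
    have ct: "c t = (x, y)" by (simp add: ceq g)
    have part: "(x, y, p) \<in> part B s" using pt tJ g by (metis image_eqI subsetD)
    then have p: "p = P (c t)" using root[of x y p] ctV ct by simp
    have *: "(v1, v2, v3) \<noteq> 0" "dF B (x, y, p) (v1, v2, v3) = 0" "p * v1 - v2 = 0"
    proof -
      have "vector_derivative \<gamma> (at t) \<noteq> 0 \<and> dF B (\<gamma> t) (vector_derivative \<gamma> (at t)) = 0 \<and>
          vector_derivative \<gamma> (at t) \<in> contact_plane (\<gamma> t)"
        using ch tJ unfolding characteristic_on_def Let_def by blast
      then show "(v1, v2, v3) \<noteq> 0" "dF B (x, y, p) (v1, v2, v3) = 0" "p * v1 - v2 = 0"
        unfolding vd[OF tJ] v g by (simp_all only: contact_plane.simps mem_Collect_eq case_prod_conv not_False_eq_True)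
    qed
    have "v1 \<noteq> 0"
    proof
      assume 0: "v1 = 0"
      then have "v2 = 0" using * by simp
      then have "dF B (x, y, p) (0, 0, v3) = 0" using * 0 by simp
      moreover have "fst (snd (B (x, y))) + snd (snd (B (x, y))) * p \<noteq> 0"
        using part part_iff[OF smB, of x y p s] by (metis less_irrefl mult_zero_right)
      ultimately have "v3 = 0" unfolding dF_vertical[OF smB] by simp
      then show False using * 0 \<open>v2 = 0\<close> by (simp add: zero_prod_def)
    qed
    moreover have "(c has_vector_derivative (v1, v2)) (at t)"
    proof -
      have b: "bounded_linear (\<lambda>m::jet. (fst m, fst (snd m)))"
        by (intro bounded_linear_Pair bounded_linear_fst bounded_linear_compose[OF bounded_linear_fst] bounded_linear_snd)
      from bounded_linear.has_vector_derivative[OF b d\<gamma>[OF tJ]]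
      show ?thesis by (simp add: ceq v)
    qed
    moreover have "v2 = P (c t) * v1" using * p by simp
    ultimately show ?thesis by (simp add: u_def v)
  qed
  show thesis
  proof (rule that[OF r(1)])
    show "smooth_on {-r<..<r} u" using smooth_on_subset[OF smu] sub by blast
  qed (use main sub in auto)
qed

text \<open>Up to a constant factor the tangent-line function has derivative u (P - P0) along c.
  Each further derivative along the curve turns P into u G and G into u L, and the terms that keep
  the factor P - P0 vanish at 0.\<close>

lemma solution_contact:
  assumes "r > 0" "smooth_on {-r<..<r} u" "\<And>t. t \<in> {-r<..<r} \<Longrightarrow> u t \<noteq> 0" "\<And>t. t \<in> {-r<..<r} \<Longrightarrow> c t \<in> V"
    "\<And>t. t \<in> {-r<..<r} \<Longrightarrow> (c has_vector_derivative (u t, P (c t) * u t)) (at t)"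
  defines "g \<equiv> along (1,0) (0,1) P P"
  shows "contact_at_least 3 c (tangent_line_eq c) \<longleftrightarrow> g (c 0) = 0"
    and "contact_at_least 4 c (tangent_line_eq c) \<longleftrightarrow> g (c 0) = 0 \<and> along (1,0) (0,1) P g (c 0) = 0"
proof -
  let ?J = "{-r<..<r}"
  have o: "open ?J" and z: "0 \<in> ?J" using assms(1) by auto
  have smg: "smooth_on V g" unfolding g_def by (intro smooth_intros V smP)
  define l where "l = along (1,0) (0,1) P g"
  have comp: "((\<lambda>t. h (c t)) has_real_derivative u t * along (1,0) (0,1) P h (c t)) (at t)"
    if "smooth_on V h" "t \<in> ?J" for h t
  proof -
    have dh: "(h has_derivative frechet_derivative h (at (c t))) (at (c t))"
      by (rule smooth_on_has_derivative[OF that(1) V assms(4)[OF that(2)]])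
    have lin: "linear (frechet_derivative h (at (c t)))" using dh has_derivative_linear by blast
    from diff_chain_at[OF assms(5)[OF that(2), unfolded has_vector_derivative_def] dh]
    have "((\<lambda>t. h (c t)) has_derivative (\<lambda>x. frechet_derivative h (at (c t)) (x *\<^sub>R (u t, P (c t) * u t)))) (at t)"
      by (simp add: o_def)
    moreover have "(\<lambda>x. frechet_derivative h (at (c t)) (x *\<^sub>R (u t, P (c t) * u t))) = (*) (u t * along (1,0) (0,1) P h (c t))"
    proof
      fix x
      have "x *\<^sub>R (u t, P (c t) * u t) = (x * u t) *\<^sub>R (1, 0) + (x * u t * P (c t)) *\<^sub>R (0, 1)" by simp
      then have "frechet_derivative h (at (c t)) (x *\<^sub>R (u t, P (c t) * u t)) =
         (x * u t) * dd (1,0) h (c t) + (x * u t * P (c t)) * dd (0,1) h (c t)"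
        by (simp only: linear_add[OF lin] linear_scale[OF lin] real_scaleR_def)
      then show "frechet_derivative h (at (c t)) (x *\<^sub>R (u t, P (c t) * u t)) = (u t * along (1,0) (0,1) P h (c t)) * x"
        by (simp add: along_def algebra_simps)
    qed
    ultimately show ?thesis unfolding has_field_derivative_def by simp
  qed
  define u0 where "u0 = u 0"
  define P0 where "P0 = P (c 0)"
  have u0: "u0 \<noteq> 0" unfolding u0_def by (rule assms(3)[OF z])
  let ?u1 = "dd 1 u" and ?u2 = "dd 1 (dd 1 u)"
  have du: "(u has_real_derivative ?u1 t) (at t)" if "t \<in> ?J" for t
    using smooth_real_derivative[OF assms(2) o that] .
  have du1: "(?u1 has_real_derivative ?u2 t) (at t)" if "t \<in> ?J" for t
    using smooth_real_derivative[OF smooth_on_dd[OF assms(2)] o that] .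
  have dP: "((\<lambda>t. P (c t)) has_real_derivative u t * g (c t)) (at t)" if "t \<in> ?J" for t
    using comp[OF smP that] by (simp add: g_def)
  have dg: "((\<lambda>t. g (c t)) has_real_derivative u t * l (c t)) (at t)" if "t \<in> ?J" for t
    using comp[OF smg that] by (simp add: l_def)
  define f where "f = tangent_line_eq c \<circ> c"
  have vd0: "vector_derivative c (at 0) = (u0, P0 * u0)"
    using vector_derivative_at[OF assms(5)[OF z]] by (simp add: u0_def P0_def)
  have feq: "f t = u0 * (snd (c t) - snd (c 0)) - P0 * u0 * (fst (c t) - fst (c 0))" for t
    by (cases "c t"; cases "c 0") (simp add: f_def tangent_line_eq_def vd0)
  define f1 where "f1 t = u0 * u t * (P (c t) - P0)" for t
  define f2 where "f2 t = u0 * (?u1 t * (P (c t) - P0) + u t * (u t * g (c t)))" for t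
  define f3 where "f3 t = u0 * (?u2 t * (P (c t) - P0) + ?u1 t * (u t * g (c t))
     + (?u1 t * (u t * g (c t)) + u t * (?u1 t * g (c t) + u t * (u t * l (c t)))))" for t
  have d0: "(f has_real_derivative f1 t) (at t)" if "t \<in> ?J" for t
  proof -
    have s: "((\<lambda>t. snd (c t)) has_real_derivative P (c t) * u t) (at t)"
      using bounded_linear.has_vector_derivative[OF bounded_linear_snd assms(5)[OF that]]
      by (simp add: has_real_derivative_iff_has_vector_derivative)
    have f: "((\<lambda>t. fst (c t)) has_real_derivative u t) (at t)"
      using bounded_linear.has_vector_derivative[OF bounded_linear_fst assms(5)[OF that]]
      by (simp add: has_real_derivative_iff_has_vector_derivative)
    have "((\<lambda>t. u0 * (snd (c t) - snd (c 0)) - P0 * u0 * (fst (c t) - fst (c 0))) has_real_derivative f1 t) (at t)"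
      by (rule derivative_eq_intros s f refl)+ (simp add: f1_def algebra_simps)
    then show ?thesis using feq by presburger
  qed
  have d1: "(f1 has_real_derivative f2 t) (at t)" if "t \<in> ?J" for t
    unfolding f1_def[abs_def]
    by (rule derivative_eq_intros du[OF that] dP[OF that] refl)+ (simp add: f2_def algebra_simps)
  have d2: "(f2 has_real_derivative f3 t) (at t)" if "t \<in> ?J" for t
    unfolding f2_def[abs_def]
    by (rule derivative_eq_intros du[OF that] du1[OF that] dP[OF that] dg[OF that] refl)+ (simp add: f3_def algebra_simps)
  have e1: "deriv f t = f1 t" if "t \<in> ?J" for t
    by (rule deriv_eq_on[OF o _ d0 that]) auto
  have e2: "deriv (deriv f) t = f2 t" if "t \<in> ?J" for t
    by (rule deriv_eq_on[OF o e1 d1 that]) auto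
  have e3: "deriv (deriv (deriv f)) t = f3 t" if "t \<in> ?J" for t
    by (rule deriv_eq_on[OF o e2 d2 that]) auto
  \<comment> \<open>\<open>f2 0\<close> is a nonzero multiple of G; once G vanishes,
    \<open>f3 0\<close> is a nonzero multiple of L, whatever the parametrization of c.\<close>
  have v: "f 0 = 0" "f1 0 = 0" "f2 0 = u0 ^ 3 * g (c 0)"
    "f3 0 = u0 * (3 * u0 * ?u1 0 * g (c 0) + u0 ^ 3 * l (c 0))"
    by (simp_all add: feq f1_def f2_def f3_def u0_def P0_def algebra_simps power3_eq_cube)
  have c3: "contact_at_least 3 c (tangent_line_eq c) \<longleftrightarrow> f2 0 = 0"
    unfolding contact_at_least_def f_def[symmetric]
    by (simp add: numeral_eq_Suc All_less_Suc e1[OF z] e2[OF z] v(1,2) del: v(3))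
  have c4: "contact_at_least 4 c (tangent_line_eq c) \<longleftrightarrow> f2 0 = 0 \<and> f3 0 = 0"
    unfolding contact_at_least_def f_def[symmetric]
    by (auto simp add: numeral_eq_Suc All_less_Suc e1[OF z] e2[OF z] e3[OF z] v(1,2))
  show "contact_at_least 3 c (tangent_line_eq c) \<longleftrightarrow> g (c 0) = 0"
    unfolding c3 v using u0 by simp
  show "contact_at_least 4 c (tangent_line_eq c) \<longleftrightarrow> g (c 0) = 0 \<and> along (1,0) (0,1) P g (c 0) = 0"
    unfolding c4 v l_def[symmetric] using u0 by auto
qed

text \<open>An integral curve of slope P is lifted to the surface by the value of P; the velocity of
  the lift is tangent because F vanishes identically along it.\<close>

lemma solution_exists:
  assumes "q \<in> V" obtains c where "solution_at B s q c"
proof -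
  obtain x0 y0 where q: "q = (x0, y0)" by force
  from ode_solution_exists[OF V smP assms[unfolded q]]
  obtain r Y where r: "r > 0" and Y0: "Y 0 = y0" and inV: "\<And>t. t \<in> {-r<..<r} \<Longrightarrow> (x0 + t, Y t) \<in> V"
    and dY: "\<And>t. t \<in> {-r<..<r} \<Longrightarrow> (Y has_real_derivative P (x0 + t, Y t)) (at t)" by blast
  let ?J = "{-r<..<r}"
  have o: "open ?J" by simp
  have smY: "smooth_on ?J Y" by (rule smooth_on_ode_solution[OF V smP inV dY])
  have smp: "smooth_on ?J (\<lambda>t. P (x0 + t, Y t))"
    by (rule smooth_on_compose[OF smP _ o V]) (use inV in \<open>auto intro!: smooth_intros smY\<close>)
  define \<gamma> where "\<gamma> t = (x0 + t, Y t, P (x0 + t, Y t))" for t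
  have sm: "smooth_on ?J \<gamma>" unfolding \<gamma>_def by (intro smooth_intros o smY smp)
  have part: "\<gamma> t \<in> part B s" if "t \<in> ?J" for t
    using root[OF inV[OF that]] by (simp add: \<gamma>_def)
  have zero: "F_jet B (\<gamma> t) = 0" if "t \<in> ?J" for t
    using part[OF that] part_iff[OF smB] by (simp add: \<gamma>_def)
  have d\<gamma>: "(\<gamma> has_vector_derivative (1, P (x0 + t, Y t), dd 1 (\<lambda>t. P (x0 + t, Y t)) t)) (at t)" if "t \<in> ?J" for t
    unfolding \<gamma>_def[abs_def]
    using dY[OF that] smooth_real_derivative[OF smp o that]
    by (auto intro!: derivative_eq_intros has_vector_derivative_Pair simp: has_real_derivative_iff_has_vector_derivative)
  have "characteristic_on B ?J \<gamma>"
    unfolding characteristic_on_def Let_def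
  proof (intro conjI ballI sm)
    fix t assume t: "t \<in> ?J"
    note vd = vector_derivative_at[OF d\<gamma>[OF t]]
    show "\<gamma> t \<in> surface B" using zero[OF t] by (simp add: surface_def)
    show "vector_derivative \<gamma> (at t) \<noteq> 0" by (simp add: vd zero_prod_def)
    show "vector_derivative \<gamma> (at t) \<in> contact_plane (\<gamma> t)" unfolding vd by (simp add: \<gamma>_def)
    have dF: "(F_jet B has_derivative dF B (\<gamma> t)) (at (\<gamma> t))"
      using smooth_on_has_derivative[OF smooth_F_jet[OF smB]] by simp
    from diff_chain_at[OF d\<gamma>[OF t, unfolded has_vector_derivative_def] dF]
    have 1: "((\<lambda>t. F_jet B (\<gamma> t)) has_derivative (\<lambda>x. dF B (\<gamma> t) (x *\<^sub>R (1, P (x0 + t, Y t), dd 1 (\<lambda>t. P (x0 + t, Y t)) t)))) (at t)"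
      by (simp add: o_def)
    have 2: "((\<lambda>t. F_jet B (\<gamma> t)) has_derivative (\<lambda>x. 0)) (at t)"
      by (rule has_derivative_transform_within_open[OF has_derivative_const o t]) (use zero in auto)
    from fun_cong[OF has_derivative_unique[OF 1 2], of 1]
    show "dF B (\<gamma> t) (vector_derivative \<gamma> (at t)) = 0" unfolding vd by simp
  qed
  moreover have "\<gamma> ` ?J \<subseteq> part B s" using part by blast
  ultimately have "solution_at B s q (proj \<circ> \<gamma>)"
    unfolding solution_at_def using r Y0 q by (intro exI[of _ r] conjI exI[of _ \<gamma>]) (auto simp: \<gamma>_def)
  then show thesis by (rule that)
qed

text \<open>All solutions through q give the same equation, and there is at least one, so the
  existential definition becomes a pointwise equation.\<close>

lemma inflection_curve_iff:
  assumes "q \<in> V"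
  shows "q \<in> inflection_curve B s \<longleftrightarrow> along (1,0) (0,1) P P q = 0"
proof -
  have *: "contact_at_least 3 c (tangent_line_eq c) \<longleftrightarrow> along (1,0) (0,1) P P q = 0" if sol: "solution_at B s q c" for c
  proof -
    have c0: "c 0 = q" using sol by (auto simp: solution_at_def)
    from solution_local[OF sol assms] obtain r u where *: "r > 0" "smooth_on {-r<..<r} u" "\<And>t. t \<in> {-r<..<r} \<Longrightarrow> u t \<noteq> 0" "\<And>t. t \<in> {-r<..<r} \<Longrightarrow> c t \<in> V"
      "\<And>t. t \<in> {-r<..<r} \<Longrightarrow> (c has_vector_derivative (u t, P (c t) * u t)) (at t)" by blast
    show ?thesis using solution_contact(1)[OF *] c0 by simp
  qed
  obtain c where "solution_at B s q c" using solution_exists[OF assms] .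
  then show ?thesis unfolding inflection_curve_def using * by blast
qed

lemma bi_inflections_iff:
  assumes "q \<in> V"
  shows "q \<in> bi_inflections B s \<longleftrightarrow> along (1,0) (0,1) P P q = 0 \<and> along (1,0) (0,1) P (along (1,0) (0,1) P P) q = 0"
proof -
  have *: "contact_at_least 4 c (tangent_line_eq c) \<longleftrightarrow>
      along (1,0) (0,1) P P q = 0 \<and> along (1,0) (0,1) P (along (1,0) (0,1) P P) q = 0" if sol: "solution_at B s q c" for c
  proof -
    have c0: "c 0 = q" using sol by (auto simp: solution_at_def)
    from solution_local[OF sol assms] obtain r u where *: "r > 0" "smooth_on {-r<..<r} u" "\<And>t. t \<in> {-r<..<r} \<Longrightarrow> u t \<noteq> 0" "\<And>t. t \<in> {-r<..<r} \<Longrightarrow> c t \<in> V"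
      "\<And>t. t \<in> {-r<..<r} \<Longrightarrow> (c has_vector_derivative (u t, P (c t) * u t)) (at t)" by blast
    show ?thesis using solution_contact(2)[OF *] c0 by simp
  qed
  obtain c where "solution_at B s q c" using solution_exists[OF assms] .
  then show ?thesis unfolding bi_inflections_def using * by blast
qed

end

lemma inflection_curve_part:
  assumes "smooth_on UNIV B" "(x, y) \<in> inflection_curve B s"
  obtains p where "(x, y, p) \<in> part B s"
proof -
  from assms(2) obtain c where "solution_at B s (x, y) c" unfolding inflection_curve_def by blast
  then obtain r \<gamma> where *: "r > 0" "\<gamma> ` {-r<..<r} \<subseteq> part B s" "c = proj \<circ> \<gamma>" "c 0 = (x, y)"
    unfolding solution_at_def by blast
  then have 0: "proj (\<gamma> 0) = (x, y)" by simp
  obtain a b p where "\<gamma> 0 = (a, b, p)" by (metis prod_cases3)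
  moreover have "\<gamma> 0 \<in> part B s" using *(1,2) by auto
  ultimately show thesis using that 0 by simp
qed

section \<open>The unfolding of a quadratic tangency\<close>

lemma line_derivative:
  fixes f :: "'a::real_normed_vector \<Rightarrow> real"
  assumes "smooth_on S f" "open S" "x + t *\<^sub>R i \<in> S"
  shows "((\<lambda>t. f (x + t *\<^sub>R i)) has_real_derivative dd i f (x + t *\<^sub>R i)) (at t)"
proof -
  have d: "(f has_derivative frechet_derivative f (at (x + t *\<^sub>R i))) (at (x + t *\<^sub>R i))"
    by (rule smooth_on_has_derivative[OF assms])
  have "((\<lambda>t. x + t *\<^sub>R i) has_derivative (\<lambda>s. s *\<^sub>R i)) (at t)" by (auto intro!: derivative_eq_intros)
  from diff_chain_at[OF this d]
  have "((\<lambda>t. f (x + t *\<^sub>R i)) has_derivative (\<lambda>s. frechet_derivative f (at (x + t *\<^sub>R i)) (s *\<^sub>R i))) (at t)"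
    by (simp add: o_def)
  moreover have "(\<lambda>s. frechet_derivative f (at (x + t *\<^sub>R i)) (s *\<^sub>R i)) = (*) (dd i f (x + t *\<^sub>R i))"
  proof
    fix s show "frechet_derivative f (at (x + t *\<^sub>R i)) (s *\<^sub>R i) = dd i f (x + t *\<^sub>R i) * s"
      using linear_scale[OF has_derivative_linear[OF d], of s i] by simp
  qed
  ultimately show ?thesis unfolding has_field_derivative_def by simp
qed

lemma line_derivative_0:
  fixes f :: "'a::real_normed_vector \<Rightarrow> real"
  assumes "smooth_on S f" "open S" "x \<in> S"
  shows "((\<lambda>t. f (x + t *\<^sub>R i)) has_real_derivative dd i f x) (at 0)"
  using line_derivative[OF assms(1,2), of x 0 i] assms(3) by simp

lemma dd_chain_curve:
  fixes f :: "'a::real_normed_vector \<Rightarrow> real"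
  assumes "smooth_on S f" "open S" "c t \<in> S" "(c has_vector_derivative v) (at t)"
  shows "((\<lambda>t. f (c t)) has_real_derivative dd v f (c t)) (at t)"
proof -
  have d: "(f has_derivative frechet_derivative f (at (c t))) (at (c t))"
    by (rule smooth_on_has_derivative[OF assms(1-3)])
  from diff_chain_at[OF assms(4)[unfolded has_vector_derivative_def] d]
  have "((\<lambda>t. f (c t)) has_derivative (\<lambda>s. frechet_derivative f (at (c t)) (s *\<^sub>R v))) (at t)"
    by (simp add: o_def)
  moreover have "(\<lambda>s. frechet_derivative f (at (c t)) (s *\<^sub>R v)) = (*) (dd v f (c t))"
  proof
    fix s show "frechet_derivative f (at (c t)) (s *\<^sub>R v) = dd v f (c t) * s"
      using linear_scale[OF has_derivative_linear[OF d], of s v] by simp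
  qed
  ultimately show ?thesis unfolding has_field_derivative_def by simp
qed

lemma ball_subset_vimage:
  fixes f :: "'a::real_normed_vector \<Rightarrow> 'b::real_normed_vector"
  assumes "smooth_on S f" "open S" "x0 \<in> S" "open T" "f x0 \<in> T"
  obtains r where "r > 0" "ball x0 r \<subseteq> S" "f ` ball x0 r \<subseteq> T"
proof -
  have "open (S \<inter> f -` T)"
    using continuous_open_preimage[OF smooth_on_continuous_on[OF assms(1,2)] assms(2,4)] .
  then obtain r where "r > 0" "ball x0 r \<subseteq> S \<inter> f -` T" using assms(3,5) by (meson IntI openE vimageI)
  then show thesis using that[of r] by blast
qed

text \<open>The critical point in X is followed as e varies and shifted to 0. Hadamard's lemma,
  applied twice, leaves the critical value plus X^2 times a nonvanishing function, whose square root
  (up to sign) is absorbed into the new coordinate \<open>a\<close>.\<close>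

lemma morse_with_parameter:
  fixes \<phi> :: "real \<times> real \<Rightarrow> real"
  assumes \<rho>: "\<rho> > 0" and sm: "smooth_on (ball 0 \<rho>) \<phi>" and z: "\<phi> 0 = 0" and dX: "dd (1,0) \<phi> 0 = 0"
    and dXX: "dd (1,0) (dd (1,0) \<phi>) 0 \<noteq> 0" and de: "dd (0,1) \<phi> 0 \<noteq> 0"
  obtains r \<sigma> a E where "r > 0" "r \<le> \<rho>" "\<sigma> \<in> {1, -1::real}" "smooth_on (ball 0 r) a" "smooth_on {-r<..<r} E"
    "\<And>X e. (X, e) \<in> ball 0 r \<Longrightarrow> \<phi> (X, e) = \<sigma> * ((a (X, e))\<^sup>2 - E e)"
    "a 0 = 0" "E 0 = 0" "dd 1 E 0 \<noteq> 0" "dd (1,0) a 0 \<noteq> 0"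
proof -
  define D where "D = dd (1,0) \<phi>"
  have smD: "smooth_on (ball 0 \<rho>) D" unfolding D_def by (rule smooth_on_dd[OF sm])
  have 0: "(0::real \<times> real) \<in> ball 0 \<rho>" using \<rho> by simp
  \<comment> \<open>The critical points are the zeros of the first component; carrying e along makes
    \<open>K\<close> a local diffeomorphism because the second X-derivative is nonzero.\<close>
  define K where "K x = (D x, snd x)" for x
  have smK: "smooth_on (ball 0 \<rho>) K" unfolding K_def by (intro smooth_intros smD) auto
  have K0: "K 0 = 0" using dX by (simp add: K_def D_def flip: zero_prod_def)
  have dD: "(D has_derivative frechet_derivative D (at 0)) (at 0)"
    by (rule smooth_on_has_derivative[OF smD _ 0]) simp
  have dK: "(K has_derivative (\<lambda>u. (frechet_derivative D (at 0) u, snd u))) (at 0)"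
    unfolding K_def by (intro has_derivative_Pair dD has_derivative_snd has_derivative_ident)
  have injK: "v = 0" if "frechet_derivative K (at 0) v = 0" for v
  proof -
    obtain X e where v: "v = (X, e)" by force
    have *: "frechet_derivative D (at 0) (X, e) = 0" "e = 0"
      using that unfolding frechet_at_eqI[OF dK] v by (auto simp: zero_prod_def)
    then have "X * dd (1,0) D 0 = 0"
      using linear_scale[OF has_derivative_linear[OF dD], of X "(1, 0)"] by simp
    then show ?thesis using dXX *(2) by (simp add: v D_def zero_prod_def)
  qed
  from smooth_inverse_function[OF open_ball smK 0 injK]
  obtain W W' g where W: "open W" "open W'" "0 \<in> W" "W \<subseteq> ball 0 \<rho>" "K 0 \<in> W'" "K ` W = W'" "g ` W' = W"
    "smooth_on W' g" "\<And>x. x \<in> W \<Longrightarrow> g (K x) = x" "\<And>y. y \<in> W' \<Longrightarrow> K (g y) = y" by metis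
  obtain r1 where r1: "r1 > 0" "ball 0 r1 \<subseteq> W'" using W(2,5) K0 by (metis openE)
  let ?I = "{-r1<..<r1}"
  have inI: "(0, e) \<in> W'" if "e \<in> ?I" for e
    using r1(2) that by (auto simp: subset_iff norm_Pair)
  define Xc where "Xc e = fst (g (0, e))" for e
  have smXc: "smooth_on ?I Xc"
    unfolding Xc_def
    by (rule smooth_on_fst[OF _ smooth_on_compose[OF W(8) _ _ W(2)]])
      (use inI in \<open>auto intro!: smooth_intros\<close>)
  have gXc: "g (0, e) = (Xc e, e)" "D (Xc e, e) = 0" "(Xc e, e) \<in> ball 0 \<rho>" if "e \<in> ?I" for e
  proof -
    have k: "K (g (0, e)) = (0, e)" using W(10)[OF inI[OF that]] .
    then show 1: "g (0, e) = (Xc e, e)" by (simp add: K_def Xc_def prod_eq_iff)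
    then show "D (Xc e, e) = 0" using k by (simp add: K_def)
    have "g (0, e) \<in> W" using W(7) inI[OF that] by blast
    then show "(Xc e, e) \<in> ball 0 \<rho>" using 1 W(4) by auto
  qed
  have Xc0: "Xc 0 = 0" using W(9)[OF W(3)] K0 by (simp add: Xc_def zero_prod_def)
  have oI: "open (UNIV \<times> ?I :: (real \<times> real) set)" by (intro open_Times) auto
  \<comment> \<open>These shears move the critical points from the e-axis to their place and
    back.\<close>
  define sh where "sh x = (fst x + Xc (snd x), snd x)" for x
  define sh' where "sh' x = (fst x - Xc (snd x), snd x)" for x
  have smXs: "smooth_on (UNIV \<times> ?I) (\<lambda>x::real \<times> real. Xc (snd x))"
    by (rule smooth_on_compose[OF smXc]) (auto intro!: smooth_intros open_Times)
  have smsh: "smooth_on (UNIV \<times> ?I) sh" and smsh': "smooth_on (UNIV \<times> ?I) sh'"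
    unfolding sh_def sh'_def by (intro smooth_intros oI smXs)+
  have I0: "0 \<in> UNIV \<times> ?I" using r1 by (simp add: zero_prod_def)
  have sh0: "sh 0 = 0" "sh' 0 = 0" using Xc0 by (auto simp: sh_def sh'_def zero_prod_def)
  obtain r2 where r2: "r2 > 0" "ball (0::real \<times> real) r2 \<subseteq> UNIV \<times> ?I" "sh ` ball 0 r2 \<subseteq> ball 0 \<rho>"
    using ball_subset_vimage[OF smsh oI I0 open_ball, of 0 \<rho>] sh0 \<rho> by (auto simp: mem_ball)
  define \<psi> where "\<psi> x = \<phi> (sh x)" for x
  have sm\<psi>: "smooth_on (ball 0 r2) \<psi>" unfolding \<psi>_def
    by (rule smooth_on_compose[OF sm smooth_on_subset[OF smsh r2(2)] _ _ r2(3)]) auto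
  have d\<psi>: "dd (1,0) \<psi> x = D (sh x)" if x: "x \<in> ball 0 r2" for x
  proof -
    have "((\<lambda>t. \<phi> (sh x + t *\<^sub>R (1,0))) has_real_derivative D (sh x)) (at 0)"
      unfolding D_def by (rule line_derivative_0[OF sm open_ball]) (use r2(3) x in blast)
    moreover have "(\<lambda>t. \<phi> (sh x + t *\<^sub>R (1,0))) = (\<lambda>t. \<psi> (x + t *\<^sub>R (1,0)))"
      by (simp add: \<psi>_def sh_def algebra_simps)
    ultimately have "((\<lambda>t. \<psi> (x + t *\<^sub>R (1,0))) has_real_derivative D (sh x)) (at 0)" by (simp only:)
    from DERIV_unique[OF line_derivative_0[OF sm\<psi> open_ball x] this] show ?thesis .
  qed
  have b1: "(1::real, 0::real) \<in> Basis" by (simp add: Basis_prod_def)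
  obtain H1 where H1: "smooth_on (ball 0 r2) H1"
    "\<And>x. x \<in> ball 0 r2 \<Longrightarrow> \<psi> x = \<psi> (x - (x \<bullet> (1,0)) *\<^sub>R (1,0)) + (x \<bullet> (1,0)) * H1 x"
    "\<And>x. x \<in> ball 0 r2 \<Longrightarrow> x \<bullet> (1,0) = 0 \<Longrightarrow> H1 x = dd (1,0) \<psi> x"
    using hadamard[OF sm\<psi> b1] by blast
  obtain H2 where H2: "smooth_on (ball 0 r2) H2"
    "\<And>x. x \<in> ball 0 r2 \<Longrightarrow> H1 x = H1 (x - (x \<bullet> (1,0)) *\<^sub>R (1,0)) + (x \<bullet> (1,0)) * H2 x"
    "\<And>x. x \<in> ball 0 r2 \<Longrightarrow> x \<bullet> (1,0) = 0 \<Longrightarrow> H2 x = dd (1,0) H1 x"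
    using hadamard[OF H1(1) b1] by blast
  have proj: "(0::real, e) \<in> ball 0 r2" if "(X, e) \<in> ball 0 r2" for X e :: real
  proof -
    have "norm (0::real, e) \<le> norm (X, e)" by (simp add: norm_Pair real_le_rsqrt)
    then show ?thesis using that unfolding mem_ball_0 by linarith
  qed
  have H10: "H1 (0, e) = 0" if "(0::real, e) \<in> ball 0 r2" for e
  proof -
    have "e \<in> ?I" using subsetD[OF r2(2) that] by simp
    then show ?thesis using H1(3)[OF that] d\<psi>[OF that] gXc(2) by (simp add: sh_def)
  qed
  have \<psi>eq: "\<psi> (X, e) = \<psi> (0, e) + X\<^sup>2 * H2 (X, e)" if "(X, e) \<in> ball 0 r2" for X e
    using H1(2)[OF that] H2(2)[OF that] H10[OF proj[OF that]] by (simp add: power2_eq_square)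
  have z2: "0 \<in> ball (0::real \<times> real) r2" using r2 by simp
  \<comment> \<open>On the X-axis \<psi> coincides with \<phi>. Differentiating \<psi> = \<psi>(0) +
    X H1 twice gives first H1 + X H1' and then 2 H1'(0), and \<open>H2\<close> at 0 is
    H1'(0).\<close>
  have H20: "2 * H2 0 = dd (1,0) D 0"
  proof -
    have "\<psi> (0 + t *\<^sub>R (1,0)) = \<phi> (0 + t *\<^sub>R (1,0))" for t
      by (simp add: \<psi>_def sh_def Xc0 zero_prod_def)
    have dH: "((\<lambda>t. H1 (0 + t *\<^sub>R (1,0))) has_real_derivative dd (1,0) H1 (0 + t *\<^sub>R (1,0))) (at t)" if "\<bar>t\<bar> < r2" for t
      by (rule line_derivative[OF H1(1)]) (use that in \<open>auto simp: norm_Pair\<close>)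
    have in2: "0 + t *\<^sub>R (1,0) \<in> ball (0::real \<times> real) r2" if "\<bar>t\<bar> < r2" for t using that by (auto simp: norm_Pair)
    have eq: "D (0 + t *\<^sub>R (1,0)) = H1 (0 + t *\<^sub>R (1,0)) + t * dd (1,0) H1 (0 + t *\<^sub>R (1,0))" if t: "\<bar>t\<bar> < r2" for t
    proof -
      have "((\<lambda>t. \<psi> (0, 0) + t * H1 (0 + t *\<^sub>R (1,0))) has_real_derivative
          H1 (0 + t *\<^sub>R (1,0)) + t * dd (1,0) H1 (0 + t *\<^sub>R (1,0))) (at t)"
        by (rule derivative_eq_intros dH[OF t] refl)+ simp
      then have "((\<lambda>t. \<psi> (0 + t *\<^sub>R (1,0))) has_real_derivative
          H1 (0 + t *\<^sub>R (1,0)) + t * dd (1,0) H1 (0 + t *\<^sub>R (1,0))) (at t)"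
        unfolding has_field_derivative_def
      proof (rule has_derivative_transform_within_open[where s="{-r2<..<r2}"])
        fix s assume "s \<in> {-r2<..<r2}"
        then have "0 + s *\<^sub>R (1,0) \<in> ball (0::real \<times> real) r2" by (auto simp: norm_Pair)
        from H1(2)[OF this] show "\<psi> (0, 0) + s * H1 (0 + s *\<^sub>R (1,0)) = \<psi> (0 + s *\<^sub>R (1,0))" by (simp add: zero_prod_def)
      qed (use t in auto)
      from DERIV_unique[OF this line_derivative[OF sm\<psi> open_ball in2[OF t]]]
      show ?thesis using d\<psi>[OF in2[OF t]] by (simp add: sh_def Xc0)
    qed
    have d1: "((\<lambda>t. dd (1,0) H1 (0 + t *\<^sub>R (1,0))) has_real_derivative dd (1,0) (dd (1,0) H1) 0) (at 0)"
      by (rule line_derivative_0[OF smooth_on_dd[OF H1(1)] open_ball z2])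
    have "((\<lambda>t. H1 (0 + t *\<^sub>R (1,0)) + t * dd (1,0) H1 (0 + t *\<^sub>R (1,0))) has_real_derivative
       dd (1,0) H1 0 + dd (1,0) H1 0) (at 0)"
      by (rule derivative_eq_intros d1 line_derivative_0[OF H1(1) open_ball z2] refl)+ (simp add: zero_prod_def)
    then have "((\<lambda>t. D (0 + t *\<^sub>R (1,0))) has_real_derivative dd (1,0) H1 0 + dd (1,0) H1 0) (at 0)"
      unfolding has_field_derivative_def
      by (rule has_derivative_transform_within_open[where s="{-r2<..<r2}"]) (use eq r2 in auto)
    from DERIV_unique[OF this line_derivative_0[OF smD open_ball 0]]
    show ?thesis using H2(3)[OF z2] by simp
  qed
  define \<sigma> where "\<sigma> = sgn (H2 0)"
  have H2n: "H2 0 \<noteq> 0" using H20 dXX by (auto simp: D_def)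
  have \<sigma>: "\<sigma> \<in> {1, -1}" "\<sigma> * \<sigma> = 1" "\<sigma> * H2 0 > 0" using H2n by (auto simp: \<sigma>_def sgn_if)
  have sm\<sigma>H: "smooth_on (ball 0 r2) (\<lambda>x. \<sigma> * H2 x)" by (intro smooth_intros H2(1)) auto
  obtain r3 where r3: "r3 > 0" "ball (0::real \<times> real) r3 \<subseteq> ball 0 r2" "(\<lambda>x. \<sigma> * H2 x) ` ball 0 r3 \<subseteq> {0<..}"
    using ball_subset_vimage[OF sm\<sigma>H open_ball z2 open_greaterThan, of 0] \<sigma>(3) by auto
  obtain r4 where r4: "r4 > 0" "ball (0::real \<times> real) r4 \<subseteq> UNIV \<times> ?I" "sh' ` ball 0 r4 \<subseteq> ball 0 r3"
    using ball_subset_vimage[OF smsh' oI I0 open_ball, of 0 r3] sh0 r3 by (auto simp: mem_ball)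
  define r where "r = min \<rho> (min r4 (min r1 r2))"
  have r: "r > 0" "r \<le> \<rho>" "r \<le> r4" "r \<le> r1" "r \<le> r2" using \<rho> r4 r1 r2 by (auto simp: r_def)
  have br: "ball (0::real \<times> real) r \<subseteq> ball 0 r4" using r by auto
  define k where "k x = sqrt (\<sigma> * H2 (sh' x))" for x
  define a where "a x = (fst x - Xc (snd x)) * k x" for x
  \<comment> \<open>Up to the sign \<sigma>, the critical value of \<phi> at parameter e.\<close>
  define E where "E e = - \<sigma> * \<phi> (Xc e, e)" for e
  have brI: "ball (0::real \<times> real) r \<subseteq> UNIV \<times> ?I" using br r4(2) by (rule order_trans)
  have shr: "sh' ` ball 0 r \<subseteq> ball 0 r3" using r4(3) br by blast
  have H2sh: "smooth_on (ball 0 r) (\<lambda>x. \<sigma> * H2 (sh' x))"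
    by (rule smooth_on_compose[OF sm\<sigma>H smooth_on_subset[OF smsh' brI] open_ball open_ball order_trans[OF shr r3(2)]])
  have kpos: "\<sigma> * H2 (sh' x) > 0" if "x \<in> ball 0 r" for x
  proof -
    have "\<sigma> * H2 (sh' x) \<in> {0<..}" using shr that r3(3) by blast
    then show ?thesis by simp
  qed
  have smk: "smooth_on (ball 0 r) k" unfolding k_def
    by (rule smooth_on_sqrt[OF _ H2sh kpos]) auto
  have sma: "smooth_on (ball 0 r) a" unfolding a_def
    by (intro smooth_intros smk smooth_on_subset[OF smXs brI] open_ball)
  have rI: "{-r<..<r} \<subseteq> ?I" using r by auto
  have smE: "smooth_on {-r<..<r} E"
  proof -
    have "smooth_on {-r<..<r} (\<lambda>e. \<phi> (Xc e, e))"
      by (rule smooth_on_compose[OF sm _ _ open_ball])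
        (use rI gXc(3) in \<open>auto intro!: smooth_intros smooth_on_subset[OF smXc]\<close>)
    then show ?thesis unfolding E_def by (intro smooth_intros) auto
  qed
  have main: "\<phi> (X, e) = \<sigma> * ((a (X, e))\<^sup>2 - E e)" if x: "(X, e) \<in> ball 0 r" for X e
  proof -
    have "sh' (X, e) \<in> ball 0 r3" using x shr by blast
    then have in2: "(X - Xc e, e) \<in> ball 0 r2" using subsetD[OF r3(2)] by (simp add: sh'_def)
    have k2: "(k (X, e))\<^sup>2 = \<sigma> * H2 (X - Xc e, e)"
      using kpos[OF x] by (simp add: k_def sh'_def)
    have "\<phi> (X, e) = \<psi> (X - Xc e, e)" by (simp add: \<psi>_def sh_def)
    also have "\<dots> = \<phi> (Xc e, e) + (X - Xc e)\<^sup>2 * H2 (X - Xc e, e)"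
      using \<psi>eq[OF in2] by (simp add: \<psi>_def sh_def)
    also have "\<dots> = \<sigma> * ((X - Xc e)\<^sup>2 * (\<sigma> * H2 (X - Xc e, e)) + \<sigma> * \<phi> (Xc e, e))"
      using \<sigma>(2) by (simp add: algebra_simps)
        (metis (no_types, opaque_lifting) \<sigma>(2) mult.assoc mult_1)
    finally show ?thesis by (simp add: a_def E_def power_mult_distrib k2)
  qed
  have a0: "a 0 = 0" by (simp add: a_def Xc0 zero_prod_def)
  have E0: "E 0 = 0" using z by (simp add: E_def Xc0 zero_prod_def)
  have zr: "0 \<in> ball (0::real \<times> real) r" using r by simp
  \<comment> \<open>The critical value moves with the e-derivative of \<phi>, since the X-derivative
    vanishes at the critical point.\<close>
  have dE: "dd 1 E 0 \<noteq> 0"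
  proof -
    have "(Xc has_vector_derivative dd 1 Xc 0) (at 0)"
      using smooth_real_derivative[OF smXc, of 0] r1 by (simp add: has_real_derivative_iff_has_vector_derivative)
    then have "((\<lambda>e. (Xc e, e)) has_vector_derivative (dd 1 Xc 0, 1)) (at 0)"
      by (intro has_vector_derivative_Pair has_vector_derivative_id)
    from dd_chain_curve[OF sm open_ball _ this]
    have 1: "((\<lambda>e. \<phi> (Xc e, e)) has_real_derivative dd (dd 1 Xc 0, 1) \<phi> 0) (at 0)"
      using \<rho> by (simp add: Xc0 flip: zero_prod_def)
    have lin: "linear (frechet_derivative \<phi> (at 0))" by (rule smooth_on_linear[OF sm _ 0]) simp
    have "(dd 1 Xc 0, 1) = dd 1 Xc 0 *\<^sub>R (1, 0) + (0, 1::real)" by simp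
    then have "dd (dd 1 Xc 0, 1) \<phi> 0 = dd 1 Xc 0 *\<^sub>R dd (1,0) \<phi> 0 + dd (0,1) \<phi> 0"
      by (metis linear_add[OF lin] linear_scale[OF lin])
    then have 2: "dd (dd 1 Xc 0, 1) \<phi> 0 = dd (0,1) \<phi> 0" using dX by simp
    have "(E has_real_derivative - \<sigma> * dd (0,1) \<phi> 0) (at 0)"
      unfolding E_def[abs_def] by (rule derivative_eq_intros 1[unfolded 2] refl)+ simp
    moreover have "(E has_real_derivative dd 1 E 0) (at 0)"
      by (rule smooth_real_derivative[OF smE]) (use r in auto)
    ultimately have "dd 1 E 0 = - \<sigma> * dd (0,1) \<phi> 0" using DERIV_unique by blast
    then show ?thesis using de \<sigma>(1) by auto
  qed
  have da: "dd (1,0) a 0 \<noteq> 0"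
  proof -
    have "((\<lambda>t. t * k (0 + t *\<^sub>R (1,0))) has_real_derivative k 0) (at 0)"
      by (rule derivative_eq_intros line_derivative_0[OF smk open_ball zr] refl)+ (simp add: zero_prod_def)
    moreover have "(\<lambda>t. t * k (0 + t *\<^sub>R (1,0))) = (\<lambda>t. a (0 + t *\<^sub>R (1,0)))"
      by (simp add: a_def Xc0)
    ultimately have "((\<lambda>t. a (0 + t *\<^sub>R (1,0))) has_real_derivative k 0) (at 0)" by (simp only:)
    from DERIV_unique[OF line_derivative_0[OF sma open_ball zr] this] have "dd (1,0) a 0 = k 0" .
    moreover have "k 0 > 0" unfolding k_def by (rule real_sqrt_gt_zero[OF kpos[OF zr]])
    ultimately show ?thesis by simp
  qed
  show thesis by (rule that[OF r(1,2) \<sigma>(1) sma smE main a0 E0 dE da])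
qed

section \<open>Jacobians in the plane with a parameter, and local diffeomorphisms\<close>

abbreviation eX :: "plane \<times> real" where "eX \<equiv> ((1, 0), 0)"
abbreviation eY :: "plane \<times> real" where "eY \<equiv> ((0, 1), 0)"
abbreviation eE :: "plane \<times> real" where "eE \<equiv> ((0, 0), 1)"

text \<open>Taken in x and y only, with \<epsilon> as a parameter: it vanishes where the planar
  gradients are dependent, in particular at a tangency of the two zero curves.\<close>

definition jac2 :: "(plane \<times> real \<Rightarrow> real) \<Rightarrow> (plane \<times> real \<Rightarrow> real) \<Rightarrow> plane \<times> real \<Rightarrow> real" where
  "jac2 g h = (\<lambda>w. dd eX g w * dd eY h w - dd eY g w * dd eX h w)"

lemma smooth_on_jac2 [smooth_intros]:
  "open S \<Longrightarrow> smooth_on S g \<Longrightarrow> smooth_on S h \<Longrightarrow> smooth_on S (jac2 g h)"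
  unfolding jac2_def by (intro smooth_intros smooth_on_dd)

lemma dd_expand:
  fixes f :: "plane \<times> real \<Rightarrow> real"
  assumes "smooth_on S f" "open S" "w \<in> S"
  shows "dd ((a, b), c) f w = a * dd eX f w + b * dd eY f w + c * dd eE f w"
proof -
  have lin: "linear (frechet_derivative f (at w))" by (rule smooth_on_linear[OF assms])
  have "((a, b), c) = a *\<^sub>R eX + b *\<^sub>R eY + c *\<^sub>R eE" by simp
  then have "dd ((a, b), c) f w = dd (a *\<^sub>R eX + b *\<^sub>R eY + c *\<^sub>R eE) f w" by (simp only:)
  then show ?thesis by (simp only: linear_add[OF lin] linear_scale[OF lin] real_scaleR_def)
qed

lemma diffeo_on_compose:
  fixes f :: "'a::euclidean_space \<Rightarrow> 'b::euclidean_space" and g :: "'b \<Rightarrow> 'c::euclidean_space"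
  assumes "diffeo_on W W' f" "diffeo_on W' W'' g"
  shows "diffeo_on W W'' (\<lambda>x. g (f x))"
proof -
  from assms obtain f' g' where f': "smooth_on W' f'" "\<And>w. w \<in> W \<Longrightarrow> f' (f w) = w"
    and g': "smooth_on W'' g'" "\<And>w. w \<in> W' \<Longrightarrow> g' (g w) = w" unfolding diffeo_on_def by blast
  have o: "open W" "open W'" "open W''" "f ` W = W'" "g ` W' = W''" "smooth_on W f" "smooth_on W' g"
    using assms unfolding diffeo_on_def by auto
  have gim: "g' ` W'' \<subseteq> W'" using o(5) g'(2) by auto
  have "smooth_on W (\<lambda>x. g (f x))" by (rule smooth_on_compose[OF o(7,6,1,2)]) (use o in auto)
  moreover have "smooth_on W'' (\<lambda>x. f' (g' x))" by (rule smooth_on_compose[OF f'(1) g'(1) o(3,2) gim])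
  moreover have "f' (g' (g (f w))) = w" if "w \<in> W" for w using that f'(2) g'(2) o(4) by auto
  moreover have "(\<lambda>x. g (f x)) ` W = W''" using o(4,5) by (metis image_image)
  ultimately show ?thesis unfolding diffeo_on_def using o by blast
qed

lemma local_diffeo:
  fixes f :: "'a::euclidean_space \<Rightarrow> 'a"
  assumes "open U" "smooth_on U f" "x0 \<in> U" "\<And>v. frechet_derivative f (at x0) v = 0 \<Longrightarrow> v = 0"
  obtains W W' where "x0 \<in> W" "W \<subseteq> U" "diffeo_on W W' f"
proof -
  obtain W W' g where W: "open W" "open W'" "x0 \<in> W" "W \<subseteq> U" "f x0 \<in> W'" "f ` W = W'" "g ` W' = W" "smooth_on W' g"
    "\<And>x. x \<in> W \<Longrightarrow> g (f x) = x" "\<And>y. y \<in> W' \<Longrightarrow> f (g y) = y"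
    using smooth_inverse_function[OF assms] by metis
  then have "diffeo_on W W' f"
    unfolding diffeo_on_def using smooth_on_subset[OF assms(2) W(4)] by blast
  then show thesis using that W by blast
qed

lemma diffeo_on_restrict:
  assumes "diffeo_on W W' f" "open V" "V \<subseteq> W'"
  shows "diffeo_on (W \<inter> f -` V) V f"
proof -
  have o: "open W" "open W'" "f ` W = W'" "smooth_on W f" using assms(1) unfolding diffeo_on_def by auto
  obtain g where g: "smooth_on W' g" "\<And>w. w \<in> W \<Longrightarrow> g (f w) = w" using assms(1) unfolding diffeo_on_def by blast
  have "open (W \<inter> f -` V)"
    using continuous_open_preimage[OF smooth_on_continuous_on[OF o(4,1)] o(1) assms(2)] .
  moreover have "f ` (W \<inter> f -` V) = V" using assms(3) o(3) by auto
  moreover have "smooth_on (W \<inter> f -` V) f" using smooth_on_subset[OF o(4)] by blast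
  moreover have "smooth_on V g" using smooth_on_subset[OF g(1) assms(3)] .
  ultimately show ?thesis unfolding diffeo_on_def using assms(2) g(2) by blast
qed

text \<open>The difference of the two curves is \<open>\<plusminus>(x\<^sup>2 - e)\<close> in suitable coordinates (Morse lemma with
  parameter); subtracting the parabola from a multiple of an equation of the first curve turns the
  pair into the symmetric pair of parabolas.\<close>

lemma fold_normal_form:
  fixes g1 g2 :: "plane \<times> real \<Rightarrow> real"
  assumes O: "open O'" "(q, \<epsilon>0) \<in> O'" and sm1: "smooth_on O' g1" and sm2: "smooth_on O' g2"
    and z1: "g1 (q, \<epsilon>0) = 0" and z2: "g2 (q, \<epsilon>0) = 0" and zD: "jac2 g1 g2 (q, \<epsilon>0) = 0"
    and d1: "dd eX g1 (q, \<epsilon>0) \<noteq> 0 \<or> dd eY g1 (q, \<epsilon>0) \<noteq> 0"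
    and d2: "dd eX g2 (q, \<epsilon>0) \<noteq> 0 \<or> dd eY g2 (q, \<epsilon>0) \<noteq> 0"
    and nd: "\<And>u. dd u g1 (q, \<epsilon>0) = 0 \<Longrightarrow> dd u g2 (q, \<epsilon>0) = 0 \<Longrightarrow> dd u (jac2 g1 g2) (q, \<epsilon>0) = 0 \<Longrightarrow> u = 0"
  obtains W W' and \<Phi> :: "plane \<times> real \<Rightarrow> plane \<times> real" and \<tau> where "(q, \<epsilon>0) \<in> W" "W \<subseteq> O'" "diffeo_on W W' \<Phi>" "\<Phi> (q, \<epsilon>0) = ((0, 0), 0)"
    "\<And>z \<epsilon>. (z, \<epsilon>) \<in> W \<Longrightarrow> snd (\<Phi> (z, \<epsilon>)) = \<tau> \<epsilon>"
    "\<And>z \<epsilon>. (z, \<epsilon>) \<in> W \<Longrightarrow> g1 (z, \<epsilon>) = 0 \<longleftrightarrow> (case \<Phi> (z, \<epsilon>) of ((x, y), e) \<Rightarrow> y - x\<^sup>2 + e = 0)"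
    "\<And>z \<epsilon>. (z, \<epsilon>) \<in> W \<Longrightarrow> g2 (z, \<epsilon>) = 0 \<longleftrightarrow> (case \<Phi> (z, \<epsilon>) of ((x, y), e) \<Rightarrow> y + x\<^sup>2 - e = 0)"
    "\<exists>r>0. smooth_on {\<epsilon>0 - r<..<\<epsilon>0 + r} \<tau>" "dd 1 \<tau> \<epsilon>0 \<noteq> 0"
proof -
  define w0 where "w0 = (q, \<epsilon>0)"
  define \<Delta> where "\<Delta> = jac2 g1 g2"
  have w0: "w0 \<in> O'" using O(2) by (simp add: w0_def)
  have sm\<Delta>: "smooth_on O' \<Delta>" unfolding \<Delta>_def by (intro smooth_intros O(1) sm1 sm2)
  define A where "A = dd eX g1 w0"
  define C where "C = dd eY g1 w0"
  have N: "A * A + C * C > 0" using d1 unfolding A_def C_def w0_def by (metis sum_squares_gt_zero_iff)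
  \<comment> \<open>Coordinates adapted to the first curve: one is linear along its tangent at q
    (the gradient turned by a right angle), the next is \<open>g1\<close> itself.\<close>
  define \<Psi> where "\<Psi> w = ((- C * (fst (fst w) - fst q) + A * (snd (fst w) - snd q), g1 w), snd w - \<epsilon>0)" for w
  have sm\<Psi>: "smooth_on O' \<Psi>" unfolding \<Psi>_def by (intro smooth_intros O(1) sm1)
  have d\<Psi>: "(\<Psi> has_derivative (\<lambda>u. ((- C * fst (fst u) + A * snd (fst u), dd u g1 w), snd u))) (at w)" if "w \<in> O'" for w
    unfolding \<Psi>_def
    by (rule derivative_eq_intros has_derivative_Pair smooth_on_has_derivative[OF sm1 O(1) that] refl)+
      (simp add: algebra_simps)
  have inj\<Psi>: "v = 0" if "frechet_derivative \<Psi> (at w0) v = 0" for v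
  proof -
    obtain a b c where v: "v = ((a, b), c)" by (metis surj_pair)
    have "- C * a + A * b = 0" "dd ((a, b), c) g1 w0 = 0" "c = 0"
      using that unfolding frechet_at_eqI[OF d\<Psi>[OF w0]] v by (auto simp: zero_prod_def)
    then have *: "- C * a + A * b = 0" "a * A + b * C = 0" "c = 0"
      using dd_expand[OF sm1 O(1) w0, of a b c] by (auto simp: A_def C_def)
    have "(A * A + C * C) * a = A * (a * A + b * C) - C * (- C * a + A * b)"
      "(A * A + C * C) * b = C * (a * A + b * C) + A * (- C * a + A * b)" by (simp_all add: algebra_simps)
    then have "a = 0" "b = 0" using N * by auto
    then show ?thesis using * v by (simp add: zero_prod_def)
  qed
  obtain W0 W0' \<psi> where W0: "open W0" "open W0'" "w0 \<in> W0" "W0 \<subseteq> O'" "\<Psi> w0 \<in> W0'" "\<Psi> ` W0 = W0'" "\<psi> ` W0' = W0"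
    "smooth_on W0' \<psi>" "\<And>x. x \<in> W0 \<Longrightarrow> \<psi> (\<Psi> x) = x" "\<And>y. y \<in> W0' \<Longrightarrow> \<Psi> (\<psi> y) = y"
    using smooth_inverse_function[OF O(1) sm\<Psi> w0 inj\<Psi>] by metis
  have \<Psi>0: "\<Psi> w0 = 0" using z1 by (simp add: \<Psi>_def w0_def zero_prod_def)
  have \<psi>0: "\<psi> 0 = w0" using W0(9)[OF W0(3)] \<Psi>0 by simp
  have z0': "0 \<in> W0'" using W0(5) \<Psi>0 by simp
  obtain \<rho> where \<rho>: "\<rho> > 0" "ball 0 \<rho> \<subseteq> W0'" using W0(2) z0' by (meson openE)
  have \<psi>O: "\<psi> y \<in> O'" if "y \<in> W0'" for y using that W0(4,7) by blast
  have g1\<psi>: "g1 (\<psi> y) = snd (fst y)" if "y \<in> W0'" for y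
    using W0(10)[OF that] unfolding \<Psi>_def by (metis fst_conv snd_conv)
  define m where "m y u = frechet_derivative \<psi> (at y) u" for y u
  have d\<psi>: "(\<psi> has_derivative m y) (at y)" if "y \<in> W0'" for y
    unfolding m_def using smooth_on_has_derivative[OF W0(8,2) that] .
  have mid: "((- C * fst (fst (m y u)) + A * snd (fst (m y u)), dd (m y u) g1 (\<psi> y)), snd (m y u)) = u" if y: "y \<in> W0'" for y u
  proof -
    have 1: "((\<lambda>y. \<Psi> (\<psi> y)) has_derivative (\<lambda>u. ((- C * fst (fst (m y u)) + A * snd (fst (m y u)), dd (m y u) g1 (\<psi> y)), snd (m y u)))) (at y)"
      using diff_chain_at[OF d\<psi>[OF y] d\<Psi>[OF \<psi>O[OF y]]] by (simp add: o_def)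
    have 2: "((\<lambda>y. \<Psi> (\<psi> y)) has_derivative (\<lambda>u. u)) (at y)"
      by (rule has_derivative_transform_within_open[OF has_derivative_ident W0(2) y]) (simp add: W0(10))
    from fun_cong[OF has_derivative_unique[OF 1 2], of u] show ?thesis .
  qed
  have dcomp: "dd u (\<lambda>y. h (\<psi> y)) y = dd (m y u) h (\<psi> y)" if "smooth_on O' h" "y \<in> W0'" for h :: "_ \<Rightarrow> real" and u y
  proof -
    from diff_chain_at[OF d\<psi>[OF that(2)] smooth_on_has_derivative[OF that(1) O(1) \<psi>O[OF that(2)]]]
    have "((\<lambda>y. h (\<psi> y)) has_derivative (\<lambda>u. dd (m y u) h (\<psi> y))) (at y)" by (simp add: o_def)
    from frechet_at_eqI[OF this] show ?thesis by metis
  qed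
  have smcomp: "smooth_on (ball 0 \<rho>) (\<lambda>y. h (\<psi> y))" if "smooth_on O' h" for h :: "_ \<Rightarrow> real"
    by (rule smooth_on_compose[OF that smooth_on_subset[OF W0(8) \<rho>(2)] open_ball O(1)]) (use \<psi>O \<rho>(2) in blast)
  define G where "G y = g2 (\<psi> y)" for y
  have smG: "smooth_on (ball 0 \<rho>) G" unfolding G_def by (rule smcomp[OF sm2])
  have G0: "G 0 = 0" using z2 by (simp add: G_def \<psi>0 w0_def)
  have bY: "eY \<in> Basis" by (simp add: Basis_prod_def)
  \<comment> \<open>Splits \<open>g2\<close> into its restriction to the first curve, below called
    \<phi>, and a multiple of the equation of that curve.\<close>
  obtain H where H: "smooth_on (ball 0 \<rho>) H"
    "\<And>x. x \<in> ball 0 \<rho> \<Longrightarrow> G x = G (x - (x \<bullet> eY) *\<^sub>R eY) + (x \<bullet> eY) * H x"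
    "\<And>x. x \<in> ball 0 \<rho> \<Longrightarrow> x \<bullet> eY = 0 \<Longrightarrow> H x = dd eY G x"
    using hadamard[OF smG bY] by blast
  define \<iota> :: "real \<times> real \<Rightarrow> plane \<times> real" where "\<iota> x = ((fst x, 0), snd x)" for x
  have n\<iota>: "norm (\<iota> x) = norm x" for x by (simp add: \<iota>_def norm_prod_def)
  have \<iota>b: "\<iota> ` ball 0 \<rho> \<subseteq> ball 0 \<rho>" using n\<iota> by auto
  have \<iota>0: "\<iota> 0 = 0" by (simp add: \<iota>_def zero_prod_def)
  have sm\<iota>: "smooth_on S \<iota>" if "open S" for S unfolding \<iota>_def by (intro smooth_intros that)
  define \<phi> where "\<phi> x = G (\<iota> x)" for x
  have smc\<iota>: "smooth_on (ball 0 \<rho>) (\<lambda>x. h (\<iota> x))" if "smooth_on (ball 0 \<rho>) h" for h :: "_ \<Rightarrow> real"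
    by (rule smooth_on_compose[OF that sm\<iota> open_ball open_ball \<iota>b]) simp
  have sm\<phi>: "smooth_on (ball 0 \<rho>) \<phi>" unfolding \<phi>_def by (rule smc\<iota>[OF smG])
  have d\<iota>: "dd u (\<lambda>x. h (\<iota> x)) x = dd (\<iota> u) h (\<iota> x)" if "smooth_on (ball 0 \<rho>) h" "x \<in> ball 0 \<rho>" for h :: "_ \<Rightarrow> real" and x u
  proof -
    have in\<iota>: "\<iota> x \<in> ball 0 \<rho>" using \<iota>b that(2) by blast
    have "bounded_linear \<iota>" unfolding \<iota>_def
      by (intro bounded_linear_Pair bounded_linear_fst bounded_linear_snd bounded_linear_zero)
    from diff_chain_at[OF bounded_linear_imp_has_derivative[OF this] smooth_on_has_derivative[OF that(1) open_ball in\<iota>]]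
    have "((\<lambda>x. h (\<iota> x)) has_derivative (\<lambda>u. dd (\<iota> u) h (\<iota> x))) (at x)"
      by (simp add: o_def)
    from frechet_at_eqI[OF this] show ?thesis by metis
  qed
  have \<iota>e: "\<iota> (1, 0) = eX" "\<iota> (0, 1) = eE" by (simp_all add: \<iota>_def)
  have zb: "0 \<in> ball (0::real \<times> real) \<rho>" "0 \<in> ball (0::plane \<times> real) \<rho>" using \<rho> by simp_all
  \<comment> \<open>Along the first curve the coordinate direction X is (-g1_y, g1_x) divided by
    \<theta>, so the X-derivative of \<phi> is \<Delta>/\<theta>. This translates the Jacobian into
    a derivative of \<phi>.\<close>
  define \<theta> where "\<theta> w = A * dd eX g1 w + C * dd eY g1 w" for w
  have sm\<theta>: "smooth_on O' \<theta>" unfolding \<theta>_def by (intro smooth_intros O(1) smooth_on_dd sm1)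
  have key: "dd (1,0) \<phi> x * \<theta> (\<psi> (\<iota> x)) = \<Delta> (\<psi> (\<iota> x))" if x: "x \<in> ball 0 \<rho>" for x
  proof -
    have y: "\<iota> x \<in> ball 0 \<rho>" using x \<iota>b by blast
    then have yW: "\<iota> x \<in> W0'" using \<rho>(2) by blast
    obtain m1 m2 m3 where m': "m (\<iota> x) eX = ((m1, m2), m3)" by (metis surj_pair)
    note E = dd_expand[OF _ O(1) \<psi>O[OF yW]]
    have e: "- C * m1 + A * m2 = 1" "m1 * dd eX g1 (\<psi> (\<iota> x)) + m2 * dd eY g1 (\<psi> (\<iota> x)) = 0" "m3 = 0"
      using mid[OF yW, of eX] unfolding m' E[OF sm1, of m1 m2 m3] by auto
    have "dd (1,0) \<phi> x = dd eX G (\<iota> x)" unfolding \<phi>_def d\<iota>[OF smG x] \<iota>e ..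
    also have "\<dots> = dd (m (\<iota> x) eX) g2 (\<psi> (\<iota> x))" unfolding G_def by (rule dcomp[OF sm2 yW])
    also have "\<dots> = m1 * dd eX g2 (\<psi> (\<iota> x)) + m2 * dd eY g2 (\<psi> (\<iota> x))" unfolding m' E[OF sm2, of m1 m2 m3] by (simp add: e)
    finally show ?thesis
      unfolding \<theta>_def \<Delta>_def jac2_def using e(1,2) by algebra
  qed
  have \<theta>0: "\<theta> w0 > 0" using N by (simp add: \<theta>_def A_def C_def)
  have D0: "dd (1,0) \<phi> 0 = 0" using key[OF zb(1)] \<theta>0 zD by (simp add: \<iota>0 \<psi>0 \<Delta>_def w0_def)
  define m0 where "m0 = m 0 eX"
  have m0: "dd m0 g1 w0 = 0" "dd m0 g2 w0 = 0" "snd m0 = 0" "m0 \<noteq> 0"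
  proof -
    have e: "- C * fst (fst m0) + A * snd (fst m0) = 1" "dd m0 g1 w0 = 0" "snd m0 = 0"
      using mid[OF z0', of eX] unfolding m0_def \<psi>0 by (metis fst_conv snd_conv)+
    then show "dd m0 g1 w0 = 0" "snd m0 = 0" "m0 \<noteq> 0" by (auto simp: zero_prod_def)
    have "dd (1,0) \<phi> 0 = dd eX G 0" unfolding \<phi>_def d\<iota>[OF smG zb(1)] \<iota>e \<iota>0 ..
    also have "\<dots> = dd m0 g2 w0" unfolding G_def m0_def using dcomp[OF sm2 z0', of eX] \<psi>0 by simp
    finally show "dd m0 g2 w0 = 0" using D0 by simp
  qed
  have m0\<Delta>: "dd m0 \<Delta> w0 \<noteq> 0" using nd[of m0] m0 unfolding w0_def \<Delta>_def by blast
  \<comment> \<open>Differentiating \<phi>_X \<theta> = \<Delta> at the critical point leaves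
    \<phi>_XX \<theta> on the left; on the right stands the derivative of \<Delta> along
    \<open>m0\<close>, which \<open>nd\<close> makes nonzero.\<close>
  have DXX: "dd (1,0) (dd (1,0) \<phi>) 0 \<noteq> 0"
  proof -
    have 1: "((\<lambda>t. dd (1,0) \<phi> (0 + t *\<^sub>R (1,0))) has_real_derivative dd (1,0) (dd (1,0) \<phi>) 0) (at 0)"
      by (rule line_derivative_0[OF smooth_on_dd[OF sm\<phi>] open_ball zb(1)])
    have 2: "((\<lambda>t. \<theta> (\<psi> (\<iota> (0 + t *\<^sub>R (1,0))))) has_real_derivative dd (1,0) (\<lambda>x. \<theta> (\<psi> (\<iota> x))) 0) (at 0)"
      by (rule line_derivative_0[OF smc\<iota>[OF smcomp[OF sm\<theta>]] open_ball zb(1)])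
    have 3: "((\<lambda>t. \<Delta> (\<psi> (\<iota> (0 + t *\<^sub>R (1,0))))) has_real_derivative dd (1,0) (\<lambda>x. \<Delta> (\<psi> (\<iota> x))) 0) (at 0)"
      by (rule line_derivative_0[OF smc\<iota>[OF smcomp[OF sm\<Delta>]] open_ball zb(1)])
    have "((\<lambda>t. dd (1,0) \<phi> (0 + t *\<^sub>R (1,0)) * \<theta> (\<psi> (\<iota> (0 + t *\<^sub>R (1,0))))) has_real_derivative
        dd (1,0) (dd (1,0) \<phi>) 0 * \<theta> w0) (at 0)"
      by (rule DERIV_cong[OF DERIV_mult[OF 1 2]]) (simp add: D0 \<iota>0 \<psi>0 flip: zero_prod_def)
    then have "((\<lambda>t. \<Delta> (\<psi> (\<iota> (0 + t *\<^sub>R (1,0))))) has_real_derivative dd (1,0) (dd (1,0) \<phi>) 0 * \<theta> w0) (at 0)"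
      unfolding has_field_derivative_def
    proof (rule has_derivative_transform_within_open[where s="{-\<rho><..<\<rho>}"])
      fix t assume "t \<in> {-\<rho><..<\<rho>}"
      then have "0 + t *\<^sub>R (1,0) \<in> ball (0::real \<times> real) \<rho>" by (auto simp: norm_Pair)
      from key[OF this] show "dd (1,0) \<phi> (0 + t *\<^sub>R (1,0)) * \<theta> (\<psi> (\<iota> (0 + t *\<^sub>R (1,0)))) = \<Delta> (\<psi> (\<iota> (0 + t *\<^sub>R (1,0))))" .
    qed (use \<rho> in auto)
    from DERIV_unique[OF this 3] have "dd (1,0) (dd (1,0) \<phi>) 0 * \<theta> w0 = dd (1,0) (\<lambda>x. \<Delta> (\<psi> (\<iota> x))) 0" .
    also have "\<dots> = dd m0 \<Delta> w0"
      unfolding d\<iota>[OF smcomp[OF sm\<Delta>] zb(1)] \<iota>e \<iota>0 dcomp[OF sm\<Delta> z0'] m0_def \<psi>0 ..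
    finally show ?thesis using m0\<Delta> by auto
  qed
  \<comment> \<open>Otherwise the lift n of the \<epsilon>-direction would annihilate both
    functions, and a multiple of \<open>m0\<close> could be added so that \<Delta> is annihilated
    too; the sum has \<epsilon>-component 1, against \<open>nd\<close>.\<close>
  have De: "dd (0,1) \<phi> 0 \<noteq> 0"
  proof
    assume 0: "dd (0,1) \<phi> 0 = 0"
    define n where "n = m 0 eE"
    have e: "dd n g1 w0 = 0" "snd n = 1"
      using mid[OF z0', of eE] unfolding n_def \<psi>0 by (metis fst_conv snd_conv)+
    have "dd (0,1) \<phi> 0 = dd eE G 0" unfolding \<phi>_def d\<iota>[OF smG zb(1)] \<iota>e \<iota>0 ..
    also have "\<dots> = dd n g2 w0" unfolding G_def n_def using dcomp[OF sm2 z0', of eE] \<psi>0 by simp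
    finally have n2: "dd n g2 w0 = 0" using 0 by simp
    define s where "s = - dd n \<Delta> w0 / dd m0 \<Delta> w0"
    have lin: "dd (n + s *\<^sub>R m0) h w0 = dd n h w0 + s * dd m0 h w0" if "smooth_on O' h" for h :: "_ \<Rightarrow> real"
      using smooth_on_linear[OF that O(1) w0] by (simp add: linear_add linear_scale)
    have "n + s *\<^sub>R m0 = 0"
      by (rule nd; fold w0_def \<Delta>_def) (use lin sm1 sm2 sm\<Delta> e n2 m0 m0\<Delta> in \<open>auto simp: s_def\<close>)
    then have "snd (n + s *\<^sub>R m0) = 0" by simp
    then show False using e m0 by simp
  qed
  have \<phi>0: "\<phi> 0 = 0" by (simp add: \<phi>_def \<iota>0 G0)
  obtain r \<sigma> a E where r: "r > 0" "r \<le> \<rho>" and \<sigma>: "\<sigma> \<in> {1, -1::real}" and sma: "smooth_on (ball 0 r) a" and smE: "smooth_on {-r<..<r} E"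
    and mo: "\<And>X e. (X, e) \<in> ball 0 r \<Longrightarrow> \<phi> (X, e) = \<sigma> * ((a (X, e))\<^sup>2 - E e)"
    and a0: "a 0 = 0" and E0: "E 0 = 0" and dE: "dd 1 E 0 \<noteq> 0" and da: "dd (1,0) a 0 \<noteq> 0"
    using morse_with_parameter[OF \<rho>(1) sm\<phi> \<phi>0 D0 DXX De] by metis
  \<comment> \<open>The gradients are parallel at the tangency; if the derivative of
    \<open>g2\<close> across the first curve vanished as well, its gradient would be zero.\<close>
  have H0: "H 0 \<noteq> 0"
  proof
    assume "H 0 = 0"
    then have "dd eY G 0 = 0" using H(3)[OF zb(2)] by simp
    then have 0: "dd (m 0 eY) g2 w0 = 0" unfolding G_def using dcomp[OF sm2 z0', of eY] \<psi>0 by simp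
    obtain m1 m2 m3 where m': "m 0 eY = ((m1, m2), m3)" by (metis surj_pair)
    have e: "- C * m1 + A * m2 = 0" "m1 * A + m2 * C = 1" "m3 = 0"
      using mid[OF z0', of eY] unfolding m' \<psi>0 dd_expand[OF sm1 O(1) w0, of m1 m2 m3] by (auto simp: A_def C_def)
    have f: "m1 * dd eX g2 w0 + m2 * dd eY g2 w0 = 0" using 0 e unfolding m' dd_expand[OF sm2 O(1) w0, of m1 m2 m3] by simp
    have g: "A * dd eY g2 w0 - C * dd eX g2 w0 = 0" using zD unfolding jac2_def A_def C_def w0_def .
    have "dd eX g2 w0 = 0" "dd eY g2 w0 = 0" using e(1,2) f g by algebra+
    then show False using d2 by (simp add: w0_def)
  qed
  have HsmR: "smooth_on (ball 0 r) H" using smooth_on_subset[OF H(1)] r(2) by (simp add: subset_ball)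
  have zr: "0 \<in> ball (0::plane \<times> real) r" "0 \<in> ball (0::real \<times> real) r" using r by simp_all
  obtain r' where r': "r' > 0" "ball (0::plane \<times> real) r' \<subseteq> ball 0 r" "H ` ball 0 r' \<subseteq> - {0}"
    using ball_subset_vimage[OF HsmR open_ball zr(1), of "- {0}"] H0 by auto
  let ?pr = "\<lambda>y::plane \<times> real. (fst (fst y), snd y)"
  have npr: "norm (?pr y) \<le> norm y" for y
    by (cases y; cases "fst y") (auto simp: norm_Pair)
  have prr: "?pr ` ball 0 r \<subseteq> ball 0 r"
  proof
    fix z assume "z \<in> ?pr ` ball 0 r"
    then obtain y where "z = ?pr y" "norm y < r" by auto
    then show "z \<in> ball 0 r" using npr[of y] by simp
  qed
  define \<alpha> where "\<alpha> y = a (?pr y)" for y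
  have sm\<alpha>: "smooth_on (ball 0 r) \<alpha>" unfolding \<alpha>_def
    by (rule smooth_on_compose[OF sma _ open_ball open_ball prr]) (intro smooth_intros open_ball)
  have sndr: "snd ` ball (0::plane \<times> real) r \<subseteq> {-r<..<r}"
  proof
    fix e assume "e \<in> snd ` ball (0::plane \<times> real) r"
    then obtain y :: "plane \<times> real" where "e = snd y" "norm y < r" by auto
    then show "e \<in> {-r<..<r}" using norm_snd_le[where x="fst y" and y="snd y"] by auto
  qed
  have smE': "smooth_on (ball 0 r) (\<lambda>y::plane \<times> real. E (snd y))"
    by (rule smooth_on_compose[OF smE _ open_ball open_greaterThanLessThan sndr]) (intro smooth_intros open_ball)
  \<comment> \<open>With Y = g1 and g2 = \<sigma> (\<alpha>^2 - E) + Y H, the second entry y is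
    chosen so that y - x^2 + e = 2 \<sigma> H Y and y + x^2 - e = 2 \<sigma> g2.\<close>
  define \<Phi>2 where "\<Phi>2 y = ((\<alpha> y, ((\<alpha> y)\<^sup>2 - E (snd y)) + 2 * \<sigma> * (snd (fst y) * H y)), E (snd y))" for y
  have sm\<Phi>2: "smooth_on (ball 0 r) \<Phi>2" unfolding \<Phi>2_def
    by (intro smooth_intros open_ball sm\<alpha> smE' HsmR)
  have \<alpha>0: "\<alpha> 0 = 0" using a0 by (simp add: \<alpha>_def flip: zero_prod_def)
  have inj2: "v = 0" if v0: "frechet_derivative \<Phi>2 (at 0) v = 0" for v
  proof -
    obtain v1 v2 v3 where v: "v = ((v1, v2), v3)" by (metis surj_pair)
    have d\<alpha>: "(\<alpha> has_derivative frechet_derivative \<alpha> (at 0)) (at 0)"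
      by (rule smooth_on_has_derivative[OF sm\<alpha> open_ball zr(1)])
    have dH: "(H has_derivative frechet_derivative H (at 0)) (at 0)"
      by (rule smooth_on_has_derivative[OF HsmR open_ball zr(1)])
    have dE1: "(E has_derivative (\<lambda>u. dd 1 E 0 * u)) (at (snd (0::plane \<times> real)))"
      using smooth_real_derivative[OF smE, of 0] r unfolding has_field_derivative_def by simp
    have dE': "((\<lambda>y::plane \<times> real. E (snd y)) has_derivative (\<lambda>u. dd 1 E 0 * snd u)) (at 0)"
      using diff_chain_at[OF has_derivative_snd[OF has_derivative_ident] dE1] by (simp add: o_def)
    have "(\<Phi>2 has_derivative (\<lambda>u. ((dd u \<alpha> 0, - (dd 1 E 0 * snd u) + 2 * \<sigma> * (snd (fst u) * H 0)), dd 1 E 0 * snd u))) (at 0)"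
      unfolding \<Phi>2_def
      by (rule derivative_eq_intros has_derivative_Pair d\<alpha> dE' dH refl)+ (simp add: \<alpha>0 fun_eq_iff)
    from v0[unfolded frechet_at_eqI[OF this]] have e: "dd ((v1, v2), v3) \<alpha> 0 = 0" "v3 = 0" "v2 = 0"
      using dE H0 \<sigma> unfolding v by (auto simp: zero_prod_def)
    then have "v1 * dd eX \<alpha> 0 = 0" using dd_expand[OF sm\<alpha> open_ball zr(1), of v1 v2 v3] by simp
    moreover have "dd eX \<alpha> 0 = dd (1,0) a 0"
    proof -
      have "bounded_linear ?pr"
        by (intro bounded_linear_Pair bounded_linear_snd bounded_linear_compose[OF bounded_linear_fst] bounded_linear_fst)
      then have p1: "(?pr has_derivative ?pr) (at 0)" by (rule bounded_linear_imp_has_derivative)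
      have p2: "(a has_derivative frechet_derivative a (at 0)) (at (?pr 0))"
        using smooth_on_has_derivative[OF sma open_ball zr(2)] by (simp flip: zero_prod_def)
      from diff_chain_at[OF p1 p2] have "(\<alpha> has_derivative (\<lambda>u. dd (?pr u) a 0)) (at 0)"
        unfolding \<alpha>_def[abs_def] comp_def .
      from frechet_at_eqI[OF this] show ?thesis by simp
    qed
    ultimately show ?thesis using e da v by (simp add: zero_prod_def)
  qed
  have z0r': "0 \<in> ball (0::plane \<times> real) r'" using r' by simp
  obtain W2 W2' where W2: "0 \<in> W2" "W2 \<subseteq> ball 0 r'" "diffeo_on W2 W2' \<Phi>2"
    using local_diffeo[OF open_ball smooth_on_subset[OF sm\<Phi>2 r'(2)] z0r' inj2] by blast
  have diff\<Psi>: "diffeo_on W0 W0' \<Psi>"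
    unfolding diffeo_on_def using W0 smooth_on_subset[OF sm\<Psi> W0(4)] by blast
  have sub2: "W2 \<subseteq> W0'" using W2(2) r'(2) r(2) \<rho>(2) subset_ball by (metis order_trans)
  have oW2: "open W2" using W2(3) unfolding diffeo_on_def by blast
  define W where "W = W0 \<inter> \<Psi> -` W2"
  define \<Phi> where "\<Phi> w = \<Phi>2 (\<Psi> w)" for w
  have dW: "diffeo_on W W2' \<Phi>" unfolding \<Phi>_def W_def
    by (rule diffeo_on_compose[OF diffeo_on_restrict[OF diff\<Psi> oW2 sub2] W2(3)])
  have w0W: "(q, \<epsilon>0) \<in> W" using W0(3) \<Psi>0 W2(1) by (simp add: W_def flip: w0_def)
  define \<tau> where "\<tau> \<epsilon> = E (\<epsilon> - \<epsilon>0)" for \<epsilon>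
  have snd\<Phi>: "snd (\<Phi> (z, \<epsilon>)) = \<tau> \<epsilon>" for z \<epsilon> by (simp add: \<Phi>_def \<Phi>2_def \<tau>_def \<Psi>_def)
  have \<Phi>0: "\<Phi> (q, \<epsilon>0) = ((0, 0), 0)"
    unfolding \<Phi>_def w0_def[symmetric] \<Psi>0 by (simp add: \<Phi>2_def \<alpha>0 E0)
  have eqs: "g1 w = 0 \<longleftrightarrow> (case \<Phi> w of ((x, y), e) \<Rightarrow> y - x\<^sup>2 + e = 0)"
    "g2 w = 0 \<longleftrightarrow> (case \<Phi> w of ((x, y), e) \<Rightarrow> y + x\<^sup>2 - e = 0)" if w: "w \<in> W" for w
  proof -
    define y where "y = \<Psi> w"
    have yW: "y \<in> W2" and wW0: "w \<in> W0" using w by (auto simp: W_def y_def)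
    have yr: "y \<in> ball 0 r'" using yW W2(2) by blast
    have yr2: "y \<in> ball 0 r" using yr r'(2) by blast
    have y\<rho>: "y \<in> ball 0 \<rho>" using yr2 r(2) by (simp add: mem_ball)
    have \<psi>y: "\<psi> y = w" unfolding y_def by (rule W0(9)[OF wW0])
    have Y: "snd (fst y) = g1 w" by (simp add: y_def \<Psi>_def)
    have Hn: "H y \<noteq> 0" using yr r'(3) by blast
    have \<sigma>n: "\<sigma> \<noteq> 0" "\<sigma> * \<sigma> = 1" using \<sigma> by auto
    obtain X Yc e where y3: "y = ((X, Yc), e)" by (metis surj_pair)
    have "(X, e) \<in> ball 0 r" using prr yr2 y3 by force
    from mo[OF this] have \<phi>y: "\<phi> (X, e) = \<sigma> * ((\<alpha> y)\<^sup>2 - E e)" by (simp add: \<alpha>_def y3)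
    have "g2 w = G y" by (simp add: G_def \<psi>y)
    also have "\<dots> = \<phi> (X, e) + Yc * H y"
      using H(2)[OF y\<rho>] by (simp add: y3 \<phi>_def \<iota>_def)
    finally have g2w: "g2 w = \<sigma> * ((\<alpha> y)\<^sup>2 - E e) + Yc * H y" using \<phi>y by simp
    have \<Phi>w: "\<Phi> w = ((\<alpha> y, ((\<alpha> y)\<^sup>2 - E e) + 2 * \<sigma> * (Yc * H y)), E e)"
      unfolding \<Phi>_def y_def[symmetric] \<Phi>2_def by (simp add: y3)
    show "g1 w = 0 \<longleftrightarrow> (case \<Phi> w of ((x, y), e) \<Rightarrow> y - x\<^sup>2 + e = 0)"
      unfolding \<Phi>w using Y Hn \<sigma>n by (simp add: y3)
    have "((\<alpha> y)\<^sup>2 - E e) + 2 * \<sigma> * (Yc * H y) + (\<alpha> y)\<^sup>2 - E e = 2 * \<sigma> * g2 w"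
    proof -
      have "2 * \<sigma> * g2 w = 2 * (\<sigma> * \<sigma>) * ((\<alpha> y)\<^sup>2 - E e) + 2 * \<sigma> * (Yc * H y)"
        unfolding g2w by (simp add: algebra_simps)
      then show ?thesis using \<sigma>n(2) by simp
    qed
    then show "g2 w = 0 \<longleftrightarrow> (case \<Phi> w of ((x, y), e) \<Rightarrow> y + x\<^sup>2 - e = 0)"
      unfolding \<Phi>w prod.case using \<sigma>n(1) by (metis mult_eq_0_iff zero_neq_numeral)
  qed
  have smt: "smooth_on {\<epsilon>0 - r<..<\<epsilon>0 + r} \<tau>" unfolding \<tau>_def
    by (rule smooth_on_compose[OF smE]) (auto intro!: smooth_intros)
  have dt: "dd 1 \<tau> \<epsilon>0 \<noteq> 0"
  proof -
    have E': "(E has_real_derivative dd 1 E 0) (at (\<epsilon>0 - \<epsilon>0))"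
      using smooth_real_derivative[OF smE, of 0] r by simp
    have "((\<lambda>\<epsilon>. \<epsilon> - \<epsilon>0) has_real_derivative 1) (at \<epsilon>0)" by (auto intro!: derivative_eq_intros)
    from DERIV_chain2[OF E' this] have "(\<tau> has_real_derivative dd 1 E 0) (at \<epsilon>0)" unfolding \<tau>_def[abs_def] by simp
    moreover have "(\<tau> has_real_derivative dd 1 \<tau> \<epsilon>0) (at \<epsilon>0)" by (rule smooth_real_derivative[OF smt]) (use r in auto)
    ultimately show ?thesis using dE DERIV_unique by metis
  qed
  have WO: "W \<subseteq> O'" using W0(4) by (auto simp: W_def)
  show thesis
  proof (rule that[OF w0W WO dW \<Phi>0])
    show "snd (\<Phi> (z, \<epsilon>)) = \<tau> \<epsilon>" for z \<epsilon> by (rule snd\<Phi>)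
    show "\<exists>r>0. smooth_on {\<epsilon>0 - r<..<\<epsilon>0 + r} \<tau>" using smt r(1) by blast
    show "dd 1 \<tau> \<epsilon>0 \<noteq> 0" by (rule dt)
  qed (fact eqs)+
qed

section \<open>Differential polynomials and parametric transversality\<close>

datatype dir = DX | DY | DE

fun vec_of :: "dir \<Rightarrow> plane \<times> real" where
  "vec_of DX = eX" | "vec_of DY = eY" | "vec_of DE = eE"

text \<open>Differential polynomials in two functions \<open>U\<close>, \<open>V\<close> of \<open>((x, y), \<epsilon>)\<close>: \<open>JU vs\<close> stands for the iterated
  derivative of \<open>U\<close> in the directions \<open>vs\<close>, and \<open>CX\<close>, \<open>CY\<close> for \<open>x\<close>, \<open>y\<close> relative to a base point.\<close>

datatype dpoly = JU "dir list" | JV "dir list" | Cst real | CX | CY | Add dpoly dpoly | Mul dpoly dpoly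

fun fD :: "dir \<Rightarrow> dpoly \<Rightarrow> dpoly" where
  "fD d (JU vs) = JU (d # vs)"
| "fD d (JV vs) = JV (d # vs)"
| "fD d (Cst c) = Cst 0"
| "fD d CX = Cst (if d = DX then 1 else 0)"
| "fD d CY = Cst (if d = DY then 1 else 0)"
| "fD d (Add a b) = Add (fD d a) (fD d b)"
| "fD d (Mul a b) = Add (Mul (fD d a) b) (Mul a (fD d b))"

abbreviation fDs :: "dir list \<Rightarrow> dpoly \<Rightarrow> dpoly" where "fDs vs e \<equiv> foldr fD vs e"

fun ev :: "(dir list \<Rightarrow> real) \<Rightarrow> (dir list \<Rightarrow> real) \<Rightarrow> real \<Rightarrow> real \<Rightarrow> dpoly \<Rightarrow> real" where
  "ev u v x y (JU vs) = u vs"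
| "ev u v x y (JV vs) = v vs"
| "ev u v x y (Cst c) = c"
| "ev u v x y CX = x"
| "ev u v x y CY = y"
| "ev u v x y (Add a b) = ev u v x y a + ev u v x y b"
| "ev u v x y (Mul a b) = ev u v x y a * ev u v x y b"

text \<open>The derivative in the direction of a perturbation \<open>(h, k)\<close> of the pair \<open>(U, V)\<close>.\<close>

fun lin :: "dpoly \<Rightarrow> dpoly \<Rightarrow> dpoly \<Rightarrow> dpoly" where
  "lin h k (JU vs) = fDs vs h"
| "lin h k (JV vs) = fDs vs k"
| "lin h k (Cst c) = Cst 0"
| "lin h k CX = Cst 0"
| "lin h k CY = Cst 0"
| "lin h k (Add a b) = Add (lin h k a) (lin h k b)"
| "lin h k (Mul a b) = Add (Mul (lin h k a) b) (Mul a (lin h k b))"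

fun pure :: "dpoly \<Rightarrow> bool" where
  "pure (JU vs) = False"
| "pure (JV vs) = False"
| "pure (Cst c) = True"
| "pure CX = True"
| "pure CY = True"
| "pure (Add a b) = (pure a \<and> pure b)"
| "pure (Mul a b) = (pure a \<and> pure b)"

lemma pure_fD: "pure e \<Longrightarrow> pure (fD d e)" by (induction e) auto
lemma pure_fDs: "pure e \<Longrightarrow> pure (fDs vs e)" by (induction vs) (auto simp: pure_fD)

section \<open>Evaluation of differential polynomials and of their perturbations\<close>

definition jet_of :: "(plane \<times> real \<Rightarrow> real) \<Rightarrow> plane \<times> real \<Rightarrow> dir list \<Rightarrow> real" where
  "jet_of U w vs = iter_deriv (map vec_of vs) U w"

definition evf :: "plane \<Rightarrow> (plane \<times> real \<Rightarrow> real) \<Rightarrow> (plane \<times> real \<Rightarrow> real) \<Rightarrow> dpoly \<Rightarrow> plane \<times> real \<Rightarrow> real" where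
  "evf z0 U V e w = ev (jet_of U w) (jet_of V w) (fst (fst w) - fst z0) (snd (fst w) - snd z0) e"

text \<open>Meant for \<open>pure\<close> polynomials, whose value does not depend on the jets
  (\<open>ev_pure\<close>): there it is the polynomial in the coordinates centred at z0.\<close>

definition pv :: "plane \<Rightarrow> dpoly \<Rightarrow> plane \<times> real \<Rightarrow> real" where
  "pv z0 e w = ev (\<lambda>_. 0) (\<lambda>_. 0) (fst (fst w) - fst z0) (snd (fst w) - snd z0) e"

lemma ev_pure: "pure e \<Longrightarrow> ev u v x y e = ev (\<lambda>_. 0) (\<lambda>_. 0) x y e"
  by (induction e) auto

lemma smooth_evf:
  assumes "open S" "smooth_on S U" "smooth_on S V"
  shows "smooth_on S (evf z0 U V e)"
proof (induction e)
  case (JU vs) then show ?case by (simp add: evf_def[abs_def] jet_of_def smooth_on_iter_deriv assms)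
next
  case (JV vs) then show ?case by (simp add: evf_def[abs_def] jet_of_def smooth_on_iter_deriv assms)
next
  case (Add a b) then show ?case using smooth_on_add[OF assms(1)] by (simp add: evf_def[abs_def])
next
  case (Mul a b) then show ?case using smooth_on_mult[OF assms(1)] by (simp add: evf_def[abs_def])
qed (simp_all add: evf_def[abs_def], (intro smooth_intros assms)+)

lemma smooth_pv: "open S \<Longrightarrow> smooth_on S (pv z0 e)"
proof (induction e)
  case (Add a b) then show ?case using smooth_on_add[of S] by (simp add: pv_def[abs_def])
next
  case (Mul a b) then show ?case using smooth_on_mult[of S] by (simp add: pv_def[abs_def])
qed (simp_all add: pv_def[abs_def], (intro smooth_intros; assumption)+)

lemma dd_add:
  assumes "smooth_on S f" "smooth_on S g" "open S" "w \<in> S"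
  shows "dd v (\<lambda>w. f w + g w) w = dd v f w + dd v g w"
  using fun_cong[OF frechet_at_eqI[OF has_derivative_add[OF smooth_on_has_derivative[OF assms(1,3,4)] smooth_on_has_derivative[OF assms(2,3,4)]]]] .

lemma dd_mult:
  fixes f g :: "_ \<Rightarrow> real"
  assumes "smooth_on S f" "smooth_on S g" "open S" "w \<in> S"
  shows "dd v (\<lambda>w. f w * g w) w = dd v f w * g w + f w * dd v g w"
  using fun_cong[OF frechet_at_eqI[OF has_derivative_mult[OF smooth_on_has_derivative[OF assms(1,3,4)] smooth_on_has_derivative[OF assms(2,3,4)]]], of v]
  by simp

lemma dd_const: "dd v (\<lambda>w. c) w = 0"
  using frechet_at_eqI[OF has_derivative_const] by metis

lemma dd_coord:
  "dd (vec_of d) (\<lambda>w. fst (fst w) - c) w = (if d = DX then 1 else 0)"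
  "dd (vec_of d) (\<lambda>w. snd (fst w) - c) w = (if d = DY then 1 else 0)"
proof -
  have 1: "((\<lambda>w::plane \<times> real. fst (fst w) - c) has_derivative (\<lambda>v. fst (fst v))) (at w)"
    and 2: "((\<lambda>w::plane \<times> real. snd (fst w) - c) has_derivative (\<lambda>v. snd (fst v))) (at w)"
    by (auto intro!: derivative_eq_intros)
  show "dd (vec_of d) (\<lambda>w. fst (fst w) - c) w = (if d = DX then 1 else 0)"
    "dd (vec_of d) (\<lambda>w. snd (fst w) - c) w = (if d = DY then 1 else 0)"
    unfolding frechet_at_eqI[OF 1] frechet_at_eqI[OF 2] by (cases d; simp)+
qed

text \<open>Justifies differentiating the conditions formally by \<open>fD\<close>, so that the
  later tests reduce to evaluating polynomials in jets.\<close>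

lemma dd_evf:
  assumes "open S" "smooth_on S U" "smooth_on S V" "w \<in> S"
  shows "dd (vec_of d) (evf z0 U V e) w = evf z0 U V (fD d e) w"
proof (induction e)
  case (Add a b)
  then show ?case using dd_add[where v="vec_of d" and f="evf z0 U V a" and g="evf z0 U V b", OF smooth_evf[OF assms(1-3)] smooth_evf[OF assms(1-3)] assms(1,4)]
    by (simp add: evf_def[abs_def])
next
  case (Mul a b)
  then show ?case using dd_mult[where v="vec_of d" and f="evf z0 U V a" and g="evf z0 U V b", OF smooth_evf[OF assms(1-3)] smooth_evf[OF assms(1-3)] assms(1,4)]
    by (simp add: evf_def[abs_def])
qed (simp_all add: evf_def[abs_def] jet_of_def dd_coord dd_const del: vec_of.simps)

lemma dd_pv: "dd (vec_of d) (pv z0 e) w = pv z0 (fD d e) w"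
proof (induction e)
  case (Add a b)
  then show ?case using dd_add[where v="vec_of d" and f="pv z0 a" and g="pv z0 b", OF smooth_pv[OF open_UNIV] smooth_pv[OF open_UNIV] open_UNIV UNIV_I]
    by (simp add: pv_def[abs_def])
next
  case (Mul a b)
  then show ?case using dd_mult[where v="vec_of d" and f="pv z0 a" and g="pv z0 b", OF smooth_pv[OF open_UNIV] smooth_pv[OF open_UNIV] open_UNIV UNIV_I]
    by (simp add: pv_def[abs_def])
qed (simp_all add: pv_def[abs_def] dd_coord dd_const del: vec_of.simps)

lemma iter_deriv_cong:
  assumes "open S" "\<And>x. x \<in> S \<Longrightarrow> f x = g x" "x \<in> S"
  shows "iter_deriv vs f x = iter_deriv vs g x"
  using assms(3)
proof (induction vs arbitrary: x)
  case (Cons v vs)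
  then show ?case using dd_cong[OF assms(1), of "iter_deriv vs f" "iter_deriv vs g" x] by simp
qed (use assms in auto)

definition pert :: "plane \<Rightarrow> ('m::finite \<Rightarrow> dpoly) \<Rightarrow> (real^'m) \<Rightarrow> plane \<times> real \<Rightarrow> real" where
  "pert z0 h s w = (\<Sum>j\<in>UNIV. s $ j * pv z0 (h j) w)"

lemma smooth_pert: "open S \<Longrightarrow> smooth_on S (pert z0 h s)"
  unfolding pert_def[abs_def] by (intro smooth_intros smooth_pv)

lemma pert_jet: "jet_of (pert z0 h s) w vs = (\<Sum>j\<in>UNIV. s $ j * pv z0 (fDs vs (h j)) w)"
proof (induction vs arbitrary: w)
  case (Cons d vs)
  have "jet_of (pert z0 h s) w (d # vs) = dd (vec_of d) (\<lambda>w. jet_of (pert z0 h s) w vs) w"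
    by (simp add: jet_of_def)
  also have "\<dots> = dd (vec_of d) (\<lambda>w. \<Sum>j\<in>UNIV. s $ j * pv z0 (fDs vs (h j)) w) w"
    by (simp only: Cons.IH)
  also have "\<dots> = (\<Sum>j\<in>UNIV. s $ j * pv z0 (fDs (d # vs) (h j)) w)"
  proof -
    have d: "(pv z0 e has_derivative frechet_derivative (pv z0 e) (at w)) (at w)" for e
      by (rule smooth_on_has_derivative[OF smooth_pv[OF open_UNIV]]) auto
    have "((\<lambda>w. \<Sum>j\<in>UNIV. s $ j * pv z0 (fDs vs (h j)) w) has_derivative
       (\<lambda>v. \<Sum>j\<in>UNIV. s $ j * dd v (pv z0 (fDs vs (h j))) w)) (at w)"
      by (rule derivative_eq_intros d refl)+ simp
    from fun_cong[OF frechet_at_eqI[OF this], of "vec_of d"] show ?thesis by (simp add: dd_pv)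
  qed
  finally show ?case .
qed (simp add: jet_of_def pert_def)

lemma jet_of_add:
  assumes "open S" "smooth_on S f" "smooth_on S g" "w \<in> S"
  shows "jet_of (\<lambda>w. f w + g w) w vs = jet_of f w vs + jet_of g w vs"
  using assms(4) unfolding jet_of_def
proof (induction vs arbitrary: w)
  case (Cons d vs)
  have "dd (vec_of d) (iter_deriv (map vec_of vs) (\<lambda>w. f w + g w)) w
     = dd (vec_of d) (\<lambda>w. iter_deriv (map vec_of vs) f w + iter_deriv (map vec_of vs) g w) w"
    by (rule fun_cong[OF dd_cong[OF assms(1) Cons.IH Cons.prems]])
  also have "\<dots> = dd (vec_of d) (iter_deriv (map vec_of vs) f) w + dd (vec_of d) (iter_deriv (map vec_of vs) g) w"
    by (rule dd_add[OF smooth_on_iter_deriv[OF assms(2)] smooth_on_iter_deriv[OF assms(3)] assms(1) Cons.prems])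
  finally show ?case by simp
qed simp

text \<open>The value at \<open>w\<close> for the perturbed pair \<open>U + pert z0 h s\<close>, \<open>V + pert z0 k s\<close>, as a function of \<open>(w, s)\<close>.\<close>

definition evj :: "plane \<Rightarrow> ('m::finite \<Rightarrow> dpoly) \<Rightarrow> ('m \<Rightarrow> dpoly) \<Rightarrow> (plane \<times> real \<Rightarrow> real) \<Rightarrow> (plane \<times> real \<Rightarrow> real)
    \<Rightarrow> dpoly \<Rightarrow> (plane \<times> real) \<times> (real^'m) \<Rightarrow> real" where
  "evj z0 h k U V e p = ev (\<lambda>vs. jet_of U (fst p) vs + (\<Sum>j\<in>UNIV. snd p $ j * pv z0 (fDs vs (h j)) (fst p)))
     (\<lambda>vs. jet_of V (fst p) vs + (\<Sum>j\<in>UNIV. snd p $ j * pv z0 (fDs vs (k j)) (fst p)))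
     (fst (fst (fst p)) - fst z0) (snd (fst (fst p)) - snd z0) e"

lemma evj_eq_evf:
  assumes "open S" "smooth_on S U" "smooth_on S V" "w \<in> S"
  shows "evj z0 h k U V e (w, s) = evf z0 (\<lambda>w. U w + pert z0 h s w) (\<lambda>w. V w + pert z0 k s w) e w"
proof -
  have "jet_of (\<lambda>w. f w + pert z0 h s w) w = (\<lambda>vs. jet_of f w vs + (\<Sum>j\<in>UNIV. s $ j * pv z0 (fDs vs (h j)) w))"
    if "smooth_on S f" for f h
    by (rule ext) (simp only: jet_of_add[OF assms(1) that smooth_pert[OF assms(1)] assms(4)] pert_jet)
  then show ?thesis unfolding evj_def evf_def fst_conv snd_conv using assms(2,3) by presburger
qed

lemma smooth_evj:
  fixes h :: "'m::finite \<Rightarrow> dpoly"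
  assumes "open S" "smooth_on S U" "smooth_on S V"
  shows "smooth_on (S \<times> UNIV) (evj z0 h k U V e)"
proof (induction e)
  have o: "open (S \<times> (UNIV :: (real^'m) set))" using assms(1) by (simp add: open_Times)
  have f: "smooth_on (S \<times> (UNIV :: (real^'m) set)) (\<lambda>p. g (fst p))" if "smooth_on S g" for g :: "_ \<Rightarrow> real"
    by (rule smooth_on_compose[OF that _ o assms(1)]) (auto intro!: smooth_intros o)
  have nth: "smooth_on (S \<times> (UNIV :: (real^'m) set)) (\<lambda>p. snd p $ j)" for j
    by (rule smooth_on_linear_comp[OF o bounded_linear_vec_nth]) (intro smooth_intros o)
  have sum: "smooth_on (S \<times> (UNIV :: (real^'m) set)) (\<lambda>p. \<Sum>j\<in>UNIV. snd p $ j * pv z0 (fDs vs (h j)) (fst p))" for vs h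
    by (intro smooth_intros o nth f[OF smooth_pv[OF assms(1)]])
  {
    case (JU vs)
    have "smooth_on S (\<lambda>w. jet_of U w vs)" using smooth_on_iter_deriv[OF assms(2)] by (simp add: jet_of_def)
    from smooth_on_add[OF o f[OF this] sum] show ?case by (simp add: evj_def[abs_def])
  next
    case (JV vs)
    have "smooth_on S (\<lambda>w. jet_of V w vs)" using smooth_on_iter_deriv[OF assms(3)] by (simp add: jet_of_def)
    from smooth_on_add[OF o f[OF this] sum] show ?case by (simp add: evj_def[abs_def])
  next
    case (Cst c) show ?case by (simp add: evj_def[abs_def] smooth_on_const)
  next
    case CX show ?case by (simp add: evj_def[abs_def]) (intro smooth_intros o)
  next
    case CY show ?case by (simp add: evj_def[abs_def]) (intro smooth_intros o)
  next
    case (Add a b) then show ?case using smooth_on_add[OF o] by (simp add: evj_def[abs_def])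
  next
    case (Mul a b) then show ?case using smooth_on_mult[OF o] by (simp add: evj_def[abs_def])
  }
qed

lemma evj_pure: "pure e \<Longrightarrow> evj z0 h k U V e p = pv z0 e (fst p)"
  unfolding evj_def pv_def by (rule ev_pure)

text \<open>A pure perturbation enters every jet linearly in s, so a parameter derivative is again a
  differential polynomial at the same point, namely the formal linearization.\<close>

lemma evj_param_derivative:
  fixes h :: "'m::finite \<Rightarrow> dpoly"
  assumes "pure (h j)" "pure (k j)"
  shows "((\<lambda>t. evj z0 h k U V e (w, s + t *\<^sub>R axis j 1)) has_real_derivative
    evj z0 h k U V (lin (h j) (k j) e) (w, s + t *\<^sub>R axis j 1)) (at t)"
proof (induction e)
  have sum: "(\<Sum>i\<in>UNIV. (s + t *\<^sub>R axis j 1) $ i * c i) = (\<Sum>i\<in>UNIV. s $ i * c i) + t * c j" for t and c :: "'m \<Rightarrow> real"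
  proof -
    have "(s + t *\<^sub>R axis j 1) $ i * c i = s $ i * c i + (if i = j then t * c i else 0)" for i
      by (simp add: axis_def algebra_simps)
    then show ?thesis by (simp add: sum.distrib)
  qed
  {
    case (JU vs)
    have e: "evj z0 h k U V (JU vs) (w, s + t *\<^sub>R axis j 1) =
        (jet_of U w vs + (\<Sum>i\<in>UNIV. s $ i * pv z0 (fDs vs (h i)) w)) + t * pv z0 (fDs vs (h j)) w" for t
      unfolding evj_def by (simp only: ev.simps fst_conv snd_conv sum add.assoc)
    show ?case unfolding e lin.simps evj_pure[OF pure_fDs[OF assms(1)]]
      by (auto intro!: derivative_eq_intros)
  next
    case (JV vs)
    have e: "evj z0 h k U V (JV vs) (w, s + t *\<^sub>R axis j 1) =
        (jet_of V w vs + (\<Sum>i\<in>UNIV. s $ i * pv z0 (fDs vs (k i)) w)) + t * pv z0 (fDs vs (k j)) w" for t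
      unfolding evj_def by (simp only: ev.simps fst_conv snd_conv sum add.assoc)
    show ?case unfolding e lin.simps evj_pure[OF pure_fDs[OF assms(2)]]
      by (auto intro!: derivative_eq_intros)
  next
    case (Add a b) from DERIV_add[OF this] show ?case by (simp add: evj_def)
  next
    case (Mul a b) from DERIV_mult[OF this] show ?case by (simp add: evj_def algebra_simps)
  }
qed (simp_all add: evj_def)


text \<open>The Gram determinant expresses surjectivity by the nonvanishing of one continuous
  function of the entries, a form that passes to limits of jets.\<close>

lemma surj_iff_gram:
  fixes N :: "real^'n^'m"
  shows "surj ((*v) N) \<longleftrightarrow> det (N ** transpose N) \<noteq> 0"
proof
  assume s: "surj ((*v) N)"
  have "x = 0" if "(N ** transpose N) *v x = 0" for x
  proof -
    have "(transpose N *v x) \<bullet> (transpose N *v x) = x \<bullet> (N *v (transpose N *v x))"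
      by (simp add: dot_lmul_matrix flip: vector_transpose_matrix)
    also have "\<dots> = 0" using that by (simp only: matrix_vector_mul_assoc inner_zero_right)
    finally have z: "transpose N *v x = 0" by simp
    obtain y where "x = N *v y" using s by (metis surjD)
    then have "x \<bullet> x = (transpose N *v x) \<bullet> y"
      by (metis dot_lmul_matrix transpose_matrix_vector)
    then show "x = 0" using z by simp
  qed
  then have "inj ((*v) (N ** transpose N))"
    using linear_injective_0[OF matrix_vector_mul_linear] by blast
  then show "det (N ** transpose N) \<noteq> 0"
    unfolding invertible_det_nz[symmetric] invertible_left_inverse matrix_left_invertible_injective .
next
  assume "det (N ** transpose N) \<noteq> 0"
  then have "surj ((*v) (N ** transpose N))"
    unfolding invertible_det_nz[symmetric] invertible_right_inverse matrix_right_invertible_surjective .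
  then show "surj ((*v) N)" unfolding surj_def by (metis matrix_vector_mul_assoc)
qed

section \<open>Parametric transversality by Sard's theorem in Cartesian coordinates\<close>

definition to3 :: "real^3 \<Rightarrow> plane \<times> real" where
  "to3 t = ((t $ 1, t $ 2), t $ 3)"

lemma bounded_linear_to3: "bounded_linear to3"
  unfolding to3_def[abs_def] by (intro bounded_linear_Pair bounded_linear_vec_nth)

lemma to3_surj: obtains t where "to3 t = w"
proof
  show "to3 (vector [fst (fst w), snd (fst w), snd w]) = w" by (simp add: to3_def)
qed

text \<open>Where the derivative in \<open>s\<close> is invertible, the zero set is a graph over \<open>w\<close>, and the parameters for
  which it is met non-transversely are critical values of the graph map.\<close>

lemma parametric_transversality:
  fixes \<Theta> :: "(plane \<times> real) \<times> (real^'m::{finite,wellorder}) \<Rightarrow> real^'m::_"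
  assumes \<Omega>: "open \<Omega>" and sm: "smooth_on \<Omega> \<Theta>" and card: "3 \<le> CARD('m)"
  shows "negligible {s. \<exists>w. (w, s) \<in> \<Omega> \<and> \<Theta> (w, s) = 0 \<and> (\<forall>v. dd (0, v) \<Theta> (w, s) = 0 \<longrightarrow> v = 0) \<and>
    \<not> surj (\<lambda>u. dd (u, 0) \<Theta> (w, s))}"
proof -
  define Bd where "Bd = {p \<in> \<Omega>. \<Theta> p = 0 \<and> (\<forall>v. dd (0, v) \<Theta> p = 0 \<longrightarrow> v = 0) \<and> \<not> surj (\<lambda>u. dd (u, 0) \<Theta> p)}"
  \<comment> \<open>At a bad point the derivative in s is invertible, so this map is a local
    diffeomorphism; its inverse over the value 0 is the graph map \<open>\<sigma>\<close>.\<close>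
  define \<Xi> where "\<Xi> p = (fst p, \<Theta> p)" for p
  have sm\<Xi>: "smooth_on \<Omega> \<Xi>" unfolding \<Xi>_def by (intro smooth_intros \<Omega> sm)
  have d\<Theta>: "(\<Theta> has_derivative frechet_derivative \<Theta> (at p)) (at p)" if "p \<in> \<Omega>" for p
    by (rule smooth_on_has_derivative[OF sm \<Omega> that])
  have d\<Xi>: "(\<Xi> has_derivative (\<lambda>v. (fst v, dd v \<Theta> p))) (at p)" if "p \<in> \<Omega>" for p
    unfolding \<Xi>_def by (intro has_derivative_Pair d\<Theta>[OF that] has_derivative_fst has_derivative_ident)
  have local: "\<exists>N. open N \<and> p \<in> N \<and> negligible (snd ` (Bd \<inter> N))" if p: "p \<in> Bd" for p
  proof -
    have p\<Omega>: "p \<in> \<Omega>" using p by (simp add: Bd_def)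
    have "v = 0" if "frechet_derivative \<Xi> (at p) v = 0" for v
    proof -
      obtain v1 v2 where v: "v = (v1, v2)" by (cases v)
      have "v1 = 0" "dd (v1, v2) \<Theta> p = 0"
        using that unfolding frechet_at_eqI[OF d\<Xi>[OF p\<Omega>]] v by (auto simp: zero_prod_def)
      then show ?thesis using p v by (simp add: Bd_def zero_prod_def)
    qed
    then obtain W W' g where W: "open W" "open W'" "p \<in> W" "W \<subseteq> \<Omega>" "\<Xi> p \<in> W'" "\<Xi> ` W = W'" "g ` W' = W" "smooth_on W' g"
      "\<And>x. x \<in> W \<Longrightarrow> g (\<Xi> x) = x" "\<And>y. y \<in> W' \<Longrightarrow> \<Xi> (g y) = y"
      using smooth_inverse_function[OF \<Omega> sm\<Xi> p\<Omega>] by metis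
    define \<sigma> where "\<sigma> t = snd (g (to3 t, 0))" for t
    define T where "T = {t. (to3 t, 0) \<in> W'}"
    have blt: "bounded_linear (\<lambda>t. (to3 t, 0::(real,'m) vec))"
      by (intro bounded_linear_Pair bounded_linear_to3 bounded_linear_zero)
    have smt: "smooth_on UNIV (\<lambda>t. (to3 t, 0::(real,'m) vec))" by (rule smooth_on_bounded_linear[OF blt])
    have oT: "open T"
    proof -
      have "T = (\<lambda>t. (to3 t, 0)) -` W'" by (auto simp: T_def)
      then show ?thesis using open_vimage[OF W(2) smooth_on_continuous_on[OF smt open_UNIV]] by simp
    qed
    have sm\<sigma>: "smooth_on T \<sigma>" unfolding \<sigma>_def
      by (rule smooth_on_snd[OF oT smooth_on_compose[OF W(8) smooth_on_subset[OF smt] oT W(2)]]) (auto simp: T_def)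
    define Tb where "Tb = {t \<in> T. (to3 t, \<sigma> t) \<in> Bd}"
    have geq: "g (to3 t, 0) = (to3 t, \<sigma> t)" "\<Theta> (to3 t, \<sigma> t) = 0" "(to3 t, \<sigma> t) \<in> W" if "t \<in> T" for t
    proof -
      have in': "(to3 t, 0) \<in> W'" using that by (simp add: T_def)
      have e: "\<Xi> (g (to3 t, 0)) = (to3 t, 0)" using W(10)[OF in'] .
      then show 1: "g (to3 t, 0) = (to3 t, \<sigma> t)" by (simp add: \<Xi>_def \<sigma>_def prod_eq_iff)
      show "\<Theta> (to3 t, \<sigma> t) = 0" using e unfolding 1 by (simp add: \<Xi>_def)
      show "(to3 t, \<sigma> t) \<in> W" using 1 in' W(7) by (metis image_eqI)
    qed
    have "negligible (\<sigma> ` Tb)"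
    proof (rule baby_Sard)
      show "CARD(3) \<le> CARD('m)" using card by simp
      fix t assume t: "t \<in> Tb"
      then have tT: "t \<in> T" and bd: "(to3 t, \<sigma> t) \<in> Bd" by (auto simp: Tb_def)
      have d\<sigma>: "(\<sigma> has_derivative frechet_derivative \<sigma> (at t)) (at t)"
        by (rule smooth_on_has_derivative[OF sm\<sigma> oT tT])
      then show "(\<sigma> has_derivative frechet_derivative \<sigma> (at t)) (at t within Tb)"
        by (rule has_derivative_at_withinI)
      have lin\<sigma>: "linear (frechet_derivative \<sigma> (at t))" using d\<sigma> has_derivative_linear by blast
      let ?q = "(to3 t, \<sigma> t)"
      have q\<Omega>: "?q \<in> \<Omega>" using bd by (simp add: Bd_def)
      have lin\<Theta>: "linear (frechet_derivative \<Theta> (at ?q))" using d\<Theta>[OF q\<Omega>] has_derivative_linear by blast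
      have pr: "((\<lambda>t. (to3 t, \<sigma> t)) has_derivative (\<lambda>u. (to3 u, frechet_derivative \<sigma> (at t) u))) (at t)"
        by (intro has_derivative_Pair d\<sigma> bounded_linear_imp_has_derivative[OF bounded_linear_to3])
      have 1: "((\<lambda>t. \<Theta> (to3 t, \<sigma> t)) has_derivative (\<lambda>u. dd (to3 u, frechet_derivative \<sigma> (at t) u) \<Theta> ?q)) (at t)"
        using diff_chain_at[OF pr d\<Theta>[OF q\<Omega>]] by (simp add: o_def)
      have 2: "((\<lambda>t. \<Theta> (to3 t, \<sigma> t)) has_derivative (\<lambda>u. 0)) (at t)"
        by (rule has_derivative_transform_within_open[OF has_derivative_const oT tT]) (simp add: geq(2))
      have z: "dd (to3 u, frechet_derivative \<sigma> (at t) u) \<Theta> ?q = 0" for u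
        using fun_cong[OF has_derivative_unique[OF 1 2], of u] by simp
      have split: "dd (a, b) \<Theta> ?q = dd (a, 0) \<Theta> ?q + dd (0, b) \<Theta> ?q" for a b
      proof -
        have "(a, b) = (a, 0) + (0, b)" by simp
        then show ?thesis by (metis linear_add[OF lin\<Theta>])
      qed
      have linb: "linear (\<lambda>v. dd (0, v) \<Theta> ?q)"
      proof
        fix b1 b2 :: "(real,'m) vec" and c :: real
        have "(0, b1 + b2) = (0::plane \<times> real, b1) + (0, b2)" by simp
        then show "dd (0, b1 + b2) \<Theta> ?q = dd (0, b1) \<Theta> ?q + dd (0, b2) \<Theta> ?q"
          by (metis linear_add[OF lin\<Theta>])
        have "(0, c *\<^sub>R b1) = c *\<^sub>R (0::plane \<times> real, b1)" by simp
        then show "dd (0, c *\<^sub>R b1) \<Theta> ?q = c *\<^sub>R dd (0, b1) \<Theta> ?q"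
          by (metis linear_scale[OF lin\<Theta>])
      qed
      have injb: "inj (\<lambda>v. dd (0, v) \<Theta> ?q)"
        using bd linear_injective_0[OF linb] by (auto simp: Bd_def)
      have surjb: "surj (\<lambda>v. dd (0, v) \<Theta> ?q)" using linear_injective_imp_surjective[OF linb injb] by simp
      \<comment> \<open>Differentiating \<Theta> (w, \<sigma> w) = 0 expresses the derivative in w
        as minus the invertible derivative in s composed with that of \<sigma>; the two are
        surjective together.\<close>
      have "\<not> surj (frechet_derivative \<sigma> (at t))"
      proof
        assume s: "surj (frechet_derivative \<sigma> (at t))"
        have "\<exists>u. y = dd (u, 0) \<Theta> ?q" for y
        proof -
          obtain v where v: "- y = dd (0, v) \<Theta> ?q" using surjb by (metis surjD)
          obtain u where "v = frechet_derivative \<sigma> (at t) u" using s by (metis surjD)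
          then have "dd (to3 u, 0) \<Theta> ?q + dd (0, v) \<Theta> ?q = 0" using z[of u] split[of "to3 u" v] by simp
          then have "y = dd (to3 u, 0) \<Theta> ?q" unfolding v[symmetric] by simp
          then show ?thesis by blast
        qed
        then have "surj (\<lambda>u. dd (u, 0) \<Theta> ?q)" unfolding surj_def by blast
        then show False using bd by (simp add: Bd_def)
      qed
      moreover have "(*v) (matrix (frechet_derivative \<sigma> (at t))) = frechet_derivative \<sigma> (at t)"
        by (rule matrix_vector_mul(2)[OF lin\<sigma>])
      ultimately have "rank (matrix (frechet_derivative \<sigma> (at t))) \<noteq> CARD('m)"
        unfolding full_rank_surjective by simp
      moreover have "rank (matrix (frechet_derivative \<sigma> (at t))) \<le> CARD('m)"
        using rank_bound[of "matrix (frechet_derivative \<sigma> (at t))"] by simp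
      ultimately show "rank (matrix (frechet_derivative \<sigma> (at t))) < CARD('m)" by simp
    qed
    moreover have "snd ` (Bd \<inter> W) \<subseteq> \<sigma> ` Tb"
    proof
      fix s assume "s \<in> snd ` (Bd \<inter> W)"
      then obtain w where w: "(w, s) \<in> Bd" "(w, s) \<in> W" by auto
      obtain t where t: "to3 t = w" by (rule to3_surj)
      have "\<Xi> (w, s) = (w, 0)" using w(1) by (simp add: \<Xi>_def Bd_def)
      moreover have "\<Xi> (w, s) \<in> W'" using w(2) W(6) by blast
      ultimately have "t \<in> T" "\<sigma> t = s" using W(9)[OF w(2)] t by (auto simp: T_def \<sigma>_def)
      then show "s \<in> \<sigma> ` Tb" using w(1) t by (auto simp: Tb_def)
    qed
    ultimately have "negligible (snd ` (Bd \<inter> W))" by (rule negligible_subset)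
    then show ?thesis using W(1,3) by blast
  qed
  \<comment> \<open>Countably many of the local neighbourhoods cover the bad set, so the bad
    parameters form a countable union of null sets.\<close>
  define \<F> where "\<F> = {N. open N \<and> negligible (snd ` (Bd \<inter> N))}"
  obtain \<F>' where F: "\<F>' \<subseteq> \<F>" "countable \<F>'" "\<Union>\<F>' = \<Union>\<F>"
    using Lindelof[of \<F>] unfolding \<F>_def by blast
  have "negligible (\<Union>((\<lambda>N. snd ` (Bd \<inter> N)) ` \<F>'))"
    using F by (intro negligible_countable_Union countable_image) (auto simp: \<F>_def)
  moreover have "{s. \<exists>w. (w, s) \<in> \<Omega> \<and> \<Theta> (w, s) = 0 \<and> (\<forall>v. dd (0, v) \<Theta> (w, s) = 0 \<longrightarrow> v = 0) \<and>
    \<not> surj (\<lambda>u. dd (u, 0) \<Theta> (w, s))} \<subseteq> \<Union>((\<lambda>N. snd ` (Bd \<inter> N)) ` \<F>')"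
  proof (rule subsetI, elim CollectE exE)
    fix s w assume "(w, s) \<in> \<Omega> \<and> \<Theta> (w, s) = 0 \<and> (\<forall>v. dd (0, v) \<Theta> (w, s) = 0 \<longrightarrow> v = 0) \<and>
      \<not> surj (\<lambda>u. dd (u, 0) \<Theta> (w, s))"
    then have b: "(w, s) \<in> Bd" by (simp add: Bd_def)
    then have "(w, s) \<in> \<Union>\<F>" using local[OF b] unfolding \<F>_def by blast
    then obtain N where N: "N \<in> \<F>'" "(w, s) \<in> N" using F(3) by blast
    have "s \<in> snd ` (Bd \<inter> N)" using b N(2) by force
    then show "s \<in> \<Union>((\<lambda>N. snd ` (Bd \<inter> N)) ` \<F>')" using N(1) by blast
  qed
  ultimately show ?thesis by (rule negligible_subset)
qed

text \<open>Convergence of jets up to order \<open>k\<close> at moving points \<open>w n\<close>; it is preserved by the operations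
  that express the direction fields through the coefficients.\<close>

context
  fixes S :: "nat \<Rightarrow> (plane \<times> real) set" and w :: "nat \<Rightarrow> plane \<times> real" and Sl :: "(plane \<times> real) set" and wl :: "plane \<times> real"
  assumes S: "\<And>n. open (S n)" "\<And>n. w n \<in> S n" and Sl: "open Sl" "wl \<in> Sl"
begin

definition jconv :: "nat \<Rightarrow> (nat \<Rightarrow> plane \<times> real \<Rightarrow> real) \<Rightarrow> (plane \<times> real \<Rightarrow> real) \<Rightarrow> bool" where
  "jconv k f g \<longleftrightarrow> (\<forall>n. smooth_on (S n) (f n)) \<and> smooth_on Sl g \<and>
     (\<forall>vs. length vs \<le> k \<longrightarrow> (\<lambda>n. jet_of (f n) (w n) vs) \<longlonglongrightarrow> jet_of g wl vs)"

lemma jet_of_snoc: "jet_of f x (vs @ [d]) = jet_of (dd (vec_of d) f) x vs"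
  by (simp add: jet_of_def iter_deriv_snoc)

lemma jconv_smooth: "jconv k f g \<Longrightarrow> smooth_on (S n) (f n)" "jconv k f g \<Longrightarrow> smooth_on Sl g"
  by (auto simp: jconv_def)

lemma jconv_value: "jconv k f g \<Longrightarrow> (\<lambda>n. f n (w n)) \<longlonglongrightarrow> g wl"
proof -
  assume "jconv k f g"
  then have "length ([] :: dir list) \<le> k \<longrightarrow> (\<lambda>n. jet_of (f n) (w n) []) \<longlonglongrightarrow> jet_of g wl []"
    unfolding jconv_def by blast
  then show ?thesis by (simp add: jet_of_def)
qed

text \<open>Gives jet convergence the recursive form of \<open>csm\<close>, so that products,
  inverses and roots are again treated by induction on k with the derivative rules.\<close>

lemma jconv_Suc:
  "jconv (Suc k) f g \<longleftrightarrow> (\<forall>n. smooth_on (S n) (f n)) \<and> smooth_on Sl g \<and> (\<lambda>n. f n (w n)) \<longlonglongrightarrow> g wl \<and>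
     (\<forall>d. jconv k (\<lambda>n. dd (vec_of d) (f n)) (dd (vec_of d) g))"
proof
  assume L: "jconv (Suc k) f g"
  have "(\<lambda>n. jet_of (dd (vec_of d) (f n)) (w n) vs) \<longlonglongrightarrow> jet_of (dd (vec_of d) g) wl vs" if "length vs \<le> k" for d vs
    using L that unfolding jconv_def jet_of_snoc[symmetric] by simp
  then show "(\<forall>n. smooth_on (S n) (f n)) \<and> smooth_on Sl g \<and> (\<lambda>n. f n (w n)) \<longlonglongrightarrow> g wl \<and>
     (\<forall>d. jconv k (\<lambda>n. dd (vec_of d) (f n)) (dd (vec_of d) g))"
    using jconv_smooth[OF L] jconv_value[OF L] unfolding jconv_def by (auto intro: smooth_on_dd)
next
  assume R: "(\<forall>n. smooth_on (S n) (f n)) \<and> smooth_on Sl g \<and> (\<lambda>n. f n (w n)) \<longlonglongrightarrow> g wl \<and>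
     (\<forall>d. jconv k (\<lambda>n. dd (vec_of d) (f n)) (dd (vec_of d) g))"
  have "(\<lambda>n. jet_of (f n) (w n) vs) \<longlonglongrightarrow> jet_of g wl vs" if "length vs \<le> Suc k" for vs
  proof (cases vs rule: rev_cases)
    case Nil
    have "(\<lambda>n. f n (w n)) \<longlonglongrightarrow> g wl" using R by blast
    then show ?thesis using Nil by (simp add: jet_of_def)
  next
    case (snoc us d)
    have "length us \<le> k" using that snoc by simp
    then show ?thesis using R unfolding snoc jet_of_snoc jconv_def by blast
  qed
  then show "jconv (Suc k) f g" using R unfolding jconv_def by blast
qed

lemma jconv_0: "jconv 0 f g \<longleftrightarrow> (\<forall>n. smooth_on (S n) (f n)) \<and> smooth_on Sl g \<and> (\<lambda>n. f n (w n)) \<longlonglongrightarrow> g wl"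
  unfolding jconv_def by (auto simp: jet_of_def)

lemma jconv_mono: "jconv k f g \<Longrightarrow> j \<le> k \<Longrightarrow> jconv j f g"
  unfolding jconv_def by auto

lemma jconv_cong:
  assumes "\<And>n x. x \<in> S n \<Longrightarrow> f n x = f' n x" "\<And>x. x \<in> Sl \<Longrightarrow> g x = g' x" "jconv k f g"
  shows "jconv k f' g'"
  unfolding jconv_def
proof (intro conjI allI impI)
  show "smooth_on (S n) (f' n)" for n
    using smooth_on_cong[OF S(1) assms(1) jconv_smooth(1)[OF assms(3)]] .
  show "smooth_on Sl g'"
    using smooth_on_cong[OF Sl(1) assms(2) jconv_smooth(2)[OF assms(3)]] .
  fix vs :: "dir list" assume "length vs \<le> k"
  then have "(\<lambda>n. jet_of (f n) (w n) vs) \<longlonglongrightarrow> jet_of g wl vs" using assms(3) by (simp add: jconv_def)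
  moreover have "jet_of (f n) (w n) vs = jet_of (f' n) (w n) vs" for n
    unfolding jet_of_def by (rule iter_deriv_cong[OF S(1) assms(1) S(2)])
  moreover have "jet_of g wl vs = jet_of g' wl vs"
    unfolding jet_of_def by (rule iter_deriv_cong[OF Sl(1) assms(2) Sl(2)])
  ultimately show "(\<lambda>n. jet_of (f' n) (w n) vs) \<longlonglongrightarrow> jet_of g' wl vs" by simp
qed

lemma jconv_add: "jconv k f g \<Longrightarrow> jconv k f' g' \<Longrightarrow> jconv k (\<lambda>n x. f n x + f' n x) (\<lambda>x. g x + g' x)"
  unfolding jconv_def
  by (auto intro!: smooth_intros S Sl tendsto_add simp: jet_of_add[OF S(1) _ _ S(2)] jet_of_add[OF Sl(1) _ _ Sl(2)])

lemma jconv_const: "jconv k (\<lambda>n x. c) (\<lambda>x. c)"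
proof (induction k arbitrary: c)
  case 0 show ?case by (auto simp: jconv_0 smooth_on_const)
next
  case (Suc k) then show ?case by (auto simp: jconv_Suc smooth_on_const dd_const)
qed

lemma jconv_mult: "jconv k f g \<Longrightarrow> jconv k f' g' \<Longrightarrow> jconv k (\<lambda>n x. f n x * f' n x) (\<lambda>x. g x * g' x)"
proof (induction k arbitrary: f g f' g')
  case 0 then show ?case unfolding jconv_0 by (auto intro!: smooth_intros S Sl tendsto_mult)
next
  case (Suc k)
  note sm = jconv_smooth[OF Suc.prems(1)] jconv_smooth[OF Suc.prems(2)]
  have "jconv k (\<lambda>n. dd (vec_of d) (\<lambda>x. f n x * f' n x)) (dd (vec_of d) (\<lambda>x. g x * g' x))" for d
  proof (rule jconv_cong)
    show "jconv k (\<lambda>n x. dd (vec_of d) (f n) x * f' n x + f n x * dd (vec_of d) (f' n) x)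
        (\<lambda>x. dd (vec_of d) g x * g' x + g x * dd (vec_of d) g' x)"
      using Suc.prems jconv_mono[OF Suc.prems(1), of k] jconv_mono[OF Suc.prems(2), of k]
      by (intro jconv_add Suc.IH) (auto simp: jconv_Suc)
  qed (simp_all add: dd_mult[OF sm(1,3) S(1)] dd_mult[OF sm(2,4) Sl(1)])
  then show ?case unfolding jconv_Suc using sm jconv_value[OF Suc.prems(1)] jconv_value[OF Suc.prems(2)]
    by (auto intro!: smooth_intros S Sl tendsto_mult)
qed

lemma dd_inverse:
  fixes f :: "plane \<times> real \<Rightarrow> real"
  assumes "smooth_on T f" "open T" "x \<in> T" "f x \<noteq> 0"
  shows "dd v (\<lambda>x. inverse (f x)) x = (- 1) * (inverse (f x) * dd v f x * inverse (f x))"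
  using fun_cong[OF frechet_at_eqI[OF Deriv.has_derivative_inverse[OF assms(4) smooth_on_has_derivative[OF assms(1-3)]]], of v] by simp

lemma dd_sqrt:
  fixes f :: "plane \<times> real \<Rightarrow> real"
  assumes "smooth_on T f" "open T" "x \<in> T" "f x > 0"
  shows "dd v (\<lambda>x. sqrt (f x)) x = (1/2) * (dd v f x * inverse (sqrt (f x)))"
proof -
  have "((\<lambda>x. sqrt (f x)) has_derivative (\<lambda>v. (1/2) * (dd v f x * inverse (sqrt (f x))))) (at x)"
    using has_derivative_real_sqrt[OF assms(4) smooth_on_has_derivative[OF assms(1-3)]] by (simp add: field_simps)
  from fun_cong[OF frechet_at_eqI[OF this]] show ?thesis .
qed

lemma jconv_inverse:
  assumes "\<And>n x. x \<in> S n \<Longrightarrow> f n x \<noteq> 0" "\<And>x. x \<in> Sl \<Longrightarrow> g x \<noteq> 0"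
  shows "jconv k f g \<Longrightarrow> jconv k (\<lambda>n x. inverse (f n x)) (\<lambda>x. inverse (g x))"
proof (induction k)
  case 0
  have "g wl \<noteq> 0" by (rule assms(2)[OF Sl(2)])
  then show ?case using 0 assms unfolding jconv_0 by (intro conjI allI smooth_on_inverse S Sl(1) tendsto_inverse) blast+
next
  case (Suc k)
  note sm = jconv_smooth[OF Suc.prems]
  have I: "jconv k (\<lambda>n x. inverse (f n x)) (\<lambda>x. inverse (g x))" using Suc.IH jconv_mono[OF Suc.prems, of k] by simp
  have "jconv k (\<lambda>n. dd (vec_of d) (\<lambda>x. inverse (f n x))) (dd (vec_of d) (\<lambda>x. inverse (g x)))" for d
  proof (rule jconv_cong)
    show "jconv k (\<lambda>n x. (- 1) * (inverse (f n x) * dd (vec_of d) (f n) x * inverse (f n x)))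
        (\<lambda>x. (- 1) * (inverse (g x) * dd (vec_of d) g x * inverse (g x)))"
      using Suc.prems by (intro jconv_mult jconv_const I) (auto simp: jconv_Suc)
  qed (use assms in \<open>simp_all add: dd_inverse[OF sm(1) S(1)] dd_inverse[OF sm(2) Sl(1)]\<close>)
  moreover have "g wl \<noteq> 0" by (rule assms(2)[OF Sl(2)])
  ultimately show ?case unfolding jconv_Suc using sm jconv_value[OF Suc.prems] assms
    by (intro conjI allI smooth_on_inverse S Sl(1) tendsto_inverse) blast+
qed

lemma jconv_sqrt:
  assumes "\<And>n x. x \<in> S n \<Longrightarrow> f n x > 0" "\<And>x. x \<in> Sl \<Longrightarrow> g x > 0"
  shows "jconv k f g \<Longrightarrow> jconv k (\<lambda>n x. sqrt (f n x)) (\<lambda>x. sqrt (g x))"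
proof (induction k)
  case 0
  then show ?case using assms unfolding jconv_0 by (intro conjI allI smooth_on_sqrt S Sl(1) tendsto_real_sqrt) blast+
next
  case (Suc k)
  note sm = jconv_smooth[OF Suc.prems]
  have I: "jconv k (\<lambda>n x. inverse (sqrt (f n x))) (\<lambda>x. inverse (sqrt (g x)))"
  proof (rule jconv_inverse)
    show "sqrt (f n x) \<noteq> 0" if "x \<in> S n" for n x using assms(1)[OF that] by simp
    show "sqrt (g x) \<noteq> 0" if "x \<in> Sl" for x using assms(2)[OF that] by simp
    show "jconv k (\<lambda>n x. sqrt (f n x)) (\<lambda>x. sqrt (g x))" using Suc.IH jconv_mono[OF Suc.prems, of k] by simp
  qed
  have "jconv k (\<lambda>n. dd (vec_of d) (\<lambda>x. sqrt (f n x))) (dd (vec_of d) (\<lambda>x. sqrt (g x)))" for d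
  proof (rule jconv_cong)
    show "jconv k (\<lambda>n x. (1/2) * (dd (vec_of d) (f n) x * inverse (sqrt (f n x))))
        (\<lambda>x. (1/2) * (dd (vec_of d) g x * inverse (sqrt (g x))))"
      using Suc.prems by (intro jconv_mult jconv_const I) (auto simp: jconv_Suc)
  qed (use assms in \<open>simp_all add: dd_sqrt[OF sm(1) S(1)] dd_sqrt[OF sm(2) Sl(1)]\<close>)
  then show ?case unfolding jconv_Suc using sm jconv_value[OF Suc.prems] assms
    by (intro conjI allI smooth_on_sqrt S Sl(1) tendsto_real_sqrt) blast+
qed

end

lemma ev_tendsto:
  assumes "\<And>vs. (\<lambda>n. u n vs) \<longlonglongrightarrow> u' vs" "\<And>vs. (\<lambda>n. v n vs) \<longlonglongrightarrow> v' vs" "x \<longlonglongrightarrow> x'" "y \<longlonglongrightarrow> y'"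
  shows "(\<lambda>n. ev (u n) (v n) (x n) (y n) e) \<longlonglongrightarrow> ev u' v' x' y' e"
  by (induction e) (auto intro!: tendsto_intros assms)

section \<open>Direction fields\<close>

abbreviation ca :: "bide_family \<Rightarrow> plane \<times> real \<Rightarrow> real" where "ca A w \<equiv> fst (A w)"
abbreviation cb :: "bide_family \<Rightarrow> plane \<times> real \<Rightarrow> real" where "cb A w \<equiv> fst (snd (A w))"
abbreviation cc :: "bide_family \<Rightarrow> plane \<times> real \<Rightarrow> real" where "cc A w \<equiv> snd (snd (A w))"

definition disc :: "bide_family \<Rightarrow> plane \<times> real \<Rightarrow> real" where
  "disc A w = (cb A w)\<^sup>2 - ca A w * cc A w"

text \<open>For \<open>\<kappa> = 1\<close> (\<open>\<kappa> = -1\<close>) the domain with two real (complex conjugate) finite directions; they are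
  \<open>Uf A \<plusminus> Vf \<kappa> A\<close> and \<open>Uf A \<plusminus> \<i> Vf \<kappa> A\<close>, respectively.\<close>

definition ddom :: "real \<Rightarrow> bide_family \<Rightarrow> (plane \<times> real) set" where
  "ddom \<kappa> A = {w. cc A w \<noteq> 0 \<and> \<kappa> * disc A w > 0}"

text \<open>The factor - 1 and the use of \<open>inverse\<close> keep the formula within the closure
  rules for \<open>jconv\<close>.\<close>

definition Uf :: "bide_family \<Rightarrow> plane \<times> real \<Rightarrow> real" where "Uf A w = - 1 * (cb A w * inverse (cc A w))"
definition Vf :: "real \<Rightarrow> bide_family \<Rightarrow> plane \<times> real \<Rightarrow> real" where
  "Vf \<kappa> A w = sqrt (\<kappa> * disc A w) * inverse (cc A w)"

lemma smooth_coeffs: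
  assumes "smooth_on UNIV A"
  shows "smooth_on S (ca A)" "smooth_on S (cb A)" "smooth_on S (cc A)" "smooth_on S (disc A)"
proof -
  have "smooth_on UNIV (ca A)" "smooth_on UNIV (cb A)" "smooth_on UNIV (cc A)"
    by (intro smooth_intros open_UNIV assms)+
  moreover from this have "smooth_on UNIV (disc A)" unfolding disc_def
    by (intro smooth_on_diff smooth_on_power smooth_on_mult open_UNIV)
  ultimately show "smooth_on S (ca A)" "smooth_on S (cb A)" "smooth_on S (cc A)" "smooth_on S (disc A)"
    using smooth_on_subset by blast+
qed

lemma open_ddom:
  assumes "smooth_on UNIV A" shows "open (ddom \<kappa> A)"
proof -
  have c: "continuous_on UNIV (cc A)" "continuous_on UNIV (disc A)"
    using smooth_on_continuous_on[OF smooth_coeffs(3)[OF assms] open_UNIV]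
      smooth_on_continuous_on[OF smooth_coeffs(4)[OF assms] open_UNIV] .
  have "open {w. cc A w \<noteq> 0}" by (rule open_Collect_neq[OF c(1) continuous_on_const])
  moreover have "open {w. 0 < \<kappa> * disc A w}"
    by (rule open_Collect_less) (auto intro!: continuous_intros c(2))
  ultimately show ?thesis unfolding ddom_def by (simp add: Collect_conj_eq open_Int)
qed

lemma smooth_UV:
  assumes "smooth_on UNIV A" shows "smooth_on (ddom \<kappa> A) (Uf A)" "smooth_on (ddom \<kappa> A) (Vf \<kappa> A)"
  unfolding Uf_def Vf_def
  by (intro smooth_intros open_ddom[OF assms] smooth_coeffs[OF assms]; simp add: ddom_def)+

lemma UV_tendsto:
  assumes A: "\<And>n. smooth_on UNIV (A n)" "smooth_on UNIV A'"
    and w: "\<And>n. w n \<in> ddom \<kappa> (A n)" "w' \<in> ddom \<kappa> A'"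
    and conv: "\<And>vs. length vs \<le> k \<Longrightarrow> (\<lambda>n. jet_of (ca (A n)) (w n) vs) \<longlonglongrightarrow> jet_of (ca A') w' vs"
     "\<And>vs. length vs \<le> k \<Longrightarrow> (\<lambda>n. jet_of (cb (A n)) (w n) vs) \<longlonglongrightarrow> jet_of (cb A') w' vs"
     "\<And>vs. length vs \<le> k \<Longrightarrow> (\<lambda>n. jet_of (cc (A n)) (w n) vs) \<longlonglongrightarrow> jet_of (cc A') w' vs"
    and "length vs \<le> k"
  shows "(\<lambda>n. jet_of (Uf (A n)) (w n) vs) \<longlonglongrightarrow> jet_of (Uf A') w' vs"
    "(\<lambda>n. jet_of (Vf \<kappa> (A n)) (w n) vs) \<longlonglongrightarrow> jet_of (Vf \<kappa> A') w' vs"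
proof -
  let ?S = "\<lambda>n. ddom \<kappa> (A n)" and ?S' = "ddom \<kappa> A'"
  note S = open_ddom[OF A(1)] w(1) open_ddom[OF A(2)] w(2)
  note J = jconv_add[OF S] jconv_mult[OF S] jconv_const[OF S] jconv_inverse[OF S] jconv_sqrt[OF S]
  let ?J = "jconv ?S w ?S' w' k"
  have a: "?J (\<lambda>n. ca (A n)) (ca A')" and b: "?J (\<lambda>n. cb (A n)) (cb A')" and c: "?J (\<lambda>n. cc (A n)) (cc A')"
    unfolding jconv_def[OF S] using smooth_coeffs[OF A(1)] smooth_coeffs[OF A(2)] conv by auto
  have ci: "?J (\<lambda>n x. inverse (cc (A n) x)) (\<lambda>x. inverse (cc A' x))"
    by (rule J(4)[OF _ _ c]) (auto simp: ddom_def)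
  have "?J (\<lambda>n x. - 1 * (cb (A n) x * inverse (cc (A n) x))) (\<lambda>x. - 1 * (cb A' x * inverse (cc A' x)))"
    by (intro J(2,3) b ci)
  then have U: "?J (\<lambda>n. Uf (A n)) (Uf A')" by (simp add: Uf_def[abs_def])
  have "?J (\<lambda>n x. \<kappa> * (cb (A n) x * cb (A n) x + (- 1) * (ca (A n) x * cc (A n) x)))
     (\<lambda>x. \<kappa> * (cb A' x * cb A' x + (- 1) * (ca A' x * cc A' x)))"
    by (intro J(1,2,3) a b c)
  then have d: "?J (\<lambda>n x. \<kappa> * disc (A n) x) (\<lambda>x. \<kappa> * disc A' x)" by (simp add: disc_def power2_eq_square)
  have "?J (\<lambda>n x. sqrt (\<kappa> * disc (A n) x) * inverse (cc (A n) x)) (\<lambda>x. sqrt (\<kappa> * disc A' x) * inverse (cc A' x))"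
    by (intro J(2) ci J(5)[OF _ _ d]) (auto simp: ddom_def)
  then have V: "?J (\<lambda>n. Vf \<kappa> (A n)) (Vf \<kappa> A')" by (simp add: Vf_def[abs_def])
  show "(\<lambda>n. jet_of (Uf (A n)) (w n) vs) \<longlonglongrightarrow> jet_of (Uf A') w' vs"
    "(\<lambda>n. jet_of (Vf \<kappa> (A n)) (w n) vs) \<longlonglongrightarrow> jet_of (Vf \<kappa> A') w' vs"
    using U V assms(8) unfolding jconv_def[OF S] by auto
qed

section \<open>The Whitney topology\<close>

lemma openin_whitney_nbhd:
  fixes f :: "'a::euclidean_space \<Rightarrow> 'b::real_normed_vector"
  assumes "smooth_on UNIV f" "continuous_on UNIV \<delta>" "\<And>x. 0 < \<delta> x"
  shows "openin whitney_topology (whitney_nbhd f k \<delta>)" "f \<in> whitney_nbhd f k \<delta>"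
proof -
  show "openin whitney_topology (whitney_nbhd f k \<delta>)"
    unfolding whitney_topology_def by (rule topology_generated_by_Basis) (use assms in blast)
  show "f \<in> whitney_nbhd f k \<delta>" using assms by (simp add: whitney_nbhd_def)
qed

lemma topspace_whitney: "topspace whitney_topology = {f :: 'a::euclidean_space \<Rightarrow> 'b::real_normed_vector. smooth_on UNIV f}"
proof
  show "topspace whitney_topology \<subseteq> {f :: 'a \<Rightarrow> 'b. smooth_on UNIV f}"
    unfolding whitney_topology_def topology_generated_by_topspace by (auto simp: whitney_nbhd_def)
  show "{f :: 'a \<Rightarrow> 'b. smooth_on UNIV f} \<subseteq> topspace whitney_topology"
  proof
    fix f :: "'a \<Rightarrow> 'b" assume "f \<in> {f. smooth_on UNIV f}"
    then have "openin whitney_topology (whitney_nbhd f 0 (\<lambda>_. 1))" "f \<in> whitney_nbhd f 0 (\<lambda>_. 1)"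
      by (auto intro!: openin_whitney_nbhd)
    then show "f \<in> topspace whitney_topology" using openin_subset by blast
  qed
qed

lemma tube:
  fixes f :: "'a::euclidean_space \<times> 'b::euclidean_space \<Rightarrow> real"
  assumes "continuous_on UNIV f" "compact C" "\<And>w. w \<in> C \<Longrightarrow> f (w, s0) > 0"
  shows "\<forall>\<^sub>F s in nhds s0. \<forall>w\<in>C. f (w, s) > 0"
proof -
  have "open {p. f p > 0}" using open_Collect_less[OF continuous_on_const assms(1)] .
  then have o: "openin (prod_topology euclidean euclidean) {p. f p > 0}"
    by (simp add: euclidean_product_topology)
  have "compactin euclidean C" using assms(2) by simp
  moreover have "C \<times> {s0} \<subseteq> {p. f p > 0}" using assms(3) by auto
  ultimately obtain U V where UV: "openin euclidean V" "C \<subseteq> U" "s0 \<in> V" "U \<times> V \<subseteq> {p. f p > 0}"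
    using tube_lemma_left[OF o, of C s0] by auto
  have "open V" using UV(1) by (rule open_openin[THEN iffD2])
  moreover have "\<forall>s\<in>V. \<forall>w\<in>C. f (w, s) > 0" using UV(2,4) by blast
  ultimately show ?thesis unfolding eventually_nhds using UV(3) by blast
qed

section \<open>Small perturbations with compact support\<close>

lemma iter_deriv_slice:
  fixes f :: "'a::real_normed_vector \<times> 'b::real_normed_vector \<Rightarrow> 'c::real_normed_vector"
  assumes "smooth_on UNIV f"
  shows "iter_deriv vs (\<lambda>w. f (w, s)) w = iter_deriv (map (\<lambda>v. (v, 0)) vs) f (w, s)"
proof (induction vs arbitrary: w)
  case (Cons v vs)
  let ?g = "iter_deriv (map (\<lambda>v. (v, 0)) vs) f"
  have d: "(?g has_derivative frechet_derivative ?g (at (w, s))) (at (w, s))"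
    by (rule smooth_on_has_derivative[OF smooth_on_iter_deriv[OF assms]]) auto
  have "((\<lambda>w. (w, s)) has_derivative (\<lambda>v. (v, 0))) (at w)" by (auto intro!: derivative_eq_intros)
  from frechet_at_eqI[OF diff_chain_at[OF this d]]
  have "dd v (\<lambda>w. ?g (w, s)) w = dd (v, 0) ?g (w, s)" by (simp add: o_def)
  moreover have "iter_deriv vs (\<lambda>w. f (w, s)) = (\<lambda>w. ?g (w, s))" using Cons.IH by (rule ext)
  ultimately show ?case by (simp only: iter_deriv.simps list.map)
qed simp

text \<open>In the strong topology a perturbation has to stay below an arbitrary positive continuous
  bound, also at infinity; it therefore has to vanish off the compact set \<open>C\<close>, and on
  \<open>C\<close> the tube lemma gives uniformity in w. The induction follows the generation of
  open sets from the subbasis.\<close>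

lemma whitney_small_perturbation:
  fixes f :: "'a::euclidean_space \<times> 'b::euclidean_space \<Rightarrow> 'c::real_normed_vector"
  assumes sm: "smooth_on UNIV f" and C: "compact C" "\<And>w s. w \<notin> C \<Longrightarrow> f (w, s) = f (w, 0)"
    and V: "openin whitney_topology V" "(\<lambda>w. f (w, 0)) \<in> V"
  shows "\<forall>\<^sub>F s in nhds 0. (\<lambda>w. f (w, s)) \<in> V"
proof -
  have sl: "smooth_on UNIV (\<lambda>w. f (w, s))" for s
    by (rule smooth_on_compose[OF sm]) (auto intro!: smooth_intros)
  have "generate_topology_on {whitney_nbhd g k \<delta> | g k \<delta>.
        smooth_on UNIV g \<and> continuous_on UNIV \<delta> \<and> (\<forall>x. 0 < \<delta> x)} V"
    using V(1) unfolding whitney_topology_def openin_topology_generated_by_iff .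
  then show ?thesis using V(2)
  proof induction
    case Empty then show ?case by simp
  next
    case (Int a b) then show ?case by (auto intro: eventually_elim2)
  next
    case (UN K)
    then obtain k where "k \<in> K" "(\<lambda>w. f (w, 0)) \<in> k" by blast
    then have "\<forall>\<^sub>F s in nhds 0. (\<lambda>w. f (w, s)) \<in> k" using UN by blast
    then show ?case by eventually_elim (use \<open>k \<in> K\<close> in blast)
  next
    case (Basis W)
    then obtain g k \<delta> where W: "W = whitney_nbhd g k \<delta>" "smooth_on UNIV g" "continuous_on UNIV \<delta>" "\<forall>x. 0 < \<delta> x" by blast
    let ?L = "{vs :: 'a list. set vs \<subseteq> Basis \<and> length vs \<le> k}"
    have fin: "finite ?L" by (rule finite_lists_length_le) simp
    have *: "\<forall>\<^sub>F s in nhds 0. \<forall>w. norm (iter_deriv vs (\<lambda>w. f (w, s)) w - iter_deriv vs g w) < \<delta> w" if vs: "vs \<in> ?L" for vs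
    proof -
      let ?h = "\<lambda>p. \<delta> (fst p) - norm (iter_deriv (map (\<lambda>v. (v, 0)) vs) f p - iter_deriv vs g (fst p))"
      have c1: "continuous_on UNIV (iter_deriv (map (\<lambda>v. (v, 0)) vs) f)" "continuous_on UNIV (iter_deriv vs g)"
        using smooth_on_continuous_on[OF smooth_on_iter_deriv open_UNIV] sm W(2) by blast+
      have "continuous_on UNIV ?h"
        by (intro continuous_intros c1 continuous_on_compose2[OF W(3)] continuous_on_compose2[OF c1(2)]) auto
      moreover have 0: "norm (iter_deriv vs (\<lambda>w. f (w, 0)) w - iter_deriv vs g w) < \<delta> w" for w
        using Basis.prems vs W(1) by (simp add: whitney_nbhd_def)
      moreover have "?h (w, 0) > 0" for w
        using 0[of w] unfolding iter_deriv_slice[OF sm, of vs 0 w] by simp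
      ultimately have "\<forall>\<^sub>F s in nhds 0. \<forall>w\<in>C. ?h (w, s) > 0"
        by (intro tube C(1)) blast+
      then show ?thesis
      proof eventually_elim
        case (elim s)
        show ?case
        proof
          fix w
          show "norm (iter_deriv vs (\<lambda>w. f (w, s)) w - iter_deriv vs g w) < \<delta> w"
          proof (cases "w \<in> C")
            case True
            from bspec[OF elim True]
            have "norm (iter_deriv (map (\<lambda>v. (v, 0)) vs) f (w, s) - iter_deriv vs g w) < \<delta> w"
              unfolding fst_conv by linarith
            then show ?thesis unfolding iter_deriv_slice[OF sm, of vs s w] .
          next
            case False
            \<comment> \<open>Equality holds on the open complement and not only at w, so all
              derivatives at w agree.\<close>
            have "open (- C)" using C(1) by (simp add: compact_imp_closed open_Compl)
            then have "iter_deriv vs (\<lambda>w. f (w, s)) w = iter_deriv vs (\<lambda>w. f (w, 0)) w"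
              by (rule iter_deriv_cong) (use C(2)[of _ s] False in auto)
            then show ?thesis using 0 by simp
          qed
        qed
      qed
    qed
    have "\<forall>\<^sub>F s in nhds 0. \<forall>vs\<in>?L. \<forall>w. norm (iter_deriv vs (\<lambda>w. f (w, s)) w - iter_deriv vs g w) < \<delta> w"
      by (intro eventually_ball_finite[OF fin] ballI *)
    then show ?case
      unfolding W(1) whitney_nbhd_def by eventually_elim (use sl in auto)
  qed
qed

section \<open>Combining generic properties\<close>

lemma generic_conj:
  assumes "generic P" "generic Q" shows "generic (\<lambda>f. P f \<and> Q f)"
proof -
  obtain U V where *: "countable U" "countable V" "\<forall>W\<in>U. openin whitney_topology W \<and> whitney_topology closure_of W = topspace whitney_topology"
    "\<forall>W\<in>V. openin whitney_topology W \<and> whitney_topology closure_of W = topspace whitney_topology"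
    "topspace whitney_topology \<inter> \<Inter>U \<subseteq> {f. P f}" "topspace whitney_topology \<inter> \<Inter>V \<subseteq> {f. Q f}"
    using assms unfolding generic_def residual_in_def by blast
  have "countable (U \<union> V)" using * by blast
  moreover have "topspace whitney_topology \<inter> \<Inter>(U \<union> V) \<subseteq> {f. P f \<and> Q f}" using * by blast
  ultimately show ?thesis unfolding generic_def residual_in_def using * by (intro exI[of _ "U \<union> V"]) blast
qed

lemma generic_mono:
  assumes "generic P" "\<And>f. smooth_on UNIV f \<Longrightarrow> P f \<Longrightarrow> Q f" shows "generic Q"
proof -
  obtain U where *: "countable U" "\<forall>W\<in>U. openin whitney_topology W \<and> whitney_topology closure_of W = topspace whitney_topology"
    "topspace whitney_topology \<inter> \<Inter>U \<subseteq> {f. P f}"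
    using assms unfolding generic_def residual_in_def by blast
  have "topspace whitney_topology \<inter> \<Inter>U \<subseteq> {f. Q f}"
    using *(3) assms(2) unfolding topspace_whitney by blast
  then show ?thesis unfolding generic_def residual_in_def using * by blast
qed

section \<open>A jet criterion for genericity\<close>

lemma vec_of_Basis: "vec_of d \<in> Basis"
  by (cases d) (auto simp: Basis_prod_def zero_prod_def)

lemma jet_of_linear:
  assumes "smooth_on UNIV B" "bounded_linear L"
  shows "jet_of (\<lambda>w. L (B w)) w vs = L (iter_deriv (map vec_of vs) B w)"
  unfolding jet_of_def
proof (induction vs arbitrary: w)
  case (Cons d vs)
  let ?g = "iter_deriv (map vec_of vs) B"
  have d: "(?g has_derivative frechet_derivative ?g (at w)) (at w)"
    by (rule smooth_on_has_derivative[OF smooth_on_iter_deriv[OF assms(1)]]) auto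
  have "iter_deriv (map vec_of vs) (\<lambda>w. L (B w)) = (\<lambda>w. L (?g w))" using Cons.IH by (rule ext)
  then show ?case using frechet_at_eqI[OF bounded_linear.has_derivative[OF assms(2) d]] by simp
qed simp

lemma tendsto_det:
  fixes M :: "nat \<Rightarrow> real^'n^'n"
  assumes "\<And>i j. (\<lambda>n. M n $ i $ j) \<longlonglongrightarrow> M' $ i $ j"
  shows "(\<lambda>n. det (M n)) \<longlonglongrightarrow> det M'"
  unfolding det_def by (intro tendsto_intros assms)

definition dir3 :: "3 \<Rightarrow> dir" where
  "dir3 d = (if d = 1 then DX else if d = 2 then DY else DE)"

text \<open>Rows are conditions, columns perturbation parameters: the derivative in s, at s = 0, of
  the conditions for the perturbed pair.\<close>

definition Mat :: "plane \<Rightarrow> real \<Rightarrow> ('m::finite \<Rightarrow> dpoly) \<Rightarrow> ('m \<Rightarrow> dpoly) \<Rightarrow> ('m \<Rightarrow> dpoly) \<Rightarrow> bide_family \<Rightarrow> plane \<times> real \<Rightarrow> real^'m^'m" where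
  "Mat z0 \<kappa> h k \<Theta> A w = (\<chi> i j. evf z0 (Uf A) (Vf \<kappa> A) (lin (h j) (k j) (\<Theta> i)) w)"

definition Jac :: "plane \<Rightarrow> real \<Rightarrow> ('m::finite \<Rightarrow> dpoly) \<Rightarrow> bide_family \<Rightarrow> plane \<times> real \<Rightarrow> real^3^'m" where
  "Jac z0 \<kappa> \<Theta> A w = (\<chi> i d. evf z0 (Uf A) (Vf \<kappa> A) (fD (dir3 d) (\<Theta> i)) w)"

text \<open>The bounds by \<open>1 / Suc n\<close> turn the conditions on \<open>w\<close> into compact ones, so that the set is open.\<close>

definition regular_set :: "nat \<Rightarrow> plane \<Rightarrow> real \<Rightarrow> ('m::finite \<Rightarrow> dpoly) \<Rightarrow> ('m \<Rightarrow> dpoly) \<Rightarrow> ('m \<Rightarrow> dpoly) \<Rightarrow> bide_family set" where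
  "regular_set n z0 \<kappa> h k \<Theta> = {A. smooth_on UNIV A \<and> (\<forall>w\<in>cball 0 (real n).
     \<bar>cc A w\<bar> \<ge> 1 / Suc n \<longrightarrow> \<kappa> * disc A w \<ge> 1 / Suc n \<longrightarrow> \<bar>det (Mat z0 \<kappa> h k \<Theta> A w)\<bar> \<ge> 1 / Suc n \<longrightarrow>
     (\<forall>i. evf z0 (Uf A) (Vf \<kappa> A) (\<Theta> i) w = 0) \<longrightarrow> det (Jac z0 \<kappa> \<Theta> A w ** transpose (Jac z0 \<kappa> \<Theta> A w)) \<noteq> 0)}"

text \<open>If no basic neighbourhood of \<open>A\<close> lay in the set, there would be equations
  whose jets converge to those of \<open>A\<close> and which violate the condition at points of a
  compact ball. The violation consists of equalities and non-strict inequalities, so a limit of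
  these points violates it for \<open>A\<close>.\<close>

lemma openin_regular_set: "openin whitney_topology (regular_set n z0 \<kappa> h k \<Theta>)"
proof (subst openin_subopen, intro ballI)
  fix A assume A: "A \<in> regular_set n z0 \<kappa> h k \<Theta>"
  then have smA: "smooth_on UNIV A" by (simp add: regular_set_def)
  have "\<exists>j. whitney_nbhd A j (\<lambda>_. 1 / Suc j) \<subseteq> regular_set n z0 \<kappa> h k \<Theta>"
  proof (rule ccontr)
    assume "\<nexists>j. whitney_nbhd A j (\<lambda>_. 1 / Suc j) \<subseteq> regular_set n z0 \<kappa> h k \<Theta>"
    then have "\<forall>j. \<exists>B. B \<in> whitney_nbhd A j (\<lambda>_. 1 / Suc j) \<and> B \<notin> regular_set n z0 \<kappa> h k \<Theta>" by blast
    then obtain B where B: "\<And>j. B j \<in> whitney_nbhd A j (\<lambda>_. 1 / Suc j)" "\<And>j. B j \<notin> regular_set n z0 \<kappa> h k \<Theta>" by metis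
    have smB: "smooth_on UNIV (B j)" for j using B(1)[of j] by (simp add: whitney_nbhd_def)
    let ?P = "\<lambda>A w. \<bar>cc A w\<bar> \<ge> 1 / Suc n \<and> \<kappa> * disc A w \<ge> 1 / Suc n \<and> \<bar>det (Mat z0 \<kappa> h k \<Theta> A w)\<bar> \<ge> 1 / Suc n \<and>
       (\<forall>i. evf z0 (Uf A) (Vf \<kappa> A) (\<Theta> i) w = 0) \<and> det (Jac z0 \<kappa> \<Theta> A w ** transpose (Jac z0 \<kappa> \<Theta> A w)) = 0"
    have "\<exists>w. w \<in> cball 0 (real n) \<and> ?P (B j) w" for j
      using B(2)[of j] smB[of j] unfolding regular_set_def by blast
    then obtain w where w: "\<And>j. w j \<in> cball 0 (real n)" "\<And>j. ?P (B j) (w j)" by metis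
    obtain w' r where w': "w' \<in> cball 0 (real n)" and r: "strict_mono (r :: nat \<Rightarrow> nat)" and lim: "(w \<circ> r) \<longlonglongrightarrow> w'"
      using compact_cball[of "0 :: plane \<times> real" "real n"] w(1) unfolding compact_def by blast
    define C where "C j = B (r j)" for j
    define x where "x j = w (r j)" for j
    have x: "x \<longlonglongrightarrow> w'" using lim by (simp add: x_def[abs_def] o_def)
    have smC: "smooth_on UNIV (C j)" for j by (simp add: C_def smB)
    have PC: "?P (C j) (x j)" for j unfolding C_def x_def by (rule w(2))
    have jets: "(\<lambda>j. iter_deriv (map vec_of vs) (C j) (x j)) \<longlonglongrightarrow> iter_deriv (map vec_of vs) A w'" for vs
    proof -
      let ?vs = "map vec_of vs"
      \<comment> \<open>The j-th neighbourhood controls j derivatives, so a fixed list of directions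
        is controlled from its length on.\<close>
      have 1: "\<forall>\<^sub>F j in sequentially. norm (iter_deriv ?vs (C j) (x j) - iter_deriv ?vs A (x j)) \<le> 1 / Suc j"
        unfolding eventually_sequentially
      proof (intro exI[of _ "length vs"] allI impI)
        fix j assume "length vs \<le> j"
        moreover have rj: "j \<le> r j" using r by (rule seq_suble)
        ultimately have "length ?vs \<le> r j" by simp
        moreover have "set ?vs \<subseteq> Basis" using vec_of_Basis by auto
        ultimately have "norm (iter_deriv ?vs (C j) (x j) - iter_deriv ?vs A (x j)) < 1 / Suc (r j)"
          using B(1)[of "r j"] unfolding whitney_nbhd_def C_def by blast
        also have "\<dots> \<le> 1 / Suc j" using rj by (simp add: frac_le)
        finally show "norm (iter_deriv ?vs (C j) (x j) - iter_deriv ?vs A (x j)) \<le> 1 / Suc j" by simp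
      qed
      have "(\<lambda>j. 1 / real (Suc j)) \<longlonglongrightarrow> 0" using LIMSEQ_Suc[OF lim_1_over_n] by simp
      then have "(\<lambda>j. iter_deriv ?vs (C j) (x j) - iter_deriv ?vs A (x j)) \<longlonglongrightarrow> 0"
        by (rule Lim_null_comparison[OF 1])
      moreover have "(\<lambda>j. iter_deriv ?vs A (x j)) \<longlonglongrightarrow> iter_deriv ?vs A w'"
      proof (rule isCont_tendsto_compose[OF _ x])
        show "isCont (iter_deriv ?vs A) w'"
          using smooth_on_continuous_on[OF smooth_on_iter_deriv[OF smA] open_UNIV, of ?vs]
          unfolding continuous_on_eq_continuous_at[OF open_UNIV] by blast
      qed
      ultimately show ?thesis using tendsto_add by fastforce
    qed
    have bl: "bounded_linear (\<lambda>v::real \<times> real \<times> real. fst v)" "bounded_linear (\<lambda>v::real \<times> real \<times> real. fst (snd v))" "bounded_linear (\<lambda>v::real \<times> real \<times> real. snd (snd v))"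
      by (intro bounded_linear_fst bounded_linear_compose[OF bounded_linear_fst bounded_linear_snd] bounded_linear_compose[OF bounded_linear_snd bounded_linear_snd])+
    have cj: "(\<lambda>j. jet_of (ca (C j)) (x j) vs) \<longlonglongrightarrow> jet_of (ca A) w' vs"
      "(\<lambda>j. jet_of (cb (C j)) (x j) vs) \<longlonglongrightarrow> jet_of (cb A) w' vs"
      "(\<lambda>j. jet_of (cc (C j)) (x j) vs) \<longlonglongrightarrow> jet_of (cc A) w' vs" for vs
      unfolding jet_of_linear[OF smC bl(1)] jet_of_linear[OF smC bl(2)] jet_of_linear[OF smC bl(3)]
        jet_of_linear[OF smA bl(1)] jet_of_linear[OF smA bl(2)] jet_of_linear[OF smA bl(3)]
      by (intro tendsto_intros jets)+
    have v: "(\<lambda>j. ca (C j) (x j)) \<longlonglongrightarrow> ca A w'" "(\<lambda>j. cb (C j) (x j)) \<longlonglongrightarrow> cb A w'" "(\<lambda>j. cc (C j) (x j)) \<longlonglongrightarrow> cc A w'"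
      using cj[of "[]"] by (simp_all add: jet_of_def)
    have "1 / Suc n \<le> \<bar>cc A w'\<bar>"
      by (rule tendsto_lowerbound[OF tendsto_rabs[OF v(3)]]) (use PC in auto)
    moreover have "(\<lambda>j. \<kappa> * disc (C j) (x j)) \<longlonglongrightarrow> \<kappa> * disc A w'"
      unfolding disc_def by (intro tendsto_intros v)
    then have "1 / Suc n \<le> \<kappa> * disc A w'"
      by (rule tendsto_lowerbound) (use PC in auto)
    ultimately have A1: "1 / Suc n \<le> \<bar>cc A w'\<bar>" "1 / Suc n \<le> \<kappa> * disc A w'" by auto
    have pos: "0 < 1 / real (Suc n)" by simp
    \<comment> \<open>The bounds away from 0 survive in the limit and keep w' in the domain where U
      and V depend smoothly on the coefficients.\<close>
    have domA: "w' \<in> ddom \<kappa> A" using A1 pos unfolding ddom_def by (metis (mono_tags, lifting) abs_zero less_le_trans mem_Collect_eq not_less)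
    have domC: "x j \<in> ddom \<kappa> (C j)" for j
      using PC[of j] pos unfolding ddom_def by (metis (mono_tags, lifting) abs_zero less_le_trans mem_Collect_eq not_less)
    have uv: "(\<lambda>j. jet_of (Uf (C j)) (x j) vs) \<longlonglongrightarrow> jet_of (Uf A) w' vs"
      "(\<lambda>j. jet_of (Vf \<kappa> (C j)) (x j) vs) \<longlonglongrightarrow> jet_of (Vf \<kappa> A) w' vs" for vs
      by (rule UV_tendsto[OF smC smA domC domA cj order_refl])+
    have evt: "(\<lambda>j. evf z0 (Uf (C j)) (Vf \<kappa> (C j)) e (x j)) \<longlonglongrightarrow> evf z0 (Uf A) (Vf \<kappa> A) e w'" for e
      unfolding evf_def by (rule ev_tendsto[OF uv]) (intro tendsto_intros x)+
    have "(\<lambda>j. \<bar>det (Mat z0 \<kappa> h k \<Theta> (C j) (x j))\<bar>) \<longlonglongrightarrow> \<bar>det (Mat z0 \<kappa> h k \<Theta> A w')\<bar>"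
      by (intro tendsto_rabs tendsto_det) (simp add: Mat_def evt)
    then have A2: "1 / Suc n \<le> \<bar>det (Mat z0 \<kappa> h k \<Theta> A w')\<bar>"
      by (rule tendsto_lowerbound) (use PC in auto)
    have A3: "evf z0 (Uf A) (Vf \<kappa> A) (\<Theta> i) w' = 0" for i
      using LIMSEQ_unique[OF evt[of "\<Theta> i"]] PC by simp
    have "(\<lambda>j. det (Jac z0 \<kappa> \<Theta> (C j) (x j) ** transpose (Jac z0 \<kappa> \<Theta> (C j) (x j)))) \<longlonglongrightarrow>
        det (Jac z0 \<kappa> \<Theta> A w' ** transpose (Jac z0 \<kappa> \<Theta> A w'))"
      by (rule tendsto_det) (simp add: matrix_matrix_mult_def transpose_def Jac_def, intro tendsto_intros evt)
    then have A4: "det (Jac z0 \<kappa> \<Theta> A w' ** transpose (Jac z0 \<kappa> \<Theta> A w')) = 0"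
      using PC LIMSEQ_unique[OF _ tendsto_const] by simp
    show False using A w' A1 A2 A3 A4 unfolding regular_set_def by blast
  qed
  then obtain j where "whitney_nbhd A j (\<lambda>_. 1 / Suc j) \<subseteq> regular_set n z0 \<kappa> h k \<Theta>" by blast
  then show "\<exists>T. openin whitney_topology T \<and> A \<in> T \<and> T \<subseteq> regular_set n z0 \<kappa> h k \<Theta>"
    using openin_whitney_nbhd[OF smA, of "\<lambda>_. 1 / Suc j" j] by (intro exI[of _ "whitney_nbhd A j (\<lambda>_. 1 / Suc j)"]) auto
qed

lemma smooth_on_vec:
  fixes f :: "'m::finite \<Rightarrow> 'a::real_normed_vector \<Rightarrow> real"
  assumes "open S" "\<And>i. smooth_on S (f i)"
  shows "smooth_on S (\<lambda>x. \<chi> i. f i x)"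
proof -
  have "smooth_on S (\<lambda>x. \<Sum>i\<in>UNIV. f i x *\<^sub>R axis i (1::real))"
    by (intro smooth_intros assms)
  moreover have "(\<Sum>i\<in>UNIV. f i x *\<^sub>R axis i (1::real)) = (\<chi> i. f i x)" for x
    by (simp add: vec_eq_iff axis_def if_distrib[of "\<lambda>t. _ * t"] cong: if_cong)
  ultimately show ?thesis by simp
qed

lemma dd_vec_nth:
  fixes f :: "'a::real_normed_vector \<Rightarrow> real^'m"
  assumes "smooth_on S f" "open S" "x \<in> S"
  shows "dd v f x $ i = dd v (\<lambda>x. f x $ i) x"
  using fun_cong[OF frechet_at_eqI[OF bounded_linear.has_derivative[OF bounded_linear_vec_nth[of i] smooth_on_has_derivative[OF assms]]], where x = v]
  by simp

definition par_map :: "plane \<Rightarrow> ('m::finite \<Rightarrow> dpoly) \<Rightarrow> ('m \<Rightarrow> dpoly) \<Rightarrow> (plane \<times> real \<Rightarrow> real) \<Rightarrow> (plane \<times> real \<Rightarrow> real)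
    \<Rightarrow> ('m \<Rightarrow> dpoly) \<Rightarrow> (plane \<times> real) \<times> (real^'m) \<Rightarrow> real^'m" where
  "par_map z0 h k U V \<Theta> p = (\<chi> i. evj z0 h k U V (\<Theta> i) p)"

context
  fixes z0 :: plane and h k :: "'m::finite \<Rightarrow> dpoly" and U V :: "plane \<times> real \<Rightarrow> real" and \<Theta> :: "'m \<Rightarrow> dpoly" and S :: "(plane \<times> real) set"
  assumes S: "open S" and U: "smooth_on S U" and V: "smooth_on S V"
    and pure: "\<And>j. pure (h j)" "\<And>j. pure (k j)"
begin

lemma smooth_par_map: "smooth_on (S \<times> UNIV) (par_map z0 h k U V \<Theta>)"
  unfolding par_map_def[abs_def]
  by (intro smooth_on_vec smooth_evj S U V open_Times open_UNIV)

lemma par_map_derivative_w: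
  assumes w: "w \<in> S"
  shows "dd (u, 0) (par_map z0 h k U V \<Theta>) (w, s) $ i =
    dd u (evf z0 (\<lambda>w. U w + pert z0 h s w) (\<lambda>w. V w + pert z0 k s w) (\<Theta> i)) w"
proof -
  let ?F = "evj z0 h k U V (\<Theta> i)"
  have o: "open (S \<times> (UNIV :: (real^'m) set))" by (intro open_Times S open_UNIV)
  have in': "(w, s) \<in> S \<times> UNIV" using w by simp
  have d: "(?F has_derivative frechet_derivative ?F (at (w, s))) (at (w, s))"
    by (rule smooth_on_has_derivative[OF smooth_evj[OF S U V] o in'])
  have "((\<lambda>w. (w, s)) has_derivative (\<lambda>v. (v, 0))) (at w)" by (auto intro!: derivative_eq_intros)
  from diff_chain_at[OF this d] have "((\<lambda>w. ?F (w, s)) has_derivative (\<lambda>v. dd (v, 0) ?F (w, s))) (at w)"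
    by (simp add: o_def)
  then have "((evf z0 (\<lambda>w. U w + pert z0 h s w) (\<lambda>w. V w + pert z0 k s w) (\<Theta> i)) has_derivative (\<lambda>v. dd (v, 0) ?F (w, s))) (at w)"
    by (rule has_derivative_transform_within_open[OF _ S w]) (rule evj_eq_evf[OF S U V])
  from fun_cong[OF frechet_at_eqI[OF this], of u]
  show ?thesis unfolding dd_vec_nth[OF smooth_par_map o in'] by (simp add: par_map_def)
qed

lemma par_map_derivative_s:
  assumes w: "w \<in> S"
  shows "dd (0, v) (par_map z0 h k U V \<Theta>) (w, s) =
    (\<chi> i j. evj z0 h k U V (lin (h j) (k j) (\<Theta> i)) (w, s)) *v v"
proof (rule vec_eq_iff[THEN iffD2], rule allI)
  fix i
  let ?F = "evj z0 h k U V (\<Theta> i)"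
  have o: "open (S \<times> (UNIV :: (real^'m) set))" by (intro open_Times S open_UNIV)
  have in': "(w, s) \<in> S \<times> UNIV" using w by simp
  note smF = smooth_evj[OF S U V, of z0 h k "\<Theta> i"]
  have lin: "linear (frechet_derivative ?F (at (w, s)))" by (rule smooth_on_linear[OF smF o in'])
  have ax: "dd (0, axis j 1) ?F (w, s) = evj z0 h k U V (lin (h j) (k j) (\<Theta> i)) (w, s)" for j
  proof -
    have "((\<lambda>t. ?F ((w, s) + t *\<^sub>R (0, axis j 1))) has_real_derivative dd (0, axis j 1) ?F (w, s)) (at 0)"
      by (rule line_derivative_0[OF smF o in'])
    moreover have "(w, s) + t *\<^sub>R (0, axis j 1) = (w, s + t *\<^sub>R axis j 1)" for t by simp
    ultimately have "((\<lambda>t. ?F (w, s + t *\<^sub>R axis j 1)) has_real_derivative dd (0, axis j 1) ?F (w, s)) (at 0)"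
      by (simp only:)
    from DERIV_unique[OF this evj_param_derivative[where t=0, OF pure]] show ?thesis by simp
  qed
  have "(0, v) = (\<Sum>j\<in>UNIV. v $ j *\<^sub>R (0::plane \<times> real, axis j 1))"
  proof -
    have "(\<Sum>j\<in>UNIV. v $ j *\<^sub>R (0::plane \<times> real, axis j 1)) = (0, \<Sum>j\<in>UNIV. v $ j *\<^sub>R axis j 1)"
      by (simp add: prod_eq_iff fst_sum snd_sum)
    also have "(\<Sum>j\<in>UNIV. v $ j *\<^sub>R axis j 1) = v"
      by (simp add: vec_eq_iff axis_def if_distrib[of "\<lambda>t. _ * t"] cong: if_cong)
    finally show ?thesis by simp
  qed
  then have "dd (0, v) ?F (w, s) = dd (\<Sum>j\<in>UNIV. v $ j *\<^sub>R (0, axis j 1)) ?F (w, s)" by simp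
  also have "\<dots> = (\<Sum>j\<in>UNIV. v $ j * dd (0, axis j 1) ?F (w, s))"
    by (simp add: linear_sum[OF lin] linear_scale[OF lin] del: scaleR_Pair)
  also have "\<dots> = ((\<chi> i j. evj z0 h k U V (lin (h j) (k j) (\<Theta> i)) (w, s)) *v v) $ i"
    by (simp add: matrix_vector_mult_def ax mult.commute)
  finally show "dd (0, v) (par_map z0 h k U V \<Theta>) (w, s) $ i = \<dots>"
    unfolding dd_vec_nth[OF smooth_par_map o in'] by (simp add: par_map_def)
qed

end

text \<open>The perturbation of the coefficients that adds \<open>\<chi> h\<close> and \<open>\<chi> k\<close> to \<open>Uf\<close> and \<open>Vf\<close>; \<open>sq\<close> stands
  for \<open>\<chi> \<surd>(\<kappa> disc)\<close>, which is smooth everywhere although the root is not.\<close>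

definition family :: "real \<Rightarrow> bide_family \<Rightarrow> (plane \<times> real \<Rightarrow> real) \<Rightarrow> (plane \<times> real) \<times> 's
   \<Rightarrow> real \<Rightarrow> real \<Rightarrow> real \<times> real \<times> real" where
  "family \<kappa> A bump p e1 e2 = (let w = fst p; x = bump w in
     (ca A w - 2 * cb A w * x * e1 - 2 * \<kappa> * (x * sqrt (\<kappa> * disc A w)) * e2 + cc A w * x\<^sup>2 * (e1\<^sup>2 - \<kappa> * e2\<^sup>2),
      cb A w - cc A w * x * e1, cc A w))"

lemma smooth_bump_sqrt:
  assumes A: "smooth_on UNIV A" and bump: "smooth_on UNIV bump" and C: "compact C" "C \<subseteq> ddom \<kappa> A" "\<And>w. w \<notin> C \<Longrightarrow> bump w = 0"
  shows "smooth_on UNIV (\<lambda>w. bump w * sqrt (\<kappa> * disc A w))"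
proof (rule smooth_on_local)
  fix w
  show "\<exists>T. open T \<and> w \<in> T \<and> smooth_on T (\<lambda>w. bump w * sqrt (\<kappa> * disc A w))"
  proof (cases "w \<in> C")
    case True
    have "smooth_on (ddom \<kappa> A) (\<lambda>w. bump w * sqrt (\<kappa> * disc A w))"
      by (intro smooth_intros open_ddom[OF A] smooth_coeffs[OF A] smooth_on_subset[OF bump]) (auto simp: ddom_def)
    then show ?thesis using True C(2) open_ddom[OF A] by blast
  next
    case False
    have o: "open (- C)" using C(1) by (simp add: compact_imp_closed open_Compl)
    have "smooth_on (- C) (\<lambda>w. bump w * sqrt (\<kappa> * disc A w))"
      by (rule smooth_on_cong[OF o _ smooth_on_const[of _ 0]]) (use C(3) in auto)
    then show ?thesis using o False by blast
  qed
qed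

text \<open>This identity dictates the first coefficient in \<open>family\<close>: the new
  discriminant becomes, up to \<kappa>, a perfect square. As long as the base of the square is
  positive, the root grows by c x e2 and V by x e2.\<close>

lemma discriminant_family:
  assumes \<kappa>: "\<kappa> \<in> {1, -1::real}" and pos: "\<kappa> * (b\<^sup>2 - a * c) \<ge> 0"
  shows "\<kappa> * ((b - c * x * e1)\<^sup>2 - (a - 2 * b * x * e1 - 2 * \<kappa> * (x * sqrt (\<kappa> * (b\<^sup>2 - a * c))) * e2 + c * x\<^sup>2 * (e1\<^sup>2 - \<kappa> * e2\<^sup>2)) * c)
    = (sqrt (\<kappa> * (b\<^sup>2 - a * c)) + c * (x * e2))\<^sup>2"
proof -
  have k: "\<kappa> * \<kappa> = 1" using \<kappa> by auto
  define q where "q = sqrt (\<kappa> * (b\<^sup>2 - a * c))"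
  have q: "q * q = \<kappa> * (b\<^sup>2 - a * c)" using pos by (simp add: q_def)
  have "\<kappa> * ((b - c * x * e1)\<^sup>2 - (a - 2 * b * x * e1 - 2 * \<kappa> * (x * q) * e2 + c * x\<^sup>2 * (e1\<^sup>2 - \<kappa> * e2\<^sup>2)) * c)
     = \<kappa> * (b\<^sup>2 - a * c) + 2 * (\<kappa> * \<kappa>) * c * x * q * e2 + (\<kappa> * \<kappa>) * (c * x * e2)\<^sup>2"
    by (simp add: power2_eq_square algebra_simps)
  also have "\<dots> = q * q + 2 * c * x * q * e2 + (c * x * e2)\<^sup>2" using k q by simp
  also have "\<dots> = (q + c * (x * e2))\<^sup>2" by (simp add: power2_eq_square algebra_simps)
  finally show ?thesis unfolding q_def .
qed

text \<open>For small parameters the family stays in the given open set. Almost all parameters are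
  transverse over the neighbourhood \<open>N\<close> of \<open>K\<close>, where the cutoff is 1 and
  the perturbation of U and V is exactly polynomial.\<close>

lemma dense_regular_set:
  fixes h k \<Theta> :: "'m::{finite,wellorder} \<Rightarrow> dpoly"
  assumes \<kappa>: "\<kappa> \<in> {1, -1}" and card: "3 \<le> CARD('m)" and pure: "\<And>j. pure (h j)" "\<And>j. pure (k j)"
  shows "whitney_topology closure_of (regular_set n z0 \<kappa> h k \<Theta>) = topspace whitney_topology"
proof (rule antisym[OF closure_of_subset_topspace], rule subsetI)
  fix A :: bide_family assume "A \<in> topspace whitney_topology"
  then have A: "smooth_on UNIV A" by (simp add: topspace_whitney)
  show "A \<in> whitney_topology closure_of (regular_set n z0 \<kappa> h k \<Theta>)"
    unfolding in_closure_of
  proof (intro conjI allI impI)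
    show "A \<in> topspace whitney_topology" using A by (simp add: topspace_whitney)
    fix T :: "bide_family set" assume T: "A \<in> T \<and> openin whitney_topology T"
    have cont: "continuous_on X (cc A)" "continuous_on X (disc A)" for X
      using smooth_on_continuous_on[OF smooth_coeffs(3)[OF A] open_UNIV]
        smooth_on_continuous_on[OF smooth_coeffs(4)[OF A] open_UNIV] continuous_on_subset by blast+
    \<comment> \<open>Half of the bound for the discriminant is a safety margin: if the discriminant
      changes by less than 1/(2(n+1)), every point to be tested for the perturbed equation lies in
      \<open>K\<close>. The coefficient c is left unchanged by \<open>family\<close>.\<close>
    define K where "K = {w \<in> cball 0 (real n). \<bar>cc A w\<bar> \<ge> 1 / Suc n \<and> \<kappa> * disc A w \<ge> 1 / (2 * Suc n)}"
    have K: "compact K"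
    proof -
      have "K = cball 0 (real n) \<inter> ({w. 1 / Suc n \<le> \<bar>cc A w\<bar>} \<inter> {w. 1 / (2 * Suc n) \<le> \<kappa> * disc A w})"
        by (auto simp: K_def)
      moreover have "closed ({w. 1 / Suc n \<le> \<bar>cc A w\<bar>} \<inter> {w. 1 / (2 * Suc n) \<le> \<kappa> * disc A w})"
        by (intro closed_Int closed_Collect_le continuous_intros cont)
      ultimately show ?thesis by (simp add: compact_Int_closed)
    qed
    have Kdom: "K \<subseteq> ddom \<kappa> A"
    proof
      fix w assume "w \<in> K"
      then have 1: "1 / real (Suc n) \<le> \<bar>cc A w\<bar>" "1 / real (2 * Suc n) \<le> \<kappa> * disc A w" by (auto simp: K_def)
      have "0 < \<bar>cc A w\<bar>" by (rule less_le_trans[OF _ 1(1)]) simp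
      moreover have "0 < \<kappa> * disc A w" by (rule less_le_trans[OF _ 1(2)]) simp
      ultimately have "\<bar>cc A w\<bar> > 0" "\<kappa> * disc A w > 0" .
      then show "w \<in> ddom \<kappa> A" by (simp add: ddom_def)
    qed
    obtain bump :: "plane \<times> real \<Rightarrow> real" and N C where bump: "smooth_on UNIV bump" and N: "open N" "K \<subseteq> N" "\<And>x. x \<in> N \<Longrightarrow> bump x = 1"
      and C: "compact C" "C \<subseteq> ddom \<kappa> A" "\<And>x. x \<notin> C \<Longrightarrow> bump x = 0" "N \<subseteq> C"
      using bump_exists[OF K open_ddom[OF A] Kdom] by blast
    have Ndom: "N \<subseteq> ddom \<kappa> A" using C by blast
    define H where "H p = pert z0 h (snd p) (fst p)" for p :: "(plane \<times> real) \<times> (real,'m) vec"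
    define G where "G p = pert z0 k (snd p) (fst p)" for p :: "(plane \<times> real) \<times> (real,'m) vec"
    define fam where "fam p = family \<kappa> A bump p (H p) (G p)" for p
    have lift: "smooth_on UNIV (\<lambda>p :: (plane \<times> real) \<times> (real,'m) vec. f (fst p))" if "smooth_on UNIV f" for f :: "_ \<Rightarrow> real"
      by (rule smooth_on_compose[OF that]) (auto intro!: smooth_intros)
    have smp: "smooth_on UNIV (\<lambda>p. pert z0 g (snd p) (fst p))" for g :: "'m \<Rightarrow> dpoly"
      unfolding pert_def
      by (intro smooth_intros lift[OF smooth_pv] open_UNIV smooth_on_linear_comp[OF open_UNIV bounded_linear_vec_nth])
    have smHG: "smooth_on UNIV H" "smooth_on UNIV G" unfolding H_def G_def by (rule smp)+
    have smfam: "smooth_on UNIV fam"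
      unfolding fam_def family_def Let_def
      by (intro smooth_on_Pair smooth_on_add smooth_on_diff smooth_on_mult smooth_on_power smooth_on_const smHG open_UNIV
          lift[OF smooth_coeffs(1)[OF A]] lift[OF smooth_coeffs(2)[OF A]] lift[OF smooth_coeffs(3)[OF A]]
          lift[OF bump] lift[OF smooth_bump_sqrt[OF A bump C(1-3)]])
    have p0: "H (w, 0) = 0" "G (w, 0) = 0" for w by (simp_all add: H_def G_def pert_def)
    have fam0: "(\<lambda>w. fam (w, 0)) = A"
      by (simp add: fam_def family_def Let_def p0 fun_eq_iff)
    have famC: "fam (w, s) = fam (w, 0)" if "w \<notin> C" for w s
      using C(3)[OF that] by (simp add: fam_def family_def Let_def)
    have e1: "\<forall>\<^sub>F s in nhds 0. (\<lambda>w. fam (w, s)) \<in> T"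
      by (rule whitney_small_perturbation[OF smfam C(1) famC]) (use T fam0 in auto)
    define D where "D s w = disc (\<lambda>w. fam (w, s)) w" for s w
    have contD: "continuous_on UNIV (\<lambda>p. D (snd p) (fst p))"
    proof -
      have "continuous_on UNIV fam" by (rule smooth_on_continuous_on[OF smfam open_UNIV])
      then show ?thesis unfolding D_def disc_def by (simp add: continuous_intros)
    qed
    have contH: "continuous_on UNIV G" by (rule smooth_on_continuous_on[OF smHG(2) open_UNIV])
    have e2: "\<forall>\<^sub>F s in nhds 0. \<forall>w\<in>cball 0 (real n). 1 / (2 * Suc n) - \<kappa> * (D s w - disc A w) > 0"
    proof -
      have c: "continuous_on UNIV (\<lambda>p :: (plane \<times> real) \<times> (real,'m) vec. 1 / (2 * Suc n) - \<kappa> * (D (snd p) (fst p) - disc A (fst p)))"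
        by (intro continuous_intros contD continuous_on_compose2[OF cont(2)[of UNIV]]) auto
      have "\<forall>\<^sub>F s in nhds 0. \<forall>w\<in>cball 0 (real n). (\<lambda>p. 1 / (2 * Suc n) - \<kappa> * (D (snd p) (fst p) - disc A (fst p))) (w, s) > 0"
        by (rule tube[OF c compact_cball]) (simp add: D_def fam0)
      then show ?thesis by simp
    qed
    \<comment> \<open>Keeps the base of the square in \<open>discriminant_family\<close> positive,
      so that it is the root of the new discriminant and not its negative.\<close>
    have e3: "\<forall>\<^sub>F s in nhds 0. \<forall>w\<in>C. sqrt (\<kappa> * disc A w) + cc A w * (bump w * G (w, s)) > 0"
    proof -
      have cb: "continuous_on UNIV bump" by (rule smooth_on_continuous_on[OF bump open_UNIV])
      have c: "continuous_on UNIV (\<lambda>p. sqrt (\<kappa> * disc A (fst p)) + cc A (fst p) * (bump (fst p) * G p))"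
        by (intro continuous_intros contH continuous_on_compose2[OF cont(2)[of UNIV]] continuous_on_compose2[OF cont(1)[of UNIV]]
            continuous_on_compose2[OF cb]) auto
      have "\<forall>\<^sub>F s in nhds 0. \<forall>w\<in>C. (\<lambda>p. sqrt (\<kappa> * disc A (fst p)) + cc A (fst p) * (bump (fst p) * G p)) (w, s) > 0"
        by (rule tube[OF c C(1)]) (use C(2) in \<open>auto simp: p0 ddom_def subset_iff\<close>)
      then show ?thesis by simp
    qed
    from eventually_conj[OF e1 eventually_conj[OF e2 e3]]
    obtain Q where Q: "open Q" "0 \<in> Q" "\<And>s. s \<in> Q \<Longrightarrow> (\<lambda>w. fam (w, s)) \<in> T \<and>
        (\<forall>w\<in>cball 0 (real n). 1 / (2 * Suc n) - \<kappa> * (D s w - disc A w) > 0) \<and>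
        (\<forall>w\<in>C. sqrt (\<kappa> * disc A w) + cc A w * (bump w * G (w, s)) > 0)"
      unfolding eventually_nhds by blast
    have smU: "smooth_on N (Uf A)" "smooth_on N (Vf \<kappa> A)" using smooth_UV[OF A] Ndom smooth_on_subset by blast+
    let ?P = "par_map z0 h k (Uf A) (Vf \<kappa> A) \<Theta>"
    have oN: "open (N \<times> (UNIV :: (real,'m) vec set))" by (intro open_Times N(1) open_UNIV)
    have "negligible {s. \<exists>w. (w, s) \<in> N \<times> UNIV \<and> ?P (w, s) = 0 \<and> (\<forall>v. dd (0, v) ?P (w, s) = 0 \<longrightarrow> v = 0) \<and>
      \<not> surj (\<lambda>u. dd (u, 0) ?P (w, s))}"
      by (rule parametric_transversality[OF oN smooth_par_map[OF N(1) smU pure] card])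
    \<comment> \<open>A nonempty open set is not null, so it contains a parameter outside the
      exceptional set.\<close>
    moreover have "\<not> negligible Q" using open_not_negligible[OF Q(1)] Q(2) by blast
    ultimately obtain s where s: "s \<in> Q" and reg: "\<And>w. w \<in> N \<Longrightarrow> ?P (w, s) = 0 \<Longrightarrow>
        (\<And>v. dd (0, v) ?P (w, s) = 0 \<Longrightarrow> v = 0) \<Longrightarrow> surj (\<lambda>u. dd (u, 0) ?P (w, s))"
      using negligible_subset by (smt (verit, ccfv_threshold) SigmaI UNIV_I mem_Collect_eq subsetI)
    define A1 where "A1 w = fam (w, s)" for w
    have A1T: "A1 \<in> T" using Q(3)[OF s] unfolding A1_def[abs_def] by blast
    have smA1: "smooth_on UNIV A1" unfolding A1_def[abs_def]
      by (rule smooth_on_compose[OF smfam]) (auto intro!: smooth_intros)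
    have cc1: "cc A1 w = cc A w" for w by (simp add: A1_def fam_def family_def Let_def)
    have UV1: "Uf A1 w = Uf A w + pert z0 h s w \<and> Vf \<kappa> A1 w = Vf \<kappa> A w + pert z0 k s w" if w: "w \<in> N" for w
    proof
      have wd: "cc A w \<noteq> 0" "\<kappa> * disc A w > 0" using Ndom w by (auto simp: ddom_def)
      have b: "bump w = 1" by (rule N(3)[OF w])
      show "Uf A1 w = Uf A w + pert z0 h s w"
        using wd(1) unfolding Uf_def cc1 by (simp add: A1_def fam_def family_def Let_def b H_def field_simps)
      have "\<kappa> * disc A1 w = (sqrt (\<kappa> * disc A w) + cc A w * (bump w * G (w, s)))\<^sup>2"
        using discriminant_family[OF \<kappa>, of "cb A w" "ca A w" "cc A w" "bump w" "H (w, s)" "G (w, s)"] wd(2)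
        unfolding disc_def A1_def fam_def family_def Let_def fst_conv snd_conv by simp
      moreover have "sqrt (\<kappa> * disc A w) + cc A w * (bump w * G (w, s)) > 0" using Q(3)[OF s] w C(4) by blast
      ultimately have "sqrt (\<kappa> * disc A1 w) = sqrt (\<kappa> * disc A w) + cc A w * G (w, s)" using b by simp
      then show "Vf \<kappa> A1 w = Vf \<kappa> A w + pert z0 k s w"
        unfolding Vf_def cc1 using wd(1) by (simp add: G_def field_simps)
    qed
    have "A1 \<in> regular_set n z0 \<kappa> h k \<Theta>"
      unfolding regular_set_def
    proof (intro CollectI conjI ballI impI smA1)
      fix w assume w: "w \<in> cball 0 (real n)" and h1: "1 / real (Suc n) \<le> \<bar>cc A1 w\<bar>" and h2: "1 / real (Suc n) \<le> \<kappa> * disc A1 w"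
        and h3: "1 / real (Suc n) \<le> \<bar>det (Mat z0 \<kappa> h k \<Theta> A1 w)\<bar>" and h4: "\<forall>i. evf z0 (Uf A1) (Vf \<kappa> A1) (\<Theta> i) w = 0"
      have "1 / real (2 * Suc n) - \<kappa> * (disc A1 w - disc A w) > 0"
        using Q(3)[OF s] w unfolding D_def A1_def[abs_def] by blast
      moreover have "1 / real (Suc n) = 1 / real (2 * Suc n) + 1 / real (2 * Suc n)" by (simp add: field_simps)
      ultimately have "1 / real (2 * Suc n) \<le> \<kappa> * disc A w" using h2 by (simp add: right_diff_distrib)
      then have "w \<in> K" using w h1 by (simp add: K_def cc1)
      then have wN: "w \<in> N" using N(2) by blast
      let ?U = "\<lambda>w. Uf A w + pert z0 h s w" and ?V = "\<lambda>w. Vf \<kappa> A w + pert z0 k s w"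
      have smU': "smooth_on N ?U" "smooth_on N ?V" by (intro smooth_on_add N(1) smU smooth_pert)+
      have jets: "jet_of (Uf A1) w = jet_of ?U w" "jet_of (Vf \<kappa> A1) w = jet_of ?V w"
        unfolding jet_of_def using UV1 by (intro ext iter_deriv_cong[OF N(1) _ wN]; simp)+
      have evf1: "evf z0 (Uf A1) (Vf \<kappa> A1) e w = evf z0 ?U ?V e w" for e
        unfolding evf_def jets ..
      have P0: "?P (w, s) = 0"
        using h4 unfolding par_map_def by (simp add: vec_eq_iff evj_eq_evf[OF N(1) smU wN] evf1)
      have Meq: "(\<chi> i j. evj z0 h k (Uf A) (Vf \<kappa> A) (lin (h j) (k j) (\<Theta> i)) (w, s)) = Mat z0 \<kappa> h k \<Theta> A1 w"
        unfolding Mat_def evj_eq_evf[OF N(1) smU wN] evf1 ..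
      have "0 < 1 / real (Suc n)" by simp
      then have "det (Mat z0 \<kappa> h k \<Theta> A1 w) \<noteq> 0" using h3 by auto
      then have "inj ((*v) (Mat z0 \<kappa> h k \<Theta> A1 w))"
        unfolding invertible_det_nz[symmetric] invertible_left_inverse matrix_left_invertible_injective .
      then have inj: "v = 0" if "dd (0, v) ?P (w, s) = 0" for v
        using that unfolding par_map_derivative_s[OF N(1) smU pure wN] Meq
        by (metis injD matrix_vector_mult_0_right)
      have "surj (\<lambda>u. dd (u, 0) ?P (w, s))" by (rule reg[OF wN P0 inj])
      have Jeq: "dd (u, 0) ?P (w, s) = Jac z0 \<kappa> \<Theta> A1 w *v (vector [fst (fst u), snd (fst u), snd u])" for u
      proof (rule vec_eq_iff[THEN iffD2], rule allI)
        fix i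
        obtain a b c where u: "u = ((a, b), c)" by (metis surj_pair)
        have v: "evf z0 (Uf A1) (Vf \<kappa> A1) (fD d e) w = dd (vec_of d) (evf z0 ?U ?V e) w" for d e
          using dd_evf[OF N(1) smU' wN] evf1 by simp
        have "dd (u, 0) ?P (w, s) $ i = dd ((a, b), c) (evf z0 ?U ?V (\<Theta> i)) w"
          unfolding par_map_derivative_w[OF N(1) smU pure wN] u ..
        also have "\<dots> = a * dd eX (evf z0 ?U ?V (\<Theta> i)) w + b * dd eY (evf z0 ?U ?V (\<Theta> i)) w + c * dd eE (evf z0 ?U ?V (\<Theta> i)) w"
          by (rule dd_expand[OF smooth_evf[OF N(1) smU'] N(1) wN])
        also have "\<dots> = (Jac z0 \<kappa> \<Theta> A1 w *v (vector [a, b, c])) $ i"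
          by (simp add: matrix_vector_mult_def sum_3 Jac_def v dir3_def)
        finally show "dd (u, 0) ?P (w, s) $ i = (Jac z0 \<kappa> \<Theta> A1 w *v (vector [fst (fst u), snd (fst u), snd u])) $ i"
          by (simp add: u)
      qed
      have "surj ((*v) (Jac z0 \<kappa> \<Theta> A1 w))"
        using \<open>surj (\<lambda>u. dd (u, 0) ?P (w, s))\<close> unfolding surj_def Jeq by blast
      then show "det (Jac z0 \<kappa> \<Theta> A1 w ** transpose (Jac z0 \<kappa> \<Theta> A1 w)) \<noteq> 0"
        unfolding surj_iff_gram .
    qed
    then show "\<exists>y. y \<in> regular_set n z0 \<kappa> h k \<Theta> \<and> y \<in> T" using A1T by blast
  qed
qed

text \<open>The conditions have to be the same for all base points; only the perturbations may refer
  to one.\<close>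

fun coord_free :: "dpoly \<Rightarrow> bool" where
  "coord_free (JU vs) = True"
| "coord_free (JV vs) = True"
| "coord_free (Cst c) = True"
| "coord_free CX = False"
| "coord_free CY = False"
| "coord_free (Add a b) = (coord_free a \<and> coord_free b)"
| "coord_free (Mul a b) = (coord_free a \<and> coord_free b)"

lemma ev_coord_free: "coord_free e \<Longrightarrow> ev u v x y e = ev u v x' y' e"
  by (induction e) auto

lemma coord_free_fD: "coord_free e \<Longrightarrow> coord_free (fD d e)"
  by (induction e) auto

lemma ev_continuous: "continuous_on UNIV (\<lambda>z::plane. ev u v (a - fst z) (b - snd z) e)"
  by (induction e) (auto intro!: continuous_intros)

text \<open>The determinant is simplest with base point at w, but only countably many open dense
  sets may be intersected. It is continuous in the base point, so one from a countable dense set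
  does as well.\<close>

theorem generic_test:
  fixes h k \<Theta> :: "'m::{finite,wellorder} \<Rightarrow> dpoly"
  assumes \<kappa>: "\<kappa> \<in> {1, -1}" and card: "3 \<le> CARD('m)" and pure: "\<And>j. pure (h j)" "\<And>j. pure (k j)"
    and cf: "\<And>i. coord_free (\<Theta> i)"
  shows "generic (\<lambda>A :: bide_family. \<forall>w\<in>ddom \<kappa> A. det (Mat (fst w) \<kappa> h k \<Theta> A w) \<noteq> 0 \<longrightarrow>
     (\<forall>i. evf 0 (Uf A) (Vf \<kappa> A) (\<Theta> i) w = 0) \<longrightarrow> surj ((*v) (Jac 0 \<kappa> \<Theta> A w)))"
proof -
  obtain Z :: "plane set" where Z: "countable Z" "\<And>X. open X \<Longrightarrow> X \<noteq> {} \<Longrightarrow> \<exists>d\<in>Z. d \<in> X"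
    using countable_dense_setE by metis
  let ?\<U> = "(\<lambda>(n, z0). regular_set n z0 \<kappa> h k \<Theta>) ` (UNIV \<times> Z)"
  have "countable ?\<U>" using Z(1) by (intro countable_image countable_SIGMA) auto
  moreover have "\<forall>U\<in>?\<U>. openin whitney_topology U \<and> whitney_topology closure_of U = topspace whitney_topology"
    using openin_regular_set dense_regular_set[OF \<kappa> card pure] by (force simp: image_iff)
  moreover have "topspace whitney_topology \<inter> \<Inter>?\<U> \<subseteq> {A. \<forall>w\<in>ddom \<kappa> A. det (Mat (fst w) \<kappa> h k \<Theta> A w) \<noteq> 0 \<longrightarrow>
     (\<forall>i. evf 0 (Uf A) (Vf \<kappa> A) (\<Theta> i) w = 0) \<longrightarrow> surj ((*v) (Jac 0 \<kappa> \<Theta> A w))}"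
  proof (intro subsetI CollectI ballI impI)
    fix A w assume A: "A \<in> topspace whitney_topology \<inter> \<Inter>?\<U>" and w: "w \<in> ddom \<kappa> A"
      and M: "det (Mat (fst w) \<kappa> h k \<Theta> A w) \<noteq> 0" and z: "\<forall>i. evf 0 (Uf A) (Vf \<kappa> A) (\<Theta> i) w = 0"
    have eq: "evf z1 (Uf A) (Vf \<kappa> A) e w = evf z2 (Uf A) (Vf \<kappa> A) e w" if "coord_free e" for z1 z2 e
      unfolding evf_def by (rule ev_coord_free[OF that])
    have c: "continuous_on UNIV (\<lambda>z. det (Mat z \<kappa> h k \<Theta> A w))"
      unfolding det_def Mat_def evf_def by (simp) (intro continuous_intros ev_continuous)
    have "open {z. det (Mat z \<kappa> h k \<Theta> A w) \<noteq> 0}" by (rule open_Collect_neq[OF c continuous_on_const])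
    then obtain z0 where z0: "z0 \<in> Z" "det (Mat z0 \<kappa> h k \<Theta> A w) \<noteq> 0" using Z(2)[of "{z. det (Mat z \<kappa> h k \<Theta> A w) \<noteq> 0}"] M by blast
    \<comment> \<open>All three quantities are positive at w, so w satisfies the compact conditions
      for some n.\<close>
    define m where "m = min \<bar>cc A w\<bar> (min (\<kappa> * disc A w) \<bar>det (Mat z0 \<kappa> h k \<Theta> A w)\<bar>)"
    have "m > 0" using w z0 by (auto simp: m_def ddom_def)
    then obtain n1 where n1: "1 / real (Suc n1) < m" using reals_Archimedean[of m] by (auto simp: inverse_eq_divide)
    obtain n2 where n2: "norm w \<le> real n2" using real_arch_simple by blast
    define n where "n = max n1 n2"
    have "1 / real (Suc n) \<le> 1 / real (Suc n1)" by (simp add: n_def frac_le)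
    then have nm: "1 / real (Suc n) \<le> m" using n1 by simp
    have "w \<in> cball 0 (real n)" using n2 by (simp add: n_def)
    moreover have "A \<in> regular_set n z0 \<kappa> h k \<Theta>" using A z0(1) by blast
    moreover have "\<forall>i. evf z0 (Uf A) (Vf \<kappa> A) (\<Theta> i) w = 0" using z eq[OF cf] by metis
    moreover have "1 / real (Suc n) \<le> \<bar>cc A w\<bar>" "1 / real (Suc n) \<le> \<kappa> * disc A w" "1 / real (Suc n) \<le> \<bar>det (Mat z0 \<kappa> h k \<Theta> A w)\<bar>"
      using nm by (auto simp: m_def)
    ultimately have "det (Jac z0 \<kappa> \<Theta> A w ** transpose (Jac z0 \<kappa> \<Theta> A w)) \<noteq> 0"
      unfolding regular_set_def by blast
    moreover have "Jac z0 \<kappa> \<Theta> A w = Jac 0 \<kappa> \<Theta> A w"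
      unfolding Jac_def using eq[OF coord_free_fD[OF cf], of z0 _ _ 0] by simp
    ultimately show "surj ((*v) (Jac 0 \<kappa> \<Theta> A w))" unfolding surj_iff_gram by simp
  qed
  ultimately show ?thesis unfolding generic_def residual_in_def by blast
qed

section \<open>Generic avoidance of four conditions and regularity of three\<close>

lemma det_nonzero_if_inj:
  fixes M :: "real^'n^'n"
  assumes "\<And>v. M *v v = 0 \<Longrightarrow> v = 0" shows "det M \<noteq> 0"
  unfolding invertible_det_nz[symmetric] invertible_left_inverse matrix_left_invertible_injective
  using assms linear_injective_0[OF matrix_vector_mul_linear] by blast

text \<open>With base point \<open>fst w\<close> the symbols \<open>CX\<close> and \<open>CY\<close>
  evaluate to 0 at w, so the test becomes a statement about jets alone, restricted by
  \<open>Q\<close>.\<close>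

lemma generic_det_test:
  fixes h k \<Theta> :: "'m::{finite,wellorder} \<Rightarrow> dpoly"
  assumes "\<kappa> \<in> {1, -1}" "3 \<le> CARD('m)" "\<And>j. pure (h j)" "\<And>j. pure (k j)" "\<And>i. coord_free (\<Theta> i)"
    and inj: "\<And>u v (c :: (real,'m) vec). Q u v \<Longrightarrow> (\<And>i. (\<Sum>j\<in>UNIV. ev u v 0 0 (lin (h j) (k j) (\<Theta> i)) * c $ j) = 0) \<Longrightarrow> c = 0"
  shows "generic (\<lambda>A :: bide_family. \<forall>w\<in>ddom \<kappa> A. Q (jet_of (Uf A) w) (jet_of (Vf \<kappa> A) w) \<longrightarrow>
     (\<forall>i. evf 0 (Uf A) (Vf \<kappa> A) (\<Theta> i) w = 0) \<longrightarrow> surj ((*v) (Jac 0 \<kappa> \<Theta> A w)))"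
proof (rule generic_mono[OF generic_test[OF assms(1-5)]], intro ballI impI)
  fix A w
  assume *: "\<forall>w\<in>ddom \<kappa> A. det (Mat (fst w) \<kappa> h k \<Theta> A w) \<noteq> 0 \<longrightarrow>
     (\<forall>i. evf 0 (Uf A) (Vf \<kappa> A) (\<Theta> i) w = 0) \<longrightarrow> surj ((*v) (Jac 0 \<kappa> \<Theta> A w))"
    and w: "w \<in> ddom \<kappa> A" and Q: "Q (jet_of (Uf A) w) (jet_of (Vf \<kappa> A) w)"
    and z: "\<forall>i. evf 0 (Uf A) (Vf \<kappa> A) (\<Theta> i) w = 0"
  have "det (Mat (fst w) \<kappa> h k \<Theta> A w) \<noteq> 0"
  proof (rule det_nonzero_if_inj, rule inj[OF Q])
    fix v i assume "Mat (fst w) \<kappa> h k \<Theta> A w *v v = 0"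
    then have "(Mat (fst w) \<kappa> h k \<Theta> A w *v v) $ i = 0" by simp
    then show "(\<Sum>j\<in>UNIV. ev (jet_of (Uf A) w) (jet_of (Vf \<kappa> A) w) 0 0 (lin (h j) (k j) (\<Theta> i)) * v $ j) = 0"
      by (simp add: matrix_vector_mult_def Mat_def evf_def)
  qed
  then show "surj ((*v) (Jac 0 \<kappa> \<Theta> A w))" using * w z by blast
qed

text \<open>The Jacobian of four functions of three variables has rank at most 3, so transversality
  means that there are no common zeros.\<close>

lemma generic_avoid:
  fixes h k \<Theta> :: "4 \<Rightarrow> dpoly"
  assumes "\<kappa> \<in> {1, -1}" "\<And>j. pure (h j)" "\<And>j. pure (k j)" "\<And>i. coord_free (\<Theta> i)"
    and inj: "\<And>u v (c :: real^4). Q u v \<Longrightarrow> (\<And>i. (\<Sum>j\<in>UNIV. ev u v 0 0 (lin (h j) (k j) (\<Theta> i)) * c $ j) = 0) \<Longrightarrow> c = 0"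
  shows "generic (\<lambda>A :: bide_family. \<forall>w\<in>ddom \<kappa> A. Q (jet_of (Uf A) w) (jet_of (Vf \<kappa> A) w) \<longrightarrow>
     \<not> (\<forall>i. evf 0 (Uf A) (Vf \<kappa> A) (\<Theta> i) w = 0))"
proof (rule generic_mono[OF generic_det_test[OF assms(1) _ assms(2-4) inj]])
  fix A :: bide_family
  have "rank (Jac 0 \<kappa> \<Theta> A w) \<noteq> CARD(4)" for w
    using rank_bound[of "Jac 0 \<kappa> \<Theta> A w"] by simp
  then have "\<not> surj ((*v) (Jac 0 \<kappa> \<Theta> A w))" for w unfolding full_rank_surjective[symmetric] .
  moreover assume "\<forall>w\<in>ddom \<kappa> A. Q (jet_of (Uf A) w) (jet_of (Vf \<kappa> A) w) \<longrightarrow>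
     (\<forall>i. evf 0 (Uf A) (Vf \<kappa> A) (\<Theta> i) w = 0) \<longrightarrow> surj ((*v) (Jac 0 \<kappa> \<Theta> A w))"
  ultimately show "\<forall>w\<in>ddom \<kappa> A. Q (jet_of (Uf A) w) (jet_of (Vf \<kappa> A) w) \<longrightarrow> \<not> (\<forall>i. evf 0 (Uf A) (Vf \<kappa> A) (\<Theta> i) w = 0)" by blast
qed simp_all

text \<open>For three conditions the Jacobian is square, so surjectivity gives injectivity: the
  three functions are local coordinates at a common zero.\<close>

lemma generic_regular:
  fixes h k \<Theta> :: "3 \<Rightarrow> dpoly"
  assumes "\<kappa> \<in> {1, -1}" "\<And>j. pure (h j)" "\<And>j. pure (k j)" "\<And>i. coord_free (\<Theta> i)"
    and inj: "\<And>u v (c :: real^3). Q u v \<Longrightarrow> (\<And>i. (\<Sum>j\<in>UNIV. ev u v 0 0 (lin (h j) (k j) (\<Theta> i)) * c $ j) = 0) \<Longrightarrow> c = 0"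
  shows "generic (\<lambda>A :: bide_family. \<forall>w\<in>ddom \<kappa> A. Q (jet_of (Uf A) w) (jet_of (Vf \<kappa> A) w) \<longrightarrow>
     (\<forall>i. evf 0 (Uf A) (Vf \<kappa> A) (\<Theta> i) w = 0) \<longrightarrow> (\<forall>u. (\<forall>i. dd u (evf 0 (Uf A) (Vf \<kappa> A) (\<Theta> i)) w = 0) \<longrightarrow> u = 0))"
proof (rule generic_mono[OF generic_det_test[where Q=Q, OF assms(1) _ assms(2-4) inj]])
  show "3 \<le> CARD(3)" by simp
next
  fix A :: bide_family
  assume "smooth_on UNIV A" "\<forall>w\<in>ddom \<kappa> A. Q (jet_of (Uf A) w) (jet_of (Vf \<kappa> A) w) \<longrightarrow>
     (\<forall>i. evf 0 (Uf A) (Vf \<kappa> A) (\<Theta> i) w = 0) \<longrightarrow> surj ((*v) (Jac 0 \<kappa> \<Theta> A w))"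
  then show "\<forall>w\<in>ddom \<kappa> A. Q (jet_of (Uf A) w) (jet_of (Vf \<kappa> A) w) \<longrightarrow>
     (\<forall>i. evf 0 (Uf A) (Vf \<kappa> A) (\<Theta> i) w = 0) \<longrightarrow> (\<forall>u. (\<forall>i. dd u (evf 0 (Uf A) (Vf \<kappa> A) (\<Theta> i)) w = 0) \<longrightarrow> u = 0)"
  proof (intro ballI impI allI)
  fix w u
  assume A: "smooth_on UNIV A" and *: "\<forall>w\<in>ddom \<kappa> A. Q (jet_of (Uf A) w) (jet_of (Vf \<kappa> A) w) \<longrightarrow>
     (\<forall>i. evf 0 (Uf A) (Vf \<kappa> A) (\<Theta> i) w = 0) \<longrightarrow> surj ((*v) (Jac 0 \<kappa> \<Theta> A w))"
    and w: "w \<in> ddom \<kappa> A" and Q: "Q (jet_of (Uf A) w) (jet_of (Vf \<kappa> A) w)"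
    and z: "\<forall>i. evf 0 (Uf A) (Vf \<kappa> A) (\<Theta> i) w = 0" and u: "\<forall>i. dd u (evf 0 (Uf A) (Vf \<kappa> A) (\<Theta> i)) w = 0"
  note S = open_ddom[OF A, of \<kappa>] and UV = smooth_UV[OF A, of \<kappa>]
  obtain a b c where uu: "u = ((a, b), c)" by (metis surj_pair)
  have "Jac 0 \<kappa> \<Theta> A w *v vector [a, b, c] = 0"
  proof (rule vec_eq_iff[THEN iffD2], rule allI)
    fix i
    have v: "evf 0 (Uf A) (Vf \<kappa> A) (fD d e) w = dd (vec_of d) (evf 0 (Uf A) (Vf \<kappa> A) e) w" for d e
      using dd_evf[OF S UV w] by simp
    have "(Jac 0 \<kappa> \<Theta> A w *v vector [a, b, c]) $ i = dd ((a, b), c) (evf 0 (Uf A) (Vf \<kappa> A) (\<Theta> i)) w"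
      unfolding dd_expand[OF smooth_evf[OF S UV] S w, of 0 "\<Theta> i" a b c]
      by (simp add: matrix_vector_mult_def sum_3 Jac_def v dir3_def)
    then show "(Jac 0 \<kappa> \<Theta> A w *v vector [a, b, c]) $ i = 0 $ i" using u uu by simp
  qed
  moreover have "surj ((*v) (Jac 0 \<kappa> \<Theta> A w))" using * w Q z by blast
  then have "inj ((*v) (Jac 0 \<kappa> \<Theta> A w))"
    using linear_surjective_imp_injective[OF matrix_vector_mul_linear] by blast
  ultimately have "vector [a, b, c] = (0 :: real^3)" by (metis injD matrix_vector_mult_0_right)
  then have "a = 0" "b = 0" "c = 0" by (auto simp: vec_eq_iff forall_3)
  then show "u = 0" by (simp add: uu zero_prod_def)
  qed
qed simp_all

section \<open>The genericity conditions\<close>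

text \<open>\<open>Pp \<tau>\<close>, \<open>Gp \<tau>\<close>, \<open>Lp \<tau>\<close> are \<open>P\<close>, \<open>G\<close>, \<open>L\<close> for \<open>P = U + \<tau> V\<close>; \<open>Re_p\<close>, \<open>Im_p\<close> are the real and imaginary
  parts of \<open>G\<close> for \<open>P = U + \<i> V\<close>.\<close>

definition Pp :: "real \<Rightarrow> dpoly" where "Pp \<tau> = Add (JU []) (Mul (Cst \<tau>) (JV []))"
definition Gp :: "real \<Rightarrow> dpoly" where "Gp \<tau> = Add (fD DX (Pp \<tau>)) (Mul (Pp \<tau>) (fD DY (Pp \<tau>)))"
definition Lp :: "real \<Rightarrow> dpoly" where "Lp \<tau> = Add (fD DX (Gp \<tau>)) (Mul (Pp \<tau>) (fD DY (Gp \<tau>)))"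
definition Jp :: "dpoly \<Rightarrow> dpoly \<Rightarrow> dpoly" where
  "Jp a b = Add (Mul (fD DX a) (fD DY b)) (Mul (Cst (-1)) (Mul (fD DY a) (fD DX b)))"
definition Re_p :: dpoly where
  "Re_p = Add (JU [DX]) (Add (Mul (JU []) (JU [DY])) (Mul (Cst (-1)) (Mul (JV []) (JV [DY]))))"
definition Im_p :: dpoly where
  "Im_p = Add (JV [DX]) (Add (Mul (JU []) (JV [DY])) (Mul (JV []) (JU [DY])))"

definition sel4 :: "'a \<Rightarrow> 'a \<Rightarrow> 'a \<Rightarrow> 'a \<Rightarrow> 4 \<Rightarrow> 'a" where
  "sel4 a b c d i = (if i = 1 then a else if i = 2 then b else if i = 3 then c else d)"
definition sel3 :: "'a \<Rightarrow> 'a \<Rightarrow> 'a \<Rightarrow> 3 \<Rightarrow> 'a" where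
  "sel3 a b c i = (if i = 1 then a else if i = 2 then b else c)"

lemma sel4_simps: "sel4 a b c d 1 = a" "sel4 a b c d 2 = b" "sel4 a b c d 3 = c" "sel4 a b c d 4 = d"
  by (simp_all add: sel4_def)
lemma sel3_simps: "sel3 a b c 1 = a" "sel3 a b c 2 = b" "sel3 a b c 3 = c"
  by (simp_all add: sel3_def)
lemma generic_avoid4:
  fixes h k :: "4 \<Rightarrow> dpoly"
  assumes "\<kappa> \<in> {1, -1}" "\<And>j. pure (h j)" "\<And>j. pure (k j)" "\<And>i. coord_free (sel4 a b c d i)"
    and "\<And>u v (x :: real^4). Q u v \<Longrightarrow> (\<And>i. (\<Sum>j\<in>UNIV. ev u v 0 0 (lin (h j) (k j) (sel4 a b c d i)) * x $ j) = 0) \<Longrightarrow> x = 0"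
  shows "generic (\<lambda>A :: bide_family. \<forall>w\<in>ddom \<kappa> A. Q (jet_of (Uf A) w) (jet_of (Vf \<kappa> A) w) \<longrightarrow>
     \<not> (evf 0 (Uf A) (Vf \<kappa> A) a w = 0 \<and> evf 0 (Uf A) (Vf \<kappa> A) b w = 0 \<and> evf 0 (Uf A) (Vf \<kappa> A) c w = 0 \<and>
        evf 0 (Uf A) (Vf \<kappa> A) d w = 0))"
  using generic_avoid[where Q=Q and h=h and k=k and \<Theta>="sel4 a b c d", OF assms]
  unfolding forall_4 sel4_simps .

lemma generic_regular3:
  fixes h k :: "3 \<Rightarrow> dpoly"
  assumes "\<kappa> \<in> {1, -1}" "\<And>j. pure (h j)" "\<And>j. pure (k j)" "\<And>i. coord_free (sel3 a b c i)"
    and "\<And>u v (x :: real^3). Q u v \<Longrightarrow> (\<And>i. (\<Sum>j\<in>UNIV. ev u v 0 0 (lin (h j) (k j) (sel3 a b c i)) * x $ j) = 0) \<Longrightarrow> x = 0"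
  shows "generic (\<lambda>A :: bide_family. \<forall>w\<in>ddom \<kappa> A. Q (jet_of (Uf A) w) (jet_of (Vf \<kappa> A) w) \<longrightarrow>
     evf 0 (Uf A) (Vf \<kappa> A) a w = 0 \<and> evf 0 (Uf A) (Vf \<kappa> A) b w = 0 \<and> evf 0 (Uf A) (Vf \<kappa> A) c w = 0 \<longrightarrow>
     (\<forall>u. dd u (evf 0 (Uf A) (Vf \<kappa> A) a) w = 0 \<and> dd u (evf 0 (Uf A) (Vf \<kappa> A) b) w = 0 \<and>
        dd u (evf 0 (Uf A) (Vf \<kappa> A) c) w = 0 \<longrightarrow> u = 0))"
  using generic_regular[where Q=Q and h=h and k=k and \<Theta>="sel3 a b c", OF assms]
  unfolding forall_3 sel3_simps .

lemma evf_ev: "coord_free e \<Longrightarrow> evf 0 U V e w = ev (jet_of U w) (jet_of V w) 0 0 e"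
  unfolding evf_def by (rule ev_coord_free)

text \<open>Adding \<open>hs e\<close> to \<open>U\<close> and \<open>ks \<tau> e\<close> to \<open>V\<close> perturbs the direction field \<open>U + \<tau> V\<close> by \<open>e\<close>
  and leaves \<open>U - \<tau> V\<close> unchanged.\<close>

abbreviation hs :: "dpoly \<Rightarrow> dpoly" where "hs e \<equiv> Mul (Cst (1/2)) e"
abbreviation ks :: "real \<Rightarrow> dpoly \<Rightarrow> dpoly" where "ks \<tau> e \<equiv> Mul (Cst (\<tau>/2)) e"
abbreviation X2 :: dpoly where "X2 \<equiv> Mul (Cst (1/2)) (Mul CX CX)"
abbreviation X3 :: dpoly where "X3 \<equiv> Mul (Cst (1/6)) (Mul CX (Mul CX CX))"
abbreviation XY :: dpoly where "XY \<equiv> Mul CX CY"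

lemma coord_free_polys: "coord_free (Pp \<tau>)" "coord_free (Gp \<tau>)" "coord_free (Lp \<tau>)" "coord_free Re_p" "coord_free Im_p"
  "coord_free a \<Longrightarrow> coord_free b \<Longrightarrow> coord_free (Jp a b)"
  by (simp_all add: Pp_def Gp_def Lp_def Re_p_def Im_p_def Jp_def coord_free_fD)

lemmas test_simps = sum_4 sum_3 forall_4 forall_3 sel4_simps sel3_simps vec_eq_iff

lemma pure_sel: "pure a \<Longrightarrow> pure b \<Longrightarrow> pure c \<Longrightarrow> pure d \<Longrightarrow> pure (sel4 a b c d i)"
  "pure a \<Longrightarrow> pure b \<Longrightarrow> pure c \<Longrightarrow> pure (sel3 a b c j)"
  by (auto simp: sel4_def sel3_def)
lemma coord_free_sel: "coord_free a \<Longrightarrow> coord_free b \<Longrightarrow> coord_free c \<Longrightarrow> coord_free d \<Longrightarrow> coord_free (sel4 a b c d i)"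
  "coord_free a \<Longrightarrow> coord_free b \<Longrightarrow> coord_free c \<Longrightarrow> coord_free (sel3 a b c j)"
  by (auto simp: sel4_def sel3_def)

text \<open>In each of the following lemmas the perturbations are chosen such that the linearization of the
  conditions is a triangular matrix with nonzero diagonal.\<close>

lemma generic_some_DY_nonzero_real:
  "generic (\<lambda>A :: bide_family. \<forall>w\<in>ddom 1 A. \<not> (evf 0 (Uf A) (Vf 1 A) (Gp 1) w = 0 \<and> evf 0 (Uf A) (Vf 1 A) (Gp (-1)) w = 0 \<and> evf 0 (Uf A) (Vf 1 A) (fD DY (Gp 1)) w = 0 \<and> evf 0 (Uf A) (Vf 1 A) (fD DY (Gp (-1))) w = 0))"
proof (rule generic_mono[OF generic_avoid4[where \<kappa>="1" and h="sel4 (hs CX) (hs CX) (hs XY) (hs XY)" and k="sel4 (ks 1 CX) (ks (-1) CX) (ks 1 XY) (ks (-1) XY)"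
    and a="(Gp 1)" and b="(Gp (-1))" and c="(fD DY (Gp 1))" and d="(fD DY (Gp (-1)))" and Q="\<lambda>_ _. True"]])
  fix u v and x :: "real^4"
  assume Q: "(\<lambda>_ _. True) u v" and "\<And>i. (\<Sum>j\<in>UNIV. ev u v 0 0 (lin ((sel4 (hs CX) (hs CX) (hs XY) (hs XY)) j) ((sel4 (ks 1 CX) (ks (-1) CX) (ks 1 XY) (ks (-1) XY)) j)
     (sel4 (Gp 1) (Gp (-1)) (fD DY (Gp 1)) (fD DY (Gp (-1))) i)) * x $ j) = 0"
  from this(2)[of 1] this(2)[of 2] this(2)[of 3] this(2)[of 4] Q show "x = 0"
    by (simp add: test_simps Gp_def Pp_def)
qed (auto intro!: pure_sel coord_free_sel coord_free_polys coord_free_fD)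

lemma generic_some_DY_nonzero_complex:
  "generic (\<lambda>A :: bide_family. \<forall>w\<in>ddom (-1) A. \<not> (evf 0 (Uf A) (Vf (-1) A) Re_p w = 0 \<and> evf 0 (Uf A) (Vf (-1) A) Im_p w = 0 \<and> evf 0 (Uf A) (Vf (-1) A) (fD DY Re_p) w = 0 \<and> evf 0 (Uf A) (Vf (-1) A) (fD DY Im_p) w = 0))"
proof (rule generic_mono[OF generic_avoid4[where \<kappa>="(-1)" and h="sel4 CX (Cst 0) XY (Cst 0)" and k="sel4 (Cst 0) CX (Cst 0) XY"
    and a="Re_p" and b="Im_p" and c="(fD DY Re_p)" and d="(fD DY Im_p)" and Q="\<lambda>_ _. True"]])
  fix u v and x :: "real^4"
  assume Q: "(\<lambda>_ _. True) u v" and "\<And>i. (\<Sum>j\<in>UNIV. ev u v 0 0 (lin ((sel4 CX (Cst 0) XY (Cst 0)) j) ((sel4 (Cst 0) CX (Cst 0) XY) j)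
     (sel4 Re_p Im_p (fD DY Re_p) (fD DY Im_p) i)) * x $ j) = 0"
  from this(2)[of 1] this(2)[of 2] this(2)[of 3] this(2)[of 4] Q show "x = 0"
    by (simp add: test_simps Re_p_def Im_p_def)
qed (auto intro!: pure_sel coord_free_sel coord_free_polys coord_free_fD)

text \<open>The two linear entries move the two values; \<open>X2\<close> moves the x-derivative of
  \<open>Gp \<tau>\<close> alone, and \<open>XY\<close> moves its y-derivative.\<close>

lemma generic_gradient_nonzero:
  assumes \<tau>: "\<tau> \<in> {1, -1}"
  shows "generic (\<lambda>A :: bide_family. \<forall>w\<in>ddom 1 A. \<not> (evf 0 (Uf A) (Vf 1 A) (Gp \<tau>) w = 0 \<and> evf 0 (Uf A) (Vf 1 A) (Gp (-\<tau>)) w = 0 \<and> evf 0 (Uf A) (Vf 1 A) (fD DX (Gp \<tau>)) w = 0 \<and> evf 0 (Uf A) (Vf 1 A) (fD DY (Gp \<tau>)) w = 0))"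
proof (rule generic_mono[OF generic_avoid4[where \<kappa>="1" and h="sel4 (hs CX) (hs CX) (hs X2) (hs XY)" and k="sel4 (ks \<tau> CX) (ks (-\<tau>) CX) (ks \<tau> X2) (ks \<tau> XY)"
    and a="(Gp \<tau>)" and b="(Gp (-\<tau>))" and c="(fD DX (Gp \<tau>))" and d="(fD DY (Gp \<tau>))" and Q="\<lambda>_ _. True"]])
  fix u v and x :: "real^4"
  assume Q: "(\<lambda>_ _. True) u v" and "\<And>i. (\<Sum>j\<in>UNIV. ev u v 0 0 (lin ((sel4 (hs CX) (hs CX) (hs X2) (hs XY)) j) ((sel4 (ks \<tau> CX) (ks (-\<tau>) CX) (ks \<tau> X2) (ks \<tau> XY)) j)
     (sel4 (Gp \<tau>) (Gp (-\<tau>)) (fD DX (Gp \<tau>)) (fD DY (Gp \<tau>)) i)) * x $ j) = 0"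
  from this(2)[of 1] this(2)[of 2] this(2)[of 3] this(2)[of 4] Q \<tau> show "x = 0"
    by (elim insertE emptyE; simp add: test_simps Gp_def Pp_def)
qed (auto intro!: pure_sel coord_free_sel coord_free_polys coord_free_fD)

text \<open>\<open>X2\<close> moves only the x-derivative of \<open>Gp \<tau>\<close>, whose
  cofactor in the Jacobian is, up to sign, the y-derivative of \<open>Gp (-\<tau>)\<close>; hence
  the guard. The two choices of \<tau> cover all common zeros by
  \<open>generic_some_DY_nonzero_real\<close>.\<close>

lemma generic_nondegenerate_tangency_real:
  assumes \<tau>: "\<tau> \<in> {1, -1}"
  shows "generic (\<lambda>A :: bide_family. \<forall>w\<in>ddom 1 A. evf 0 (Uf A) (Vf 1 A) (fD DY (Gp (-\<tau>))) w \<noteq> 0 \<longrightarrow> evf 0 (Uf A) (Vf 1 A) (Gp \<tau>) w = 0 \<and> evf 0 (Uf A) (Vf 1 A) (Gp (-\<tau>)) w = 0 \<and> evf 0 (Uf A) (Vf 1 A) (Jp (Gp (-1)) (Gp 1)) w = 0 \<longrightarrow>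
     (\<forall>u. dd u (evf 0 (Uf A) (Vf 1 A) (Gp \<tau>)) w = 0 \<and> dd u (evf 0 (Uf A) (Vf 1 A) (Gp (-\<tau>))) w = 0 \<and> dd u (evf 0 (Uf A) (Vf 1 A) (Jp (Gp (-1)) (Gp 1))) w = 0 \<longrightarrow> u = 0))"
proof (rule generic_mono[OF generic_regular3[where \<kappa>="1" and h="sel3 (hs CX) (hs CX) (hs X2)" and k="sel3 (ks \<tau> CX) (ks (-\<tau>) CX) (ks \<tau> X2)"
    and a="(Gp \<tau>)" and b="(Gp (-\<tau>))" and c="(Jp (Gp (-1)) (Gp 1))" and Q="\<lambda>u v. ev u v 0 0 (fD DY (Gp (-\<tau>))) \<noteq> 0"]])
  fix u v and x :: "real^3"
  assume Q: "(\<lambda>u v. ev u v 0 0 (fD DY (Gp (-\<tau>))) \<noteq> 0) u v" and "\<And>i. (\<Sum>j\<in>UNIV. ev u v 0 0 (lin ((sel3 (hs CX) (hs CX) (hs X2)) j) ((sel3 (ks \<tau> CX) (ks (-\<tau>) CX) (ks \<tau> X2)) j)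
     (sel3 (Gp \<tau>) (Gp (-\<tau>)) (Jp (Gp (-1)) (Gp 1)) i)) * x $ j) = 0"
  from this(2)[of 1] this(2)[of 2] this(2)[of 3] Q \<tau> show "x = 0"
    by (elim insertE emptyE; simp add: test_simps Gp_def Pp_def Jp_def)
qed (auto simp: evf_ev coord_free_fD coord_free_polys intro!: pure_sel coord_free_sel coord_free_polys coord_free_fD)

text \<open>\<open>X2\<close> added to U moves the x-derivative of \<open>Re_p\<close>, whose
  cofactor in the Jacobian is the y-derivative of \<open>Im_p\<close>; the next lemma exchanges the
  roles by perturbing V.\<close>

lemma generic_nondegenerate_tangency_Im:
  "generic (\<lambda>A :: bide_family. \<forall>w\<in>ddom (-1) A. evf 0 (Uf A) (Vf (-1) A) (fD DY Im_p) w \<noteq> 0 \<longrightarrow> evf 0 (Uf A) (Vf (-1) A) Re_p w = 0 \<and> evf 0 (Uf A) (Vf (-1) A) Im_p w = 0 \<and> evf 0 (Uf A) (Vf (-1) A) (Jp Re_p Im_p) w = 0 \<longrightarrow>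
     (\<forall>u. dd u (evf 0 (Uf A) (Vf (-1) A) Re_p) w = 0 \<and> dd u (evf 0 (Uf A) (Vf (-1) A) Im_p) w = 0 \<and> dd u (evf 0 (Uf A) (Vf (-1) A) (Jp Re_p Im_p)) w = 0 \<longrightarrow> u = 0))"
proof (rule generic_mono[OF generic_regular3[where \<kappa>="(-1)" and h="sel3 CX (Cst 0) X2" and k="sel3 (Cst 0) CX (Cst 0)"
    and a="Re_p" and b="Im_p" and c="(Jp Re_p Im_p)" and Q="\<lambda>u v. ev u v 0 0 (fD DY Im_p) \<noteq> 0"]])
  fix u v and x :: "real^3"
  assume Q: "(\<lambda>u v. ev u v 0 0 (fD DY Im_p) \<noteq> 0) u v" and "\<And>i. (\<Sum>j\<in>UNIV. ev u v 0 0 (lin ((sel3 CX (Cst 0) X2) j) ((sel3 (Cst 0) CX (Cst 0)) j)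
     (sel3 Re_p Im_p (Jp Re_p Im_p) i)) * x $ j) = 0"
  from this(2)[of 1] this(2)[of 2] this(2)[of 3] Q show "x = 0"
    by (simp add: test_simps Re_p_def Im_p_def Jp_def)
qed (auto simp: evf_ev coord_free_fD coord_free_polys intro!: pure_sel coord_free_sel coord_free_polys coord_free_fD)

lemma generic_nondegenerate_tangency_Re:
  "generic (\<lambda>A :: bide_family. \<forall>w\<in>ddom (-1) A. evf 0 (Uf A) (Vf (-1) A) (fD DY Re_p) w \<noteq> 0 \<longrightarrow> evf 0 (Uf A) (Vf (-1) A) Re_p w = 0 \<and> evf 0 (Uf A) (Vf (-1) A) Im_p w = 0 \<and> evf 0 (Uf A) (Vf (-1) A) (Jp Re_p Im_p) w = 0 \<longrightarrow>
     (\<forall>u. dd u (evf 0 (Uf A) (Vf (-1) A) Re_p) w = 0 \<and> dd u (evf 0 (Uf A) (Vf (-1) A) Im_p) w = 0 \<and> dd u (evf 0 (Uf A) (Vf (-1) A) (Jp Re_p Im_p)) w = 0 \<longrightarrow> u = 0))"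
proof (rule generic_mono[OF generic_regular3[where \<kappa>="(-1)" and h="sel3 CX (Cst 0) (Cst 0)" and k="sel3 (Cst 0) CX X2"
    and a="Re_p" and b="Im_p" and c="(Jp Re_p Im_p)" and Q="\<lambda>u v. ev u v 0 0 (fD DY Re_p) \<noteq> 0"]])
  fix u v and x :: "real^3"
  assume Q: "(\<lambda>u v. ev u v 0 0 (fD DY Re_p) \<noteq> 0) u v" and "\<And>i. (\<Sum>j\<in>UNIV. ev u v 0 0 (lin ((sel3 CX (Cst 0) (Cst 0)) j) ((sel3 (Cst 0) CX X2) j)
     (sel3 Re_p Im_p (Jp Re_p Im_p) i)) * x $ j) = 0"
  from this(2)[of 1] this(2)[of 2] this(2)[of 3] Q show "x = 0"
    by (simp add: test_simps Re_p_def Im_p_def Jp_def)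
qed (auto simp: evf_ev coord_free_fD coord_free_polys intro!: pure_sel coord_free_sel coord_free_polys coord_free_fD)

text \<open>\<open>X2\<close> moves the x-derivative of G and with it L, but neither value of G. The
  conclusion is what gives the bi-inflection nonzero speed across the other curve.\<close>

lemma generic_bi_inflection_moves:
  assumes \<tau>: "\<tau> \<in> {1, -1}"
  shows "generic (\<lambda>A :: bide_family. \<forall>w\<in>ddom 1 A. evf 0 (Uf A) (Vf 1 A) (Gp \<tau>) w = 0 \<and> evf 0 (Uf A) (Vf 1 A) (Gp (-\<tau>)) w = 0 \<and> evf 0 (Uf A) (Vf 1 A) (Lp \<tau>) w = 0 \<longrightarrow>
     (\<forall>u. dd u (evf 0 (Uf A) (Vf 1 A) (Gp \<tau>)) w = 0 \<and> dd u (evf 0 (Uf A) (Vf 1 A) (Gp (-\<tau>))) w = 0 \<and> dd u (evf 0 (Uf A) (Vf 1 A) (Lp \<tau>)) w = 0 \<longrightarrow> u = 0))"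
proof (rule generic_mono[OF generic_regular3[where \<kappa>="1" and h="sel3 (hs CX) (hs CX) (hs X2)" and k="sel3 (ks \<tau> CX) (ks (-\<tau>) CX) (ks \<tau> X2)"
    and a="(Gp \<tau>)" and b="(Gp (-\<tau>))" and c="(Lp \<tau>)" and Q="\<lambda>_ _. True"]])
  fix u v and x :: "real^3"
  assume Q: "(\<lambda>_ _. True) u v" and "\<And>i. (\<Sum>j\<in>UNIV. ev u v 0 0 (lin ((sel3 (hs CX) (hs CX) (hs X2)) j) ((sel3 (ks \<tau> CX) (ks (-\<tau>) CX) (ks \<tau> X2)) j)
     (sel3 (Gp \<tau>) (Gp (-\<tau>)) (Lp \<tau>) i)) * x $ j) = 0"
  from this(2)[of 1] this(2)[of 2] this(2)[of 3] Q \<tau> show "x = 0"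
    by (elim insertE emptyE; simp add: test_simps Gp_def Pp_def Lp_def)
qed (auto intro!: pure_sel coord_free_sel coord_free_polys coord_free_fD)

text \<open>\<open>X3\<close> moves only the x-derivative of \<open>Lp \<tau>\<close>, whose
  cofactor in the Jacobian is the y-derivative of \<open>Gp \<tau>\<close>; hence the guard. In
  \<open>generic_hyp\<close> it is derived from the regularity of the curve.\<close>

lemma generic_bi_inflection_simple:
  assumes \<tau>: "\<tau> \<in> {1, -1}"
  shows "generic (\<lambda>A :: bide_family. \<forall>w\<in>ddom 1 A. evf 0 (Uf A) (Vf 1 A) (fD DY (Gp \<tau>)) w \<noteq> 0 \<longrightarrow> \<not> (evf 0 (Uf A) (Vf 1 A) (Gp \<tau>) w = 0 \<and> evf 0 (Uf A) (Vf 1 A) (Gp (-\<tau>)) w = 0 \<and> evf 0 (Uf A) (Vf 1 A) (Lp \<tau>) w = 0 \<and> evf 0 (Uf A) (Vf 1 A) (Jp (Gp \<tau>) (Lp \<tau>)) w = 0))"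
proof (rule generic_mono[OF generic_avoid4[where \<kappa>="1" and h="sel4 (hs CX) (hs CX) (hs X2) (hs X3)" and k="sel4 (ks \<tau> CX) (ks (-\<tau>) CX) (ks \<tau> X2) (ks \<tau> X3)"
    and a="(Gp \<tau>)" and b="(Gp (-\<tau>))" and c="(Lp \<tau>)" and d="(Jp (Gp \<tau>) (Lp \<tau>))" and Q="\<lambda>u v. ev u v 0 0 (fD DY (Gp \<tau>)) \<noteq> 0"]])
  fix u v and x :: "real^4"
  assume Q: "(\<lambda>u v. ev u v 0 0 (fD DY (Gp \<tau>)) \<noteq> 0) u v" and "\<And>i. (\<Sum>j\<in>UNIV. ev u v 0 0 (lin ((sel4 (hs CX) (hs CX) (hs X2) (hs X3)) j) ((sel4 (ks \<tau> CX) (ks (-\<tau>) CX) (ks \<tau> X2) (ks \<tau> X3)) j)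
     (sel4 (Gp \<tau>) (Gp (-\<tau>)) (Lp \<tau>) (Jp (Gp \<tau>) (Lp \<tau>)) i)) * x $ j) = 0"
  from this(2)[of 1] this(2)[of 2] this(2)[of 3] this(2)[of 4] Q \<tau> show "x = 0"
    by (elim insertE emptyE; simp add: test_simps Gp_def Pp_def Lp_def Jp_def)
qed (auto simp: evf_ev coord_free_fD coord_free_polys intro!: pure_sel coord_free_sel coord_free_polys coord_free_fD)

section \<open>Left and right inflections\<close>

lemma dd_slice:
  assumes "smooth_on S f" "open S" "(z, \<epsilon>) \<in> S"
  shows "((\<lambda>z. f (z, \<epsilon>)) has_derivative (\<lambda>u. dd (u, 0) f (z, \<epsilon>))) (at z)"
    "dd u (\<lambda>z. f (z, \<epsilon>)) z = dd (u, 0) f (z, \<epsilon>)"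
proof -
  have d: "(f has_derivative frechet_derivative f (at (z, \<epsilon>))) (at (z, \<epsilon>))"
    by (rule smooth_on_has_derivative[OF assms])
  have "((\<lambda>z. (z, \<epsilon>)) has_derivative (\<lambda>v. (v, 0))) (at z)" by (auto intro!: derivative_eq_intros)
  from diff_chain_at[OF this d] show 1: "((\<lambda>z. f (z, \<epsilon>)) has_derivative (\<lambda>u. dd (u, 0) f (z, \<epsilon>))) (at z)"
    by (simp add: o_def)
  show "dd u (\<lambda>z. f (z, \<epsilon>)) z = dd (u, 0) f (z, \<epsilon>)" by (rule fun_cong[OF frechet_at_eqI[OF 1]])
qed

lemma smooth_slice:
  fixes S :: "('a::euclidean_space \<times> real) set"
  assumes "smooth_on S f" "open S"
  shows "open {z. (z, \<epsilon>) \<in> S}" "smooth_on {z. (z, \<epsilon>) \<in> S} (\<lambda>z. f (z, \<epsilon>))"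
proof -
  have "{z. (z, \<epsilon>) \<in> S} = (\<lambda>z. (z, \<epsilon>)) -` S" by auto
  then show o: "open {z. (z, \<epsilon>) \<in> S}" using open_vimage[OF assms(2), of "\<lambda>z. (z, \<epsilon>)"] by (simp add: continuous_intros)
  show "smooth_on {z. (z, \<epsilon>) \<in> S} (\<lambda>z. f (z, \<epsilon>))"
    by (rule smooth_on_compose[OF assms(1) _ o assms(2)]) (auto intro!: smooth_intros o)
qed

definition Pf :: "real \<Rightarrow> bide_family \<Rightarrow> plane \<times> real \<Rightarrow> real" where "Pf \<tau> A = evf 0 (Uf A) (Vf 1 A) (Pp \<tau>)"
definition Gf :: "real \<Rightarrow> bide_family \<Rightarrow> plane \<times> real \<Rightarrow> real" where "Gf \<tau> A = evf 0 (Uf A) (Vf 1 A) (Gp \<tau>)"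
definition Lf :: "real \<Rightarrow> bide_family \<Rightarrow> plane \<times> real \<Rightarrow> real" where "Lf \<tau> A = evf 0 (Uf A) (Vf 1 A) (Lp \<tau>)"

lemma Pf_eq: "Pf \<tau> A w = Uf A w + \<tau> * Vf 1 A w"
  by (simp add: Pf_def Pp_def evf_def jet_of_def)

context
  fixes A :: bide_family
  assumes A: "smooth_on UNIV A"
begin

lemma smooth_fields: "smooth_on (ddom 1 A) (Pf \<tau> A)" "smooth_on (ddom 1 A) (Gf \<tau> A)" "smooth_on (ddom 1 A) (Lf \<tau> A)"
  unfolding Pf_def Gf_def Lf_def by (intro smooth_evf open_ddom A smooth_UV)+

lemma dd_evf_ddom:
  assumes "w \<in> ddom \<kappa> A"
  shows "dd eX (evf 0 (Uf A) (Vf \<kappa> A) e) w = evf 0 (Uf A) (Vf \<kappa> A) (fD DX e) w"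
    "dd eY (evf 0 (Uf A) (Vf \<kappa> A) e) w = evf 0 (Uf A) (Vf \<kappa> A) (fD DY e) w"
  using dd_evf[where d=DX and ?z0.0=0 and e=e, OF open_ddom[OF A] smooth_UV[OF A] assms]
    dd_evf[where d=DY and ?z0.0=0 and e=e, OF open_ddom[OF A] smooth_UV[OF A] assms]
  by simp_all

lemma jac2_evf:
  assumes "w \<in> ddom \<kappa> A"
  shows "evf 0 (Uf A) (Vf \<kappa> A) (Jp a b) w = jac2 (evf 0 (Uf A) (Vf \<kappa> A) a) (evf 0 (Uf A) (Vf \<kappa> A) b) w"
  unfolding jac2_def dd_evf_ddom[OF assms] Jp_def by (simp add: evf_def)

lemma dd_jac2_evf:
  assumes "w \<in> ddom \<kappa> A"
  shows "dd u (evf 0 (Uf A) (Vf \<kappa> A) (Jp a b)) w = dd u (jac2 (evf 0 (Uf A) (Vf \<kappa> A) a) (evf 0 (Uf A) (Vf \<kappa> A) b)) w"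
  by (rule fun_cong[OF dd_cong[OF open_ddom[OF A] jac2_evf assms]])

lemma Gf_along: "w \<in> ddom 1 A \<Longrightarrow> Gf \<tau> A w = dd eX (Pf \<tau> A) w + Pf \<tau> A w * dd eY (Pf \<tau> A) w"
  unfolding Pf_def Gf_def dd_evf_ddom by (simp add: Gp_def evf_def)

lemma Lf_along: "w \<in> ddom 1 A \<Longrightarrow> Lf \<tau> A w = dd eX (Gf \<tau> A) w + Pf \<tau> A w * dd eY (Gf \<tau> A) w"
  unfolding Pf_def Gf_def Lf_def dd_evf_ddom by (simp add: Lp_def evf_def)

lemma smooth_member: "smooth_on UNIV (member A \<epsilon>)"
  unfolding member_def by (rule smooth_on_compose[OF A]) (auto intro!: smooth_intros)

lemma F_real: "F (member A \<epsilon>) z (p::real) = ca A (z, \<epsilon>) + 2 * cb A (z, \<epsilon>) * p + cc A (z, \<epsilon>) * p\<^sup>2"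
  by (simp add: F_def member_def case_prod_beta)

lemma square_completion: "cc A w * (ca A w + 2 * cb A w * p + cc A w * p\<^sup>2) = (cb A w + cc A w * p)\<^sup>2 - disc A w"
  by (simp add: disc_def power2_eq_square algebra_simps)

text \<open>Completing the square gives c F = (b + c p)^2 - disc, and the side is the sign of b + c
  p. Since \<open>Vf\<close> is divided by c, U + V is the right direction whatever the sign of
  c.\<close>

lemma part_root:
  assumes w: "((x, y), \<epsilon>) \<in> ddom 1 A"
  shows "(x, y, p) \<in> part (member A \<epsilon>) s \<longleftrightarrow> p = Pf (side_sgn s) A ((x, y), \<epsilon>)"
proof -
  let ?w = "((x, y), \<epsilon>)"
  define c where "c = cc A ?w"
  define b where "b = cb A ?w"
  define q where "q = sqrt (disc A ?w)"
  define \<sigma> where "\<sigma> = side_sgn s"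
  have \<sigma>: "\<sigma> = 1 \<or> \<sigma> = -1" unfolding \<sigma>_def by (cases s) auto
  have c: "c \<noteq> 0" and q: "q > 0" "q\<^sup>2 = disc A ?w" using w by (auto simp: ddom_def c_def q_def)
  have "F (member A \<epsilon>) (x, y) p = 0 \<longleftrightarrow> (b + c * p)\<^sup>2 = q\<^sup>2"
    unfolding F_real using square_completion[of ?w p] c q(2) by (simp add: b_def c_def) (metis mult_eq_0_iff eq_iff_diff_eq_0)
  moreover have "(b + c * p)\<^sup>2 = q\<^sup>2 \<and> \<sigma> * (b + c * p) > 0 \<longleftrightarrow> b + c * p = \<sigma> * q"
    using \<sigma> q(1) by (auto simp: power2_eq_iff)
  moreover have "b + c * p = \<sigma> * q \<longleftrightarrow> p = Pf \<sigma> A ?w"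
    unfolding Pf_eq Uf_def Vf_def c_def[symmetric] b_def[symmetric] using c by (auto simp: q_def field_simps)
  ultimately show ?thesis
    unfolding part_iff[OF smooth_member] \<sigma>_def[symmetric] by (simp add: member_def b_def c_def)
qed

lemma along_slice:
  assumes "smooth_on (ddom 1 A) P" "smooth_on (ddom 1 A) g" "(z, \<epsilon>) \<in> ddom 1 A"
  shows "along (1,0) (0,1) (\<lambda>z. P (z, \<epsilon>)) (\<lambda>z. g (z, \<epsilon>)) z = dd eX g (z, \<epsilon>) + P (z, \<epsilon>) * dd eY g (z, \<epsilon>)"
  unfolding along_def dd_slice(2)[OF assms(2) open_ddom[OF A] assms(3)] ..

lemma inflection_iff:
  assumes w: "(z, \<epsilon>) \<in> ddom 1 A"
  shows "z \<in> inflection_curve (member A \<epsilon>) s \<longleftrightarrow> Gf (side_sgn s) A (z, \<epsilon>) = 0"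
    "z \<in> bi_inflections (member A \<epsilon>) s \<longleftrightarrow> Gf (side_sgn s) A (z, \<epsilon>) = 0 \<and> Lf (side_sgn s) A (z, \<epsilon>) = 0"
proof -
  let ?\<sigma> = "side_sgn s" and ?V = "{z. (z, \<epsilon>) \<in> ddom 1 A}"
  let ?P = "\<lambda>z. Pf ?\<sigma> A (z, \<epsilon>)"
  note o = smooth_slice(1)[OF smooth_fields(1)[of ?\<sigma>] open_ddom[OF A], of \<epsilon>]
  note sm = smooth_slice(2)[OF smooth_fields(1)[of ?\<sigma>] open_ddom[OF A], of \<epsilon>]
  have root: "(x, y, p) \<in> part (member A \<epsilon>) s \<longleftrightarrow> p = ?P (x, y)" if "(x, y) \<in> ?V" for x y p
    using part_root that by simp
  have zV: "z \<in> ?V" using w by simp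
  have G: "along (1,0) (0,1) ?P ?P z' = Gf ?\<sigma> A (z', \<epsilon>)" if "z' \<in> ?V" for z'
    using along_slice[OF smooth_fields(1) smooth_fields(1)] Gf_along that by simp
  have "along (1,0) (0,1) ?P (along (1,0) (0,1) ?P ?P) z = along (1,0) (0,1) ?P (\<lambda>z. Gf ?\<sigma> A (z, \<epsilon>)) z"
    unfolding along_def[of _ _ _ "along _ _ _ _"] along_def[of _ _ _ "\<lambda>z. Gf ?\<sigma> A (z, \<epsilon>)"]
    by (simp only: dd_cong[OF o G zV])
  also have "\<dots> = Lf ?\<sigma> A (z, \<epsilon>)"
    using along_slice[OF smooth_fields(1) smooth_fields(2) w] Lf_along[OF w] by simp
  finally have L: "along (1,0) (0,1) ?P (along (1,0) (0,1) ?P ?P) z = Lf ?\<sigma> A (z, \<epsilon>)" .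
  show "z \<in> inflection_curve (member A \<epsilon>) s \<longleftrightarrow> Gf ?\<sigma> A (z, \<epsilon>) = 0"
    using inflection_curve_iff[OF smooth_member o sm root zV] G[OF zV] by simp
  show "z \<in> bi_inflections (member A \<epsilon>) s \<longleftrightarrow> Gf ?\<sigma> A (z, \<epsilon>) = 0 \<and> Lf ?\<sigma> A (z, \<epsilon>) = 0"
    using bi_inflections_iff[OF smooth_member o sm root zV] G[OF zV] L by simp
qed

text \<open>Directions on both sides give b + c p opposite signs at one point, which forces c to be
  nonzero; F = 0 then makes the discriminant a positive square.\<close>

lemma both_inflections_ddom:
  assumes "z \<in> inflection_curve (member A \<epsilon>) Left_Side" "z \<in> inflection_curve (member A \<epsilon>) Right_Side"
  shows "(z, \<epsilon>) \<in> ddom 1 A"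
proof -
  obtain x y where z: "z = (x, y)" by (cases z)
  obtain p1 p2 where "(x, y, p1) \<in> part (member A \<epsilon>) Left_Side" "(x, y, p2) \<in> part (member A \<epsilon>) Right_Side"
    using inflection_curve_part[OF smooth_member] assms unfolding z by metis
  then have *: "F (member A \<epsilon>) (x, y) p2 = 0" "cb A (z, \<epsilon>) + cc A (z, \<epsilon>) * p1 < 0" "cb A (z, \<epsilon>) + cc A (z, \<epsilon>) * p2 > 0"
    unfolding part_iff[OF smooth_member] by (auto simp: member_def z)
  have "cc A (z, \<epsilon>) \<noteq> 0" using *(2,3) by auto
  moreover have "(cb A (z, \<epsilon>) + cc A (z, \<epsilon>) * p2)\<^sup>2 - disc A (z, \<epsilon>) = 0"
    using *(1) square_completion[of "(z, \<epsilon>)" p2] unfolding F_real z by simp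
  then have "disc A (z, \<epsilon>) > 0" using *(3) by (metis eq_iff_diff_eq_0 less_irrefl zero_less_power2)
  ultimately show ?thesis by (simp add: ddom_def)
qed

end

text \<open>Tangency is defined with arbitrary local equations; this carries tangent vectors over to
  the equations \<open>Gf\<close>, for which the generic conditions are stated. The inverse function
  theorem produces a curve inside h = 0 whose velocity is a multiple of v.\<close>

lemma zero_set_tangent:
  fixes f h :: "plane \<Rightarrow> real"
  assumes U: "open U" "q \<in> U" and sm: "smooth_on U f" "smooth_on U h"
    and eq: "\<And>z. z \<in> U \<Longrightarrow> h z = 0 \<Longrightarrow> f z = 0" and hq: "h q = 0"
    and n: "dd n h q \<noteq> 0" and v: "dd v h q = 0"
  shows "dd v f q = 0"
proof (cases "v = 0")
  case True
  then show ?thesis using linear_0[OF smooth_on_linear[OF sm(1) U]] by simp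
next
  case v0: False
  have lin: "linear (frechet_derivative h (at q))" by (rule smooth_on_linear[OF sm(2) U])
  obtain v1 v2 where vv: "v = (v1, v2)" by (cases v)
  define h1 where "h1 = dd (1,0) h q"
  define h2 where "h2 = dd (0,1) h q"
  have h: "dd (a, b) h q = a * h1 + b * h2" for a b
  proof -
    have "(a, b) = a *\<^sub>R (1, 0) + b *\<^sub>R (0, 1::real)" by simp
    then have "dd (a, b) h q = dd (a *\<^sub>R (1, 0) + b *\<^sub>R (0, 1)) h q" by (simp only:)
    then show ?thesis by (simp only: linear_add[OF lin] linear_scale[OF lin] real_scaleR_def h1_def h2_def)
  qed
  have hn: "h1 \<noteq> 0 \<or> h2 \<noteq> 0" using n h by (cases n) auto
  have hv: "v1 * h1 + v2 * h2 = 0" using v h vv by simp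
  have vpos: "v1 * v1 + v2 * v2 > 0" using v0 vv by (metis sum_squares_gt_zero_iff zero_prod_def)
  \<comment> \<open>The second coordinate measures displacement along v, so the inverse map
    restricted to h = 0 is parametrized by it.\<close>
  define \<Psi> where "\<Psi> z = (h z, v1 * (fst z - fst q) + v2 * (snd z - snd q))" for z
  have sm\<Psi>: "smooth_on U \<Psi>" unfolding \<Psi>_def by (intro smooth_intros U sm)
  have d\<Psi>: "(\<Psi> has_derivative (\<lambda>u. (dd u h q, v1 * fst u + v2 * snd u))) (at q)"
    unfolding \<Psi>_def
    by (rule derivative_eq_intros has_derivative_Pair smooth_on_has_derivative[OF sm(2) U] refl)+ (simp add: fun_eq_iff)
  \<comment> \<open>In the plane a vector tangent to h = 0 is a multiple of v, and its inner product
    with v determines which.\<close>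
  have key: "u = (w / (v1 * v1 + v2 * v2)) *\<^sub>R v" if "dd u h q = 0" "v1 * fst u + v2 * snd u = w" for u w
  proof -
    obtain u1 u2 where u: "u = (u1, u2)" by (cases u)
    have e: "u1 * h1 + u2 * h2 = 0" "v1 * u1 + v2 * u2 = w" using that h u by auto
    have "h1 * (u1 * v2 - u2 * v1) = 0" "h2 * (u1 * v2 - u2 * v1) = 0" using e(1) hv by algebra+
    then have "u1 * v2 = u2 * v1" using hn by auto
    then have *: "u1 * (v1 * v1 + v2 * v2) = w * v1" "u2 * (v1 * v1 + v2 * v2) = w * v2"
      unfolding e(2)[symmetric] by algebra+
    have "v1 * v1 + v2 * v2 \<noteq> 0" by (rule less_imp_neq[OF vpos, symmetric])
    then have "u1 = w / (v1 * v1 + v2 * v2) * v1" "u2 = w / (v1 * v1 + v2 * v2) * v2"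
      using * by (metis nonzero_eq_divide_eq times_divide_eq_left)+
    then show ?thesis by (simp add: u vv)
  qed
  have "u = 0" if "frechet_derivative \<Psi> (at q) u = 0" for u
    using key[of u 0] that unfolding frechet_at_eqI[OF d\<Psi>] by (auto simp: zero_prod_def)
  then obtain W W' g where W: "open W" "open W'" "q \<in> W" "W \<subseteq> U" "\<Psi> q \<in> W'" "\<Psi> ` W = W'" "g ` W' = W" "smooth_on W' g"
      "\<And>x. x \<in> W \<Longrightarrow> g (\<Psi> x) = x" "\<And>y. y \<in> W' \<Longrightarrow> \<Psi> (g y) = y"
    using smooth_inverse_function[OF U(1) sm\<Psi> U(2)] by metis
  have \<Psi>q: "\<Psi> q = (0, 0)" using hq by (simp add: \<Psi>_def)
  define T where "T = {t::real. (0, t) \<in> W'}"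
  have oT: "open T"
  proof -
    have "T = (\<lambda>t. (0, t)) -` W'" by (auto simp: T_def)
    then show ?thesis using open_vimage[OF W(2), of "\<lambda>t. (0, t)"] by (simp add: continuous_intros)
  qed
  have T0: "0 \<in> T" using W(5) \<Psi>q by (simp add: T_def)
  have g0: "g (0, 0) = q" using W(9)[OF W(3)] \<Psi>q by simp
  have dg: "(g has_derivative frechet_derivative g (at (0, 0))) (at (0, 0))"
    by (rule smooth_on_has_derivative[OF W(8,2)]) (use W(5) \<Psi>q in simp)
  define m where "m = frechet_derivative g (at (0, 0)) (0, 1)"
  have "((\<lambda>t. (0::real, t)) has_derivative (\<lambda>t. (0, t))) (at 0)" by (auto intro!: derivative_eq_intros)
  from diff_chain_at[OF this dg]
  have "((\<lambda>t. g (0, t)) has_derivative (\<lambda>t. frechet_derivative g (at (0, 0)) (0, t))) (at 0)" by (simp add: o_def)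
  moreover have "frechet_derivative g (at (0, 0)) (0, t) = t *\<^sub>R m" for t
    using linear_scale[OF has_derivative_linear[OF dg], of t "(0, 1)"] by (simp add: m_def)
  ultimately have dc: "((\<lambda>t. g (0, t)) has_vector_derivative m) (at 0)" by (simp add: has_vector_derivative_def)
  have inU: "g (0, t) \<in> U" if "t \<in> T" for t using that W(4,7) by (auto simp: T_def)
  have h0: "h (g (0, t)) = 0" "v1 * (fst (g (0, t)) - fst q) + v2 * (snd (g (0, t)) - snd q) = t" if "t \<in> T" for t
    using W(10)[of "(0, t)"] that by (auto simp: T_def \<Psi>_def)
  have zero: "dd m k q = 0" if k: "smooth_on U k" "\<And>t. t \<in> T \<Longrightarrow> k (g (0, t)) = 0" for k :: "plane \<Rightarrow> real"
  proof -
    have "((\<lambda>t. k (g (0, t))) has_real_derivative dd m k (g (0, 0))) (at 0)"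
      by (rule dd_chain_curve[OF k(1) U(1) inU[OF T0] dc])
    moreover have "((\<lambda>t. k (g (0, t))) has_real_derivative 0) (at 0)"
      unfolding has_field_derivative_def
      by (rule has_derivative_transform_within_open[OF DERIV_const[unfolded has_field_derivative_def] oT T0]) (simp add: k(2))
    ultimately show ?thesis using DERIV_unique g0 by metis
  qed
  have "dd m h q = 0" by (rule zero[OF sm(2) h0(1)])
  moreover have "v1 * fst m + v2 * snd m = 1"
  proof -
    have f: "((\<lambda>t. fst (g (0, t))) has_real_derivative fst m) (at 0)" and s: "((\<lambda>t. snd (g (0, t))) has_real_derivative snd m) (at 0)"
      using bounded_linear.has_vector_derivative[OF bounded_linear_fst dc] bounded_linear.has_vector_derivative[OF bounded_linear_snd dc]
      by (simp_all add: has_real_derivative_iff_has_vector_derivative)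
    have "((\<lambda>t. v1 * (fst (g (0, t)) - fst q) + v2 * (snd (g (0, t)) - snd q)) has_real_derivative v1 * fst m + v2 * snd m) (at 0)"
      by (rule derivative_eq_intros f s refl)+ simp
    moreover have "((\<lambda>t. v1 * (fst (g (0, t)) - fst q) + v2 * (snd (g (0, t)) - snd q)) has_real_derivative 1) (at 0)"
      unfolding has_field_derivative_def
      by (rule has_derivative_transform_within_open[OF DERIV_ident[unfolded has_field_derivative_def] oT T0]) (simp add: h0(2))
    ultimately show ?thesis by (rule DERIV_unique)
  qed
  ultimately have "m = (1 / (v1 * v1 + v2 * v2)) *\<^sub>R v" by (rule key)
  moreover have "dd m f q = 0" by (rule zero[OF sm(1)]) (use eq inU h0(1) in auto)
  ultimately have "(1 / (v1 * v1 + v2 * v2)) * dd v f q = 0"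
    using linear_scale[OF smooth_on_linear[OF sm(1) U]] by simp
  then show ?thesis using less_imp_neq[OF vpos] by (metis divide_eq_0_iff mult_eq_0_iff zero_neq_one)
qed

text \<open>The conditions concern common zeros of the two G only. They say that both curves are
  regular, that a tangency is nondegenerate in (x, y, \<epsilon>), and that a bi-inflection there is
  isolated for fixed \<epsilon> and moves transversely to the other curve.\<close>

definition hyp_generic :: "bide_family \<Rightarrow> bool" where
  "hyp_generic A \<longleftrightarrow> (\<forall>w\<in>ddom 1 A. Gf 1 A w = 0 \<longrightarrow> Gf (-1) A w = 0 \<longrightarrow>
     (\<forall>\<tau>\<in>{1,-1}. dd eX (Gf \<tau> A) w \<noteq> 0 \<or> dd eY (Gf \<tau> A) w \<noteq> 0) \<and>
     (jac2 (Gf (-1) A) (Gf 1 A) w = 0 \<longrightarrow> (\<forall>u. dd u (Gf (-1) A) w = 0 \<longrightarrow> dd u (Gf 1 A) w = 0 \<longrightarrow>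
        dd u (jac2 (Gf (-1) A) (Gf 1 A)) w = 0 \<longrightarrow> u = 0)) \<and>
     (\<forall>\<tau>\<in>{1,-1}. Lf \<tau> A w = 0 \<longrightarrow> jac2 (Gf \<tau> A) (Lf \<tau> A) w \<noteq> 0 \<and>
        (\<forall>u. dd u (Gf \<tau> A) w = 0 \<longrightarrow> dd u (Gf (-\<tau>) A) w = 0 \<longrightarrow> dd u (Lf \<tau> A) w = 0 \<longrightarrow> u = 0)))"

lemma generic_hyp: "generic hyp_generic"
proof -
  have p: "(1::real) \<in> {1,-1}" "(-1::real) \<in> {1,-1}" by auto
  note G = generic_conj[OF generic_some_DY_nonzero_real generic_conj[OF generic_gradient_nonzero[OF p(1)] generic_conj[OF generic_gradient_nonzero[OF p(2)]
    generic_conj[OF generic_nondegenerate_tangency_real[OF p(1)] generic_conj[OF generic_nondegenerate_tangency_real[OF p(2)] generic_conj[OF generic_bi_inflection_moves[OF p(1)]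
    generic_conj[OF generic_bi_inflection_moves[OF p(2)] generic_conj[OF generic_bi_inflection_simple[OF p(1)] generic_bi_inflection_simple[OF p(2)]]]]]]]]]
  show ?thesis
  proof (rule generic_mono[OF G])
    fix A :: bide_family assume A: "smooth_on UNIV A"
    assume H: "(\<forall>w\<in>ddom 1 A.
         \<not> (evf 0 (Uf A) (Vf 1 A) (Gp 1) w = 0 \<and> evf 0 (Uf A) (Vf 1 A) (Gp (- 1)) w = 0 \<and>
             evf 0 (Uf A) (Vf 1 A) (fD DY (Gp 1)) w = 0 \<and> evf 0 (Uf A) (Vf 1 A) (fD DY (Gp (- 1))) w = 0)) \<and>
      (\<forall>w\<in>ddom 1 A. \<not> (evf 0 (Uf A) (Vf 1 A) (Gp 1) w = 0 \<and> evf 0 (Uf A) (Vf 1 A) (Gp (- 1)) w = 0 \<and>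
             evf 0 (Uf A) (Vf 1 A) (fD DX (Gp 1)) w = 0 \<and> evf 0 (Uf A) (Vf 1 A) (fD DY (Gp 1)) w = 0)) \<and>
      (\<forall>w\<in>ddom 1 A. \<not> (evf 0 (Uf A) (Vf 1 A) (Gp (- 1)) w = 0 \<and> evf 0 (Uf A) (Vf 1 A) (Gp (- (- 1))) w = 0 \<and>
             evf 0 (Uf A) (Vf 1 A) (fD DX (Gp (- 1))) w = 0 \<and> evf 0 (Uf A) (Vf 1 A) (fD DY (Gp (- 1))) w = 0)) \<and>
      (\<forall>w\<in>ddom 1 A. evf 0 (Uf A) (Vf 1 A) (fD DY (Gp (- 1))) w \<noteq> 0 \<longrightarrow>
          evf 0 (Uf A) (Vf 1 A) (Gp 1) w = 0 \<and> evf 0 (Uf A) (Vf 1 A) (Gp (- 1)) w = 0 \<and> evf 0 (Uf A) (Vf 1 A) (Jp (Gp (- 1)) (Gp 1)) w = 0 \<longrightarrow>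
          (\<forall>u. dd u (evf 0 (Uf A) (Vf 1 A) (Gp 1)) w = 0 \<and> dd u (evf 0 (Uf A) (Vf 1 A) (Gp (- 1))) w = 0 \<and>
               dd u (evf 0 (Uf A) (Vf 1 A) (Jp (Gp (- 1)) (Gp 1))) w = 0 \<longrightarrow> u = 0)) \<and>
      (\<forall>w\<in>ddom 1 A. evf 0 (Uf A) (Vf 1 A) (fD DY (Gp (- (- 1)))) w \<noteq> 0 \<longrightarrow>
          evf 0 (Uf A) (Vf 1 A) (Gp (- 1)) w = 0 \<and> evf 0 (Uf A) (Vf 1 A) (Gp (- (- 1))) w = 0 \<and> evf 0 (Uf A) (Vf 1 A) (Jp (Gp (- 1)) (Gp 1)) w = 0 \<longrightarrow>
          (\<forall>u. dd u (evf 0 (Uf A) (Vf 1 A) (Gp (- 1))) w = 0 \<and> dd u (evf 0 (Uf A) (Vf 1 A) (Gp (- (- 1)))) w = 0 \<and>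
               dd u (evf 0 (Uf A) (Vf 1 A) (Jp (Gp (- 1)) (Gp 1))) w = 0 \<longrightarrow> u = 0)) \<and>
      (\<forall>w\<in>ddom 1 A. evf 0 (Uf A) (Vf 1 A) (Gp 1) w = 0 \<and> evf 0 (Uf A) (Vf 1 A) (Gp (- 1)) w = 0 \<and> evf 0 (Uf A) (Vf 1 A) (Lp 1) w = 0 \<longrightarrow>
          (\<forall>u. dd u (evf 0 (Uf A) (Vf 1 A) (Gp 1)) w = 0 \<and> dd u (evf 0 (Uf A) (Vf 1 A) (Gp (- 1))) w = 0 \<and>
               dd u (evf 0 (Uf A) (Vf 1 A) (Lp 1)) w = 0 \<longrightarrow> u = 0)) \<and>
      (\<forall>w\<in>ddom 1 A. evf 0 (Uf A) (Vf 1 A) (Gp (- 1)) w = 0 \<and> evf 0 (Uf A) (Vf 1 A) (Gp (- (- 1))) w = 0 \<and> evf 0 (Uf A) (Vf 1 A) (Lp (- 1)) w = 0 \<longrightarrow>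
          (\<forall>u. dd u (evf 0 (Uf A) (Vf 1 A) (Gp (- 1))) w = 0 \<and> dd u (evf 0 (Uf A) (Vf 1 A) (Gp (- (- 1)))) w = 0 \<and>
               dd u (evf 0 (Uf A) (Vf 1 A) (Lp (- 1))) w = 0 \<longrightarrow> u = 0)) \<and>
      (\<forall>w\<in>ddom 1 A. evf 0 (Uf A) (Vf 1 A) (fD DY (Gp 1)) w \<noteq> 0 \<longrightarrow>
          \<not> (evf 0 (Uf A) (Vf 1 A) (Gp 1) w = 0 \<and> evf 0 (Uf A) (Vf 1 A) (Gp (- 1)) w = 0 \<and> evf 0 (Uf A) (Vf 1 A) (Lp 1) w = 0 \<and>
              evf 0 (Uf A) (Vf 1 A) (Jp (Gp 1) (Lp 1)) w = 0)) \<and>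
      (\<forall>w\<in>ddom 1 A. evf 0 (Uf A) (Vf 1 A) (fD DY (Gp (- 1))) w \<noteq> 0 \<longrightarrow>
          \<not> (evf 0 (Uf A) (Vf 1 A) (Gp (- 1)) w = 0 \<and> evf 0 (Uf A) (Vf 1 A) (Gp (- (- 1))) w = 0 \<and> evf 0 (Uf A) (Vf 1 A) (Lp (- 1)) w = 0 \<and>
              evf 0 (Uf A) (Vf 1 A) (Jp (Gp (- 1)) (Lp (- 1))) w = 0))"
    show "hyp_generic A"
      unfolding hyp_generic_def
    proof (intro ballI impI)
      fix w assume w: "w \<in> ddom 1 A" and z: "Gf 1 A w = 0" "Gf (-1) A w = 0"
      note e = dd_evf_ddom[OF A w, symmetric] jac2_evf[OF A w] dd_jac2_evf[OF A w]
      note K1 = H[THEN conjunct1, THEN bspec, OF w, unfolded minus_minus e, folded Gf_def Lf_def]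
      note K2 = H[THEN conjunct2, THEN conjunct1, THEN bspec, OF w, unfolded minus_minus e, folded Gf_def Lf_def]
      note K3 = H[THEN conjunct2, THEN conjunct2, THEN conjunct1, THEN bspec, OF w, unfolded minus_minus e, folded Gf_def Lf_def]
      note K4 = H[THEN conjunct2, THEN conjunct2, THEN conjunct2, THEN conjunct1, THEN bspec, OF w, unfolded minus_minus e, folded Gf_def Lf_def]
      note K5 = H[THEN conjunct2, THEN conjunct2, THEN conjunct2, THEN conjunct2, THEN conjunct1, THEN bspec, OF w, unfolded minus_minus e, folded Gf_def Lf_def]
      note K6 = H[THEN conjunct2, THEN conjunct2, THEN conjunct2, THEN conjunct2, THEN conjunct2, THEN conjunct1, THEN bspec, OF w, unfolded minus_minus e, folded Gf_def Lf_def]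
      note K7 = H[THEN conjunct2, THEN conjunct2, THEN conjunct2, THEN conjunct2, THEN conjunct2, THEN conjunct2, THEN conjunct1, THEN bspec, OF w, unfolded minus_minus e, folded Gf_def Lf_def]
      note K8 = H[THEN conjunct2, THEN conjunct2, THEN conjunct2, THEN conjunct2, THEN conjunct2, THEN conjunct2, THEN conjunct2, THEN conjunct1, THEN bspec, OF w, unfolded minus_minus e, folded Gf_def Lf_def]
      note K9 = H[THEN conjunct2, THEN conjunct2, THEN conjunct2, THEN conjunct2, THEN conjunct2, THEN conjunct2, THEN conjunct2, THEN conjunct2, THEN bspec, OF w, unfolded minus_minus e, folded Gf_def Lf_def]
      have N1: "\<not> (dd eY (Gf 1 A) w = 0 \<and> dd eY (Gf (-1) A) w = 0)"
        and N3: "\<not> (dd eX (Gf 1 A) w = 0 \<and> dd eY (Gf 1 A) w = 0)" "\<not> (dd eX (Gf (-1) A) w = 0 \<and> dd eY (Gf (-1) A) w = 0)"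
        using K1 K2 K3 z by blast+
      \<comment> \<open>L = G_x + P G_y, so L = 0 and G_y = 0 would annihilate the whole gradient of
        G.\<close>
      have Ly: "dd eY (Gf \<tau> A) w \<noteq> 0" if "Lf \<tau> A w = 0" "\<tau> \<in> {1,-1}" for \<tau>
        using Lf_along[OF A w, of \<tau>] that N3 by auto
      show "(\<forall>\<tau>\<in>{1,-1}. dd eX (Gf \<tau> A) w \<noteq> 0 \<or> dd eY (Gf \<tau> A) w \<noteq> 0) \<and>
         (jac2 (Gf (-1) A) (Gf 1 A) w = 0 \<longrightarrow> (\<forall>u. dd u (Gf (-1) A) w = 0 \<longrightarrow> dd u (Gf 1 A) w = 0 \<longrightarrow>
            dd u (jac2 (Gf (-1) A) (Gf 1 A)) w = 0 \<longrightarrow> u = 0)) \<and>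
         (\<forall>\<tau>\<in>{1,-1}. Lf \<tau> A w = 0 \<longrightarrow> jac2 (Gf \<tau> A) (Lf \<tau> A) w \<noteq> 0 \<and>
            (\<forall>u. dd u (Gf \<tau> A) w = 0 \<longrightarrow> dd u (Gf (-\<tau>) A) w = 0 \<longrightarrow> dd u (Lf \<tau> A) w = 0 \<longrightarrow> u = 0))"
      proof (intro conjI ballI impI allI)
        fix \<tau> :: real assume \<tau>: "\<tau> \<in> {1,-1}"
        then show "dd eX (Gf \<tau> A) w \<noteq> 0 \<or> dd eY (Gf \<tau> A) w \<noteq> 0" using N3 by auto
        assume L: "Lf \<tau> A w = 0"
        consider "\<tau> = 1" | "\<tau> = -1" using \<tau> by auto
        then show "jac2 (Gf \<tau> A) (Lf \<tau> A) w \<noteq> 0"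
        proof cases
          case 1 then show ?thesis using K8 z L Ly[OF L \<tau>] by simp
        next
          case 2 then show ?thesis using K9 z L Ly[OF L \<tau>] by simp
        qed
        fix u assume u: "dd u (Gf \<tau> A) w = 0" "dd u (Gf (-\<tau>) A) w = 0" "dd u (Lf \<tau> A) w = 0"
        consider "\<tau> = 1" | "\<tau> = -1" using \<tau> by auto
        then show "u = 0"
        proof cases
          case 1 then show ?thesis using K6[rule_format, of u] z L u by simp
        next
          case 2 then show ?thesis using K7[rule_format, of u] z L u by simp
        qed
      next
        fix u assume "jac2 (Gf (-1) A) (Gf 1 A) w = 0" "dd u (Gf (-1) A) w = 0" "dd u (Gf 1 A) w = 0"
          "dd u (jac2 (Gf (-1) A) (Gf 1 A)) w = 0"
        \<comment> \<open>At least one of the two y-derivatives is nonzero, and the tangency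
          condition with that guard applies.\<close>
        then show "u = 0" using N1 K4[rule_format, of u] K5[rule_format, of u] z by metis
      qed
    qed
  qed
qed

section \<open>Tangent inflection curves, and bi-inflections crossing the other curve\<close>

context
  fixes A :: bide_family
  assumes A: "smooth_on UNIV A" and gen: "hyp_generic A"
begin

text \<open>The velocity of \<open>c\<close> is tangent to both curves, so the Jacobian of their
  equations vanishes; \<open>hyp_generic\<close> then supplies the nondegeneracy for the normal
  form.\<close>

lemma hyperbolic_transition:
  assumes qt: "quadratically_tangent_at (inflection_curve (member A \<epsilon>0) Left_Side) (inflection_curve (member A \<epsilon>0) Right_Side) q"
  shows "hyperbolic_creation_annihilation (\<lambda>\<epsilon>. inflection_curve (member A \<epsilon>) Left_Side)
          (\<lambda>\<epsilon>. inflection_curve (member A \<epsilon>) Right_Side) q \<epsilon>0"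
proof -
  let ?IL = "inflection_curve (member A \<epsilon>0) Left_Side" and ?IR = "inflection_curve (member A \<epsilon>0) Right_Side"
  let ?g1 = "Gf (-1) A" and ?g2 = "Gf 1 A"
  obtain U g h r c where lg: "local_equation ?IL q U g" and lh: "local_equation ?IR q U h" and r: "r > 0"
    and c: "smooth_on {-r<..<r} c" "c 0 = q" "vector_derivative c (at 0) \<noteq> 0" "c ` {-r<..<r} \<subseteq> ?IL \<inter> U" "contact_exactly 2 c h"
    using qt unfolding quadratically_tangent_at_def by blast
  have U: "open U" "q \<in> U" and qL: "q \<in> ?IL" and qR: "q \<in> ?IR" and smh: "smooth_on U h"
    and hz: "?IR \<inter> U = {z \<in> U. h z = 0}" and hn: "\<exists>v. frechet_derivative h (at q) v \<noteq> 0"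
    using lg lh unfolding local_equation_def by auto
  let ?w = "(q, \<epsilon>0)"
  have w: "?w \<in> ddom 1 A" by (rule both_inflections_ddom[OF A qL qR])
  note o = open_ddom[OF A, of 1] and sm = smooth_fields[OF A]
  have z1: "?g1 ?w = 0" and z2: "?g2 ?w = 0"
    using inflection_iff(1)[OF A w, of Left_Side] inflection_iff(1)[OF A w, of Right_Side] qL qR by auto
  have J: "open {-r<..<r}" "0 \<in> {-r<..<r}" using r by auto
  have dc: "(c has_vector_derivative vector_derivative c (at 0)) (at 0)"
    using smooth_on_differentiable[OF c(1) J] by (simp add: vector_derivative_works)
  let ?v = "vector_derivative c (at 0)"
  define V where "V = U \<inter> {z. (z, \<epsilon>0) \<in> ddom 1 A}"
  have V: "open V" "q \<in> V" using U smooth_slice(1)[OF sm(1) o] w by (auto simp: V_def open_Int)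
  have sl: "smooth_on V (\<lambda>z. Gf \<tau> A (z, \<epsilon>0))" for \<tau>
    using smooth_on_subset[OF smooth_slice(2)[OF sm(2) o]] by (auto simp: V_def)
  have "open ({-r<..<r} \<inter> c -` V)"
    using continuous_open_preimage[OF smooth_on_continuous_on[OF c(1) J(1)] J(1) V(1)] .
  then obtain T where T: "open T" "0 \<in> T" "T \<subseteq> {-r<..<r}" "c ` T \<subseteq> V"
  proof (rule that[of "{-r<..<r} \<inter> c -` V"])
    show "0 \<in> {-r<..<r} \<inter> c -` V" using J(2) c(2) V(2) by simp
  qed blast+
  have "((\<lambda>t. ?g1 (c t, \<epsilon>0)) has_real_derivative dd ?v (\<lambda>z. ?g1 (z, \<epsilon>0)) (c 0)) (at 0)"
    by (rule dd_chain_curve[OF sl V(1) _ dc]) (simp add: c(2) V(2))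
  moreover have "((\<lambda>t. ?g1 (c t, \<epsilon>0)) has_real_derivative 0) (at 0)"
    unfolding has_field_derivative_def
  proof (rule has_derivative_transform_within_open[OF DERIV_const[unfolded has_field_derivative_def] T(1,2)])
    fix t assume t: "t \<in> T"
    have "c t \<in> ?IL" using subsetD[OF T(3) t] c(4) by blast
    moreover have "(c t, \<epsilon>0) \<in> ddom 1 A" using t T(4) unfolding V_def by blast
    ultimately    show "0 = ?g1 (c t, \<epsilon>0)" using inflection_iff(1)[OF A, of "c t" \<epsilon>0 Left_Side] by simp
  qed
  ultimately have 1: "dd (?v, 0) ?g1 ?w = 0"
    using DERIV_unique dd_slice(2)[OF sm(2)[of "-1"] o w, where u = ?v] c(2) by metis
  have "deriv (h \<circ> c) 0 = 0"
  proof -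
    have "(deriv ^^ 1) (h \<circ> c) 0 = 0"
      using c(5) unfolding contact_exactly_def contact_at_least_def by (metis one_less_numeral_iff semiring_norm(76))
    then show ?thesis by simp
  qed
  moreover have "((\<lambda>t. h (c t)) has_real_derivative dd ?v h (c 0)) (at 0)"
    by (rule dd_chain_curve[OF smh U(1) _ dc]) (simp add: c(2) U(2))
  ultimately have hv: "dd ?v h q = 0" using DERIV_imp_deriv c(2) unfolding comp_def by metis
  obtain n where n: "dd n h q \<noteq> 0" using hn by blast
  have hV: "smooth_on V h" by (rule smooth_on_subset[OF smh]) (simp add: V_def)
  have hq: "h q = 0" using hz U(2) qR by blast
  have hG: "?g2 (z, \<epsilon>0) = 0" if "z \<in> V" "h z = 0" for z
  proof -
    have "z \<in> ?IR" "(z, \<epsilon>0) \<in> ddom 1 A" using that hz by (auto simp: V_def)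
    then show ?thesis using inflection_iff(1)[OF A, of z \<epsilon>0 Right_Side] by simp
  qed
  have "dd ?v (\<lambda>z. ?g2 (z, \<epsilon>0)) q = 0"
    by (rule zero_set_tangent[OF V sl hV hG hq n hv])
  then have 2: "dd (?v, 0) ?g2 ?w = 0" using dd_slice(2)[OF sm(2)[of 1] o w, where u = ?v] by simp
  obtain a b where v: "?v = (a, b)" by (cases ?v)
  have ab: "a \<noteq> 0 \<or> b \<noteq> 0" using c(3) v by (auto simp: zero_prod_def)
  have e: "a * dd eX ?g1 ?w + b * dd eY ?g1 ?w = 0" "a * dd eX ?g2 ?w + b * dd eY ?g2 ?w = 0"
    using 1 2 dd_expand[OF sm(2)[of "-1"] o w, of a b 0] dd_expand[OF sm(2)[of 1] o w, of a b 0] unfolding v by simp_all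
  have jac: "jac2 ?g1 ?g2 ?w = 0"
  proof -
    have "a * jac2 ?g1 ?g2 ?w = 0" "b * jac2 ?g1 ?g2 ?w = 0"
      unfolding jac2_def using e by algebra+
    then show ?thesis using ab by auto
  qed
  have G: "(\<forall>\<tau>\<in>{1,-1}. dd eX (Gf \<tau> A) ?w \<noteq> 0 \<or> dd eY (Gf \<tau> A) ?w \<noteq> 0)"
     "jac2 ?g1 ?g2 ?w = 0 \<longrightarrow> (\<forall>u. dd u ?g1 ?w = 0 \<longrightarrow> dd u ?g2 ?w = 0 \<longrightarrow> dd u (jac2 ?g1 ?g2) ?w = 0 \<longrightarrow> u = 0)"
    using gen w z1 z2 unfolding hyp_generic_def by blast+
  have d1: "dd eX ?g1 ?w \<noteq> 0 \<or> dd eY ?g1 ?w \<noteq> 0" and d2: "dd eX ?g2 ?w \<noteq> 0 \<or> dd eY ?g2 ?w \<noteq> 0"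
    using G(1) by auto
  have nd: "\<And>u. dd u ?g1 ?w = 0 \<Longrightarrow> dd u ?g2 ?w = 0 \<Longrightarrow> dd u (jac2 ?g1 ?g2) ?w = 0 \<Longrightarrow> u = 0"
    using G(2) jac by blast
  obtain W W' and \<Phi> :: "plane \<times> real \<Rightarrow> plane \<times> real" and \<tau> where W: "?w \<in> W" "W \<subseteq> ddom 1 A" "diffeo_on W W' \<Phi>" "\<Phi> ?w = ((0, 0), 0)"
    "\<And>z \<epsilon>. (z, \<epsilon>) \<in> W \<Longrightarrow> snd (\<Phi> (z, \<epsilon>)) = \<tau> \<epsilon>"
    "\<And>z \<epsilon>. (z, \<epsilon>) \<in> W \<Longrightarrow> ?g1 (z, \<epsilon>) = 0 \<longleftrightarrow> (case \<Phi> (z, \<epsilon>) of ((x, y), e) \<Rightarrow> y - x\<^sup>2 + e = 0)"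
    "\<And>z \<epsilon>. (z, \<epsilon>) \<in> W \<Longrightarrow> ?g2 (z, \<epsilon>) = 0 \<longleftrightarrow> (case \<Phi> (z, \<epsilon>) of ((x, y), e) \<Rightarrow> y + x\<^sup>2 - e = 0)"
    "\<exists>r>0. smooth_on {\<epsilon>0 - r<..<\<epsilon>0 + r} \<tau>" "dd 1 \<tau> \<epsilon>0 \<noteq> 0"
  proof (rule fold_normal_form[OF o w sm(2) sm(2) z1 z2 jac d1 d2], goal_cases)
    case prems: 1
    show ?case by (rule nd[OF prems(2-)])
  next
    case prems: 2
    show ?case by (rule that[OF prems(2-)])
  qed
  have L: "z \<in> inflection_curve (member A \<epsilon>) Left_Side \<longleftrightarrow> (case \<Phi> (z, \<epsilon>) of ((x, y), e) \<Rightarrow> y - x\<^sup>2 + e = 0)"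
    "z \<in> inflection_curve (member A \<epsilon>) Right_Side \<longleftrightarrow> (case \<Phi> (z, \<epsilon>) of ((x, y), e) \<Rightarrow> y + x\<^sup>2 - e = 0)"
    if "(z, \<epsilon>) \<in> W" for z \<epsilon>
    using inflection_iff(1)[OF A subsetD[OF W(2) that], of Left_Side] inflection_iff(1)[OF A subsetD[OF W(2) that], of Right_Side]
      W(6)[OF that] W(7)[OF that] by simp_all
  show ?thesis
    unfolding hyperbolic_creation_annihilation_def
  proof (rule exI[of _ W], rule exI[of _ W'], rule exI[of _ \<Phi>], rule exI[of _ \<tau>], intro conjI W(1,3,4))
    show "\<forall>(z, \<epsilon>)\<in>W. snd (\<Phi> (z, \<epsilon>)) = \<tau> \<epsilon>" using W(5) by auto
    show "\<forall>(z, \<epsilon>)\<in>W. z \<in> inflection_curve (member A \<epsilon>) Left_Side \<longleftrightarrow> (case \<Phi> (z, \<epsilon>) of ((x, y), e) \<Rightarrow> y - x\<^sup>2 + e = 0)"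
      unfolding Ball_def split_paired_All prod.case by (intro allI impI) (rule L(1))
    show "\<forall>(z, \<epsilon>)\<in>W. z \<in> inflection_curve (member A \<epsilon>) Right_Side \<longleftrightarrow> (case \<Phi> (z, \<epsilon>) of ((x, y), e) \<Rightarrow> y + x\<^sup>2 - e = 0)"
      unfolding Ball_def split_paired_All prod.case by (intro allI impI) (rule L(2))
  qed
qed

text \<open>The bi-inflections form a curve over \<epsilon>, and the equation k of the other
  inflection curve has a nonzero derivative along it, so it changes sign at \<epsilon>0.\<close>

lemma bi_inflection_crossing:
  assumes hn: "hyperbolic_node (member A \<epsilon>0) q" and bi: "q \<in> bi_inflections (member A \<epsilon>0) s"
  shows "moves_along_and_crosses (\<lambda>\<epsilon>. bi_inflections (member A \<epsilon>) s)
          (\<lambda>\<epsilon>. inflection_curve (member A \<epsilon>) s) (\<lambda>\<epsilon>. inflection_curve (member A \<epsilon>) (other_side s)) q \<epsilon>0"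
proof -
  let ?w = "(q, \<epsilon>0)"
  have qq: "q \<in> inflection_curve (member A \<epsilon>0) Left_Side" "q \<in> inflection_curve (member A \<epsilon>0) Right_Side"
    using hn unfolding hyperbolic_node_def transverse_at_def local_equation_def by blast+
  have w: "?w \<in> ddom 1 A" by (rule both_inflections_ddom[OF A qq])
  note o = open_ddom[OF A, of 1] and sm = smooth_fields[OF A]
  define \<sigma> where "\<sigma> = side_sgn s"
  have \<sigma>: "\<sigma> \<in> {1, -1}" "-\<sigma> \<in> {1, -1}" by (cases s; simp add: \<sigma>_def)+
  have os: "side_sgn (other_side s) = -\<sigma>" by (cases s) (auto simp: \<sigma>_def)
  define g where "g = Gf \<sigma> A"
  define k where "k = Gf (-\<sigma>) A"
  define l where "l = Lf \<sigma> A"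
  have smg: "smooth_on (ddom 1 A) g" "smooth_on (ddom 1 A) k" "smooth_on (ddom 1 A) l" unfolding g_def k_def l_def by (rule sm)+
  have zz: "Gf 1 A ?w = 0" "Gf (-1) A ?w = 0"
    using inflection_iff(1)[OF A w, of Left_Side] inflection_iff(1)[OF A w, of Right_Side] qq by auto
  have z: "g ?w = 0" "k ?w = 0" using zz \<sigma> unfolding g_def k_def by auto
  have zl: "l ?w = 0" using inflection_iff(2)[OF A w, of s] bi by (simp add: l_def \<sigma>_def)
  have gw: "(\<forall>\<tau>\<in>{1,-1}. dd eX (Gf \<tau> A) ?w \<noteq> 0 \<or> dd eY (Gf \<tau> A) ?w \<noteq> 0)"
    "\<forall>\<tau>\<in>{1,-1}. Lf \<tau> A ?w = 0 \<longrightarrow> jac2 (Gf \<tau> A) (Lf \<tau> A) ?w \<noteq> 0 \<and>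
        (\<forall>u. dd u (Gf \<tau> A) ?w = 0 \<longrightarrow> dd u (Gf (-\<tau>) A) ?w = 0 \<longrightarrow> dd u (Lf \<tau> A) ?w = 0 \<longrightarrow> u = 0)"
    using gen w zz unfolding hyp_generic_def by blast+
  have dk: "dd eX k ?w \<noteq> 0 \<or> dd eY k ?w \<noteq> 0" using gw(1) \<sigma>(2) unfolding k_def by blast
  have jac: "jac2 g l ?w \<noteq> 0" and nd: "\<And>u. dd u g ?w = 0 \<Longrightarrow> dd u k ?w = 0 \<Longrightarrow> dd u l ?w = 0 \<Longrightarrow> u = 0"
    using gw(2) \<sigma>(1) zl unfolding g_def k_def l_def by blast+
  define \<Psi> where "\<Psi> w = ((g w, l w), snd w - \<epsilon>0)" for w
  have sm\<Psi>: "smooth_on (ddom 1 A) \<Psi>" unfolding \<Psi>_def by (intro smooth_intros o smg)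
  have d\<Psi>: "(\<Psi> has_derivative (\<lambda>u. ((dd u g ?w, dd u l ?w), snd u))) (at ?w)"
    unfolding \<Psi>_def
    by (rule derivative_eq_intros has_derivative_Pair smooth_on_has_derivative[OF smg(1) o w] smooth_on_has_derivative[OF smg(3) o w] refl)+
      (simp add: fun_eq_iff)
  have "v = 0" if "frechet_derivative \<Psi> (at ?w) v = 0" for v
  proof -
    obtain a b c where v: "v = ((a, b), c)" by (metis surj_pair)
    have e: "dd ((a, b), c) g ?w = 0" "dd ((a, b), c) l ?w = 0" "c = 0"
      using that unfolding frechet_at_eqI[OF d\<Psi>] v by (auto simp: zero_prod_def)
    have f: "a * dd eX g ?w + b * dd eY g ?w = 0" "a * dd eX l ?w + b * dd eY l ?w = 0"
      using e dd_expand[OF smg(1) o w, of a b c] dd_expand[OF smg(3) o w, of a b c] by simp_all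
    have "a * jac2 g l ?w = 0" "b * jac2 g l ?w = 0" unfolding jac2_def using f by algebra+
    then show ?thesis using jac e(3) v by (simp add: zero_prod_def)
  qed
  then obtain W W' \<psi> where W: "open W" "open W'" "?w \<in> W" "W \<subseteq> ddom 1 A" "\<Psi> ?w \<in> W'" "\<Psi> ` W = W'" "\<psi> ` W' = W" "smooth_on W' \<psi>"
      "\<And>x. x \<in> W \<Longrightarrow> \<psi> (\<Psi> x) = x" "\<And>y. y \<in> W' \<Longrightarrow> \<Psi> (\<psi> y) = y"
    using smooth_inverse_function[OF o sm\<Psi> w] by metis
  have \<Psi>w: "\<Psi> ?w = ((0, 0), 0)" using z zl by (simp add: \<Psi>_def)
  have \<psi>0: "\<psi> ((0, 0), 0) = ?w" using W(9)[OF W(3)] \<Psi>w by simp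
  define \<gamma> where "\<gamma> \<epsilon> = \<psi> ((0, 0), \<epsilon> - \<epsilon>0)" for \<epsilon>
  define D where "D = {\<epsilon>. ((0, 0), \<epsilon> - \<epsilon>0) \<in> W'}"
  have oD: "open D"
  proof -
    have "D = (\<lambda>\<epsilon>. ((0, 0), \<epsilon> - \<epsilon>0)) -` W'" by (auto simp: D_def)
    then show ?thesis using open_vimage[OF W(2), of "\<lambda>\<epsilon>. ((0, 0), \<epsilon> - \<epsilon>0)"] by (simp add: continuous_intros)
  qed
  have D0: "\<epsilon>0 \<in> D" using W(5) \<Psi>w by (simp add: D_def)
  have "smooth_on D (\<lambda>\<epsilon>. ((0, 0), \<epsilon> - \<epsilon>0) :: plane \<times> real)" by (intro smooth_intros oD)
  then have sm\<gamma>: "smooth_on D \<gamma>" unfolding \<gamma>_def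
    by (rule smooth_on_compose[OF W(8) _ oD W(2)]) (auto simp: D_def)
  have \<gamma>: "\<gamma> \<epsilon> \<in> W" "snd (\<gamma> \<epsilon>) = \<epsilon>" "g (\<gamma> \<epsilon>) = 0" "l (\<gamma> \<epsilon>) = 0" if "\<epsilon> \<in> D" for \<epsilon>
    using W(7) W(10)[of "((0, 0), \<epsilon> - \<epsilon>0)"] that by (auto simp: D_def \<gamma>_def \<Psi>_def)
  have \<gamma>0: "\<gamma> \<epsilon>0 = ?w" using \<psi>0 by (simp add: \<gamma>_def)
  define \<beta> where "\<beta> \<epsilon> = fst (\<gamma> \<epsilon>)" for \<epsilon>
  have \<beta>: "\<gamma> \<epsilon> = (\<beta> \<epsilon>, \<epsilon>)" if "\<epsilon> \<in> D" for \<epsilon> using \<gamma>(2)[OF that] by (simp add: \<beta>_def prod_eq_iff)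
  have d\<gamma>: "(\<gamma> has_vector_derivative vector_derivative \<gamma> (at \<epsilon>0)) (at \<epsilon>0)"
    using smooth_on_differentiable[OF sm\<gamma> oD D0] by (simp add: vector_derivative_works)
  let ?u = "vector_derivative \<gamma> (at \<epsilon>0)"
  have \<gamma>dom: "\<gamma> \<epsilon>0 \<in> ddom 1 A" using \<gamma>0 w by simp
  have dz: "dd ?u f ?w = 0" if "smooth_on (ddom 1 A) f" "\<And>\<epsilon>. \<epsilon> \<in> D \<Longrightarrow> f (\<gamma> \<epsilon>) = 0" for f :: "plane \<times> real \<Rightarrow> real"
  proof -
    have "((\<lambda>\<epsilon>. f (\<gamma> \<epsilon>)) has_real_derivative dd ?u f (\<gamma> \<epsilon>0)) (at \<epsilon>0)"
      by (rule dd_chain_curve[OF that(1) o \<gamma>dom d\<gamma>])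
    moreover have "((\<lambda>\<epsilon>. f (\<gamma> \<epsilon>)) has_real_derivative 0) (at \<epsilon>0)"
      unfolding has_field_derivative_def
      by (rule has_derivative_transform_within_open[OF DERIV_const[unfolded has_field_derivative_def] oD D0]) (simp add: that(2))
    ultimately show ?thesis using DERIV_unique \<gamma>0 by metis
  qed
  have snd1: "snd ?u = 1"
  proof -
    have "((\<lambda>\<epsilon>. snd (\<gamma> \<epsilon>)) has_real_derivative snd ?u) (at \<epsilon>0)"
      using bounded_linear.has_vector_derivative[OF bounded_linear_snd d\<gamma>] by (simp add: has_real_derivative_iff_has_vector_derivative)
    moreover have "((\<lambda>\<epsilon>. snd (\<gamma> \<epsilon>)) has_real_derivative 1) (at \<epsilon>0)"
      unfolding has_field_derivative_def
      by (rule has_derivative_transform_within_open[OF DERIV_ident[unfolded has_field_derivative_def] oD D0]) (simp add: \<gamma>(2))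
    ultimately show ?thesis by (rule DERIV_unique)
  qed
  \<comment> \<open>The velocity annihilates g and l and has \<epsilon>-component 1, so
    \<open>nd\<close> forbids that it annihilates k.\<close>
  have ku: "dd ?u k ?w \<noteq> 0"
  proof
    assume "dd ?u k ?w = 0"
    then have "?u = 0" using nd dz[OF smg(1) \<gamma>(3)] dz[OF smg(3) \<gamma>(4)] by blast
    then show False using snd1 by simp
  qed
  \<comment> \<open>The definition of crossing asks for the sign of \<epsilon> - \<epsilon>0 along
    the bi-inflections; this sign corrects the orientation of k.\<close>
  define \<kappa> where "\<kappa> = sgn (dd ?u k ?w)"
  have \<kappa>: "\<kappa> \<noteq> 0" "\<kappa> * dd ?u k ?w > 0" using ku by (auto simp: \<kappa>_def sgn_if)
  define h where "h w = \<kappa> * k w" for w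
  have smh: "smooth_on (ddom 1 A) h" unfolding h_def by (intro smooth_intros o smg)
  have ddh: "dd v h x = \<kappa> * dd v k x" if "x \<in> ddom 1 A" for v x
    using dd_mult[OF smooth_on_const[of _ \<kappa>] smg(2) o that, of v] unfolding h_def by (simp add: dd_const)
  define m where "m \<epsilon> = h (\<gamma> \<epsilon>)" for \<epsilon>
  have dm: "(m has_real_derivative \<kappa> * dd ?u k ?w) (at \<epsilon>0)"
    using dd_chain_curve[OF smh o \<gamma>dom d\<gamma>] ddh[OF w] unfolding m_def[abs_def] \<gamma>0 by simp
  have m0: "m \<epsilon>0 = 0" using z by (simp add: m_def \<gamma>0 h_def)
  obtain r1 where r1: "r1 > 0" "\<And>t. t > 0 \<Longrightarrow> t < r1 \<Longrightarrow> m \<epsilon>0 < m (\<epsilon>0 + t)"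
    using DERIV_pos_inc_right[OF dm \<kappa>(2)] by blast
  obtain r2 where r2: "r2 > 0" "\<And>t. t > 0 \<Longrightarrow> t < r2 \<Longrightarrow> m (\<epsilon>0 - t) < m \<epsilon>0"
    using DERIV_pos_inc_left[OF dm \<kappa>(2)] by blast
  have sgnm: "sgn (m \<epsilon>) = sgn (\<epsilon> - \<epsilon>0)" if "\<bar>\<epsilon> - \<epsilon>0\<bar> < min r1 r2" for \<epsilon>
  proof (cases \<epsilon> \<epsilon>0 rule: linorder_cases)
    case less
    then show ?thesis using r2(2)[of "\<epsilon>0 - \<epsilon>"] that m0 by simp
  next
    case equal then show ?thesis using m0 by simp
  next
    case greater
    then show ?thesis using r1(2)[of "\<epsilon> - \<epsilon>0"] that m0 by simp
  qed
  \<comment> \<open>On this set the planar gradient of k is nonzero, so k is a regular equation at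
    every point of the neighbouring curves, not only at q.\<close>
  define N where "N = {x \<in> ddom 1 A. dd eX k x \<noteq> 0} \<union> {x \<in> ddom 1 A. dd eY k x \<noteq> 0}"
  have oN: "open N"
  proof -
    have "open {x \<in> ddom 1 A. dd v k x \<noteq> 0}" for v
    proof -
      have "open (ddom 1 A \<inter> dd v k -` (-{0}))"
        by (rule continuous_open_preimage[OF smooth_on_continuous_on[OF smooth_on_dd[OF smg(2)] o] o]) auto
      moreover have "ddom 1 A \<inter> dd v k -` (-{0}) = {x \<in> ddom 1 A. dd v k x \<noteq> 0}" by auto
      ultimately show ?thesis by (rule back_subst[where P="open"])
    qed
    then show ?thesis unfolding N_def by (intro open_Un)
  qed
  have "?w \<in> W \<inter> N" using W(3) w dk by (auto simp: N_def)
  moreover have "open (W \<inter> N)" using W(1) oN by blast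
  ultimately obtain U I where U: "open U" "open I" "?w \<in> U \<times> I" "U \<times> I \<subseteq> W \<inter> N" by (metis open_prod_elim)
  have "open (D \<inter> I \<inter> \<gamma> -` (U \<times> I))"
  proof -
    have "open (D \<inter> \<gamma> -` (U \<times> I))"
      by (rule continuous_open_preimage[OF smooth_on_continuous_on[OF sm\<gamma> oD] oD]) (use U in \<open>auto intro: open_Times\<close>)
    moreover have "D \<inter> I \<inter> \<gamma> -` (U \<times> I) = (D \<inter> \<gamma> -` (U \<times> I)) \<inter> I" by auto
    ultimately show ?thesis using U(2) by auto
  qed
  moreover have "\<epsilon>0 \<in> D \<inter> I \<inter> \<gamma> -` (U \<times> I)" using D0 U(3) \<gamma>0 by auto
  ultimately obtain r3 where r3: "r3 > 0" "ball \<epsilon>0 r3 \<subseteq> D \<inter> I \<inter> \<gamma> -` (U \<times> I)" by (meson openE)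
  define r where "r = min r3 (min r1 r2)"
  have r: "r > 0" using r1 r2 r3 by (simp add: r_def)
  let ?J = "{\<epsilon>0 - r<..<\<epsilon>0 + r}"
  have J: "\<epsilon> \<in> D" "\<epsilon> \<in> I" "\<gamma> \<epsilon> \<in> U \<times> I" "\<bar>\<epsilon> - \<epsilon>0\<bar> < min r1 r2" if "\<epsilon> \<in> ?J" for \<epsilon>
  proof -
    have "\<epsilon> \<in> ball \<epsilon>0 r3" using that by (auto simp: r_def dist_real_def)
    then show "\<epsilon> \<in> D" "\<epsilon> \<in> I" "\<gamma> \<epsilon> \<in> U \<times> I" using r3(2) by auto
    show "\<bar>\<epsilon> - \<epsilon>0\<bar> < min r1 r2" using that by (auto simp: r_def)
  qed
  have UJ: "(x, \<epsilon>) \<in> W \<inter> N" if "x \<in> U" "\<epsilon> \<in> ?J" for x \<epsilon> using U(4) J(2) that by blast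
  have UJd: "(x, \<epsilon>) \<in> ddom 1 A" if "x \<in> U" "\<epsilon> \<in> ?J" for x \<epsilon> using UJ[OF that] W(4) by blast
  have oJ: "open (U \<times> ?J)" using U(1) by (intro open_Times) auto
  have subd: "U \<times> ?J \<subseteq> ddom 1 A" using UJd by blast
  have T: "inflection_curve (member A \<epsilon>) (other_side s) \<inter> U = {x \<in> U. h (x, \<epsilon>) = 0}" if "\<epsilon> \<in> ?J" for \<epsilon>
    using inflection_iff(1)[OF A UJd[OF _ that], of _ "other_side s"] \<kappa>(1) unfolding os k_def h_def by auto
  show ?thesis
    unfolding moves_along_and_crosses_def Let_def
  proof (intro exI[of _ U] exI[of _ r] exI[of _ \<beta>] exI[of _ h] conjI ballI U(1) r)
    show "q \<in> U" using U(3) by simp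
    show "smooth_on ?J \<beta>" unfolding \<beta>_def
      by (rule smooth_on_fst[OF _ smooth_on_subset[OF sm\<gamma>]]) (use J(1) in auto)
    show "\<beta> \<epsilon>0 = q" by (simp add: \<beta>_def \<gamma>0)
    show "smooth_on (U \<times> ?J) h" by (rule smooth_on_subset[OF smh subd])
    fix \<epsilon> assume \<epsilon>: "\<epsilon> \<in> ?J"
    have \<beta>U: "\<beta> \<epsilon> \<in> U" using J(3)[OF \<epsilon>] \<beta>[OF J(1)[OF \<epsilon>]] by simp
    have \<beta>z: "g (\<beta> \<epsilon>, \<epsilon>) = 0" "l (\<beta> \<epsilon>, \<epsilon>) = 0" using \<gamma>(3,4)[OF J(1)[OF \<epsilon>]] \<beta>[OF J(1)[OF \<epsilon>]] by simp_all
    have bif: "x \<in> bi_inflections (member A \<epsilon>) s \<longleftrightarrow> g (x, \<epsilon>) = 0 \<and> l (x, \<epsilon>) = 0" if "x \<in> U" for x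
      using inflection_iff(2)[OF A UJd[OF that \<epsilon>], of s] by (simp add: g_def l_def \<sigma>_def)
    have uniq: "x = \<beta> \<epsilon>" if "x \<in> U" "g (x, \<epsilon>) = 0" "l (x, \<epsilon>) = 0" for x
    proof -
      have "(x, \<epsilon>) \<in> W" using UJ[OF that(1) \<epsilon>] by blast
      then have "\<psi> (\<Psi> (x, \<epsilon>)) = (x, \<epsilon>)" by (rule W(9))
      moreover have "\<Psi> (x, \<epsilon>) = ((0, 0), \<epsilon> - \<epsilon>0)" using that by (simp add: \<Psi>_def)
      ultimately show ?thesis by (simp add: \<beta>_def \<gamma>_def)
    qed
    show "bi_inflections (member A \<epsilon>) s \<inter> U = {\<beta> \<epsilon>}"
    proof (intro set_eqI iffI)
      fix x assume "x \<in> bi_inflections (member A \<epsilon>) s \<inter> U"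
      then show "x \<in> {\<beta> \<epsilon>}" using bif[of x] uniq[of x] by blast
    next
      fix x assume "x \<in> {\<beta> \<epsilon>}"
      then show "x \<in> bi_inflections (member A \<epsilon>) s \<inter> U" using bif[OF \<beta>U] \<beta>U \<beta>z by blast
    qed
    show "\<beta> \<epsilon> \<in> inflection_curve (member A \<epsilon>) s"
      using inflection_iff(1)[OF A UJd[OF \<beta>U \<epsilon>], of s] \<beta>z by (simp add: g_def \<sigma>_def)
    show T': "inflection_curve (member A \<epsilon>) (other_side s) \<inter> U = {z \<in> U. h (z, \<epsilon>) = 0}" by (rule T[OF \<epsilon>])
    have "sgn (m \<epsilon>) = sgn (\<epsilon> - \<epsilon>0)" by (rule sgnm[OF J(4)[OF \<epsilon>]])
    then show "sgn (h (\<beta> \<epsilon>, \<epsilon>)) = sgn (\<epsilon> - \<epsilon>0)" using \<beta>[OF J(1)[OF \<epsilon>]] by (simp add: m_def)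
    fix x assume x: "x \<in> inflection_curve (member A \<epsilon>) (other_side s) \<inter> U"
    have xd: "(x, \<epsilon>) \<in> ddom 1 A" "(x, \<epsilon>) \<in> N" using UJ[OF _ \<epsilon>] UJd[OF _ \<epsilon>] x by auto
    have "smooth_on U (\<lambda>w. h (w, \<epsilon>))"
      by (rule smooth_on_subset[OF smooth_slice(2)[OF smh o]]) (use UJd[OF _ \<epsilon>] in auto)
    moreover have "\<exists>v. frechet_derivative (\<lambda>w. h (w, \<epsilon>)) (at x) v \<noteq> 0"
    proof -
      have "dd eX k (x, \<epsilon>) \<noteq> 0 \<or> dd eY k (x, \<epsilon>) \<noteq> 0" using xd(2) by (auto simp: N_def)
      then have "dd (1,0) (\<lambda>w. h (w, \<epsilon>)) x \<noteq> 0 \<or> dd (0,1) (\<lambda>w. h (w, \<epsilon>)) x \<noteq> 0"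
        unfolding dd_slice(2)[OF smh o xd(1)] ddh[OF xd(1)] using \<kappa>(1) by simp
      then show ?thesis by blast
    qed
    ultimately show "local_equation (inflection_curve (member A \<epsilon>) (other_side s)) x U (\<lambda>w. h (w, \<epsilon>))"
      unfolding local_equation_def using x U(1) T' by auto
  qed
qed

end

section \<open>Complex inflections\<close>

definition Re_f :: "bide_family \<Rightarrow> plane \<times> real \<Rightarrow> real" where "Re_f A = evf 0 (Uf A) (Vf (-1) A) Re_p"
definition Im_f :: "bide_family \<Rightarrow> plane \<times> real \<Rightarrow> real" where "Im_f A = evf 0 (Uf A) (Vf (-1) A) Im_p"

text \<open>The common zeros are the elliptic nodes (\<open>elliptic_nodes_iff\<close>); a zero with
  vanishing Jacobian is required to be nondegenerate in (x, y, \<epsilon>).\<close>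

definition ell_generic :: "bide_family \<Rightarrow> bool" where
  "ell_generic A \<longleftrightarrow> (\<forall>w\<in>ddom (-1) A. Re_f A w = 0 \<longrightarrow> Im_f A w = 0 \<longrightarrow> jac2 (Re_f A) (Im_f A) w = 0 \<longrightarrow>
     (\<forall>u. dd u (Re_f A) w = 0 \<longrightarrow> dd u (Im_f A) w = 0 \<longrightarrow> dd u (jac2 (Re_f A) (Im_f A)) w = 0 \<longrightarrow> u = 0))"

lemma generic_ell: "generic ell_generic"
proof (rule generic_mono[OF generic_conj[OF generic_some_DY_nonzero_complex generic_conj[OF generic_nondegenerate_tangency_Im generic_nondegenerate_tangency_Re]]])
  fix A :: bide_family assume A: "smooth_on UNIV A"
  assume H: "(\<forall>w\<in>ddom (- 1) A. \<not> (evf 0 (Uf A) (Vf (- 1) A) Re_p w = 0 \<and> evf 0 (Uf A) (Vf (- 1) A) Im_p w = 0 \<and>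
             evf 0 (Uf A) (Vf (- 1) A) (fD DY Re_p) w = 0 \<and> evf 0 (Uf A) (Vf (- 1) A) (fD DY Im_p) w = 0)) \<and>
      (\<forall>w\<in>ddom (- 1) A. evf 0 (Uf A) (Vf (- 1) A) (fD DY Im_p) w \<noteq> 0 \<longrightarrow>
          evf 0 (Uf A) (Vf (- 1) A) Re_p w = 0 \<and> evf 0 (Uf A) (Vf (- 1) A) Im_p w = 0 \<and> evf 0 (Uf A) (Vf (- 1) A) (Jp Re_p Im_p) w = 0 \<longrightarrow>
          (\<forall>u. dd u (evf 0 (Uf A) (Vf (- 1) A) Re_p) w = 0 \<and> dd u (evf 0 (Uf A) (Vf (- 1) A) Im_p) w = 0 \<and>
               dd u (evf 0 (Uf A) (Vf (- 1) A) (Jp Re_p Im_p)) w = 0 \<longrightarrow> u = 0)) \<and>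
      (\<forall>w\<in>ddom (- 1) A. evf 0 (Uf A) (Vf (- 1) A) (fD DY Re_p) w \<noteq> 0 \<longrightarrow>
          evf 0 (Uf A) (Vf (- 1) A) Re_p w = 0 \<and> evf 0 (Uf A) (Vf (- 1) A) Im_p w = 0 \<and> evf 0 (Uf A) (Vf (- 1) A) (Jp Re_p Im_p) w = 0 \<longrightarrow>
          (\<forall>u. dd u (evf 0 (Uf A) (Vf (- 1) A) Re_p) w = 0 \<and> dd u (evf 0 (Uf A) (Vf (- 1) A) Im_p) w = 0 \<and>
               dd u (evf 0 (Uf A) (Vf (- 1) A) (Jp Re_p Im_p)) w = 0 \<longrightarrow> u = 0))"
  show "ell_generic A"
    unfolding ell_generic_def
  proof (intro ballI impI allI)
    fix w u assume w: "w \<in> ddom (-1) A" and z: "Re_f A w = 0" "Im_f A w = 0" "jac2 (Re_f A) (Im_f A) w = 0"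
      "dd u (Re_f A) w = 0" "dd u (Im_f A) w = 0" "dd u (jac2 (Re_f A) (Im_f A)) w = 0"
    note e = jac2_evf[OF A w] dd_jac2_evf[OF A w]
    note K1 = H[THEN conjunct1, THEN bspec, OF w, folded Re_f_def Im_f_def]
    note K2 = H[THEN conjunct2, THEN conjunct1, THEN bspec, OF w, unfolded e, folded Re_f_def Im_f_def]
    note K3 = H[THEN conjunct2, THEN conjunct2, THEN bspec, OF w, unfolded e, folded Re_f_def Im_f_def]
    show "u = 0" using K1 K2[rule_format, of u] K3[rule_format, of u] z by metis
  qed
qed

text \<open>The points \<open>((x, y), e)\<close> with \<open>y = 0\<close> and \<open>x\<^sup>2 = e\<close> are the intersections of the two parabolas of
  the normal form.\<close>

lemma fold_points:
  fixes E :: "real \<Rightarrow> plane set" and \<Phi> :: "plane \<times> real \<Rightarrow> plane \<times> real"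
  assumes W: "(q, \<epsilon>0) \<in> W" "diffeo_on W W' \<Phi>" "\<Phi> (q, \<epsilon>0) = ((0, 0), 0)"
    and \<tau>: "\<And>z \<epsilon>. (z, \<epsilon>) \<in> W \<Longrightarrow> snd (\<Phi> (z, \<epsilon>)) = \<tau> \<epsilon>"
    and E: "\<And>z \<epsilon>. (z, \<epsilon>) \<in> W \<Longrightarrow> z \<in> E \<epsilon> \<longleftrightarrow>
        (case \<Phi> (z, \<epsilon>) of ((x, y), e) \<Rightarrow> y - x\<^sup>2 + e = 0) \<and> (case \<Phi> (z, \<epsilon>) of ((x, y), e) \<Rightarrow> y + x\<^sup>2 - e = 0)"
    and sm\<tau>: "\<exists>r>0. smooth_on {\<epsilon>0 - r<..<\<epsilon>0 + r} \<tau>" and d\<tau>: "dd 1 \<tau> \<epsilon>0 \<noteq> 0"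
  shows "elliptic_creation_annihilation E q \<epsilon>0"
proof -
  have oW: "open W" "open W'" "\<Phi> ` W = W'" using W(2) unfolding diffeo_on_def by auto
  obtain \<Psi> where \<Psi>: "smooth_on W' \<Psi>" "\<And>w. w \<in> W \<Longrightarrow> \<Psi> (\<Phi> w) = w" using W(2) unfolding diffeo_on_def by blast
  have \<Psi>': "\<Psi> y \<in> W" "\<Phi> (\<Psi> y) = y" if "y \<in> W'" for y using that oW(3) \<Psi>(2) by auto
  have zW': "((0, 0), 0) \<in> W'" using W(1,3) oW(3) by (metis image_eqI)
  have \<Psi>0: "\<Psi> ((0, 0), 0) = (q, \<epsilon>0)" using \<Psi>(2)[OF W(1)] W(3) by simp
  have \<tau>0: "\<tau> \<epsilon>0 = 0" using \<tau>[OF W(1)] W(3) by simp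
  obtain r0 where r0: "r0 > 0" "smooth_on {\<epsilon>0 - r0<..<\<epsilon>0 + r0} \<tau>" using sm\<tau> by blast
  let ?J0 = "{\<epsilon>0 - r0<..<\<epsilon>0 + r0}"
  have J0: "open ?J0" "\<epsilon>0 \<in> ?J0" using r0 by auto
  have D: "(\<tau> has_real_derivative dd 1 \<tau> \<epsilon>0) (at \<epsilon>0)" by (rule smooth_real_derivative[OF r0(2) J0])
  have "v = 0" if "frechet_derivative \<tau> (at \<epsilon>0) v = 0" for v
    using that d\<tau> linear_scale[OF smooth_on_linear[OF r0(2) J0], of v 1] by simp
  then obtain I I' g where I: "open I" "\<epsilon>0 \<in> I" "I \<subseteq> ?J0" "\<And>x. x \<in> I \<Longrightarrow> g (\<tau> x) = x"
    using smooth_inverse_function[OF J0(1) r0(2) J0(2)] by metis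
  \<comment> \<open>Time is oriented so that the parameter \<open>m t\<close> of the normal form has
    the sign of t near 0.\<close>
  define \<sigma> where "\<sigma> = sgn (dd 1 \<tau> \<epsilon>0)"
  have \<sigma>: "\<sigma> \<in> {1, -1}" using d\<tau> by (auto simp: \<sigma>_def sgn_if)
  define m where "m t = \<tau> (\<epsilon>0 + \<sigma> * t)" for t
  have dm: "(m has_real_derivative dd 1 \<tau> \<epsilon>0 * \<sigma>) (at 0)"
  proof -
    have D': "(\<tau> has_real_derivative dd 1 \<tau> \<epsilon>0) (at (\<epsilon>0 + \<sigma> * 0))" using D by simp
    have "((\<lambda>t. \<epsilon>0 + \<sigma> * t) has_real_derivative \<sigma>) (at 0)" by (auto intro!: derivative_eq_intros)
    from DERIV_chain2[OF D' this] show ?thesis unfolding m_def[abs_def] .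
  qed
  have dpos: "dd 1 \<tau> \<epsilon>0 * \<sigma> > 0" using d\<tau> by (auto simp: \<sigma>_def sgn_if)
  have m0: "m 0 = 0" by (simp add: m_def \<tau>0)
  obtain r1 where r1: "r1 > 0" "\<And>t. t > 0 \<Longrightarrow> t < r1 \<Longrightarrow> m 0 < m (0 + t)"
    using DERIV_pos_inc_right[OF dm dpos] by blast
  obtain r2 where r2: "r2 > 0" "\<And>t. t > 0 \<Longrightarrow> t < r2 \<Longrightarrow> m (0 - t) < m 0"
    using DERIV_pos_inc_left[OF dm dpos] by blast
  obtain U K where UK: "open U" "open K" "(q, \<epsilon>0) \<in> U \<times> K" "U \<times> K \<subseteq> W" using oW(1) W(1) by (metis open_prod_elim)
  \<comment> \<open>For s = 1 and s = -1 these are the two intersection points. The function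
    \<open>sqrt\<close> is continuous also at negative arguments, where it takes negative values, so
    \<open>y s\<close> is continuous on both sides of 0.\<close>
  define y :: "real \<Rightarrow> real \<Rightarrow> plane \<times> real" where "y s t = ((s * sqrt (m t), 0), m t)" for s t
  have contm: "continuous_on {-r0<..<r0} m"
    unfolding m_def
    by (rule continuous_on_compose2[OF smooth_on_continuous_on[OF r0(2) J0(1)]])
      (use \<sigma> in \<open>auto intro!: continuous_intros\<close>)
  have conty: "continuous_on {-r0<..<r0} (y s)" for s
    unfolding y_def by (intro continuous_intros contm)
  have y0: "y s 0 = ((0, 0), 0)" for s by (simp add: y_def m0)
  \<comment> \<open>Points of this set have preimages in \<open>U\<close> at times where \<tau> is
    invertible.\<close>
  define Q where "Q = W' \<inter> \<Psi> -` (U \<times> (K \<inter> I))"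
  have oQ: "open Q" unfolding Q_def
    by (rule continuous_open_preimage[OF smooth_on_continuous_on[OF \<Psi>(1) oW(2)] oW(2)]) (intro open_Times UK open_Int I)
  have Q0: "((0, 0), 0) \<in> Q" using zW' \<Psi>0 UK(3) I(2) by (auto simp: Q_def)
  have near: "\<exists>d>0. \<forall>t. \<bar>t\<bar> < d \<longrightarrow> y s t \<in> Q" for s
  proof -
    have "open ({-r0<..<r0} \<inter> y s -` Q)" by (rule continuous_open_preimage[OF conty _ oQ]) simp
    moreover have "0 \<in> {-r0<..<r0} \<inter> y s -` Q" using r0(1) y0 Q0 by simp
    ultimately obtain d where "d > 0" "ball 0 d \<subseteq> {-r0<..<r0} \<inter> y s -` Q" by (meson openE)
    then show ?thesis by (intro exI[of _ d]) (auto simp: subset_iff)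
  qed
  obtain d1 where d1: "d1 > 0" "\<And>t. \<bar>t\<bar> < d1 \<Longrightarrow> y 1 t \<in> Q" using near[of 1] by blast
  obtain d2 where d2: "d2 > 0" "\<And>t. \<bar>t\<bar> < d2 \<Longrightarrow> y (-1) t \<in> Q" using near[of "-1"] by blast
  obtain d3 where d3: "d3 > 0" "ball \<epsilon>0 d3 \<subseteq> K \<inter> I" using UK(2,3) I(1,2) by (metis IntI SigmaD2 open_Int openE)
  define r where "r = min r0 (min (min r1 r2) (min d3 (min d1 d2)))"
  have r: "r > 0" "r \<le> r0" "r \<le> r1" "r \<le> r2" "r \<le> d3" "r \<le> d1" "r \<le> d2"
    using r0 r1 r2 d1 d2 d3 by (auto simp: r_def)
  have eps: "\<epsilon>0 + \<sigma> * t \<in> K \<inter> I" if "\<bar>t\<bar> < r" for t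
    using d3(2) that r(5) \<sigma> by (auto simp: subset_iff dist_real_def)
  define \<nu> where "\<nu> s t = fst (\<Psi> (y s t))" for s t
  have yQ: "y s t \<in> Q" if "s \<in> {1, -1}" "\<bar>t\<bar> < r" for s t
    using that d1(2)[of t] d2(2)[of t] r by auto
  have \<Psi>y: "\<Psi> (y s t) = (\<nu> s t, \<epsilon>0 + \<sigma> * t)" "\<nu> s t \<in> U" if "s \<in> {1, -1}" "\<bar>t\<bar> < r" for s t
  proof -
    have q: "y s t \<in> W'" "\<Psi> (y s t) \<in> U \<times> (K \<inter> I)" using yQ[OF that] by (auto simp: Q_def)
    obtain z \<epsilon> where ze: "\<Psi> (y s t) = (z, \<epsilon>)" by (cases "\<Psi> (y s t)")
    have "(z, \<epsilon>) \<in> W" "\<Phi> (z, \<epsilon>) = y s t" using \<Psi>'[OF q(1)] ze by auto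
    then have "\<tau> \<epsilon> = m t" using \<tau>[of z \<epsilon>] by (simp add: y_def)
    \<comment> \<open>The normal form only determines \<tau> \<epsilon>; the local inverse
      \<open>g\<close> of \<tau> recovers \<epsilon>.\<close>
    then have "g (\<tau> \<epsilon>) = g (\<tau> (\<epsilon>0 + \<sigma> * t))" by (simp add: m_def)
    then have "\<epsilon> = \<epsilon>0 + \<sigma> * t" using I(4) q(2) ze eps[OF that(2)] by auto
    then show "\<Psi> (y s t) = (\<nu> s t, \<epsilon>0 + \<sigma> * t)" "\<nu> s t \<in> U" using ze q(2) by (auto simp: \<nu>_def)
  qed
  have \<Phi>\<nu>: "\<Phi> (\<nu> s t, \<epsilon>0 + \<sigma> * t) = y s t" "(\<nu> s t, \<epsilon>0 + \<sigma> * t) \<in> W" if "s \<in> {1, -1}" "\<bar>t\<bar> < r" for s t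
    using \<Psi>'[of "y s t"] \<Psi>y(1)[OF that] yQ[OF that] by (auto simp: Q_def)
  have mem: "z = \<nu> 1 t \<or> z = \<nu> (-1) t" "m t \<ge> 0" if z: "z \<in> E (\<epsilon>0 + \<sigma> * t)" "z \<in> U" and t: "\<bar>t\<bar> < r" for z t
  proof -
    have zW: "(z, \<epsilon>0 + \<sigma> * t) \<in> W" using UK(4) z(2) eps[OF t] by blast
    obtain a b e where abe: "\<Phi> (z, \<epsilon>0 + \<sigma> * t) = ((a, b), e)" by (metis surj_pair)
    have e: "e = m t" using \<tau>[OF zW] abe by (simp add: m_def)
    have "b - a\<^sup>2 + e = 0" "b + a\<^sup>2 - e = 0" using E[OF zW] z(1) abe by auto
    then have b: "b = 0" and a: "a\<^sup>2 = m t" using e by auto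
    show mt: "m t \<ge> 0" using a by (metis zero_le_power2)
    have "a = sqrt (m t) \<or> a = - sqrt (m t)" using a by (metis real_sqrt_abs abs_if minus_minus)
    then have "\<Phi> (z, \<epsilon>0 + \<sigma> * t) = y 1 t \<or> \<Phi> (z, \<epsilon>0 + \<sigma> * t) = y (-1) t" using abe b e by (auto simp: y_def)
    then show "z = \<nu> 1 t \<or> z = \<nu> (-1) t" using \<Psi>(2)[OF zW] unfolding \<nu>_def by (metis fst_conv)
  qed
  have mpos: "m t \<ge> 0" if "0 \<le> t" "t < r" for t
    using r1(2)[of t] that r(3) m0 by (cases "t = 0") auto
  have \<nu>E: "\<nu> s t \<in> E (\<epsilon>0 + \<sigma> * t)" if "s \<in> {1, -1}" "0 \<le> t" "t < r" for s t
  proof -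
    have t: "\<bar>t\<bar> < r" using that by simp
    have "(s * sqrt (m t))\<^sup>2 = m t" using mpos[OF that(2,3)] that(1) by (auto simp: power_mult_distrib)
    then show ?thesis using E[OF \<Phi>\<nu>(2)[OF that(1) t]] unfolding \<Phi>\<nu>(1)[OF that(1) t] by (simp add: y_def)
  qed
  have cont\<nu>: "continuous_on {0..<r} (\<nu> s)" if "s \<in> {1, -1}" for s
    unfolding \<nu>_def
  proof (intro continuous_on_fst continuous_on_compose2[OF smooth_on_continuous_on[OF \<Psi>(1) oW(2)]])
    show "continuous_on {0..<r} (y s)" by (rule continuous_on_subset[OF conty]) (use r(2) r0(1) in auto)
    show "y s ` {0..<r} \<subseteq> W'" using yQ[OF that] by (auto simp: Q_def)
  qed
  show ?thesis
    unfolding elliptic_creation_annihilation_def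
  proof (rule exI[of _ U], rule exI[of _ r], rule exI[of _ \<sigma>], rule exI[of _ "\<nu> 1"], rule exI[of _ "\<nu> (-1)"],
      intro conjI ballI UK(1) r(1) \<sigma> cont\<nu>)
    show "q \<in> U" using UK(3) by simp
    show "\<nu> 1 0 = q" "\<nu> (-1) 0 = q" by (simp_all add: \<nu>_def y0 \<Psi>0)
    fix t assume t: "t \<in> {0..<r}"
    then have t': "\<bar>t\<bar> < r" by simp
    show "E (\<epsilon>0 + \<sigma> * t) \<inter> U = {\<nu> 1 t, \<nu> (-1) t}"
      using mem(1)[OF _ _ t'] \<nu>E[of 1 t] \<nu>E[of "-1" t] \<Psi>y(2)[OF _ t'] t by auto
  next
    fix t assume t: "t \<in> {0<..<r}"
    then have t': "\<bar>t\<bar> < r" "\<bar>-t\<bar> < r" by auto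
    have mt: "m t > 0" using r1(2)[of t] t r(3) m0 by auto
    have mt': "m (-t) < 0" using r2(2)[of t] t r(4) m0 by auto
    show "\<nu> 1 t \<noteq> \<nu> (-1) t"
    proof
      assume "\<nu> 1 t = \<nu> (-1) t"
      then have "y 1 t = y (-1) t" using \<Phi>\<nu>(1)[of 1 t] \<Phi>\<nu>(1)[of "-1" t] t' by simp
      then show False using mt by (simp add: y_def)
    qed
    show "E (\<epsilon>0 - \<sigma> * t) \<inter> U = {}"
      using mem(2)[of _ "-t", OF _ _ t'(2)] mt' by force
  qed simp_all
qed

section \<open>Complex directions, their branches, and elliptic nodes\<close>

context
  fixes A :: bide_family
  assumes A: "smooth_on UNIV A"
begin

lemma smooth_ell: "smooth_on (ddom (-1) A) (Re_f A)" "smooth_on (ddom (-1) A) (Im_f A)"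
  unfolding Re_f_def Im_f_def by (intro smooth_evf open_ddom A smooth_UV)+

lemma Re_f_eq: "Re_f A w = dd eX (Uf A) w + Uf A w * dd eY (Uf A) w - Vf (-1) A w * dd eY (Vf (-1) A) w"
  and Im_f_eq: "Im_f A w = dd eX (Vf (-1) A) w + Uf A w * dd eY (Vf (-1) A) w + Vf (-1) A w * dd eY (Uf A) w"
  by (simp_all add: Re_f_def Im_f_def Re_p_def Im_p_def evf_def jet_of_def)

lemma Vf_nonzero: "w \<in> ddom (-1) A \<Longrightarrow> Vf (-1) A w \<noteq> 0"
  by (auto simp: Vf_def ddom_def)

lemma F_factor:
  assumes w: "(z, \<epsilon>) \<in> ddom (-1) A"
  shows "F (member A \<epsilon>) z (r :: complex) =
    of_real (cc A (z, \<epsilon>)) * ((r - of_real (Uf A (z, \<epsilon>)))\<^sup>2 + (of_real (Vf (-1) A (z, \<epsilon>)))\<^sup>2)"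
proof -
  let ?w = "(z, \<epsilon>)"
  define a where "a = ca A ?w"
  define b where "b = cb A ?w"
  define c where "c = cc A ?w"
  define U where "U = Uf A ?w"
  define V where "V = Vf (-1) A ?w"
  have c: "c \<noteq> 0" and d: "disc A ?w \<le> 0" using w by (auto simp: ddom_def c_def)
  have 1: "c * U = - b" using c by (simp add: U_def Uf_def b_def[symmetric] c_def[symmetric])
  have "c\<^sup>2 * V\<^sup>2 = a * c - b\<^sup>2"
    using c d by (simp add: V_def Vf_def c_def[symmetric] power_mult_distrib disc_def a_def b_def power_inverse)
  then have "c * (c * (U\<^sup>2 + V\<^sup>2)) = c * a" using 1 by algebra
  then have 2: "c * (U\<^sup>2 + V\<^sup>2) = a" using c by simp
  have b: "b = - (c * U)" using 1 by simp
  have "F (member A \<epsilon>) z r = of_real a + 2 * of_real b * r + of_real c * r\<^sup>2"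
    by (simp add: F_def member_def case_prod_beta a_def b_def c_def)
  also have "\<dots> = of_real c * ((r - of_real U)\<^sup>2 + (of_real V)\<^sup>2)"
    unfolding 2[symmetric] b by (simp add: power2_eq_square algebra_simps)
  finally show ?thesis unfolding c_def U_def V_def .
qed

lemma complex_roots:
  assumes w: "(z, \<epsilon>) \<in> ddom (-1) A"
  shows "F (member A \<epsilon>) z (r :: complex) = 0 \<longleftrightarrow>
    r = Complex (Uf A (z, \<epsilon>)) (1 * Vf (-1) A (z, \<epsilon>)) \<or> r = Complex (Uf A (z, \<epsilon>)) (-1 * Vf (-1) A (z, \<epsilon>))"
proof -
  let ?V = "complex_of_real (Vf (-1) A (z, \<epsilon>))" and ?U = "complex_of_real (Uf A (z, \<epsilon>))"
  have "cc A (z, \<epsilon>) \<noteq> 0" using w by (simp add: ddom_def)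
  then have "F (member A \<epsilon>) z r = 0 \<longleftrightarrow> (r - ?U)\<^sup>2 + ?V\<^sup>2 = 0" unfolding F_factor[OF w] by simp
  also have "\<dots> \<longleftrightarrow> (r - ?U)\<^sup>2 = (\<i> * ?V)\<^sup>2" by (simp add: power_mult_distrib eq_neg_iff_add_eq_0)
  also have "\<dots> \<longleftrightarrow> r - ?U = \<i> * ?V \<or> r - ?U = - (\<i> * ?V)" by (rule power2_eq_iff)
  finally show ?thesis by (auto simp: complex_eq_iff)
qed

text \<open>For a nonreal root p the imaginary part of the equation gives b = - c Re p. If c were 0,
  the whole polynomial would vanish, and its root set could not be {p, cnj p}.\<close>

lemma elliptic_domain_iff: "z \<in> elliptic_domain (member A \<epsilon>) \<longleftrightarrow> (z, \<epsilon>) \<in> ddom (-1) A"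
proof
  assume w: "(z, \<epsilon>) \<in> ddom (-1) A"
  let ?p = "Complex (Uf A (z, \<epsilon>)) (Vf (-1) A (z, \<epsilon>))"
  have "{r. F (member A \<epsilon>) z r = 0} = {?p, cnj ?p}" using complex_roots[OF w] by (auto simp: complex_cnj)
  then show "z \<in> elliptic_domain (member A \<epsilon>)"
    unfolding elliptic_domain_def using Vf_nonzero[OF w] by (intro CollectI exI[of _ ?p]) simp
next
  assume "z \<in> elliptic_domain (member A \<epsilon>)"
  then obtain p :: complex where p: "Im p \<noteq> 0" "{r. F (member A \<epsilon>) z r = 0} = {p, cnj p}"
    unfolding elliptic_domain_def by blast
  define a where "a = ca A (z, \<epsilon>)"
  define b where "b = cb A (z, \<epsilon>)"
  define c where "c = cc A (z, \<epsilon>)"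
  have F: "F (member A \<epsilon>) z r = of_real a + 2 * of_real b * r + of_real c * r\<^sup>2" for r :: complex
    by (simp add: F_def member_def case_prod_beta a_def b_def c_def)
  have "of_real a + 2 * of_real b * p + of_real c * p\<^sup>2 = 0" using p(2) F by auto
  then have re: "a + 2 * b * Re p + c * ((Re p)\<^sup>2 - (Im p)\<^sup>2) = 0" and im: "2 * (b + c * Re p) * Im p = 0"
    by (simp_all add: complex_eq_iff power2_eq_square algebra_simps)
  have b: "b = - c * Re p" using im p(1) by simp
  have a: "a = c * ((Re p)\<^sup>2 + (Im p)\<^sup>2)" using re b by (simp add: power2_eq_square algebra_simps)
  have c: "c \<noteq> 0"
  proof
    assume "c = 0"
    then have "F (member A \<epsilon>) z (0::complex) = 0" using F a b by simp
    then have "0 \<in> {p, cnj p}" using p(2) by blast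
    then show False using p(1) by auto
  qed
  have "disc A (z, \<epsilon>) = b\<^sup>2 - a * c" by (simp add: disc_def a_def b_def c_def)
  also have "\<dots> = - (c * Im p)\<^sup>2" unfolding a b by (simp add: power2_eq_square algebra_simps)
  also have "\<dots> < 0" using c p(1) by simp
  finally show "(z, \<epsilon>) \<in> ddom (-1) A" using c by (simp add: ddom_def c_def)
qed

text \<open>Minus the derivative of F in p at the root with index \<tau>: the factor that appears in
  implicit differentiation.\<close>

definition Mf :: "real \<Rightarrow> plane \<times> real \<Rightarrow> complex" where
  "Mf \<tau> w = of_real (cc A w * Vf (-1) A w) * (- 2 * \<i> * of_real \<tau>)"

lemma Mf_nonzero: "w \<in> ddom (-1) A \<Longrightarrow> \<tau> \<in> {1,-1} \<Longrightarrow> Mf \<tau> w \<noteq> 0"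
  using Vf_nonzero by (auto simp: Mf_def ddom_def)

lemma F_directional:
  assumes w: "(z, \<epsilon>) \<in> ddom (-1) A" and \<tau>: "\<tau> \<in> {1,-1}" and p: "p = Complex (Uf A (z, \<epsilon>)) (\<tau> * Vf (-1) A (z, \<epsilon>))"
  shows "frechet_derivative (\<lambda>z. F (member A \<epsilon>) z p) (at z) u =
    Mf \<tau> (z, \<epsilon>) * Complex (dd (u, 0) (Uf A) (z, \<epsilon>)) (\<tau> * dd (u, 0) (Vf (-1) A) (z, \<epsilon>))"
proof -
  note o = open_ddom[OF A, of "-1"]
  note sm = smooth_coeffs(3)[OF A, of "ddom (-1) A"] smooth_UV[OF A, of "-1"]
  note o' = smooth_slice(1)[OF sm(1) o, of \<epsilon>]
  let ?G = "\<lambda>z. complex_of_real (cc A (z, \<epsilon>)) * ((p - of_real (Uf A (z, \<epsilon>)))\<^sup>2 + (of_real (Vf (-1) A (z, \<epsilon>)))\<^sup>2)"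
  note d = has_derivative_of_real[OF dd_slice(1)[OF sm(1) o w], where 'a = complex]
    has_derivative_of_real[OF dd_slice(1)[OF sm(2) o w], where 'a = complex]
    has_derivative_of_real[OF dd_slice(1)[OF sm(3) o w], where 'a = complex]
  have "(?G has_derivative (\<lambda>u. Mf \<tau> (z, \<epsilon>) * Complex (dd (u, 0) (Uf A) (z, \<epsilon>)) (\<tau> * dd (u, 0) (Vf (-1) A) (z, \<epsilon>)))) (at z)"
    by (rule derivative_eq_intros d refl)+
      (use \<tau> in \<open>auto simp: fun_eq_iff p Mf_def complex_eq_iff power2_eq_square algebra_simps\<close>)
  then have "((\<lambda>z. F (member A \<epsilon>) z p) has_derivative (\<lambda>u. Mf \<tau> (z, \<epsilon>) * Complex (dd (u, 0) (Uf A) (z, \<epsilon>)) (\<tau> * dd (u, 0) (Vf (-1) A) (z, \<epsilon>)))) (at z)"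
    by (rule has_derivative_transform_within_open[OF _ o']) (use w F_factor in auto)
  then show ?thesis by (rule fun_cong[OF frechet_at_eqI])
qed

text \<open>Differentiating F(z, P z) = 0 implicitly gives F_x + p F_y = - F_p (P_x + P P_y); the
  last factor has real part \<open>Re_f\<close> and imaginary part \<tau> times
  \<open>Im_f\<close>.\<close>

lemma branch_value:
  assumes w: "(z, \<epsilon>) \<in> ddom (-1) A" and \<tau>: "\<tau> \<in> {1,-1}" and p: "p = Complex (Uf A (z, \<epsilon>)) (\<tau> * Vf (-1) A (z, \<epsilon>))"
  shows "F_x (member A \<epsilon>) z p + p * F_y (member A \<epsilon>) z p = Mf \<tau> (z, \<epsilon>) * Complex (Re_f A (z, \<epsilon>)) (\<tau> * Im_f A (z, \<epsilon>))"
proof -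
  let ?U = "\<lambda>d. dd d (Uf A) (z, \<epsilon>)" and ?V = "\<lambda>d. dd d (Vf (-1) A) (z, \<epsilon>)"
  have "Complex (?U eX) (\<tau> * ?V eX) + p * Complex (?U eY) (\<tau> * ?V eY) = Complex (Re_f A (z, \<epsilon>)) (\<tau> * Im_f A (z, \<epsilon>))"
    using \<tau> by (auto simp: p Re_f_eq Im_f_eq complex_eq_iff algebra_simps)
  then have "Mf \<tau> (z, \<epsilon>) * (Complex (?U eX) (\<tau> * ?V eX) + p * Complex (?U eY) (\<tau> * ?V eY)) =
      Mf \<tau> (z, \<epsilon>) * Complex (Re_f A (z, \<epsilon>)) (\<tau> * Im_f A (z, \<epsilon>))" by (rule arg_cong)
  then show ?thesis unfolding F_x_def F_y_def F_directional[OF assms] distrib_left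
    by (simp only: mult.left_commute[of "Mf \<tau> (z, \<epsilon>)" p])
qed

lemma elliptic_nodes_iff:
  "z \<in> elliptic_nodes (member A \<epsilon>) \<longleftrightarrow> (z, \<epsilon>) \<in> ddom (-1) A \<and> Re_f A (z, \<epsilon>) = 0 \<and> Im_f A (z, \<epsilon>) = 0"
proof (cases "(z, \<epsilon>) \<in> ddom (-1) A")
  case w: True
  let ?p = "\<lambda>\<tau>. Complex (Uf A (z, \<epsilon>)) (\<tau> * Vf (-1) A (z, \<epsilon>))"
  have *: "complex_inflection (member A \<epsilon>) z (?p \<tau>) \<longleftrightarrow> Re_f A (z, \<epsilon>) = 0 \<and> Im_f A (z, \<epsilon>) = 0" if \<tau>: "\<tau> \<in> {1,-1}" for \<tau>
  proof -
    have "F (member A \<epsilon>) z (?p \<tau>) = 0"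
      unfolding complex_roots[OF w] using \<tau> by (elim insertE emptyE) simp_all
    moreover have "Complex (Re_f A (z, \<epsilon>)) (\<tau> * Im_f A (z, \<epsilon>)) = 0 \<longleftrightarrow> Re_f A (z, \<epsilon>) = 0 \<and> Im_f A (z, \<epsilon>) = 0"
      using \<tau> by (auto simp: complex_eq_iff)
    ultimately show ?thesis
      unfolding complex_inflection_def branch_value[OF w \<tau> refl] using Mf_nonzero[OF w \<tau>] by simp
  qed
  have c: "cnj (?p 1) = ?p (-1)" by (simp add: complex_eq_iff)
  have "(\<exists>p. complex_inflection (member A \<epsilon>) z p \<and> complex_inflection (member A \<epsilon>) z (cnj p)) \<longleftrightarrow> Re_f A (z, \<epsilon>) = 0 \<and> Im_f A (z, \<epsilon>) = 0"
  proof
    assume "\<exists>p. complex_inflection (member A \<epsilon>) z p \<and> complex_inflection (member A \<epsilon>) z (cnj p)"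
    then obtain p where p: "complex_inflection (member A \<epsilon>) z p" by blast
    then have "p = ?p 1 \<or> p = ?p (-1)" using complex_roots[OF w, of p] by (auto simp: complex_inflection_def)
    then show "Re_f A (z, \<epsilon>) = 0 \<and> Im_f A (z, \<epsilon>) = 0" using p *[of 1] *[of "-1"] by blast
  next
    assume "Re_f A (z, \<epsilon>) = 0 \<and> Im_f A (z, \<epsilon>) = 0"
    then have "complex_inflection (member A \<epsilon>) z (?p 1)" "complex_inflection (member A \<epsilon>) z (cnj (?p 1))"
      unfolding c using *[of 1] *[of "-1"] by blast+
    then show "\<exists>p. complex_inflection (member A \<epsilon>) z p \<and> complex_inflection (member A \<epsilon>) z (cnj p)" by blast
  qed
  then show ?thesis using w by (simp add: elliptic_nodes_def elliptic_domain_iff)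
qed (simp add: elliptic_nodes_def elliptic_domain_iff)

text \<open>At a zero of a product only the vanishing factor is differentiated, so \<open>Mf\<close>
  enters as a nonzero constant.\<close>

lemma branch_derivative:
  assumes N: "open N" "q \<in> N" "\<And>z. z \<in> N \<Longrightarrow> (z, \<epsilon>) \<in> ddom (-1) A" and \<tau>: "\<tau> \<in> {1,-1}"
    and p: "\<And>z. z \<in> N \<Longrightarrow> p z = Complex (Uf A (z, \<epsilon>)) (\<tau> * Vf (-1) A (z, \<epsilon>))"
    and z: "branch_eq (member A \<epsilon>) p q = 0"
  shows "Re_f A (q, \<epsilon>) = 0" "Im_f A (q, \<epsilon>) = 0"
    "frechet_derivative (branch_eq (member A \<epsilon>) p) (at q) u =
      Mf \<tau> (q, \<epsilon>) * Complex (dd (u, 0) (Re_f A) (q, \<epsilon>)) (\<tau> * dd (u, 0) (Im_f A) (q, \<epsilon>))"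
proof -
  note w = N(3)[OF N(2)]
  note o = open_ddom[OF A, of "-1"]
  have B: "branch_eq (member A \<epsilon>) p z = Mf \<tau> (z, \<epsilon>) * Complex (Re_f A (z, \<epsilon>)) (\<tau> * Im_f A (z, \<epsilon>))" if "z \<in> N" for z
    unfolding branch_eq_def by (rule branch_value[OF N(3)[OF that] \<tau> p[OF that]])
  have "Complex (Re_f A (q, \<epsilon>)) (\<tau> * Im_f A (q, \<epsilon>)) = 0"
    using B[OF N(2)] z Mf_nonzero[OF w \<tau>] by simp
  then show 1: "Re_f A (q, \<epsilon>) = 0" and 2: "Im_f A (q, \<epsilon>) = 0"
    using \<tau> by (auto simp: complex_eq_iff)
  have "smooth_on (ddom (-1) A) (\<lambda>w. cc A w * Vf (-1) A w)"
    by (intro smooth_on_mult o smooth_coeffs[OF A] smooth_UV[OF A])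
  note d = has_derivative_of_real[OF dd_slice(1)[OF this o w], where 'a = complex]
    has_derivative_of_real[OF dd_slice(1)[OF smooth_ell(1) o w], where 'a = complex]
    has_derivative_of_real[OF dd_slice(1)[OF smooth_ell(2) o w], where 'a = complex]
  have "((\<lambda>z. of_real (cc A (z, \<epsilon>) * Vf (-1) A (z, \<epsilon>)) * (- 2 * \<i> * of_real \<tau>) * (of_real (Re_f A (z, \<epsilon>)) + \<i> * of_real \<tau> * of_real (Im_f A (z, \<epsilon>))))
      has_derivative (\<lambda>u. Mf \<tau> (q, \<epsilon>) * Complex (dd (u, 0) (Re_f A) (q, \<epsilon>)) (\<tau> * dd (u, 0) (Im_f A) (q, \<epsilon>)))) (at q)"
    by (rule derivative_eq_intros d refl)+ (simp add: fun_eq_iff Mf_def Complex_eq 1 2)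
  then have "(branch_eq (member A \<epsilon>) p has_derivative (\<lambda>u. Mf \<tau> (q, \<epsilon>) * Complex (dd (u, 0) (Re_f A) (q, \<epsilon>)) (\<tau> * dd (u, 0) (Im_f A) (q, \<epsilon>)))) (at q)"
    by (rule has_derivative_transform_within_open[OF _ N(1,2)]) (simp add: B Mf_def Complex_eq)
  then show "frechet_derivative (branch_eq (member A \<epsilon>) p) (at q) u =
      Mf \<tau> (q, \<epsilon>) * Complex (dd (u, 0) (Re_f A) (q, \<epsilon>)) (\<tau> * dd (u, 0) (Im_f A) (q, \<epsilon>))"
    by (rule fun_cong[OF frechet_at_eqI])
qed

lemma conjugate_branches_tangentD:
  assumes "conjugate_branches_tangent_at (member A \<epsilon>) q"
  shows "(q, \<epsilon>) \<in> ddom (-1) A" "Re_f A (q, \<epsilon>) = 0" "Im_f A (q, \<epsilon>) = 0" "jac2 (Re_f A) (Im_f A) (q, \<epsilon>) = 0"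
    "dd eX (Re_f A) (q, \<epsilon>) \<noteq> 0 \<or> dd eY (Re_f A) (q, \<epsilon>) \<noteq> 0 \<or> dd eX (Im_f A) (q, \<epsilon>) \<noteq> 0 \<or> dd eY (Im_f A) (q, \<epsilon>) \<noteq> 0"
proof -
  obtain U p where qU: "q \<in> U" and rf: "complex_root_field (member A \<epsilon>) U p"
    and r1: "branch_regular_at (member A \<epsilon>) p q" and r2: "branch_regular_at (member A \<epsilon>) (cnj \<circ> p) q"
    and t: "branch_tangent (member A \<epsilon>) p q = branch_tangent (member A \<epsilon>) (cnj \<circ> p) q"
    using assms unfolding conjugate_branches_tangent_at_def by blast
  have U: "open U" "smooth_on U p" "\<And>z. z \<in> U \<Longrightarrow> (z, \<epsilon>) \<in> ddom (-1) A" "\<And>z. z \<in> U \<Longrightarrow> F (member A \<epsilon>) z (p z) = 0"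
    using rf elliptic_domain_iff unfolding complex_root_field_def by auto
  note w = U(3)[OF qU]
  note o = open_ddom[OF A, of "-1"]
  show "(q, \<epsilon>) \<in> ddom (-1) A" by (rule w)
  let ?V = "\<lambda>z. Vf (-1) A (z, \<epsilon>)" and ?p = "\<lambda>\<tau> z. Complex (Uf A (z, \<epsilon>)) (\<tau> * Vf (-1) A (z, \<epsilon>))"
  obtain \<tau> where \<tau>: "\<tau> \<in> {1,-1}" "p q = ?p \<tau> q" using complex_roots[OF w] U(4)[OF qU] by blast
  \<comment> \<open>The given p is some smooth choice of root; the sign of its imaginary part
    compared with V shows that it keeps the index \<tau> near q.\<close>
  define N where "N = U \<inter> (\<lambda>z. \<tau> * Im (p z) * ?V z) -` {0<..}"
  have "continuous_on U ?V"
    by (rule continuous_on_subset[OF smooth_on_continuous_on[OF smooth_slice(2)[OF smooth_UV(2)[OF A] o] smooth_slice(1)[OF smooth_UV(2)[OF A] o]]])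
      (use U(3) in auto)
  then have oN: "open N" unfolding N_def
    by (intro continuous_open_preimage U(1) continuous_intros smooth_on_continuous_on[OF U(2,1)]) auto
  have \<tau>2: "\<tau> * \<tau> = 1" using \<tau>(1) by auto
  have V2: "\<tau> * (\<tau> * ?V z) * ?V z = ?V z * ?V z" for z using \<tau>2 by (metis mult.assoc mult_1)
  have "\<tau> * Im (p q) * ?V q = ?V q * ?V q" unfolding \<tau>(2) complex.sel(2) by (rule V2)
  then have "\<tau> * Im (p q) * ?V q > 0" using Vf_nonzero[OF w] not_real_square_gt_zero[of "?V q"] by metis
  then have qN: "q \<in> N" using qU by (simp add: N_def)
  have pN: "p z = ?p \<tau> z" if "z \<in> N" for z
  proof -
    have z: "z \<in> U" "\<tau> * Im (p z) * ?V z > 0" using that by (auto simp: N_def)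
    have "p z = ?p \<tau> z \<or> p z = ?p (-\<tau>) z" using complex_roots[OF U(3)[OF z(1)]] U(4)[OF z(1)] \<tau>(1) by auto
    moreover have "p z \<noteq> ?p (-\<tau>) z"
    proof
      assume "p z = ?p (-\<tau>) z"
      then have "\<tau> * Im (p z) * ?V z = - (\<tau> * (\<tau> * ?V z) * ?V z)" by simp
      then show False using z(2) V2[of z] by (simp add: not_square_less_zero)
    qed
    ultimately show ?thesis by blast
  qed
  have cN: "(cnj \<circ> p) z = ?p (-\<tau>) z" if "z \<in> N" for z using pN[OF that] by (simp add: complex_eq_iff)
  have \<tau>': "-\<tau> \<in> {1,-1}" using \<tau>(1) by auto
  have Ud: "(z, \<epsilon>) \<in> ddom (-1) A" if "z \<in> N" for z using that U(3) by (simp add: N_def)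
  have z1: "branch_eq (member A \<epsilon>) p q = 0" and z2: "branch_eq (member A \<epsilon>) (cnj \<circ> p) q = 0"
    using r1 r2 unfolding branch_regular_at_def by blast+
  have D1: "frechet_derivative (branch_eq (member A \<epsilon>) p) (at q) u =
      Mf \<tau> (q, \<epsilon>) * Complex (dd (u, 0) (Re_f A) (q, \<epsilon>)) (\<tau> * dd (u, 0) (Im_f A) (q, \<epsilon>))" for u
    by (rule branch_derivative(3)[OF oN qN _ \<tau>(1) _ z1]) (erule Ud pN)+
  have D2: "frechet_derivative (branch_eq (member A \<epsilon>) (cnj \<circ> p)) (at q) u =
      Mf (-\<tau>) (q, \<epsilon>) * Complex (dd (u, 0) (Re_f A) (q, \<epsilon>)) (-\<tau> * dd (u, 0) (Im_f A) (q, \<epsilon>))" for u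
    by (rule branch_derivative(3)[OF oN qN _ \<tau>' _ z2]) (erule Ud cN)+
  show "Re_f A (q, \<epsilon>) = 0"
    by (rule branch_derivative(1)[OF oN qN _ \<tau>(1) _ z1]) (erule Ud pN)+
  show "Im_f A (q, \<epsilon>) = 0"
    by (rule branch_derivative(2)[OF oN qN _ \<tau>(1) _ z1]) (erule Ud pN)+
  let ?X = "\<lambda>\<tau>. Complex (dd eX (Re_f A) (q, \<epsilon>)) (\<tau> * dd eX (Im_f A) (q, \<epsilon>))"
  let ?Y = "\<lambda>\<tau>. Complex (dd eY (Re_f A) (q, \<epsilon>)) (\<tau> * dd eY (Im_f A) (q, \<epsilon>))"
  \<comment> \<open>This vector lies on the tangent of the branch with derivatives (X, Y). Its
    membership in the conjugate tangent says that cnj X * Y is real, which is the vanishing of the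
    real Jacobian.\<close>
  have "(?Y \<tau>, - ?X \<tau>) \<in> branch_tangent (member A \<epsilon>) p q"
    unfolding branch_tangent_def D1 by (simp add: algebra_simps)
  then have "Mf (-\<tau>) (q, \<epsilon>) * (?X (-\<tau>) * ?Y \<tau> - ?Y (-\<tau>) * ?X \<tau>) = 0"
    unfolding t unfolding branch_tangent_def D2 by (simp add: algebra_simps)
  then have "?X (-\<tau>) * ?Y \<tau> - ?Y (-\<tau>) * ?X \<tau> = 0" using Mf_nonzero[OF w \<tau>'] by simp
  then have "Im (?X (-\<tau>) * ?Y \<tau> - ?Y (-\<tau>) * ?X \<tau>) = 0" by simp
  moreover have "Im (?X (-\<tau>) * ?Y \<tau> - ?Y (-\<tau>) * ?X \<tau>) = 2 * \<tau> * jac2 (Re_f A) (Im_f A) (q, \<epsilon>)"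
    by (simp add: jac2_def algebra_simps)
  ultimately show "jac2 (Re_f A) (Im_f A) (q, \<epsilon>) = 0" using \<tau>(1) by auto
  show "dd eX (Re_f A) (q, \<epsilon>) \<noteq> 0 \<or> dd eY (Re_f A) (q, \<epsilon>) \<noteq> 0 \<or> dd eX (Im_f A) (q, \<epsilon>) \<noteq> 0 \<or> dd eY (Im_f A) (q, \<epsilon>) \<noteq> 0"
  proof (rule ccontr)
    assume n: "\<not> ?thesis"
    obtain a b where ab: "frechet_derivative (branch_eq (member A \<epsilon>) p) (at q) (a, b) \<noteq> 0"
      using r1 unfolding branch_regular_at_def by auto
    have "dd ((a, b), 0) (Re_f A) (q, \<epsilon>) = 0" "dd ((a, b), 0) (Im_f A) (q, \<epsilon>) = 0"
      using n dd_expand[OF smooth_ell(1) o w, of a b 0] dd_expand[OF smooth_ell(2) o w, of a b 0] by simp_all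
    then show False using ab unfolding D1 by (simp add: complex_eq_iff)
  qed
qed

text \<open>Elliptic nodes are the common points of two real curves, so the tangency of the complex
  branches is treated as a tangency of real curves and the fold normal form applies.\<close>

lemma elliptic_transition:
  assumes gen: "ell_generic A" and ct: "conjugate_branches_tangent_at (member A \<epsilon>0) q"
  shows "elliptic_creation_annihilation (\<lambda>\<epsilon>. elliptic_nodes (member A \<epsilon>)) q \<epsilon>0"
proof -
  let ?R = "Re_f A" and ?I = "Im_f A" and ?w = "(q, \<epsilon>0)"
  note T = conjugate_branches_tangentD[OF ct]
  note w = T(1) and o = open_ddom[OF A, of "-1"] and sm = smooth_ell
  \<comment> \<open>One of the two real gradients may vanish at q. Adding the other function to that
    one keeps the common zeros and makes both gradients nonzero; since the product of the two
    coefficients is 0, the Jacobian is unchanged.\<close>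
  obtain \<alpha> \<beta> :: real where \<alpha>\<beta>: "\<alpha> * \<beta> = 0"
    and n1: "dd eX ?R ?w + \<alpha> * dd eX ?I ?w \<noteq> 0 \<or> dd eY ?R ?w + \<alpha> * dd eY ?I ?w \<noteq> 0"
    and n2: "dd eX ?I ?w + \<beta> * dd eX ?R ?w \<noteq> 0 \<or> dd eY ?I ?w + \<beta> * dd eY ?R ?w \<noteq> 0"
  proof (cases "dd eX ?R ?w = 0 \<and> dd eY ?R ?w = 0")
    case True then show ?thesis using T(5) by (intro that[of 1 0]) auto
  next
    case R: False
    show ?thesis
    proof (cases "dd eX ?I ?w = 0 \<and> dd eY ?I ?w = 0")
      case True then show ?thesis using R by (intro that[of 0 1]) auto
    next
      case False then show ?thesis using R by (intro that[of 0 0]) auto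
    qed
  qed
  define g where "g w = ?R w + \<alpha> * ?I w" for w
  define h where "h w = ?I w + \<beta> * ?R w" for w
  have smg: "smooth_on (ddom (-1) A) g" "smooth_on (ddom (-1) A) h" unfolding g_def h_def by (intro smooth_intros o sm)+
  have cm: "smooth_on (ddom (-1) A) (\<lambda>w. c * f w)" "dd u (\<lambda>w. c * f w) x = c * dd u f x"
    if "smooth_on (ddom (-1) A) f" "x \<in> ddom (-1) A" for f u x and c :: real
    using dd_mult[OF smooth_on_const[of _ c] that(1) o that(2), of u] that(1) by (auto simp: dd_const intro!: smooth_intros o)
  have dg: "dd u g x = dd u ?R x + \<alpha> * dd u ?I x" "dd u h x = dd u ?I x + \<beta> * dd u ?R x" if "x \<in> ddom (-1) A" for u x
    unfolding g_def h_def
    using dd_add[OF sm(1) cm(1)[OF sm(2) that] o that, where v = u] dd_add[OF sm(2) cm(1)[OF sm(1) that] o that, where v = u]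
      cm(2)[OF sm(1) that] cm(2)[OF sm(2) that] by simp_all
  have J: "jac2 g h x = jac2 ?R ?I x" if "x \<in> ddom (-1) A" for x
  proof -
    have "jac2 g h x = (1 - \<alpha> * \<beta>) * jac2 ?R ?I x" unfolding jac2_def dg[OF that] by (simp add: algebra_simps)
    then show ?thesis using \<alpha>\<beta> by simp
  qed
  have dJ: "dd u (jac2 g h) ?w = dd u (jac2 ?R ?I) ?w" for u by (rule fun_cong[OF dd_cong[OF o J w]])
  have zero: "g x = 0 \<and> h x = 0 \<longleftrightarrow> ?R x = 0 \<and> ?I x = 0" for x
    using \<alpha>\<beta> by (auto simp: g_def h_def)
  have combo: "a + \<alpha> * b = 0 \<Longrightarrow> b + \<beta> * a = 0 \<Longrightarrow> a = 0 \<and> b = 0" for a b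
    using \<alpha>\<beta> by auto
  have nd: "u = 0" if "dd u g ?w = 0" "dd u h ?w = 0" "dd u (jac2 g h) ?w = 0" for u
  proof -
    have "dd u ?R ?w = 0 \<and> dd u ?I ?w = 0" using that(1,2) unfolding dg[OF w] by (rule combo)
    then show ?thesis using gen w T that(3) unfolding ell_generic_def dJ by blast
  qed
  have z: "g ?w = 0" "h ?w = 0" using zero[of ?w] T(2,3) by blast+
  have jac: "jac2 g h ?w = 0" using J[OF w] T(4) by simp
  have d1: "dd eX g ?w \<noteq> 0 \<or> dd eY g ?w \<noteq> 0" and d2: "dd eX h ?w \<noteq> 0 \<or> dd eY h ?w \<noteq> 0"
    using n1 n2 unfolding dg[OF w] by blast+
  obtain W W' and \<Phi> :: "plane \<times> real \<Rightarrow> plane \<times> real" and \<tau> where W: "?w \<in> W" "W \<subseteq> ddom (-1) A" "diffeo_on W W' \<Phi>" "\<Phi> ?w = ((0, 0), 0)"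
    "\<And>z \<epsilon>. (z, \<epsilon>) \<in> W \<Longrightarrow> snd (\<Phi> (z, \<epsilon>)) = \<tau> \<epsilon>"
    "\<And>z \<epsilon>. (z, \<epsilon>) \<in> W \<Longrightarrow> g (z, \<epsilon>) = 0 \<longleftrightarrow> (case \<Phi> (z, \<epsilon>) of ((x, y), e) \<Rightarrow> y - x\<^sup>2 + e = 0)"
    "\<And>z \<epsilon>. (z, \<epsilon>) \<in> W \<Longrightarrow> h (z, \<epsilon>) = 0 \<longleftrightarrow> (case \<Phi> (z, \<epsilon>) of ((x, y), e) \<Rightarrow> y + x\<^sup>2 - e = 0)"
    "\<exists>r>0. smooth_on {\<epsilon>0 - r<..<\<epsilon>0 + r} \<tau>" "dd 1 \<tau> \<epsilon>0 \<noteq> 0"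
  proof (rule fold_normal_form[OF o w smg z jac d1 d2], goal_cases)
    case prems: 1
    show ?case by (rule nd[OF prems(2-)])
  next
    case prems: 2
    show ?case by (rule that[OF prems(2-)])
  qed
  have en: "z \<in> elliptic_nodes (member A \<epsilon>) \<longleftrightarrow> (case \<Phi> (z, \<epsilon>) of ((x, y), e) \<Rightarrow> y - x\<^sup>2 + e = 0) \<and>
      (case \<Phi> (z, \<epsilon>) of ((x, y), e) \<Rightarrow> y + x\<^sup>2 - e = 0)" if "(z, \<epsilon>) \<in> W" for z \<epsilon>
    unfolding elliptic_nodes_iff W(6)[OF that, symmetric] W(7)[OF that, symmetric] zero using W(2) that by blast
  show ?thesis by (rule fold_points[where E = "\<lambda>\<epsilon>. elliptic_nodes (member A \<epsilon>)", OF W(1,3,4,5) en W(8,9)])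
qed

end

theorem theorem1p4:
  shows "generic (\<lambda>A :: bide_family. \<forall>\<epsilon>0 q.
     (quadratically_tangent_at (inflection_curve (member A \<epsilon>0) Left_Side)
          (inflection_curve (member A \<epsilon>0) Right_Side) q \<longrightarrow>
        hyperbolic_creation_annihilation (\<lambda>\<epsilon>. inflection_curve (member A \<epsilon>) Left_Side)
          (\<lambda>\<epsilon>. inflection_curve (member A \<epsilon>) Right_Side) q \<epsilon>0) \<and>
     (\<forall>s. hyperbolic_node (member A \<epsilon>0) q \<and> q \<in> bi_inflections (member A \<epsilon>0) s \<longrightarrow>
        moves_along_and_crosses (\<lambda>\<epsilon>. bi_inflections (member A \<epsilon>) s)
          (\<lambda>\<epsilon>. inflection_curve (member A \<epsilon>) s)
          (\<lambda>\<epsilon>. inflection_curve (member A \<epsilon>) (other_side s)) q \<epsilon>0) \<and>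
     (conjugate_branches_tangent_at (member A \<epsilon>0) q \<longrightarrow>
        elliptic_creation_annihilation (\<lambda>\<epsilon>. elliptic_nodes (member A \<epsilon>)) q \<epsilon>0))"
proof (rule generic_mono[OF generic_conj[OF generic_hyp generic_ell]], elim conjE, intro allI conjI impI)
  fix A :: bide_family and \<epsilon>0 q s
  assume A: "smooth_on UNIV A" and G: "hyp_generic A" "ell_generic A"
  show "hyperbolic_creation_annihilation (\<lambda>\<epsilon>. inflection_curve (member A \<epsilon>) Left_Side)
      (\<lambda>\<epsilon>. inflection_curve (member A \<epsilon>) Right_Side) q \<epsilon>0"
    if "quadratically_tangent_at (inflection_curve (member A \<epsilon>0) Left_Side) (inflection_curve (member A \<epsilon>0) Right_Side) q"
    by (rule hyperbolic_transition[OF A G(1) that])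
  show "moves_along_and_crosses (\<lambda>\<epsilon>. bi_inflections (member A \<epsilon>) s) (\<lambda>\<epsilon>. inflection_curve (member A \<epsilon>) s)
      (\<lambda>\<epsilon>. inflection_curve (member A \<epsilon>) (other_side s)) q \<epsilon>0"
    if "hyperbolic_node (member A \<epsilon>0) q \<and> q \<in> bi_inflections (member A \<epsilon>0) s"
    by (rule bi_inflection_crossing[OF A G(1) that[THEN conjunct1] that[THEN conjunct2]])
  show "elliptic_creation_annihilation (\<lambda>\<epsilon>. elliptic_nodes (member A \<epsilon>)) q \<epsilon>0"
    if "conjugate_branches_tangent_at (member A \<epsilon>0) q"
    by (rule elliptic_transition[OF A G(2) that])
qed

end
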